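(* Let $\mathscr{C}$ be a pointed $\infty$-category with (finite) limits and colimits. The functors $\mathrm{Cof}$ and $\mathrm{Fib}$ (defined in the context) form an adjunction of $\infty$-categories $$\mathrm{Cof}:\ \mathrm{Fun}(\Delta^1,\mathscr{C})\rightleftarrows\mathrm{Fun}(\Delta^1,\mathscr{C}):\ \mathrm{Fib},$$ with $\mathrm{Cof}$ left adjoint to $\mathrm{Fib}$.
   Context: $\infty$-category means quasi-category; pointed means having a zero object $0$. Let $\Box=\Delta^1\times\Delta^1$ with vertices $(0,0),(1,0)$ (top row) and $(0,1),(1,1)$ (bottom row). A triangle is a functor $\Box\to\mathscr{C}$ with value $0$ at $(0,1)$; it is a fiber (cofiber) sequence if it is a pullback (pushout) square. $\mathrm{Cof}$ is the composite: extend a morphism $f:A\to X$, placed on the edge $(0,0)\to(1,0)$, by zero (right Kan extension) to the diagram $0\leftarrow A\xrightarrow{f}X$, then by left Kan extension to the pushout square (cofiber sequence) on $\Box$, and restrict to the right vertical edge $(1,0)\to(1,1)$, giving $\mathrm{Cof}(f):X\to\mathrm{colim}\{0\leftarrow A\to X\}$. $\mathrm{Fib}$ is the composite: extend a morphism $p:X\to B$, placed on the edge $(1,0)\to(1,1)$, by zero (left Kan extension) to the diagram $0\to B\xleftarrow{p}X$, then by right Kan extension to the pullback square (fiber sequence) on $\Box$, and restrict to the top horizontal edge $(0,0)\to(1,0)$, giving $\mathrm{Fib}(p):\lim\{0\to B\leftarrow X\}\to X$. *)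

theory Defs
  imports Main "HOL-Library.FuncSet"
begin

section \<open>Simplicial sets\<close>

text \<open>
  A weakly monotone map \<open>[m] \<rightarrow> [n]\<close> is encoded as the list of its \<open>m + 1\<close> values. If \<open>x\<close> is an
  \<open>n\<close>-simplex of \<open>X\<close> and \<open>\<theta> : [m] \<rightarrow> [n]\<close>, then \<open>act X n \<theta> x\<close> is the \<open>m\<close>-simplex \<open>\<theta>\<^sup>* x\<close>; the list
  determines \<open>m\<close> but not \<open>n\<close>. Behaviour outside these domains is irrelevant.
\<close>

definition mono_maps :: "nat \<Rightarrow> nat \<Rightarrow> nat list set" where
  "mono_maps m n = {\<theta>. length \<theta> = Suc m \<and> sorted \<theta> \<and> set \<theta> \<subseteq> {..n}}"

definition id_map :: "nat \<Rightarrow> nat list" where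
  "id_map n = [0..<Suc n]"

definition after :: "nat list \<Rightarrow> nat list \<Rightarrow> nat list" (infixl "\<cdot>" 70) where
  "\<theta> \<cdot> \<phi> = map (\<lambda>i. \<theta> ! i) \<phi>"

record 'a sset =
  cell :: "nat \<Rightarrow> 'a set"
  act :: "nat \<Rightarrow> nat list \<Rightarrow> 'a \<Rightarrow> 'a"

definition simplicial_set :: "'a sset \<Rightarrow> bool" where
  "simplicial_set X \<longleftrightarrow>
     (\<forall>m n. \<forall>\<theta>\<in>mono_maps m n. \<forall>x\<in>cell X n. act X n \<theta> x \<in> cell X m) \<and>
     (\<forall>n. \<forall>x\<in>cell X n. act X n (id_map n) x = x) \<and>
     (\<forall>k m n. \<forall>\<theta>\<in>mono_maps m n. \<forall>\<phi>\<in>mono_maps k m. \<forall>x\<in>cell X n.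
        act X m \<phi> (act X n \<theta> x) = act X n (\<theta> \<cdot> \<phi>) x)"

text \<open>
  Simplicial maps are extensional in each degree, so that two of them are equal in HOL iff they agree
  on simplices.
\<close>

definition hom :: "'a sset \<Rightarrow> 'b sset \<Rightarrow> (nat \<Rightarrow> 'a \<Rightarrow> 'b) set" where
  "hom X Y =
     {f. (\<forall>n. f n \<in> cell X n \<rightarrow>\<^sub>E cell Y n) \<and>
         (\<forall>m n. \<forall>\<theta>\<in>mono_maps m n. \<forall>x\<in>cell X n. f m (act X n \<theta> x) = act Y n \<theta> (f n x))}"

definition restr :: "'a sset \<Rightarrow> (nat \<Rightarrow> 'a \<Rightarrow> 'b) \<Rightarrow> nat \<Rightarrow> 'a \<Rightarrow> 'b" where
  "restr A f = (\<lambda>n. restrict (f n) (cell A n))"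

definition idm :: "'a sset \<Rightarrow> nat \<Rightarrow> 'a \<Rightarrow> 'a" where
  "idm X = restr X (\<lambda>n x. x)"

definition cmp :: "'a sset \<Rightarrow> (nat \<Rightarrow> 'b \<Rightarrow> 'c) \<Rightarrow> (nat \<Rightarrow> 'a \<Rightarrow> 'b) \<Rightarrow> nat \<Rightarrow> 'a \<Rightarrow> 'c" where
  "cmp X g f = restr X (\<lambda>n x. g n (f n x))"

definition simplex :: "nat \<Rightarrow> nat list sset" ("\<Delta>") where
  "\<Delta> n = \<lparr>cell = (\<lambda>m. mono_maps m n), act = (\<lambda>m \<theta> a. a \<cdot> \<theta>)\<rparr>"

definition boundary :: "nat \<Rightarrow> nat list sset" where
  "boundary n = \<lparr>cell = (\<lambda>m. {a \<in> mono_maps m n. set a \<noteq> {..n}}), act = act (\<Delta> n)\<rparr>"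

definition horn :: "nat \<Rightarrow> nat \<Rightarrow> nat list sset" where
  "horn n k = \<lparr>cell = (\<lambda>m. {a \<in> mono_maps m n. \<not> {..n} - {k} \<subseteq> set a}), act = act (\<Delta> n)\<rparr>"

definition quasi_category :: "'a sset \<Rightarrow> bool" where
  "quasi_category C \<longleftrightarrow> simplicial_set C \<and>
     (\<forall>n k. 0 < k \<and> k < n \<longrightarrow>
        (\<forall>f\<in>hom (horn n k) C. \<exists>g\<in>hom (\<Delta> n) C. restr (horn n k) g = f))"

text \<open>The full simplicial subset on a set of vertices.\<close>

definition full_sub :: "'a sset \<Rightarrow> 'a set \<Rightarrow> 'a sset" where
  "full_sub X V = X\<lparr>cell := (\<lambda>n. {x \<in> cell X n. \<forall>i\<le>n. act X n [i] x \<in> V})\<rparr>"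

definition nondegenerate :: "'a sset \<Rightarrow> nat \<Rightarrow> 'a \<Rightarrow> bool" where
  "nondegenerate X n x \<longleftrightarrow> x \<in> cell X n \<and>
     (\<forall>m<n. \<forall>\<theta>\<in>mono_maps n m. \<forall>y\<in>cell X m. x \<noteq> act X m \<theta> y)"

definition finite_sset :: "'a sset \<Rightarrow> bool" where
  "finite_sset X \<longleftrightarrow> simplicial_set X \<and> finite {(n, x). nondegenerate X n x}"


section \<open>Products and functor objects\<close>

definition prod_sset :: "'a sset \<Rightarrow> 'b sset \<Rightarrow> ('a \<times> 'b) sset" (infixr "\<otimes>" 75) where
  "X \<otimes> Y = \<lparr>cell = (\<lambda>n. cell X n \<times> cell Y n),
              act = (\<lambda>n \<theta> (x, y). (act X n \<theta> x, act Y n \<theta> y))\<rparr>"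

type_synonym ('a, 'b) fun_cell = "nat \<Rightarrow> nat list \<times> 'a \<Rightarrow> 'b"

text \<open>An \<open>n\<close>-simplex of \<open>Fun X Y\<close> is a simplicial map \<open>\<Delta> n \<otimes> X \<rightarrow> Y\<close>.\<close>

definition Fun :: "'a sset \<Rightarrow> 'b sset \<Rightarrow> ('a, 'b) fun_cell sset" where
  "Fun X Y = \<lparr>cell = (\<lambda>n. hom (\<Delta> n \<otimes> X) Y),
              act = (\<lambda>n \<theta> h. restr (\<Delta> (length \<theta> - 1) \<otimes> X) (\<lambda>k (a, x). h k (\<theta> \<cdot> a, x)))\<rparr>"

text \<open>The identification of simplicial maps \<open>X \<rightarrow> Y\<close> with vertices of \<open>Fun X Y\<close>.\<close>

definition vertex_of :: "'a sset \<Rightarrow> (nat \<Rightarrow> 'a \<Rightarrow> 'b) \<Rightarrow> ('a, 'b) fun_cell" where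
  "vertex_of X f = restr (\<Delta> 0 \<otimes> X) (\<lambda>m (a, x). f m x)"

definition map_of_vertex :: "'a sset \<Rightarrow> ('a, 'b) fun_cell \<Rightarrow> nat \<Rightarrow> 'a \<Rightarrow> 'b" where
  "map_of_vertex X h = restr X (\<lambda>m x. h m (replicate (Suc m) 0, x))"

text \<open>Precomposition with \<open>j : X' \<rightarrow> X\<close>, as a map \<open>Fun X Y \<rightarrow> Fun X' Y\<close>.\<close>

definition precomp ::
  "'c sset \<Rightarrow> 'a sset \<Rightarrow> 'b sset \<Rightarrow> (nat \<Rightarrow> 'c \<Rightarrow> 'a) \<Rightarrow> nat \<Rightarrow> ('a, 'b) fun_cell \<Rightarrow> ('c, 'b) fun_cell" where
  "precomp X' X Y j =
     restr (Fun X Y) (\<lambda>n h. restr (\<Delta> n \<otimes> X') (\<lambda>m (a, x). h m (a, j m x)))"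

text \<open>Postcomposition with \<open>g : Y \<rightarrow> Y'\<close>, as a map \<open>Fun X Y \<rightarrow> Fun X Y'\<close>.\<close>

definition postcomp ::
  "'a sset \<Rightarrow> 'b sset \<Rightarrow> (nat \<Rightarrow> 'b \<Rightarrow> 'c) \<Rightarrow> nat \<Rightarrow> ('a, 'b) fun_cell \<Rightarrow> ('a, 'c) fun_cell" where
  "postcomp X Y g = restr (Fun X Y) (\<lambda>n h. cmp (\<Delta> n \<otimes> X) g h)"


section \<open>Joins and slices\<close>

text \<open>
  \<open>JM i j x y\<close> stands for the simplex of dimension \<open>i + j + 1\<close> whose restriction to the vertices
  \<open>0, \<dots>, i\<close> is the \<open>i\<close>-simplex \<open>x\<close> of \<open>X\<close> and whose restriction to the vertices
  \<open>i + 1, \<dots>, i + j + 1\<close> is the \<open>j\<close>-simplex \<open>y\<close> of \<open>Y\<close>.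
\<close>

datatype ('a, 'b) join = JL 'a | JR 'b | JM nat nat 'a 'b

fun join_act :: "'a sset \<Rightarrow> 'b sset \<Rightarrow> nat \<Rightarrow> nat list \<Rightarrow> ('a, 'b) join \<Rightarrow> ('a, 'b) join" where
  "join_act X Y n \<theta> (JL x) = JL (act X n \<theta> x)"
| "join_act X Y n \<theta> (JR y) = JR (act Y n \<theta> y)"
| "join_act X Y n \<theta> (JM i j x y) =
     (let l = filter (\<lambda>t. t \<le> i) \<theta>; r = map (\<lambda>t. t - Suc i) (filter (\<lambda>t. i < t) \<theta>)
      in if r = [] then JL (act X i l x)
         else if l = [] then JR (act Y j r y)
         else JM (length l - 1) (length r - 1) (act X i l x) (act Y j r y))"

definition join_sset :: "'a sset \<Rightarrow> 'b sset \<Rightarrow> ('a, 'b) join sset" (infixr "\<star>" 72) where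
  "X \<star> Y = \<lparr>cell = (\<lambda>n. JL ` cell X n \<union> JR ` cell Y n \<union>
                       {JM i j x y | i j x y. i + j + 1 = n \<and> x \<in> cell X i \<and> y \<in> cell Y j}),
             act = join_act X Y\<rparr>"

fun join_map ::
  "(nat \<Rightarrow> 'a \<Rightarrow> 'c) \<Rightarrow> (nat \<Rightarrow> 'b \<Rightarrow> 'd) \<Rightarrow> nat \<Rightarrow> ('a, 'b) join \<Rightarrow> ('c, 'd) join" where
  "join_map f g n (JL x) = JL (f n x)"
| "join_map f g n (JR y) = JR (g n y)"
| "join_map f g n (JM i j x y) = JM i j (f i x) (g j y)"

text \<open>\<open>over K C p\<close> is \<open>C\<^bsub>/p\<^esub>\<close> and \<open>under K C p\<close> is \<open>C\<^bsub>p/\<^esub>\<close>, for \<open>p : K \<rightarrow> C\<close>.\<close>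

definition over ::
  "'k sset \<Rightarrow> 'a sset \<Rightarrow> (nat \<Rightarrow> 'k \<Rightarrow> 'a) \<Rightarrow> (nat \<Rightarrow> (nat list, 'k) join \<Rightarrow> 'a) sset" where
  "over K C p =
     \<lparr>cell = (\<lambda>n. {h \<in> hom (\<Delta> n \<star> K) C. \<forall>m. \<forall>y\<in>cell K m. h m (JR y) = p m y}),
      act = (\<lambda>n \<theta> h. restr (\<Delta> (length \<theta> - 1) \<star> K)
                       (\<lambda>m z. h m (join_map (\<lambda>_ a. \<theta> \<cdot> a) (\<lambda>_ y. y) m z)))\<rparr>"

definition under ::
  "'k sset \<Rightarrow> 'a sset \<Rightarrow> (nat \<Rightarrow> 'k \<Rightarrow> 'a) \<Rightarrow> (nat \<Rightarrow> ('k, nat list) join \<Rightarrow> 'a) sset" where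
  "under K C p =
     \<lparr>cell = (\<lambda>n. {h \<in> hom (K \<star> \<Delta> n) C. \<forall>m. \<forall>y\<in>cell K m. h m (JL y) = p m y}),
      act = (\<lambda>n \<theta> h. restr (K \<star> \<Delta> (length \<theta> - 1))
                       (\<lambda>m z. h m (join_map (\<lambda>_ y. y) (\<lambda>_ a. \<theta> \<cdot> a) m z)))\<rparr>"


section \<open>Initial and final objects, limits and colimits\<close>

text \<open>
  Joyal's definition: a vertex \<open>x\<close> is final (initial) if every sphere \<open>\<partial>\<Delta>\<^sup>n \<rightarrow> C\<close>, \<open>n > 0\<close>, with last
  (first) vertex \<open>x\<close> can be filled; equivalently, the projection from \<open>C\<^bsub>/x\<^esub>\<close> (from \<open>C\<^bsub>x/\<^esub>\<close>) to \<open>C\<close>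
  is a trivial Kan fibration.
\<close>

definition final :: "'a sset \<Rightarrow> 'a \<Rightarrow> bool" where
  "final C x \<longleftrightarrow> x \<in> cell C 0 \<and>
     (\<forall>n>0. \<forall>f\<in>hom (boundary n) C. f 0 [n] = x \<longrightarrow>
        (\<exists>g\<in>hom (\<Delta> n) C. restr (boundary n) g = f))"

definition initial :: "'a sset \<Rightarrow> 'a \<Rightarrow> bool" where
  "initial C x \<longleftrightarrow> x \<in> cell C 0 \<and>
     (\<forall>n>0. \<forall>f\<in>hom (boundary n) C. f 0 [0] = x \<longrightarrow>
        (\<exists>g\<in>hom (\<Delta> n) C. restr (boundary n) g = f))"

definition pointed :: "'a sset \<Rightarrow> bool" where
  "pointed C \<longleftrightarrow> (\<exists>z. initial C z \<and> final C z)"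

definition base_of_cone ::
  "'k sset \<Rightarrow> (nat \<Rightarrow> (nat list, 'k) join \<Rightarrow> 'a) \<Rightarrow> nat \<Rightarrow> 'k \<Rightarrow> 'a" where
  "base_of_cone K q = restr K (\<lambda>m y. q m (JR y))"

definition base_of_cocone ::
  "'k sset \<Rightarrow> (nat \<Rightarrow> ('k, nat list) join \<Rightarrow> 'a) \<Rightarrow> nat \<Rightarrow> 'k \<Rightarrow> 'a" where
  "base_of_cocone K q = restr K (\<lambda>m y. q m (JL y))"

text \<open>
  A map \<open>\<Delta> 0 \<star> K \<rightarrow> C\<close> extending \<open>p\<close> is literally a vertex of \<open>C\<^bsub>/p\<^esub>\<close>; it is a limit diagram if this
  vertex is final. Dually for colimits.
\<close>

definition limit_diagram ::
  "'k sset \<Rightarrow> 'a sset \<Rightarrow> (nat \<Rightarrow> (nat list, 'k) join \<Rightarrow> 'a) \<Rightarrow> bool" where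
  "limit_diagram K C q \<longleftrightarrow> q \<in> hom (\<Delta> 0 \<star> K) C \<and> final (over K C (base_of_cone K q)) q"

definition colimit_diagram ::
  "'k sset \<Rightarrow> 'a sset \<Rightarrow> (nat \<Rightarrow> ('k, nat list) join \<Rightarrow> 'a) \<Rightarrow> bool" where
  "colimit_diagram K C q \<longleftrightarrow> q \<in> hom (K \<star> \<Delta> 0) C \<and> initial (under K C (base_of_cocone K q)) q"

text \<open>
  Every finite simplicial set has countably many simplices, hence is isomorphic to one whose simplices
  are natural numbers; so it suffices to let the indexing simplicial set range over \<open>nat sset\<close>.
\<close>

definition has_finite_limits :: "'a sset \<Rightarrow> bool" where
  "has_finite_limits C \<longleftrightarrow>
     (\<forall>K :: nat sset. finite_sset K \<longrightarrow>
        (\<forall>p\<in>hom K C. \<exists>q. limit_diagram K C q \<and> base_of_cone K q = p))"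

definition has_finite_colimits :: "'a sset \<Rightarrow> bool" where
  "has_finite_colimits C \<longleftrightarrow>
     (\<forall>K :: nat sset. finite_sset K \<longrightarrow>
        (\<forall>p\<in>hom K C. \<exists>q. colimit_diagram K C q \<and> base_of_cocone K q = p))"


section \<open>Kan extensions along full inclusions\<close>

definition const_map :: "'k sset \<Rightarrow> 'k \<Rightarrow> nat \<Rightarrow> nat list \<Rightarrow> 'k" where
  "const_map K x = restr (\<Delta> 0) (\<lambda>m a. act K 0 a x)"

text \<open>
  For a set \<open>V\<close> of vertices of \<open>K\<close>, spanning the full simplicial subset \<open>K0\<close>, and a vertex \<open>x\<close> of \<open>K\<close>:
  the simplicial sets \<open>K0 \<times>\<^bsub>K\<^esub> K\<^bsub>x/\<^esub>\<close> and \<open>K0 \<times>\<^bsub>K\<^esub> K\<^bsub>/x\<^esub>\<close>. As these are full in the slice, it is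
  enough to constrain vertices: the object of \<open>K\<close> underlying a vertex \<open>h\<close> is \<open>h 0 (JR [0])\<close>,
  resp. \<open>h 0 (JL [0])\<close>.
\<close>

definition rel_under ::
  "'k sset \<Rightarrow> 'k set \<Rightarrow> 'k \<Rightarrow> (nat \<Rightarrow> (nat list, nat list) join \<Rightarrow> 'k) sset" where
  "rel_under K V x = full_sub (under (\<Delta> 0) K (const_map K x)) {h. h 0 (JR [0]) \<in> V}"

definition rel_over ::
  "'k sset \<Rightarrow> 'k set \<Rightarrow> 'k \<Rightarrow> (nat \<Rightarrow> (nat list, nat list) join \<Rightarrow> 'k) sset" where
  "rel_over K V x = full_sub (over (\<Delta> 0) K (const_map K x)) {h. h 0 (JL [0]) \<in> V}"

text \<open>
  The tautological maps \<open>\<Delta> 0 \<star> K\<^bsub>x/\<^esub> \<rightarrow> K\<close> and \<open>K\<^bsub>/x\<^esub> \<star> \<Delta> 0 \<rightarrow> K\<close>, sending the cone point to \<open>x\<close>.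
\<close>

fun under_cone ::
  "'k sset \<Rightarrow> 'k \<Rightarrow> nat \<Rightarrow> (nat list, nat \<Rightarrow> (nat list, nat list) join \<Rightarrow> 'k) join \<Rightarrow> 'k" where
  "under_cone K x n (JL a) = act K 0 a x"
| "under_cone K x n (JR h) = h n (JR (id_map n))"
| "under_cone K x n (JM i j a h) = h n (JM i j a (id_map j))"

fun over_cone ::
  "'k sset \<Rightarrow> 'k \<Rightarrow> nat \<Rightarrow> (nat \<Rightarrow> (nat list, nat list) join \<Rightarrow> 'k, nat list) join \<Rightarrow> 'k" where
  "over_cone K x n (JL h) = h n (JL (id_map n))"
| "over_cone K x n (JR a) = act K 0 a x"
| "over_cone K x n (JM i j h a) = h n (JM i j (id_map i) a)"

text \<open>\<open>F : K \<rightarrow> C\<close> is a right (left) Kan extension of its restriction to \<open>K0\<close>.\<close>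

definition right_kan :: "'k sset \<Rightarrow> 'k set \<Rightarrow> 'a sset \<Rightarrow> (nat \<Rightarrow> 'k \<Rightarrow> 'a) \<Rightarrow> bool" where
  "right_kan K V C F \<longleftrightarrow> F \<in> hom K C \<and>
     (\<forall>x\<in>cell K 0. limit_diagram (rel_under K V x) C
        (cmp (\<Delta> 0 \<star> rel_under K V x) F (under_cone K x)))"

definition left_kan :: "'k sset \<Rightarrow> 'k set \<Rightarrow> 'a sset \<Rightarrow> (nat \<Rightarrow> 'k \<Rightarrow> 'a) \<Rightarrow> bool" where
  "left_kan K V C F \<longleftrightarrow> F \<in> hom K C \<and>
     (\<forall>x\<in>cell K 0. colimit_diagram (rel_over K V x) C
        (cmp (rel_over K V x \<star> \<Delta> 0) F (over_cone K x)))"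

text \<open>
  A Kan extension functor is a section of the restriction map \<open>Fun K C \<rightarrow> Fun K0 C\<close> whose values on
  objects are Kan extensions. It is determined up to a contractible space of choices, which is why the
  notion is a predicate rather than a function.
\<close>

definition kan_section ::
  "'k sset \<Rightarrow> 'k set \<Rightarrow> 'a sset \<Rightarrow> (nat \<Rightarrow> ('k, 'a) fun_cell \<Rightarrow> ('k, 'a) fun_cell) \<Rightarrow> bool" where
  "kan_section K V C S \<longleftrightarrow> S \<in> hom (Fun (full_sub K V) C) (Fun K C) \<and>
     cmp (Fun (full_sub K V) C) (precomp (full_sub K V) K C (\<lambda>_ x. x)) S = idm (Fun (full_sub K V) C)"

definition right_kan_functor ::
  "'k sset \<Rightarrow> 'k set \<Rightarrow> 'a sset \<Rightarrow> (nat \<Rightarrow> ('k, 'a) fun_cell \<Rightarrow> ('k, 'a) fun_cell) \<Rightarrow> bool" where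
  "right_kan_functor K V C R \<longleftrightarrow> kan_section K V C R \<and>
     (\<forall>u\<in>cell (Fun (full_sub K V) C) 0. right_kan K V C (map_of_vertex K (R 0 u)))"

definition left_kan_functor ::
  "'k sset \<Rightarrow> 'k set \<Rightarrow> 'a sset \<Rightarrow> (nat \<Rightarrow> ('k, 'a) fun_cell \<Rightarrow> ('k, 'a) fun_cell) \<Rightarrow> bool" where
  "left_kan_functor K V C L \<longleftrightarrow> kan_section K V C L \<and>
     (\<forall>u\<in>cell (Fun (full_sub K V) C) 0. left_kan K V C (map_of_vertex K (L 0 u)))"


section \<open>Cofiber and fiber functors\<close>

type_synonym sq = "nat list \<times> nat list"

text \<open>The first coordinate runs horizontally, the second one downwards.\<close>

definition Sq :: "sq sset" where
  "Sq = \<Delta> 1 \<otimes> \<Delta> 1"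

definition top_edge :: "sq set" where
  "top_edge = {([0], [0]), ([1], [0])}"

definition right_edge :: "sq set" where
  "right_edge = {([1], [0]), ([1], [1])}"

definition span :: "sq set" where
  "span = insert ([0], [1]) top_edge"

definition cospan :: "sq set" where
  "cospan = insert ([0], [1]) right_edge"

definition incl_top :: "nat \<Rightarrow> nat list \<Rightarrow> sq" where
  "incl_top m a = (a, replicate (Suc m) 0)"

definition incl_right :: "nat \<Rightarrow> nat list \<Rightarrow> sq" where
  "incl_right m a = (replicate (Suc m) 1, a)"

text \<open>
  The edges \<open>full_sub _ top_edge\<close> and \<open>full_sub _ right_edge\<close> are identified with \<open>\<Delta> 1\<close> by the first,
  respectively second, projection; restriction along these projections places an arrow of \<open>C\<close> on the
  edge.
\<close>

definition is_Cof ::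
  "'a sset \<Rightarrow> (nat \<Rightarrow> (nat list, 'a) fun_cell \<Rightarrow> (nat list, 'a) fun_cell) \<Rightarrow> bool" where
  "is_Cof C F \<longleftrightarrow> (\<exists>R L.
     right_kan_functor (full_sub Sq span) top_edge C R \<and>
     left_kan_functor Sq span C L \<and>
     F = cmp (Fun (\<Delta> 1) C) (precomp (\<Delta> 1) Sq C incl_right)
          (cmp (Fun (\<Delta> 1) C) L
            (cmp (Fun (\<Delta> 1) C) R
              (precomp (full_sub (full_sub Sq span) top_edge) (\<Delta> 1) C (\<lambda>_. fst)))))"

definition is_Fib ::
  "'a sset \<Rightarrow> (nat \<Rightarrow> (nat list, 'a) fun_cell \<Rightarrow> (nat list, 'a) fun_cell) \<Rightarrow> bool" where
  "is_Fib C G \<longleftrightarrow> (\<exists>L R.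
     left_kan_functor (full_sub Sq cospan) right_edge C L \<and>
     right_kan_functor Sq cospan C R \<and>
     G = cmp (Fun (\<Delta> 1) C) (precomp (\<Delta> 1) Sq C incl_top)
          (cmp (Fun (\<Delta> 1) C) R
            (cmp (Fun (\<Delta> 1) C) L
              (precomp (full_sub (full_sub Sq cospan) right_edge) (\<Delta> 1) C (\<lambda>_. snd)))))"


section \<open>Adjunctions\<close>

text \<open>
  \<open>composite X f g h\<close>: the edge \<open>h\<close> is a composite of \<open>f\<close> followed by \<open>g\<close>, witnessed by a 2-simplex.
\<close>

definition composite :: "'a sset \<Rightarrow> 'a \<Rightarrow> 'a \<Rightarrow> 'a \<Rightarrow> bool" where
  "composite X f g h \<longleftrightarrow>
     (\<exists>s\<in>cell X 2. act X 2 [0, 1] s = f \<and> act X 2 [1, 2] s = g \<and> act X 2 [0, 2] s = h)"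

definition nat_trans ::
  "'a sset \<Rightarrow> 'b sset \<Rightarrow> (nat \<Rightarrow> 'a \<Rightarrow> 'b) \<Rightarrow> (nat \<Rightarrow> 'a \<Rightarrow> 'b) \<Rightarrow> ('a, 'b) fun_cell \<Rightarrow> bool" where
  "nat_trans X Y f g t \<longleftrightarrow> t \<in> cell (Fun X Y) 1 \<and>
     act (Fun X Y) 1 [0] t = vertex_of X f \<and> act (Fun X Y) 1 [1] t = vertex_of X g"

definition id_trans :: "'a sset \<Rightarrow> 'b sset \<Rightarrow> (nat \<Rightarrow> 'a \<Rightarrow> 'b) \<Rightarrow> ('a, 'b) fun_cell" where
  "id_trans X Y f = act (Fun X Y) 0 [0, 0] (vertex_of X f)"

text \<open>
  \<open>F\<close> is left adjoint to \<open>G\<close>: there are a unit \<open>\<eta> : id \<rightarrow> G F\<close> and a counit \<open>\<epsilon> : F G \<rightarrow> id\<close> satisfying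
  the triangle identities up to homotopy, i.e. the identity of \<open>F\<close> is a composite of \<open>F \<eta>\<close> and \<open>\<epsilon> F\<close>
  in \<open>Fun C D\<close>, and the identity of \<open>G\<close> is a composite of \<open>\<eta> G\<close> and \<open>G \<epsilon>\<close> in \<open>Fun D C\<close>.
\<close>

definition adjunction ::
  "'a sset \<Rightarrow> 'b sset \<Rightarrow> (nat \<Rightarrow> 'a \<Rightarrow> 'b) \<Rightarrow> (nat \<Rightarrow> 'b \<Rightarrow> 'a) \<Rightarrow> bool" where
  "adjunction C D F G \<longleftrightarrow> F \<in> hom C D \<and> G \<in> hom D C \<and>
     (\<exists>\<eta> \<epsilon>. nat_trans C C (idm C) (cmp C G F) \<eta> \<and> nat_trans D D (cmp D F G) (idm D) \<epsilon> \<and>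
        composite (Fun C D) (postcomp C C F 1 \<eta>) (precomp C D D F 1 \<epsilon>) (id_trans C D F) \<and>
        composite (Fun D C) (precomp D C C G 1 \<eta>) (postcomp D D G 1 \<epsilon>) (id_trans D C G))"

end

theory Submission
 imports Defs "HOL-Library.Product_Lexorder" "HOL-Library.Countable"
begin

text \<open>
 Restricting a square to its top edge has a section sending a morphism to its cofiber square, restricting it to
 its right edge has a section sending a morphism to its fiber square, and \<open>Cof\<close> (\<open>Fib\<close>) is the first (second)
 section followed by the other restriction. Restriction to the top edge lifts spheres whose first vertex is a
 cofiber square and whose last vertex has a zero corner; restriction to the right edge lifts spheres whose last
 vertex is a fiber square and whose first vertex has a zero corner. Lifting identities along the two restrictions
 gives transformations between the sections, whose other restrictions are the unit and the counit, and the
 triangle identities come from lifting degenerate 2-simplices.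

 Colimits over, and Kan extensions along, full subcategories of the square are described by extension of maps
 between ordered simplicial complexes, where everything reduces to filling inner horns.
\<close>

text \<open>Kan extension functors are unique only up to a contractible choice, so
  \<open>Cof\<close> and \<open>Fib\<close> admit no formula; using nothing but the lifting of
  spheres makes the argument independent of the choice. The zero object is used twice: it supplies
  the value at the corner \<open>(0, 1)\<close>, and it makes every final object initial and
  conversely. The second use resolves a mismatch: cofiber squares come with a final corner, but the
  lifts that start at them along the right edge ask for an initial one; for fiber squares it is the
  other way round. The main obstacle is that Kan extensions at a vertex of the subcategory itself
  are colimits of diagrams with a greatest vertex, which lead to outer horns with a degenerate first
  edge; these must be reduced to inner horns. Limits are obtained from colimits in the opposite, by
  the order-reversing reflection of the square that fixes the corner. Vertices are tuples of numbers
  whose lexicographic order refines the partial order at hand, so that squares, joins and prisms are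
  all complexes with sorted lists as simplices.\<close>

type_synonym pair = "nat * nat"
type_synonym triple = "nat * nat * nat"

section \<open>Monotone maps\<close>

lemma mono_mapsD:
 assumes "th : mono_maps m n"
 shows "length th = Suc m" "sorted th" "!!i. i <= m ==> th ! i <= n"
  "!!i j. i <= j ==> j <= m ==> th ! i <= th ! j" "set th <= {..n}"
proof -
 have *: "length th = Suc m" "sorted th" "set th <= {..n}"
  using assms by (auto simp: mono_maps_def)
 then show "length th = Suc m" "sorted th" "set th <= {..n}" by auto
 show "th ! i <= th ! j" if "i <= j" "j <= m" for i j
  using * that by (auto simp: sorted_iff_nth_mono)
 show "th ! i <= n" if "i <= m" for i
  using * that nth_mem[of i th] by (metis atMost_iff less_Suc_eq_le subsetD)
qed

lemma mono_mapsI: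
 assumes "length th = Suc m" "!!i j. i <= j ==> j <= m ==> th ! i <= th ! j"
  "!!i. i <= m ==> th ! i <= n"
 shows "th : mono_maps m n"
 using assms by (auto simp: mono_maps_def sorted_iff_nth_mono in_set_conv_nth less_Suc_eq_le)

lemma length_after [simp]: "length (th \<cdot> fi) = length fi"
 by (simp add: after_def)

lemma nth_after [simp]: "i < length fi ==> (th \<cdot> fi) ! i = th ! (fi ! i)"
 by (simp add: after_def)

lemma after_assoc_length: "(!!i. i : set psi ==> i < length fi) ==> (th \<cdot> fi) \<cdot> psi = th \<cdot> (fi \<cdot> psi)"
 by (simp add: after_def)

lemma after_assoc:
 assumes "psi : mono_maps j k" "length fi = Suc k"
 shows "(th \<cdot> fi) \<cdot> psi = th \<cdot> (fi \<cdot> psi)"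
 using mono_mapsD(5)[OF assms(1)] assms(2) by (intro after_assoc_length) auto

lemma after_mono [intro]:
 assumes "th : mono_maps m n" "fi : mono_maps k m"
 shows "th \<cdot> fi : mono_maps k n"
 using mono_mapsD[OF assms(1)] mono_mapsD[OF assms(2)]
 by (intro mono_mapsI) (auto simp: less_Suc_eq_le)

lemma id_map_mono [simp, intro]: "id_map n : mono_maps n n"
 by (intro mono_mapsI) (auto simp: id_map_def simp del: upt_Suc)

lemma length_id_map [simp]: "length (id_map n) = Suc n"
 by (simp add: id_map_def)

lemma set_id_map [simp]: "set (id_map n) = {..n}"
 by (auto simp: id_map_def)

lemma nth_id_map [simp]: "i <= n ==> id_map n ! i = i"
 by (simp add: id_map_def del: upt_Suc)

lemma id_after [simp]: "fi : mono_maps k n ==> id_map n \<cdot> fi = fi"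
 using mono_mapsD[of fi k n] by (auto intro!: nth_equalityI)

lemma after_id_length: "length th = Suc n ==> th \<cdot> id_map n = th"
 by (auto intro!: nth_equalityI)

lemma after_id [simp]: "th : mono_maps n k ==> th \<cdot> id_map n = th"
 using mono_mapsD(1) after_id_length by blast

lemma singleton_mono [simp]: "[i] : mono_maps 0 n \<longleftrightarrow> i <= n"
 by (auto simp: mono_maps_def)

lemma mono_maps_0: "th : mono_maps 0 n \<longleftrightarrow> (EX i<=n. th = [i])"
 by (auto simp: mono_maps_def length_Suc_conv)

lemma after_singleton [simp]: "th \<cdot> [i] = [th ! i]"
 by (simp add: after_def)

lemma set_after_subset: "set fi <= {..<length th} ==> set (th \<cdot> fi) <= set th"
 by (auto simp: after_def)

lemma set_after_mono: "fi : mono_maps k m ==> length th = Suc m ==> set (th \<cdot> fi) <= set th"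
 using mono_mapsD(5)[of fi k m] by (intro set_after_subset) auto

lemma mono_full_id:
 assumes "a : mono_maps n n" "set a = {..n}" shows "a = id_map n"
proof -
 have "distinct a" using assms mono_mapsD(1)[OF assms(1)] by (intro card_distinct) auto
 moreover have "distinct (id_map n)" by (simp add: id_map_def del: upt_Suc)
 ultimately show ?thesis
  using assms(2) mono_mapsD(2)[OF assms(1)] mono_mapsD(2)[OF id_map_mono[of n]]
  by (intro sorted_distinct_set_unique) simp_all
qed

lemma mono_full_ends:
 assumes "a : mono_maps m n" "set a = {..n}" shows "a ! 0 = 0" "a ! m = n"
proof -
 from assms(2) have "0 : set a" "n : set a" by auto
 then obtain i j where ij: "i <= m" "a ! i = 0" "j <= m" "a ! j = n"
  unfolding in_set_conv_nth mono_mapsD(1)[OF assms(1)] less_Suc_eq_le by auto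
 show "a ! 0 = 0" using mono_mapsD(4)[OF assms(1), of 0 i] ij by simp
 show "a ! m = n" using mono_mapsD(4)[OF assms(1), of j m] mono_mapsD(3)[OF assms(1), of m] ij by simp
qed

section \<open>Coface maps and factorization through faces\<close>

definition skip :: "nat => nat => nat list" where
 "skip n i = map (%t. if t < i then t else Suc t) [0..<Suc n]"

text \<open>This is the codegeneracy that repeats \<open>i\<close>; on lists that avoid
  \<open>i\<close> it undoes the coface map \<open>skip\<close>.\<close>

definition unskip :: "nat => nat list => nat list" where
 "unskip i a = map (%t. if t <= i then t else t - 1) a"

lemma skip_mono [intro, simp]: "skip n i : mono_maps n (Suc n)"
 by (intro mono_mapsI) (auto simp: skip_def simp del: upt_Suc)

lemma length_skip [simp]: "length (skip n i) = Suc n"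
 by (simp add: skip_def)

lemma nth_skip [simp]: "t <= n ==> skip n i ! t = (if t < i then t else Suc t)"
 by (simp add: skip_def del: upt_Suc)

lemma not_in_skip: "i ~: set (skip n i)"
 by (auto simp: skip_def)

lemma unskip_mono:
 assumes "a : mono_maps m (Suc n)" "i ~: set a" "i <= Suc n"
 shows "unskip i a : mono_maps m n"
proof (rule mono_mapsI)
 have *: "a ! t ~= i" "a ! t <= Suc n" if "t <= m" for t
  using assms(2) mono_mapsD(1,3)[OF assms(1)] that by (auto simp: in_set_conv_nth less_Suc_eq_le)
 show "unskip i a ! t <= n" if "t <= m" for t
  using *[OF that] assms(3) that mono_mapsD(1)[OF assms(1)] by (auto simp: unskip_def)
 show "unskip i a ! t <= unskip i a ! u" if "t <= u" "u <= m" for t u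
  using *[OF that(2)] that mono_mapsD(1)[OF assms(1)] mono_mapsD(4)[OF assms(1) that] by (auto simp: unskip_def)
qed (use mono_mapsD(1)[OF assms(1)] in \<open>simp add: unskip_def\<close>)

lemma skip_unskip:
 assumes "a : mono_maps m (Suc n)" "i ~: set a" "i <= Suc n"
 shows "skip n i \<cdot> unskip i a = a"
proof (rule nth_equalityI)
 fix t assume "t < length (skip n i \<cdot> unskip i a)"
 then have t: "t < length a" by (simp add: unskip_def)
 then have "a ! t ~= i" using assms(2) nth_mem by blast
 moreover have "a ! t <= Suc n" using t mono_mapsD(1,3)[OF assms(1)] by auto
 ultimately show "(skip n i \<cdot> unskip i a) ! t = a ! t"
  using t assms(3) by (auto simp: unskip_def)
qed (simp add: unskip_def)

section \<open>Simplicial sets and maps\<close>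

lemma sset_cell: "simplicial_set X ==> th : mono_maps m n ==> x : cell X n ==> act X n th x : cell X m"
 by (auto simp: simplicial_set_def)

lemma sset_id: "simplicial_set X ==> x : cell X n ==> act X n (id_map n) x = x"
 by (auto simp: simplicial_set_def)

lemma sset_act: "simplicial_set X ==> th : mono_maps m n ==> fi : mono_maps k m ==> x : cell X n ==>
  act X m fi (act X n th x) = act X n (th \<cdot> fi) x"
 by (auto simp: simplicial_set_def)

lemma simplicial_setI:
 assumes "!!m n th x. th : mono_maps m n ==> x : cell X n ==> act X n th x : cell X m"
  and "!!n x. x : cell X n ==> act X n (id_map n) x = x"
  and "!!k m n th fi x. th : mono_maps m n ==> fi : mono_maps k m ==> x : cell X n ==>
    act X m fi (act X n th x) = act X n (th \<cdot> fi) x"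
 shows "simplicial_set X"
 using assms by (auto simp: simplicial_set_def)

lemma hom_cell: "f : hom X Y ==> x : cell X n ==> f n x : cell Y n"
 by (auto simp: hom_def)

lemma hom_act: "f : hom X Y ==> th : mono_maps m n ==> x : cell X n ==> f m (act X n th x) = act Y n th (f n x)"
 by (auto simp: hom_def)

lemma restr_apply [simp]: "x : cell A n ==> restr A f n x = f n x"
 by (simp add: restr_def)

lemma restr_homI:
 assumes "!!n x. x : cell X n ==> f n x : cell Y n"
  and "!!m n th x. th : mono_maps m n ==> x : cell X n ==> act X n th x : cell X m"
  and "!!m n th x. th : mono_maps m n ==> x : cell X n ==> f m (act X n th x) = act Y n th (f n x)"
 shows "restr X f : hom X Y"
 using assms by (auto simp: hom_def restr_def)

lemma hom_undefined: "f : hom X Y ==> x ~: cell X n ==> f n x = undefined"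
 unfolding hom_def by (blast intro: PiE_arb)

lemma hom_eqI:
 assumes "f : hom X Y" "g : hom X Z" "!!n x. x : cell X n ==> f n x = g n x"
 shows "f = g"
proof (intro ext)
 fix n x show "f n x = g n x"
  using assms(3) hom_undefined[OF assms(1)] hom_undefined[OF assms(2)]
  by (cases "x : cell X n") simp_all
qed

lemma restr_eqI:
 assumes "f : hom X Y" "!!n x. x : cell X n ==> g n x = f n x"
 shows "restr X g = f"
proof (intro ext)
 fix n x show "restr X g n x = f n x"
  using assms(2) hom_undefined[OF assms(1)] by (cases "x : cell X n") (simp_all add: restr_def)
qed

lemma restr_cong: "(!!n x. x : cell X n ==> g n x = f n x) ==> restr X g = restr X f"
 by (auto simp: restr_def fun_eq_iff)

lemma hom_compose:
 assumes "f : hom X Y" "g : hom Y Z" "simplicial_set X"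
 shows "restr X (%n x. g n (f n x)) : hom X Z"
 using assms by (intro restr_homI) (auto simp: hom_cell hom_act sset_cell)

lemma cmp_hom: "f : hom X Y ==> g : hom Y Z ==> simplicial_set X ==> cmp X g f : hom X Z"
 unfolding cmp_def by (rule hom_compose)

lemma cmp_apply [simp]: "x : cell X n ==> cmp X g f n x = g n (f n x)"
 by (simp add: cmp_def)

lemma idm_apply [simp]: "x : cell X n ==> idm X n x = x"
 by (simp add: idm_def)

lemma idm_hom [intro]: "simplicial_set X ==> idm X : hom X X"
 unfolding idm_def by (rule restr_homI) (auto simp: sset_cell)

text \<open>Equality of the actions as total functions, rather than agreement on simplices, lets
  \<open>act A\<close> be rewritten to \<open>act X\<close> without side conditions.\<close>

definition sub_sset :: "'a sset => 'a sset => bool" where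
 "sub_sset A X \<longleftrightarrow> act A = act X & (ALL n. cell A n <= cell X n) &
   (ALL m n. ALL th:mono_maps m n. ALL x:cell A n. act X n th x : cell A m)"

lemma sub_cell: "sub_sset A X ==> x : cell A n ==> x : cell X n"
 by (auto simp: sub_sset_def)

lemma sub_act: "sub_sset A X ==> act A = act X"
 by (auto simp: sub_sset_def)

lemma sub_closed: "sub_sset A X ==> th : mono_maps m n ==> x : cell A n ==> act X n th x : cell A m"
 by (auto simp: sub_sset_def)

lemma sub_sset_simplicial:
 assumes "sub_sset A X" "simplicial_set X" shows "simplicial_set A"
 by (rule simplicial_setI)
  (simp_all add: sub_act[OF assms(1)] sub_closed[OF assms(1)] sub_cell[OF assms(1)]
   sset_id[OF assms(2)] sset_act[OF assms(2)])

lemma sub_restr_hom: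
 assumes "sub_sset A X" "f : hom X Y"
 shows "restr A f : hom A Y"
 by (rule restr_homI)
  (simp_all add: hom_cell[OF assms(2)] hom_act[OF assms(2)] sub_cell[OF assms(1)] sub_act[OF assms(1)] sub_closed[OF assms(1)])

lemma full_sub_cell: "x : cell (full_sub X V) n \<longleftrightarrow> x : cell X n & (ALL i<=n. act X n [i] x : V)"
 by (simp add: full_sub_def)

lemma full_sub_act [simp]: "act (full_sub X V) = act X"
 by (simp add: full_sub_def)

lemma full_sub_sub [intro]: "simplicial_set X ==> sub_sset (full_sub X V) X"
 unfolding sub_sset_def
 by (auto simp: full_sub_cell sset_cell sset_act[where k = 0] mono_mapsD(3))

lemma full_sub_full_sub: "simplicial_set X ==> full_sub (full_sub X V) W = full_sub X (V Int W)"
 by (auto simp: full_sub_def intro!: arg_cong[of _ _ "%c. X\<lparr>cell := c\<rparr>"])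

lemma full_sub_simplicial: "simplicial_set X ==> simplicial_set (full_sub X V)"
 using full_sub_sub sub_sset_simplicial by blast

lemma simplex_cell [simp]: "cell (\<Delta> n) m = mono_maps m n"
 by (simp add: simplex_def)

lemma simplex_act [simp]: "act (\<Delta> n) m th a = a \<cdot> th"
 by (simp add: simplex_def)

lemma simplex_simplicial [simp, intro]: "simplicial_set (\<Delta> n)"
 by (rule simplicial_setI) (auto simp: after_assoc mono_mapsD(1))

lemma boundary_cell: "a : cell (boundary n) m \<longleftrightarrow> a : mono_maps m n & set a ~= {..n}"
 by (simp add: boundary_def)

lemma boundary_act [simp]: "act (boundary n) m th a = a \<cdot> th"
 by (simp add: boundary_def)

lemma boundary_sub: "sub_sset (boundary n) (\<Delta> n)"
 unfolding sub_sset_def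
proof (intro conjI ballI allI)
 fix m k th x assume *: "th : mono_maps m k" "x : cell (boundary n) k"
 then have "set (x \<cdot> th) <= set x"
  by (intro set_after_mono) (auto simp: boundary_cell mono_mapsD(1))
 moreover have "set x ~= {..n}" "set x <= {..n}" using * mono_mapsD(5)[of x k n] by (auto simp: boundary_cell)
 ultimately show "act (\<Delta> n) k th x : cell (boundary n) m"
  using * by (auto simp: boundary_cell)
qed (auto simp: boundary_cell fun_eq_iff)

lemma boundary_simplicial [simp, intro]: "simplicial_set (boundary n)"
 using sub_sset_simplicial[OF boundary_sub] by blast

lemma horn_cell: "a : cell (horn n k) m \<longleftrightarrow> a : mono_maps m n & ~ {..n} - {k} <= set a"
 by (simp add: horn_def)

lemma horn_act [simp]: "act (horn n k) m th a = a \<cdot> th"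
 by (simp add: horn_def)

lemma horn_sub: "sub_sset (horn n k) (\<Delta> n)"
 unfolding sub_sset_def
proof (intro conjI ballI allI)
 fix m j th x assume *: "th : mono_maps m j" "x : cell (horn n k) j"
 then have "set (x \<cdot> th) <= set x"
  by (intro set_after_mono) (auto simp: horn_cell mono_mapsD(1))
 then show "act (\<Delta> n) j th x : cell (horn n k) m"
  using * by (auto simp: horn_cell)
qed (auto simp: horn_cell fun_eq_iff)

lemma horn_simplicial [simp, intro]: "simplicial_set (horn n k)"
 using sub_sset_simplicial[OF horn_sub] by blast

section \<open>Representable maps and the filling of spheres\<close>

definition yo :: "'a sset => nat => 'a => nat => nat list => 'a" where
 "yo X n x = restr (\<Delta> n) (%m a. act X n a x)"

lemma yo_apply [simp]: "a : mono_maps m n ==> yo X n x m a = act X n a x"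
 by (simp add: yo_def)

lemma yo_hom: "simplicial_set X ==> x : cell X n ==> yo X n x : hom (\<Delta> n) X"
 unfolding yo_def by (rule restr_homI) (auto simp: sset_cell sset_act)

text \<open>Yoneda: every list \<open>a\<close> is the restriction of the identity list along
  \<open>a\<close>.\<close>

lemma hom_yo:
 assumes "g : hom (\<Delta> n) X" "a : mono_maps m n"
 shows "g m a = act X n a (g n (id_map n))"
 using hom_act[OF assms(1), of a m n "id_map n"] assms by simp

text \<open>A filler is recorded as a single simplex. By Yoneda this amounts to a map out of
  \<open>\<Delta> n\<close>, but a simplex is easier to adjoin to a partial map in the extension
  over skeleta.\<close>

definition sphere_fill :: "'a sset => nat => (nat => nat list => 'a) => 'a => bool" where
 "sphere_fill E n s e \<longleftrightarrow> e : cell E n & (ALL m. ALL a:cell (boundary n) m. act E n a e = s m a)"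

lemma sphere_fill_iff:
 assumes "simplicial_set E" "s : hom (boundary n) E"
 shows "(EX e. sphere_fill E n s e) \<longleftrightarrow> (EX g:hom (\<Delta> n) E. restr (boundary n) g = s)"
proof
 assume "EX e. sphere_fill E n s e"
 then obtain e where e: "sphere_fill E n s e" by blast
 then have "yo E n e : hom (\<Delta> n) E" using assms by (auto simp: sphere_fill_def yo_hom)
 moreover have "restr (boundary n) (yo E n e) = s"
  using e by (intro restr_eqI[OF assms(2)]) (auto simp: sphere_fill_def boundary_cell)
 ultimately show "EX g:hom (\<Delta> n) E. restr (boundary n) g = s" by blast
next
 assume "EX g:hom (\<Delta> n) E. restr (boundary n) g = s"
 then obtain g where g: "g : hom (\<Delta> n) E" "restr (boundary n) g = s" by blast
 have "sphere_fill E n s (g n (id_map n))"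
  unfolding sphere_fill_def using g
  by (auto simp: hom_cell boundary_cell simp flip: hom_yo)
 then show "EX e. sphere_fill E n s e" by blast
qed

lemma initial_iff:
 assumes "simplicial_set C"
 shows "initial C x \<longleftrightarrow> x : cell C 0 &
   (ALL n>0. ALL f:hom (boundary n) C. f 0 [0] = x --> (EX e. sphere_fill C n f e))"
 unfolding initial_def using sphere_fill_iff[OF assms] by auto

lemma final_iff:
 assumes "simplicial_set C"
 shows "final C x \<longleftrightarrow> x : cell C 0 &
   (ALL n>0. ALL f:hom (boundary n) C. f 0 [n] = x --> (EX e. sphere_fill C n f e))"
 unfolding final_def using sphere_fill_iff[OF assms] by auto

section \<open>Products and functor objects\<close>

lemma prod_cell [simp]: "cell (X \<otimes> Y) n = cell X n \<times> cell Y n"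
 by (simp add: prod_sset_def)

lemma prod_act [simp]: "act (X \<otimes> Y) n th (x, y) = (act X n th x, act Y n th y)"
 by (simp add: prod_sset_def)

lemma prod_simplicial [intro]: "simplicial_set X ==> simplicial_set Y ==> simplicial_set (X \<otimes> Y)"
 by (rule simplicial_setI) (auto simp: sset_cell sset_id sset_act)

lemma Fun_cell [simp]: "cell (Fun X Y) n = hom (\<Delta> n \<otimes> X) Y"
 by (simp add: Fun_def)

lemma Fun_act: "th : mono_maps m n ==>
  act (Fun X Y) k th h = restr (\<Delta> m \<otimes> X) (%k (a, x). h k (th \<cdot> a, x))"
 by (simp add: Fun_def mono_mapsD(1))

lemma Fun_act_apply [simp]: "th : mono_maps m n ==> a : mono_maps k m ==> x : cell X k ==>
  act (Fun X Y) j th h k (a, x) = h k (th \<cdot> a, x)"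
 by (simp add: Fun_act)

lemma Fun_act_cell:
 assumes "simplicial_set X" "th : mono_maps m n" "h : hom (\<Delta> n \<otimes> X) Y"
 shows "act (Fun X Y) n th h : hom (\<Delta> m \<otimes> X) Y"
proof -
 have "h k ((th \<cdot> a) \<cdot> fi, act X j fi x) = act Y j fi (h j (th \<cdot> a, x))"
  if "a : mono_maps j m" "x : cell X j" "fi : mono_maps k j" for k j fi a x
  using that hom_act[OF assms(3), of fi k j "(th \<cdot> a, x)"] assms(2) by auto
 with assms show ?thesis
  unfolding Fun_act[OF assms(2)]
  by (intro restr_homI) (auto simp: sset_cell after_assoc mono_mapsD(1) intro!: hom_cell[OF assms(3)])
qed

lemma Fun_simplicial [intro]:
 assumes "simplicial_set X"
 shows "simplicial_set (Fun X Y)"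
proof (rule simplicial_setI)
 fix m n th h assume "th : mono_maps m n" "h : cell (Fun X Y) n"
 then show "act (Fun X Y) n th h : cell (Fun X Y) m" using Fun_act_cell assms by simp
next
 fix n h assume h: "h : cell (Fun X Y) n"
 then have h': "h : hom (\<Delta> n \<otimes> X) Y" by simp
 show "act (Fun X Y) n (id_map n) h = h"
  by (rule hom_eqI[OF Fun_act_cell[OF assms id_map_mono h'] h']) (auto simp: Fun_act[OF id_map_mono])
next
 fix k m n th fi h assume *: "th : mono_maps m n" "fi : mono_maps k m" "h : cell (Fun X Y) n"
 then have h': "h : hom (\<Delta> n \<otimes> X) Y" by simp
 show "act (Fun X Y) m fi (act (Fun X Y) n th h) = act (Fun X Y) n (th \<cdot> fi) h"
  by (rule hom_eqI[OF Fun_act_cell[OF assms *(2) Fun_act_cell[OF assms *(1) h']] Fun_act_cell[OF assms after_mono[OF *(1,2)] h']])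
   (use * in \<open>auto simp: Fun_act[OF *(1)] Fun_act[OF *(2)] Fun_act[OF after_mono[OF *(1,2)]] after_assoc mono_mapsD(1) after_mono[OF *(2)]\<close>)
qed

lemma precomp_apply [simp]: "h : hom (\<Delta> n \<otimes> X) Y ==>
  precomp X' X Y j n h = restr (\<Delta> n \<otimes> X') (%m (a, x). h m (a, j m x))"
 by (simp add: precomp_def)

lemma precomp_cell:
 assumes "simplicial_set X'" "h : hom (\<Delta> n \<otimes> X) Y"
  "!!m x. x : cell X' m ==> j m x : cell X m"
  "!!m k th x. x : cell X' m ==> th : mono_maps k m ==> j k (act X' m th x) = act X m th (j m x)"
 shows "restr (\<Delta> n \<otimes> X') (%m (a, x). h m (a, j m x)) : hom (\<Delta> n \<otimes> X') Y"
proof -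
 have "h k (a \<cdot> fi, act X m fi (j m x)) = act Y m fi (h m (a, j m x))"
  if "a : mono_maps m n" "x : cell X' m" "fi : mono_maps k m" for k m fi a x
  using that hom_act[OF assms(2), of fi k m "(a, j m x)"] assms(3) by auto
 with assms show ?thesis
  by (intro restr_homI) (auto simp: sset_cell intro!: hom_cell[OF assms(2)])
qed

lemma precomp_hom:
 assumes "simplicial_set X'" "simplicial_set X"
  "!!m x. x : cell X' m ==> j m x : cell X m"
  "!!m k th x. x : cell X' m ==> th : mono_maps k m ==> j k (act X' m th x) = act X m th (j m x)"
 shows "precomp X' X Y j : hom (Fun X Y) (Fun X' Y)"
 unfolding precomp_def
proof (rule restr_homI)
 fix m n th h assume *: "th : mono_maps m n" "h : cell (Fun X Y) n"
 then have h: "h : hom (\<Delta> n \<otimes> X) Y" by simp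
 note h' = Fun_act_cell[OF assms(2) *(1) h]
 note c = precomp_cell[OF assms(1) h assms(3,4)]
 note c' = precomp_cell[OF assms(1) h' assms(3,4)]
 show "act (Fun X Y) n th h : cell (Fun X Y) m" using h' by simp
 show "restr (\<Delta> m \<otimes> X') (%k (a, x). act (Fun X Y) n th h k (a, j k x)) =
    act (Fun X' Y) n th (restr (\<Delta> n \<otimes> X') (%m (a, x). h m (a, j m x)))"
  by (rule hom_eqI[OF c' Fun_act_cell[OF assms(1) *(1) c]])
   (use * assms(3) in \<open>auto simp: Fun_act[OF *(1)] after_mono[OF *(1)]\<close>)
qed (use precomp_cell[OF assms(1) _ assms(3,4)] in auto)

lemma postcomp_apply [simp]: "h : hom (\<Delta> n \<otimes> X) Y ==> postcomp X Y g n h = cmp (\<Delta> n \<otimes> X) g h"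
 by (simp add: postcomp_def)

lemma postcomp_hom:
 assumes "simplicial_set X" "g : hom Y Y'"
 shows "postcomp X Y g : hom (Fun X Y) (Fun X Y')"
 unfolding postcomp_def
proof (rule restr_homI)
 fix m n th h assume *: "th : mono_maps m n" "h : cell (Fun X Y) n"
 then have h: "h : hom (\<Delta> n \<otimes> X) Y" by simp
 note h' = Fun_act_cell[OF assms(1) *(1) h]
 have s: "simplicial_set (\<Delta> k \<otimes> X)" for k using assms(1) by blast
 show "act (Fun X Y) n th h : cell (Fun X Y) m" using h' by simp
 show "cmp (\<Delta> m \<otimes> X) g (act (Fun X Y) n th h) = act (Fun X Y') n th (cmp (\<Delta> n \<otimes> X) g h)"
  by (rule hom_eqI[OF cmp_hom[OF h' assms(2) s] Fun_act_cell[OF assms(1) *(1) cmp_hom[OF h assms(2) s]]])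
   (use * in \<open>auto simp: Fun_act[OF *(1)] after_mono[OF *(1)]\<close>)
next
 fix n h assume "h : cell (Fun X Y) n"
 then show "cmp (\<Delta> n \<otimes> X) g h : cell (Fun X Y') n"
  using assms by (auto intro!: cmp_hom)
qed

section \<open>Opposites\<close>

text \<open>Conjugation of a monotone map with the order reversals of its source and its
  target.\<close>

definition flip :: "nat => nat list => nat list" where
 "flip n th = rev (map (%t. n - t) th)"

lemma length_flip [simp]: "length (flip n th) = length th"
 by (simp add: flip_def)

lemma nth_flip: "length th = Suc m ==> i <= m ==> flip n th ! i = n - th ! (m - i)"
 by (simp add: flip_def rev_nth)

lemma flip_mono [intro, simp]:
 assumes "th : mono_maps m n" shows "flip n th : mono_maps m n"
 using mono_mapsD[OF assms] by (intro mono_mapsI) (auto simp: nth_flip diff_le_mono2)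

lemma flip_flip [simp]: "th : mono_maps m n ==> flip n (flip n th) = th"
 using mono_mapsD[of th m n] mono_mapsD(1)[OF flip_mono[of th m n]]
 by (auto intro!: nth_equalityI simp: nth_flip less_Suc_eq_le)

lemma flip_id [simp]: "flip n (id_map n) = id_map n"
 by (auto intro!: nth_equalityI simp: nth_flip less_Suc_eq_le)

lemma flip_after:
 assumes "fi : mono_maps k m" "length th = Suc m"
 shows "flip n (th \<cdot> fi) = flip n th \<cdot> flip m fi"
 using assms mono_mapsD[OF assms(1)]
 by (auto intro!: nth_equalityI simp: nth_flip less_Suc_eq_le)

lemma set_flip: "set (flip n th) = (%t. n - t) ` set th"
 by (simp add: flip_def)

definition op :: "'a sset => 'a sset" where
 "op X = \<lparr>cell = cell X, act = (%n th. act X n (flip n th))\<rparr>"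

lemma op_cell [simp]: "cell (op X) = cell X"
 by (simp add: op_def)

lemma op_act [simp]: "act (op X) n th = act X n (flip n th)"
 by (simp add: op_def)

lemma op_simplicial [intro, simp]: "simplicial_set X ==> simplicial_set (op X)"
 by (rule simplicial_setI) (auto simp: sset_cell sset_id sset_act[OF _ flip_mono flip_mono] flip_after mono_mapsD(1))

text \<open>\<open>flip n\<close> permutes the monotone maps \<open>[m] \<rightarrow> [n]\<close>,
  so a naturality condition may as well be quantified over flipped maps.\<close>

lemma hom_flip_iff:
 "(ALL m n. ALL th:mono_maps m n. P m n (flip n th)) \<longleftrightarrow> (ALL m n. ALL th:mono_maps m n. P m n th)"
 by (metis flip_flip flip_mono)

lemma op_hom_iff: "f : hom (op X) (op Y) \<longleftrightarrow> f : hom X Y"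
 unfolding hom_def mem_Collect_eq op_cell op_act
 by (subst hom_flip_iff[of "%m n th. ALL x:cell X n. f m (act X n th x) = act Y n th (f n x)"]) (rule refl)

text \<open>\<open>op (op X)\<close> and \<open>X\<close> are different records, because
  \<open>flip n\<close> is an involution only on lists with entries up to \<open>n\<close>. Moving
  \<open>op\<close> across \<open>hom\<close> takes the place of the missing equation.\<close>

lemma hom_op_iff: "f : hom (op X) Y \<longleftrightarrow> f : hom X (op Y)"
proof -
 have "f : hom (op X) Y \<longleftrightarrow> (ALL n. f n : cell X n \<rightarrow>\<^sub>E cell Y n) &
   (ALL m n. ALL th:mono_maps m n. ALL x:cell X n. f m (act X n (flip n th) x) = act Y n th (f n x))"
  by (simp add: hom_def)
 also have "... \<longleftrightarrow> (ALL n. f n : cell X n \<rightarrow>\<^sub>E cell Y n) &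
   (ALL m n. ALL th:mono_maps m n. ALL x:cell X n. f m (act X n (flip n (flip n th)) x) = act Y n (flip n th) (f n x))"
  by (subst hom_flip_iff[of "%m n th. ALL x:cell X n. f m (act X n (flip n th) x) = act Y n th (f n x)"]) (rule refl)
 also have "... \<longleftrightarrow> f : hom X (op Y)"
  by (simp add: hom_def)
 finally show ?thesis .
qed

section \<open>Gluing faces\<close>

lemma unskip_unskip: "i < j ==> i ~: set a ==> j ~: set a ==> unskip (j - 1) (unskip i a) = unskip i (unskip j a)"
 by (auto simp: unskip_def)

lemma unskip_skip: "unskip i (skip k i) = id_map k"
 by (auto simp: unskip_def skip_def id_map_def intro!: nth_equalityI simp del: upt_Suc)

lemma not_in_unskip:
 assumes "i < j" "i ~: set a" "j ~: set a"
 shows "j - 1 ~: set (unskip i a)" "i ~: set (unskip j a)"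
proof -
 have *: "t ~= i" "t ~= j" if "t : set a" for t using assms that by auto
 show "j - 1 ~: set (unskip i a)"
 proof
  assume "j - 1 : set (unskip i a)"
  then obtain t where "t : set a" "j - 1 = (if t <= i then t else t - 1)" by (auto simp: unskip_def)
  with *[of t] assms(1) show False by (auto split: if_splits)
 qed
 show "i ~: set (unskip j a)"
 proof
  assume "i : set (unskip j a)"
  then obtain t where "t : set a" "i = (if t <= j then t else t - 1)" by (auto simp: unskip_def)
  with *[of t] assms(1) show False by (auto split: if_splits)
 qed
qed

lemma unskip_after:
 assumes "th : mono_maps k m" "length a = Suc m" shows "unskip i (a \<cdot> th) = unskip i a \<cdot> th"
 using mono_mapsD(5)[OF assms(1)] assms(2) by (auto simp: unskip_def after_def)

text \<open>A simplex of the union lies in the face opposite any vertex of \<open>I\<close> that it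
  misses. If it misses two of them, it factors through their common face of codimension two, where
  \<open>compat\<close> makes both candidate values agree; so the choice of the missed vertex does
  not matter.\<close>

lemma faces_glue:
 assumes X: "simplicial_set X" and y: "!!i. i : I ==> y i : cell X k" and I: "I <= {..Suc k}"
  and compat: "!!i j l. k = Suc l ==> i : I ==> j : I ==> i < j ==>
   act X k (skip l i) (y j) = act X k (skip l (j - 1)) (y i)"
  and A: "sub_sset A (\<Delta> (Suc k))"
   "!!m a. a : cell A m \<longleftrightarrow> a : mono_maps m (Suc k) & (EX i:I. i ~: set a)"
 obtains f where "f : hom A X" "!!i. i : I ==> f k (skip k i) = y i"
proof -
 have *: "act X k (unskip i a) (y i) = act X k (unskip j a) (y j)"
  if a: "a : mono_maps m (Suc k)" "i : I" "j : I" "i ~: set a" "j ~: set a" "i < j" for a m i j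
 proof (cases k)
  \<comment> \<open>There is no face of codimension two here, but the situation is contradictory: a
    list with entries in \<open>{0, 1}\<close> cannot avoid both.\<close>
  case 0
  then have "i = 0" "j = 1" using a I by auto
  moreover have "a ! 0 <= 1" "a ! 0 : set a" using mono_mapsD[OF a(1)] 0 by auto
  ultimately show ?thesis using a by (metis le_zero_eq le_Suc_eq One_nat_def)
 next
  case (Suc l)
  have ij: "i <= Suc k" "j <= Suc k" "j - 1 <= Suc l" "i <= Suc l" using a I Suc by auto
  note ui = unskip_mono[OF a(1) a(4) ij(1)] and uj = unskip_mono[OF a(1) a(5) ij(2)]
  note n = not_in_unskip[OF a(6,4,5)]
  have ui': "unskip i a : mono_maps m (Suc l)" "unskip j a : mono_maps m (Suc l)" using ui uj Suc by auto
  have yi: "y i : cell X (Suc l)" "y j : cell X (Suc l)" using y a Suc by auto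
  let ?b = "unskip (j - 1) (unskip i a)"
  have b: "?b : mono_maps m l" using unskip_mono[OF ui'(1) n(1) ij(3)] .
  have "act X (Suc l) (unskip i a) (y i) = act X (Suc l) (skip l (j - 1) \<cdot> ?b) (y i)"
   using skip_unskip[OF ui'(1) n(1) ij(3)] by simp
  also have "... = act X l ?b (act X (Suc l) (skip l (j - 1)) (y i))"
   using sset_act[OF X skip_mono b yi(1)] by simp
  also have "... = act X l ?b (act X (Suc l) (skip l i) (y j))"
   using compat[OF Suc a(2,3,6)] Suc by simp
  also have "... = act X (Suc l) (skip l i \<cdot> ?b) (y j)"
   using sset_act[OF X skip_mono b yi(2)] by simp
  also have "skip l i \<cdot> ?b = unskip j a"
   using skip_unskip[OF ui'(2) n(2) ij(4)] unskip_unskip[OF a(6,4,5)] by simp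
  finally show ?thesis using Suc by simp
 qed
 define c where "c a = (SOME i. i : I & i ~: set a)" for a
 define f where "f = restr A (%m a. act X k (unskip (c a) a) (y (c a)))"
 have c: "c a : I" "c a ~: set a" if "a : cell A m" for a m
  using someI_ex[of "%i. i : I & i ~: set a"] that by (auto simp: A(2) c_def)
 have f: "f m a = act X k (unskip i a) (y i)" if a: "a : cell A m" "i : I" "i ~: set a" for m a i
 proof -
  have am: "a : mono_maps m (Suc k)" using a(1) A(2) by blast
  have "f m a = act X k (unskip (c a) a) (y (c a))" using a(1) by (simp add: f_def)
  also have "... = act X k (unskip i a) (y i)"
   using *[OF am a(2) c(1)[OF a(1)] a(3) c(2)[OF a(1)]] *[OF am c(1)[OF a(1)] a(2) c(2)[OF a(1)] a(3)]
   by (metis linorder_neqE_nat)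
  finally show ?thesis .
 qed
 have u: "unskip i a : mono_maps m k" if "a : cell A m" "i : I" "i ~: set a" for a m i
  using that I unskip_mono[of a m k i] by (auto simp: A(2))
 have "f : hom A X"
  unfolding f_def
 proof (rule restr_homI)
  fix m a assume a: "a : cell A m"
  show "act X k (unskip (c a) a) (y (c a)) : cell X m"
   using u[OF a c[OF a]] y[OF c(1)[OF a]] X by (auto simp: sset_cell)
 next
  fix m n th a assume th: "th : mono_maps m n" and a: "a : cell A n"
  show at: "act A n th a : cell A m" using sub_closed[OF A(1) th a] sub_act[OF A(1)] by simp
  have la: "length a = Suc n" using a by (auto simp: A(2) mono_mapsD)
  have eq: "act A n th a = a \<cdot> th" using sub_act[OF A(1)] by simp
  then have at': "a \<cdot> th : cell A m" using at by simp
  have ca: "c a ~: set (a \<cdot> th)" using set_after_mono[OF th la] c(2)[OF a] by auto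
  have "f m (a \<cdot> th) = act X k (unskip (c a) (a \<cdot> th)) (y (c a))"
   using f[OF at' c(1)[OF a] ca] .
  also have "... = act X n th (act X k (unskip (c a) a) (y (c a)))"
   using sset_act[OF X u[OF a c[OF a]] th y[OF c(1)[OF a]]] unskip_after[OF th la] by simp
  finally show "act X k (unskip (c (act A n th a)) (act A n th a)) (y (c (act A n th a))) =
      act X n th (act X k (unskip (c a) a) (y (c a)))"
   unfolding eq f_def using at' by simp
 qed
 moreover have "f k (skip k i) = y i" if "i : I" for i
  using f[of "skip k i" k i] that not_in_skip[of i k] sset_id[OF X y[OF that]]
  by (auto simp: A(2) unskip_skip)
 ultimately show ?thesis using that by blast
qed

text \<open>Every simplex of \<open>A\<close> factors through one of the faces
  \<open>skip k i\<close>, so agreement on these propagates by functoriality.\<close>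

lemma hom_faces_eq:
 assumes A: "sub_sset A (\<Delta> (Suc k))"
   "!!m a. a : cell A m \<longleftrightarrow> a : mono_maps m (Suc k) & (EX i:I. i ~: set a)" and I: "I <= {..Suc k}"
  and X: "simplicial_set X" and f: "f : hom A X" and e: "e : cell X (Suc k)"
  and eq: "!!i. i : I ==> act X (Suc k) (skip k i) e = f k (skip k i)" and a: "a : cell A m"
 shows "act X (Suc k) a e = f m a"
proof -
 obtain i where i: "i : I" "i ~: set a" and am: "a : mono_maps m (Suc k)" using a A(2) by auto
 have ile: "i <= Suc k" using i I by auto
 note u = unskip_mono[OF am i(2) ile]
 have s: "skip k i : cell A k" using i not_in_skip A(2) by auto
 have "act X (Suc k) a e = act X (Suc k) (skip k i \<cdot> unskip i a) e"
  using skip_unskip[OF am i(2) ile] by simp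
 also have "... = act X k (unskip i a) (f k (skip k i))"
  using sset_act[OF X skip_mono[of k i] u e] eq[OF i(1)] by simp
 also have "... = f m (act A k (unskip i a) (skip k i))"
  using hom_act[OF f u s] by simp
 also have "act A k (unskip i a) (skip k i) = a"
  using skip_unskip[OF am i(2) ile] sub_act[OF A(1)] by simp
 finally show ?thesis .
qed

lemma boundary_faces: "a : cell (boundary n) m \<longleftrightarrow> a : mono_maps m n & (EX i:{..n}. i ~: set a)"
 using mono_mapsD(5)[of a m n] by (auto simp: boundary_cell)

lemma sphere_glue:
 assumes "simplicial_set X" "!!i. i <= Suc k ==> y i : cell X k"
  "!!i j l. k = Suc l ==> j <= Suc k ==> i < j ==>
   act X k (skip l i) (y j) = act X k (skip l (j - 1)) (y i)"
 obtains f where "f : hom (boundary (Suc k)) X" "!!i. i <= Suc k ==> f k (skip k i) = y i"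
proof (rule faces_glue[where y = y and k = k, OF assms(1) _ _ _ boundary_sub boundary_faces])
 fix f assume "f : hom (boundary (Suc k)) X" "!!i. i : {..Suc k} ==> f k (skip k i) = y i"
 then show thesis using that by simp
next
 fix i j l assume "k = Suc l" "i : {..Suc k}" "j : {..Suc k}" "i < j"
 then show "act X k (skip l i) (y j) = act X k (skip l (j - 1)) (y i)" using assms(3) by simp
qed (use assms(2) in auto)

lemma sphere_fillD: "sphere_fill X n f e ==> e : cell X n"
 "sphere_fill X n f e ==> a : cell (boundary n) m ==> act X n a e = f m a"
 by (auto simp: sphere_fill_def)

lemma skip_in_boundary: "i <= Suc k ==> skip k i : cell (boundary (Suc k)) k"
 using not_in_skip[of i k] by (auto simp: boundary_faces)

lemma vertex_in_boundary: "0 < n ==> i <= n ==> [i] : cell (boundary n) 0"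
proof -
 assume "0 < n" "i <= n"
 then have "0 ~= i | n ~= i" by auto
 then have "{i} ~= {..n}" by blast
 then show ?thesis using \<open>i <= n\<close> by (simp add: boundary_cell)
qed

section \<open>Extension along skeleta\<close>

text \<open>Prescribing one value of the section separates surjections: if \<open>th\<close> and
  \<open>th'\<close> differ at \<open>i0\<close>, the section of \<open>th\<close> through
  \<open>i0\<close> is not a section of \<open>th'\<close>.\<close>

lemma mono_section:
 assumes th: "th : mono_maps m n" "set th = {..n}" and i0: "i0 <= m"
 obtains de where "de : mono_maps n m" "th \<cdot> de = id_map n" "de ! (th ! i0) = i0"
proof -
 define d where "d t = (if t = th ! i0 then i0 else SOME i. i <= m & th ! i = t)" for t
 have ex: "EX i. i <= m & th ! i = t" if "t <= n" for t
  using that th(2) mono_mapsD(1)[OF th(1)] by (metis atMost_iff in_set_conv_nth less_Suc_eq_le)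
 have d: "d t <= m" "th ! d t = t" if "t <= n" for t
  using someI_ex[OF ex[OF that]] i0 by (auto simp: d_def)
 define de where "de = map d [0..<Suc n]"
 have nth: "de ! t = d t" if "t <= n" for t using that by (simp add: de_def del: upt_Suc)
 have len: "length de = Suc n" by (simp add: de_def)
 have mono: "d t <= d u" if "t <= u" "u <= n" for t u
 proof (rule ccontr)
  assume "~ d t <= d u"
  then have "th ! d u <= th ! d t" using mono_mapsD(4)[OF th(1), of "d u" "d t"] d[of t] that by auto
  then have "t = u" using d that by auto
  with \<open>~ d t <= d u\<close> show False by simp
 qed
 have "de : mono_maps n m"
  by (rule mono_mapsI) (use len nth mono d in auto)
 moreover have "th \<cdot> de = id_map n"
  by (rule nth_equalityI) (use len nth d in \<open>auto simp: less_Suc_eq_le\<close>)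
 moreover have "de ! (th ! i0) = i0"
  using nth[of "th ! i0"] mono_mapsD(3)[OF th(1) i0] by (simp add: d_def)
 ultimately show ?thesis using that by blast
qed

text \<open>
 Zorn's lemma for partial lifts; a partial lift is represented by its graph. A missing simplex of
 least dimension is nondegenerate and its boundary is already lifted.
\<close>

lemma skeletal_extension:
 assumes B: "simplicial_set B" and E: "simplicial_set E" and D: "simplicial_set D" and A: "sub_sset A B"
  and p: "p : hom E D" and f: "f : hom A E" and g: "g : hom B D"
  and pf: "!!n a. a : cell A n ==> p n (f n a) = g n a"
  and If: "!!a. a : cell A 0 ==> I a (f 0 a)"
  and zero: "!!b. b : cell B 0 ==> b ~: cell A 0 ==> EX e:cell E 0. p 0 e = g 0 b & I b e"
  and suc: "!!n b s. 0 < n ==> b : cell B n ==> b ~: cell A n ==> s : hom (boundary n) E ==>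
    (!!m a. a : cell (boundary n) m ==> p m (s m a) = act D n a (g n b)) ==>
    (!!i. i <= n ==> I (act B n [i] b) (s 0 [i])) ==>
    EX e. sphere_fill E n s e & p n e = g n b"
 obtains h where "h : hom B E" "!!n a. a : cell A n ==> h n a = f n a"
  "!!n b. b : cell B n ==> p n (h n b) = g n b" "!!b. b : cell B 0 ==> I b (h 0 b)"
proof -
 \<comment> \<open>A good set is the graph of a simplicial map on a simplicial subset of
   \<open>B\<close> which lifts \<open>g\<close> and respects \<open>I\<close> on vertices.\<close>
 define good where "good G \<longleftrightarrow>
   (ALL n b e. (n, b, e) : G --> b : cell B n & e : cell E n & p n e = g n b) &
   (ALL n b e e'. (n, b, e) : G --> (n, b, e') : G --> e = e') &
   (ALL n b e m th. (n, b, e) : G --> th : mono_maps m n --> (m, act B n th b, act E n th e) : G) &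
   (ALL b e. (0, b, e) : G --> I b e)" for G :: "(nat \<times> 'a \<times> 'b) set"
 define G0 where "G0 = {(n, a, e). a : cell A n & e = f n a}"
 have G0: "good G0"
  unfolding good_def G0_def
  using sub_cell[OF A] hom_cell[OF f] pf sub_closed[OF A] hom_act[OF f] If
  by (auto simp: sub_act[OF A])
 have "EX M:{G. good G & G0 <= G}. ALL G:{G. good G & G0 <= G}. M <= G --> G = M"
 proof (rule subset_Zorn_nonempty)
  show "{G. good G & G0 <= G} ~= {}" using G0 by auto
  fix \<C> assume \<C>: "\<C> ~= {}" "subset.chain {G. good G & G0 <= G} \<C>"
  then have gd: "good G" "G0 <= G" if "G : \<C>" for G using that by (auto simp: subset.chain_def)
  have tot: "G <= H | H <= G" if "G : \<C>" "H : \<C>" for G H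
   using \<C>(2) that unfolding subset.chain_def by blast
  have "G0 <= \<Union>\<C>" using \<C>(1) gd by blast
  moreover have "good (\<Union>\<C>)"
   unfolding good_def
  proof (intro conjI allI impI)
   fix n b e e' assume "(n, b, e) : \<Union>\<C>" "(n, b, e') : \<Union>\<C>"
   then obtain G H where GH: "G : \<C>" "H : \<C>" "(n, b, e) : G" "(n, b, e') : H" by blast
   with tot[OF GH(1,2)] have "((n, b, e) : G & (n, b, e') : G) | ((n, b, e) : H & (n, b, e') : H)" by blast
   then show "e = e'" using gd GH unfolding good_def by blast
  next
   fix n b e m th assume "(n, b, e) : \<Union>\<C>" "th : mono_maps m n"
   then show "(m, act B n th b, act E n th e) : \<Union>\<C>" using gd unfolding good_def by blast
  next
   fix n b e assume "(n, b, e) : \<Union>\<C>"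
   then obtain G where "G : \<C>" "(n, b, e) : G" by blast
   then show "b : cell B n" "e : cell E n" "p n e = g n b" using gd unfolding good_def by blast+
  next
   fix b e assume "(0, b, e) : \<Union>\<C>"
   then obtain G where "G : \<C>" "(0, b, e) : G" by blast
   then show "I b e" using gd unfolding good_def by blast
  qed
  ultimately show "\<Union>\<C> : {G. good G & G0 <= G}" by blast
 qed
 then obtain M where M: "good M" "G0 <= M" and max: "!!G. good G ==> M <= G ==> G = M"
  by (metis (no_types, lifting) mem_Collect_eq order_trans)
 have Mc: "b : cell B n" "e : cell E n" "p n e = g n b" if "(n, b, e) : M" for n b e
  using M(1) that unfolding good_def by blast+
 have Mf: "e = e'" if "(n, b, e) : M" "(n, b, e') : M" for n b e e'
  using M(1) that unfolding good_def by blast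
 have MT: "(n, b, THE e. (n, b, e) : M) : M" if "EX e. (n, b, e) : M" for n b
  using that by (metis (mono_tags, lifting) Mf theI)
 have Ma: "(m, act B n th b, act E n th e) : M" if "(n, b, e) : M" "th : mono_maps m n" for n b e m th
  using M(1) that unfolding good_def by blast
 have MI: "I b e" if "(0, b, e) : M" for b e
  using M(1) that unfolding good_def by blast
 have dom: "EX e. (n, b, e) : M" if "b : cell B n" for n b
  using that
 proof (induction n arbitrary: b rule: less_induct)
  case (less n)
  show ?case
  proof (rule ccontr)
   assume nodom: "\<nexists>e. (n, b, e) : M"
   have bA: "b ~: cell A n" using nodom M(2) by (auto simp: G0_def)
   have face: "EX e. (m, act B n a b, e) : M" if a: "a : cell (boundary n) m" for m a
   proof -
    obtain i where i: "i <= n" "i ~: set a" and am: "a : mono_maps m n" using a by (auto simp: boundary_faces)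
    have "n ~= 0"
    proof
     assume "n = 0"
     with i am have "a ! 0 ~= 0" using mono_mapsD(1)[OF am] by (metis le_zero_eq nth_mem zero_less_Suc)
     with am \<open>n = 0\<close> show False using mono_mapsD(3)[OF am, of 0] by simp
    qed
    then obtain l where n: "n = Suc l" by (cases n) auto
    note am = am[unfolded n] and i = i(2) i(1)[unfolded n]
    note u = unskip_mono[OF am i]
    have "act B n (skip l i) b : cell B l" using less.prems n B by (auto simp: sset_cell)
    then obtain e where "(l, act B n (skip l i) b, e) : M" using less.IH[of l] n by blast
    from Ma[OF this u] have "(m, act B l (unskip i a) (act B n (skip l i) b), act E l (unskip i a) e) : M" .
    moreover have "act B l (unskip i a) (act B n (skip l i) b) = act B n a b"
     using sset_act[OF B skip_mono u] less.prems skip_unskip[OF am i] n by simp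
    ultimately show ?thesis by auto
   qed
   define s where "s = restr (boundary n) (%m a. THE e. (m, act B n a b, e) : M)"
   have s: "(m, act B n a b, s m a) : M" if "a : cell (boundary n) m" for m a
    using MT[OF face[OF that]] that by (simp add: s_def)
   have s_hom: "s : hom (boundary n) E"
   proof -
    have "s m (a \<cdot> th) = act E k th (s k a)" if "a : cell (boundary n) k" "th : mono_maps m k" for a k m th
    proof -
     have am: "a : mono_maps k n" using that by (simp add: boundary_cell)
     have at: "a \<cdot> th : cell (boundary n) m"
      using sub_closed[OF boundary_sub that(2,1)] by simp
     show ?thesis
      using Mf[OF s[OF at]] Ma[OF s[OF that(1)] that(2)] sset_act[OF B am that(2) less.prems] by simp
    qed
    note nat = this
    have "restr (boundary n) s : hom (boundary n) E"
    proof (rule restr_homI)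
     fix m k th a assume *: "th : mono_maps m k" "a : cell (boundary n) k"
     show "act (boundary n) k th a : cell (boundary n) m" using sub_closed[OF boundary_sub *] by simp
     show "s m (act (boundary n) k th a) = act E k th (s k a)" using nat[OF *(2,1)] by simp
    qed (use Mc(2)[OF s] in blast)
    moreover have "restr (boundary n) s = s" unfolding s_def by (auto simp: restr_def fun_eq_iff)
    ultimately show ?thesis by simp
   qed
   obtain e where e: "sphere_fill E n s e" "p n e = g n b" "n = 0 ==> I b e"
   proof (cases "n = 0")
    case True
    then obtain e where e: "e : cell E 0" "p 0 e = g 0 b" "I b e" using zero less.prems bA by blast
    have "cell (boundary 0) m = {}" for m
    proof -
     have "set a = {0}" if "a : mono_maps m 0" for a
      using mono_mapsD(1,5)[OF that] by (metis atMost_0 length_0_conv nat.distinct(1) set_empty subset_singletonD)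
     then show ?thesis by (auto simp: boundary_cell)
    qed
    then have "sphere_fill E n s e" using True e by (auto simp: sphere_fill_def)
    then show ?thesis using that e True by blast
   next
    case False
    have "EX e. sphere_fill E n s e & p n e = g n b"
    proof (rule suc[OF _ less.prems bA s_hom])
     fix m a assume a: "a : cell (boundary n) m"
     then show "p m (s m a) = act D n a (g n b)"
      using Mc(3)[OF s[OF a]] hom_act[OF g _ less.prems] by (auto simp: boundary_cell)
    next
     fix i assume "i <= n"
     then have "[i] : cell (boundary n) 0" using vertex_in_boundary False by blast
     then show "I (act B n [i] b) (s 0 [i])" using MI s by blast
    qed (use False in auto)
    then show ?thesis using that False by blast
   qed
   have ec: "e : cell E n" using e by (auto simp: sphere_fill_def)
   \<comment> \<open>The filler is added together with all its restrictions along monotone maps; the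
     point is that the enlarged graph is still single-valued.\<close>
   define M' where "M' = M Un {(m, act B n th b, act E n th e) | m th. th : mono_maps m n}"
   have nonsurj: "act E n th e = e'" if "th : mono_maps m n" "set th ~= {..n}" "(m, act B n th b, e') : M" for m th e'
    using s[of th m] that Mf e(1) by (auto simp: boundary_cell sphere_fill_def)
   \<comment> \<open>A value on a degeneracy of \<open>b\<close> would restrict, along a section of
     the surjection, to a value on \<open>b\<close> itself.\<close>
   have surj: "EX e'. (m, act B n th b, e') : M ==> set th ~= {..n}" if th: "th : mono_maps m n" for m th
   proof
    assume "EX e'. (m, act B n th b, e') : M" "set th = {..n}"
    then obtain e' where e': "(m, act B n th b, e') : M" by blast
    obtain de where de: "de : mono_maps n m" "th \<cdot> de = id_map n"
     using mono_section[OF th \<open>set th = {..n}\<close>, of 0] by blast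
    have "act B m de (act B n th b) = b"
     using sset_act[OF B th de(1) less.prems] de(2) sset_id[OF B less.prems] by simp
    then show False using Ma[OF e' de(1)] nodom by auto
   qed
   \<comment> \<open>The Eilenberg-Zilber argument: if two different surjections \<open>th\<close>
     and \<open>th'\<close> gave the same simplex, then \<open>b\<close> would be its own
     restriction along \<open>th' \<cdot> de\<close>, which is not surjective, and so
     \<open>b\<close> would already have a value.\<close>
   have fun_new: "act E n th e = act E n th' e"
    if th: "th : mono_maps m n" "th' : mono_maps m n" and eq: "act B n th b = act B n th' b" for m th th'
   proof (cases "EX e'. (m, act B n th b, e') : M")
    case True
    then obtain e' where e': "(m, act B n th b, e') : M" by blast
    moreover have "set th' ~= {..n}" using surj[OF th(2)] True eq by simp
    moreover have "set th ~= {..n}" using surj[OF th(1)] True by simp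
    ultimately show ?thesis using nonsurj[OF th(1)] nonsurj[OF th(2)] eq by simp
   next
    case False
    have full: "set th = {..n}" "set th' = {..n}"
     using face[of th m] face[of th' m] False eq th by (auto simp: boundary_cell)
    have "th = th'"
    proof (rule ccontr)
     assume "th ~= th'"
     then obtain i0 where i0: "i0 <= m" "th ! i0 ~= th' ! i0"
      using mono_mapsD(1)[OF th(1)] mono_mapsD(1)[OF th(2)]
      by (metis less_Suc_eq_le nth_equalityI)
     obtain de where de: "de : mono_maps n m" "th \<cdot> de = id_map n" "de ! (th ! i0) = i0"
      using mono_section[OF th(1) full(1) i0(1)] by blast
     have t: "th' \<cdot> de : mono_maps n n" using after_mono[OF th(2) de(1)] .
     have "(th' \<cdot> de) ! (th ! i0) = th' ! i0"
      using de mono_mapsD(1)[OF de(1)] mono_mapsD(3)[OF th(1) i0(1)] by simp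
     then have "th' \<cdot> de ~= id_map n" using i0(2) mono_mapsD(3)[OF th(1) i0(1)] by auto
     then have ns: "th' \<cdot> de : cell (boundary n) n"
      using mono_full_id[OF t] t by (auto simp: boundary_cell)
     have "act B n (th' \<cdot> de) b = act B m de (act B n th b)"
      using sset_act[OF B th(2) de(1) less.prems] eq by simp
     also have "... = b"
      using sset_act[OF B th(1) de(1) less.prems] de(2) sset_id[OF B less.prems] by simp
     finally show False using face[OF ns] nodom by simp
    qed
    then show ?thesis by simp
   qed
   have "good M'"
    unfolding good_def
   proof (intro conjI allI impI)
    fix m x y assume "(m, x, y) : M'"
    then have "(m, x, y) : M | (EX th. th : mono_maps m n & x = act B n th b & y = act E n th e)"
     by (auto simp: M'_def)
    then show "x : cell B m" "y : cell E m" "p m y = g m x"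
     using Mc sset_cell[OF B _ less.prems] sset_cell[OF E _ ec]
      hom_act[OF p _ ec] hom_act[OF g _ less.prems] e(2) by auto
   next
    fix m x y y' assume "(m, x, y) : M'" "(m, x, y') : M'"
    then have "(m, x, y) : M | (EX th. th : mono_maps m n & x = act B n th b & y = act E n th e)"
     "(m, x, y') : M | (EX th. th : mono_maps m n & x = act B n th b & y' = act E n th e)"
     by (auto simp: M'_def)
    moreover have "act E n th e = z" if "(m, act B n th b, z) : M" "th : mono_maps m n" for th z
     using nonsurj[OF that(2) _ that(1)] surj[OF that(2)] that(1) by blast
    ultimately show "y = y'" using Mf fun_new by metis
   next
    fix m x y k th assume "(m, x, y) : M'" and th: "th : mono_maps k m"
    then have "(m, x, y) : M | (EX fi. fi : mono_maps m n & x = act B n fi b & y = act E n fi e)"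
     by (auto simp: M'_def)
    then show "(k, act B m th x, act E m th y) : M'"
    proof
     assume "(m, x, y) : M"
     then show ?thesis using Ma[OF _ th] by (auto simp: M'_def)
    next
     assume "EX fi. fi : mono_maps m n & x = act B n fi b & y = act E n fi e"
     then obtain fi where fi: "fi : mono_maps m n" "x = act B n fi b" "y = act E n fi e" by blast
     then show ?thesis unfolding M'_def
      using sset_act[OF B fi(1) th less.prems] sset_act[OF E fi(1) th ec] after_mono[OF fi(1) th] by auto
    qed
   next
    fix x y assume "(0, x, y) : M'"
    then have "(0, x, y) : M | (EX th. th : mono_maps 0 n & x = act B n th b & y = act E n th e)"
     by (auto simp: M'_def)
    then show "I x y"
    proof
     assume "(0, x, y) : M" then show ?thesis by (rule MI)
    next
     assume "EX th. th : mono_maps 0 n & x = act B n th b & y = act E n th e"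
     then obtain i where i: "i <= n" "x = act B n [i] b" "y = act E n [i] e" by (auto simp: mono_maps_0)
     show ?thesis
     proof (cases "n = 0")
      case True
      then have "[i] = id_map n" using i(1) by (simp add: id_map_def)
      then show ?thesis using i e(3)[OF True] sset_id[OF B less.prems] sset_id[OF E ec] by simp
     next
      case False
      then have bd: "[i] : cell (boundary n) 0" using vertex_in_boundary False i(1) by blast
      then have "y = s 0 [i]" using e(1) i by (auto simp: sphere_fill_def)
      then show ?thesis using MI[OF s[OF bd]] i by simp
     qed
    qed
   qed
   moreover have "M <= M'" by (auto simp: M'_def)
   ultimately have "M' = M" by (rule max)
   moreover have "(n, act B n (id_map n) b, act E n (id_map n) e) : M'" unfolding M'_def by blast
   ultimately show False using nodom sset_id[OF B less.prems] by auto
  qed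
 qed
 define h where "h = restr B (%n b. THE e. (n, b, e) : M)"
 have h: "(n, b, h n b) : M" if "b : cell B n" for n b
  using MT[OF dom[OF that]] that by (simp add: h_def)
 have "h m (act B n th b) = act E n th (h n b)" if "b : cell B n" "th : mono_maps m n" for m n th b
  using Mf h[OF sset_cell[OF B that(2,1)]] Ma[OF h[OF that(1)] that(2)] by blast
 note nat = this
 have "restr B h : hom B E"
  by (rule restr_homI) (simp_all add: Mc(2)[OF h] sset_cell[OF B] nat)
 moreover have "restr B h = h" unfolding h_def by (auto simp: restr_def fun_eq_iff)
 ultimately have "h : hom B E" by simp
 moreover have "h n a = f n a" if "a : cell A n" for n a
  using Mf[OF h[OF sub_cell[OF A that]]] M(2) that by (auto simp: G0_def)
 moreover have "p n (h n b) = g n b" if "b : cell B n" for n b using Mc(3)[OF h[OF that]] .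
 moreover have "I b (h 0 b)" if "b : cell B 0" for b using MI[OF h[OF that]] .
 ultimately show ?thesis using that by blast
qed

lemma mono_maps_target_0: "a : mono_maps m 0 ==> b : mono_maps m 0 ==> a = b"
 using mono_mapsD(1,3)[of a m 0] mono_mapsD(1,3)[of b m 0]
 by (intro nth_equalityI) (auto simp: less_Suc_eq_le)

lemma replicate_mono: "i <= n ==> replicate (Suc m) i : mono_maps m n"
 by (rule mono_mapsI) (simp_all del: replicate_Suc)

lemma terminal_hom:
 assumes "simplicial_set X" shows "restr X (%n x. replicate (Suc n) 0) : hom X (\<Delta> 0)"
proof (rule restr_homI)
 fix m n th x assume th: "th : mono_maps m n"
 show "replicate (Suc m) 0 = act (\<Delta> 0) n th (replicate (Suc n) 0)"
  using mono_maps_target_0[OF replicate_mono[of 0 0 m] after_mono[OF replicate_mono th]] by simp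
qed (use assms replicate_mono[of 0 0] in \<open>simp_all add: sset_cell del: replicate_Suc\<close>)

text \<open>The case of a one-point base: there is only one map to \<open>\<Delta> 0\<close>, so
  every filler of a sphere lies over the right simplex.\<close>

lemma skeletal_extension_absolute:
 assumes B: "simplicial_set B" and E: "simplicial_set E" and A: "sub_sset A B" and f: "f : hom A E"
  and If: "!!a. a : cell A 0 ==> I a (f 0 a)"
  and zero: "!!b. b : cell B 0 ==> b ~: cell A 0 ==> EX e:cell E 0. I b e"
  and suc: "!!n b s. 0 < n ==> b : cell B n ==> b ~: cell A n ==> s : hom (boundary n) E ==>
    (!!i. i <= n ==> I (act B n [i] b) (s 0 [i])) ==> EX e. sphere_fill E n s e"
 obtains h where "h : hom B E" "!!n a. a : cell A n ==> h n a = f n a"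
  "!!b. b : cell B 0 ==> I b (h 0 b)"
proof -
 define p :: "nat => 'b => nat list" where "p = restr E (%n x. replicate (Suc n) 0)"
 define g :: "nat => 'a => nat list" where "g = restr B (%n x. replicate (Suc n) 0)"
 have p: "p : hom E (\<Delta> 0)" and g: "g : hom B (\<Delta> 0)" using terminal_hom E B by (auto simp: p_def g_def)
 have eq: "p n e = g n b" if "e : cell E n" "b : cell B n" for n e b using that by (simp add: p_def g_def)
 show thesis
 proof (rule skeletal_extension[OF B E simplex_simplicial[of 0] A p f g])
  fix n a assume "a : cell A n"
  then show "p n (f n a) = g n a" using eq[of "f n a" n a] hom_cell[OF f] sub_cell[OF A] by blast
 next
  fix b assume "b : cell B 0" "b ~: cell A 0"
  then show "EX e:cell E 0. p 0 e = g 0 b & I b e" using zero[of b] eq[of _ 0 b] by blast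
 next
  fix n b s assume *: "0 < n" "b : cell B n" "b ~: cell A n" "s : hom (boundary n) E"
   "!!i. i <= n ==> I (act B n [i] b) (s 0 [i])"
  then obtain e where "sphere_fill E n s e" using suc by blast
  then show "EX e. sphere_fill E n s e & p n e = g n b" using eq[OF sphere_fillD(1) *(2)] by blast
 qed (use If that in auto)
qed

text \<open>The last vertex of a simplex outside \<open>A\<close> is either new, and then sent to
  \<open>z\<close>, or old, and then final by \<open>last\<close>. In both cases finality fills the
  sphere given by the boundary of the simplex.\<close>

lemma final_extension:
 assumes B: "simplicial_set B" and E: "simplicial_set E" and A: "sub_sset A B" and f: "f : hom A E"
  and z: "final E z"
  and last: "!!n b. b : cell B n ==> b ~: cell A n ==> act B n [n] b : cell A 0 ==> final E (f 0 (act B n [n] b))"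
 obtains h where "h : hom B E" "!!n a. a : cell A n ==> h n a = f n a"
  "!!b. b : cell B 0 ==> b ~: cell A 0 ==> h 0 b = z"
proof (rule skeletal_extension_absolute[OF B E A f, where I = "%b e. e = (if b : cell A 0 then f 0 b else z)"])
 fix n b s assume *: "0 < n" "b : cell B n" "b ~: cell A n" "s : hom (boundary n) E"
   "!!i. i <= n ==> s 0 [i] = (if act B n [i] b : cell A 0 then f 0 (act B n [i] b) else z)"
 then have "final E (s 0 [n])" using last[OF *(2,3)] z by simp
 then show "EX e. sphere_fill E n s e" using * final_iff[OF E] by blast
qed (use z that in \<open>auto simp: final_def\<close>)

lemma initial_extension:
 assumes B: "simplicial_set B" and E: "simplicial_set E" and A: "sub_sset A B" and f: "f : hom A E"
  and z: "initial E z"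
  and first: "!!n b. b : cell B n ==> b ~: cell A n ==> act B n [0] b : cell A 0 ==> initial E (f 0 (act B n [0] b))"
 obtains h where "h : hom B E" "!!n a. a : cell A n ==> h n a = f n a"
  "!!b. b : cell B 0 ==> b ~: cell A 0 ==> h 0 b = z"
proof (rule skeletal_extension_absolute[OF B E A f, where I = "%b e. e = (if b : cell A 0 then f 0 b else z)"])
 fix n b s assume *: "0 < n" "b : cell B n" "b ~: cell A n" "s : hom (boundary n) E"
   "!!i. i <= n ==> s 0 [i] = (if act B n [i] b : cell A 0 then f 0 (act B n [i] b) else z)"
 then have "initial E (s 0 [0])" using first[OF *(2,3)] z by simp
 then show "EX e. sphere_fill E n s e" using * initial_iff[OF E] by blast
qed (use z that in \<open>auto simp: initial_def\<close>)

text \<open>A section is an extension from the empty simplicial subset. The property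
  \<open>G\<close> of the chosen vertices is carried along so that it is at hand when spheres have
  to be filled.\<close>

lemma section_extension:
 assumes E: "simplicial_set E" and D: "simplicial_set D" and p: "p : hom E D"
  and zero: "!!d. d : cell D 0 ==> EX e:cell E 0. p 0 e = d & G e"
  and suc: "!!n d s. 0 < n ==> d : cell D n ==> s : hom (boundary n) E ==>
    (!!m a. a : cell (boundary n) m ==> p m (s m a) = act D n a d) ==>
    (!!i. i <= n ==> G (s 0 [i])) ==> EX e. sphere_fill E n s e & p n e = d"
 obtains S where "S : hom D E" "cmp D p S = idm D" "!!d. d : cell D 0 ==> G (S 0 d)"
proof -
 let ?A = "\<lparr>cell = (%_. {}), act = act D\<rparr>"
 have A: "sub_sset ?A D" by (simp add: sub_sset_def)
 have f: "restr ?A (%_ _. undefined) : hom ?A E" by (rule restr_homI) auto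
 show thesis
 proof (rule skeletal_extension[OF D E D A p f idm_hom[OF D], where I = "%b e. G e"])
  fix h assume h: "h : hom D E" "!!n b. b : cell D n ==> p n (h n b) = idm D n b"
   "!!b. b : cell D 0 ==> G (h 0 b)"
  have "cmp D p h = idm D"
   by (rule hom_eqI[OF cmp_hom[OF h(1) p D] idm_hom[OF D]]) (simp add: h(2))
  then show thesis using that h by blast
 qed (use zero suc in auto)
qed

section \<open>Sphere lifting for functor objects\<close>

text \<open>By naturality a map into \<open>Fun X C\<close> is determined by its values at identity
  lists; this is the transposition between functor objects and products in computational
  form.\<close>

lemma hom_Fun_eval:
 assumes s: "s : hom A (Fun X C)" and th: "th : mono_maps k m" and a: "a : cell A m" and x: "x : cell X k"
 shows "s k (act A m th a) k (id_map k, x) = s m a k (th, x)"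
 using hom_act[OF s th a] th x by simp

text \<open>The domain of the pushout-product of the inclusions of \<open>boundary n\<close> in
  \<open>\<Delta> n\<close> and of \<open>Y\<close> in \<open>X\<close>.\<close>

definition prod_rel :: "nat => 'a sset => 'a sset => (nat list \<times> 'a) sset" where
 "prod_rel n X Y = \<lparr>cell = (%m. {(a, x). a : mono_maps m n & x : cell X m & (set a ~= {..n} | x : cell Y m)}),
   act = act (\<Delta> n \<otimes> X)\<rparr>"

lemma prod_rel_cell: "(a, x) : cell (prod_rel n X Y) m \<longleftrightarrow>
  a : mono_maps m n & x : cell X m & (a : cell (boundary n) m | x : cell Y m)"
 by (auto simp: prod_rel_def boundary_cell)

lemma prod_rel_act: "act (prod_rel n X Y) k th (a, x) = (a \<cdot> th, act X k th x)"
 by (simp add: prod_rel_def)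

lemma boundary_closed: "a : cell (boundary n) m ==> th : mono_maps k m ==> a \<cdot> th : cell (boundary n) k"
 using sub_closed[OF boundary_sub, of th k m a n] by simp

lemma prod_rel_sub:
 assumes "simplicial_set X" "sub_sset Y X" shows "sub_sset (prod_rel n X Y) (\<Delta> n \<otimes> X)"
 unfolding sub_sset_def
proof (intro conjI allI ballI)
 fix m k th z assume *: "th : mono_maps m k" "z : cell (prod_rel n X Y) k"
 obtain a x where z: "z = (a, x)" by (cases z)
 have ax: "a : mono_maps k n" "x : cell X k" "a : cell (boundary n) k | x : cell Y k"
  using *(2) unfolding z prod_rel_cell by blast+
 show "act (\<Delta> n \<otimes> X) k th z : cell (prod_rel n X Y) m"
  using ax(3) after_mono[OF ax(1) *(1)] sset_cell[OF assms(1) *(1) ax(2)]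
   boundary_closed[OF _ *(1), of a n] sub_closed[OF assms(2) *(1), of x]
  unfolding z prod_act simplex_act prod_rel_cell by blast
next
 show "act (prod_rel n X Y) = act (\<Delta> n \<otimes> X)" by (simp add: prod_rel_def)
 show "cell (prod_rel n X Y) m <= cell (\<Delta> n \<otimes> X) m" for m by (auto simp: prod_rel_cell)
qed

text \<open>The sphere transposes to a map on \<open>boundary n \<otimes> X\<close>, and the base
  simplex, carried from \<open>X'\<close> to the image \<open>Y\<close> by the inverse
  \<open>r\<close> of \<open>j\<close>, to a map on \<open>\<Delta> n \<otimes> Y\<close>. That the
  two agree on the overlap is the content of \<open>pd\<close>.\<close>

lemma precomp_lift_glue:
 assumes X: "simplicial_set X" and X': "simplicial_set X'" and Y: "sub_sset Y X"
  and j: "!!m x. x : cell X' m ==> j m x : cell X m"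
   "!!m k th x. x : cell X' m ==> th : mono_maps k m ==> j k (act X' m th x) = act X m th (j m x)"
  and r: "!!m x. x : cell Y m ==> r m x : cell X' m & j m (r m x) = x"
   "!!m x. x : cell X' m ==> j m x : cell Y m & r m (j m x) = x"
  and s: "s : hom (boundary n) (Fun X C)" and d: "d : hom (\<Delta> n \<otimes> X') C"
  and pd: "!!m a. a : cell (boundary n) m ==> precomp X' X C j m (s m a) = act (Fun X' C) n a d"
 obtains u where "u : hom (prod_rel n X Y) C"
  "!!m a x. a : cell (boundary n) m ==> x : cell X m ==> u m (a, x) = s m a m (id_map m, x)"
  "!!m a x. a : mono_maps m n ==> x : cell X' m ==> u m (a, j m x) = d m (a, x)"
proof -
 define u where "u = restr (prod_rel n X Y) (%m (a, x). if x : cell Y m then d m (a, r m x) else s m a m (id_map m, x))"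
 have sc: "s m a : hom (\<Delta> m \<otimes> X) C" if "a : cell (boundary n) m" for m a
  using hom_cell[OF s that] by simp
 have ub: "u m (a, x) = s m a m (id_map m, x)" if a: "a : cell (boundary n) m" and x: "x : cell X m" for m a x
 proof (cases "x : cell Y m")
  case True
  have am: "a : mono_maps m n" using a by (simp add: boundary_cell)
  have rx: "r m x : cell X' m" "j m (r m x) = x" using r(1)[OF True] by auto
  have "s m a m (id_map m, j m (r m x)) = precomp X' X C j m (s m a) m (id_map m, r m x)"
   using sc[OF a] rx by simp
  also have "... = d m (a, r m x)"
   unfolding pd[OF a] using am rx by simp
  finally show ?thesis using True am x rx by (simp add: u_def prod_rel_cell)
 next
  case False
  then show ?thesis using a x by (simp add: u_def prod_rel_cell boundary_cell)
 qed
 have ud: "u m (a, j m x) = d m (a, x)" if "a : mono_maps m n" "x : cell X' m" for m a x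
  using r(2)[OF that(2)] j(1)[OF that(2)] that by (simp add: u_def prod_rel_cell)
 have "restr (prod_rel n X Y) u : hom (prod_rel n X Y) C"
 proof (rule restr_homI)
  fix m z assume z: "z : cell (prod_rel n X Y) m"
  obtain a x where zz: "z = (a, x)" by (cases z)
  have ax: "a : mono_maps m n" "x : cell X m" "a : cell (boundary n) m | x : cell Y m"
   using z unfolding zz prod_rel_cell by blast+
  from ax(3) show "u m z : cell C m"
  proof
   assume "a : cell (boundary n) m"
   then show ?thesis using ub[OF _ ax(2)] hom_cell[OF sc, of a m "(id_map m, x)" m] ax(2) zz by simp
  next
   assume "x : cell Y m"
   then show ?thesis using ud[OF ax(1), of "r m x"] r(1)[of x m] hom_cell[OF d, of "(a, r m x)" m] ax zz by simp
  qed
  fix k th assume th: "th : mono_maps k m"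
  show "act (prod_rel n X Y) m th z : cell (prod_rel n X Y) k"
   using sub_closed[OF prod_rel_sub[OF X Y] th z] by (simp add: prod_rel_def)
  from ax(3) show "u k (act (prod_rel n X Y) m th z) = act C m th (u m z)"
  proof
   assume a: "a : cell (boundary n) m"
   have "u k (a \<cdot> th, act X m th x) = s k (a \<cdot> th) k (id_map k, act X m th x)"
    by (rule ub[OF boundary_closed[OF a th] sset_cell[OF X th ax(2)]])
   also have "... = s m a k (th, act X m th x)"
    using hom_Fun_eval[OF s th a sset_cell[OF X th ax(2)]] by simp
   also have "... = act C m th (s m a m (id_map m, x))"
    using hom_act[OF sc[OF a] th, of "(id_map m, x)"] th ax(2) by simp
   finally show ?thesis using ub[OF a ax(2)] by (simp add: zz prod_rel_act)
  next
   assume x: "x : cell Y m"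
   have rx: "r m x : cell X' m" "j m (r m x) = x" using r(1)[OF x] by auto
   have e: "act X m th x = j k (act X' m th (r m x))" using j(2)[OF rx(1) th] rx by simp
   have "u k (a \<cdot> th, act X m th x) = d k (a \<cdot> th, act X' m th (r m x))"
    unfolding e by (rule ud[OF after_mono[OF ax(1) th] sset_cell[OF X' th rx(1)]])
   also have "... = act C m th (d m (a, r m x))"
    using hom_act[OF d th, of "(a, r m x)"] ax(1) rx(1) by simp
   also have "... = act C m th (u m (a, x))" using ud[OF ax(1) rx(1)] rx(2) by simp
   finally show ?thesis by (simp add: zz prod_rel_act)
  qed
 qed
 moreover have "restr (prod_rel n X Y) u = u" unfolding u_def by (simp add: restr_def fun_eq_iff)
 ultimately have "u : hom (prod_rel n X Y) C" by simp
 then show thesis using that ub ud by blast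
qed

text \<open>By \<open>hom_Fun_eval\<close> the comparison at identity lists already fixes all faces
  of \<open>H\<close>.\<close>

lemma sphere_fill_Fun:
 assumes X: "simplicial_set X" and s: "s : hom (boundary n) (Fun X C)" and H: "H : hom (\<Delta> n \<otimes> X) C"
  and eq: "!!m a x. a : cell (boundary n) m ==> x : cell X m ==> H m (a, x) = s m a m (id_map m, x)"
 shows "sphere_fill (Fun X C) n s H"
 unfolding sphere_fill_def
proof (intro conjI allI ballI)
 show "H : cell (Fun X C) n" using H by simp
 fix m a assume a: "a : cell (boundary n) m"
 then have am: "a : mono_maps m n" by (simp add: boundary_cell)
 have sc: "s m a : hom (\<Delta> m \<otimes> X) C" using hom_cell[OF s a] by simp
 show "act (Fun X C) n a H = s m a"
 proof (rule hom_eqI[OF Fun_act_cell[OF X am H] sc])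
  fix k z assume "z : cell (\<Delta> m \<otimes> X) k"
  then obtain b x where z: "z = (b, x)" "b : mono_maps k m" "x : cell X k" by (cases z) auto
  have "H k (a \<cdot> b, x) = s k (a \<cdot> b) k (id_map k, x)" by (rule eq[OF boundary_closed[OF a z(2)] z(3)])
  then show "act (Fun X C) n a H k z = s m a k z"
   using hom_Fun_eval[OF s z(2) a z(3)] am z by simp
 qed
qed

lemma precomp_lift_fill:
 assumes X: "simplicial_set X" and X': "simplicial_set X'"
  and j: "!!m x. x : cell X' m ==> j m x : cell X m"
   "!!m k th x. x : cell X' m ==> th : mono_maps k m ==> j k (act X' m th x) = act X m th (j m x)"
  and H: "H : hom (\<Delta> n \<otimes> X) C" and d: "d : hom (\<Delta> n \<otimes> X') C"
  and Hd: "!!m a x. a : mono_maps m n ==> x : cell X' m ==> H m (a, j m x) = d m (a, x)"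
 shows "precomp X' X C j n H = d"
 unfolding precomp_apply[OF H] by (rule restr_eqI[OF d]) (use Hd in auto)

text \<open>
 Simplices of \<open>\<Delta> n \<otimes> X\<close> outside \<open>boundary n \<otimes> X\<close> surject onto \<open>\<Delta> n\<close>, so that their first and last
 vertices lie over \<open>0\<close> and \<open>n\<close>; \<open>J i\<close> is a property of the vertices over \<open>i\<close>.
\<close>

lemma postcomp_lift:
 assumes X: "simplicial_set X" and E: "simplicial_set E" and D: "simplicial_set D" and p: "p : hom E D"
  and n: "0 < n" and s: "s : hom (boundary n) (Fun X E)" and d: "d : hom (\<Delta> n \<otimes> X) D"
  and pd: "!!m a. a : cell (boundary n) m ==> postcomp X E p m (s m a) = act (Fun X D) n a d"
  and J: "!!i x. i <= n ==> x : cell X 0 ==> J i (s 0 [i] 0 ([0], x))"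
  and lift: "!!k sg de a. 0 < k ==> sg : hom (boundary k) E ==> de : cell D k ==>
   (!!m b. b : cell (boundary k) m ==> p m (sg m b) = act D k b de) ==>
   a : mono_maps k n ==> set a = {..n} ==> (!!i. i <= k ==> J (a ! i) (sg 0 [i])) ==>
   EX e. sphere_fill E k sg e & p k e = de"
 shows "EX H. sphere_fill (Fun X E) n s H & postcomp X E p n H = d"
proof -
 let ?B = "\<Delta> n \<otimes> X" and ?A = "boundary n \<otimes> X"
 have B: "simplicial_set ?B" using X by auto
 have A: "sub_sset ?A ?B"
  unfolding sub_sset_def
 proof (intro conjI allI ballI)
  fix m k th z assume *: "th : mono_maps m k" "z : cell ?A k"
  then show "act ?B k th z : cell ?A m"
   using boundary_closed[OF _ *(1)] sset_cell[OF X *(1)] by (cases z) simp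
 qed (auto simp: boundary_cell fun_eq_iff)
 have sc: "s m a : hom (\<Delta> m \<otimes> X) E" if "a : cell (boundary n) m" for m a
  using hom_cell[OF s that] by simp
 define f where "f = restr ?A (%m (a, x). s m a m (id_map m, x))"
 have f: "f : hom ?A E"
  unfolding f_def
 proof (rule restr_homI)
  fix m z assume "z : cell ?A m"
  then obtain a x where z: "z = (a, x)" "a : cell (boundary n) m" "x : cell X m" by (cases z) auto
  show "(case z of (a, x) => s m a m (id_map m, x)) : cell E m"
   using hom_cell[OF sc[OF z(2)], of "(id_map m, x)" m] z by simp
  fix k th assume th: "th : mono_maps k m"
  show "act ?A m th z : cell ?A k" using z boundary_closed[OF z(2) th] sset_cell[OF X th z(3)] by simp
  show "(case act ?A m th z of (a, x) => s k a k (id_map k, x)) = act E m th (case z of (a, x) => s m a m (id_map m, x))"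
   using hom_Fun_eval[OF s th z(2) sset_cell[OF X th z(3)]] hom_act[OF sc[OF z(2)] th, of "(id_map m, x)"] th z by simp
 qed
 have fa: "f m (a, x) = s m a m (id_map m, x)" if "a : cell (boundary n) m" "x : cell X m" for m a x
  using that by (simp add: f_def)
 show ?thesis
 proof (rule skeletal_extension[OF B E D A p f d, where I = "%b e. J (fst b ! 0) e"])
  fix m z assume "z : cell ?A m"
  then obtain a x where z: "z = (a, x)" "a : cell (boundary n) m" "x : cell X m" by (cases z) auto
  have am: "a : mono_maps m n" using z by (simp add: boundary_cell)
  have "p m (s m a m (id_map m, x)) = postcomp X E p m (s m a) m (id_map m, x)"
   using sc[OF z(2)] z by simp
  also have "... = d m (a, x)" unfolding pd[OF z(2)] using am z by simp
  finally show "p m (f m z) = d m z" using fa z by simp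
 next
  fix z assume "z : cell ?A 0"
  then obtain a x where z: "z = (a, x)" "a : cell (boundary n) 0" "x : cell X 0" by (cases z) auto
  then obtain i where "i <= n" "a = [i]" by (auto simp: boundary_cell mono_maps_0)
  then show "J (fst z ! 0) (f 0 z)" using J[of i x] fa[OF z(2,3)] z by (simp add: id_map_def)
 next
  \<comment> \<open>As \<open>n\<close> is positive, every vertex of \<open>\<Delta> n\<close> lies
    in the boundary, so there is no new vertex.\<close>
  fix z assume z: "z : cell ?B 0" "z ~: cell ?A 0"
  then have "z : cell ?A 0" using vertex_in_boundary[OF n] by (auto simp: mono_maps_0)
  with z show "EX e:cell E 0. p 0 e = d 0 z & J (fst z ! 0) e" by blast
 next
  fix k z sg assume *: "0 < k" "z : cell ?B k" "z ~: cell ?A k" "sg : hom (boundary k) E"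
   "!!m a. a : cell (boundary k) m ==> p m (sg m a) = act D k a (d k z)"
   "!!i. i <= k ==> J (fst (act ?B k [i] z) ! 0) (sg 0 [i])"
  obtain a x where z: "z = (a, x)" "a : mono_maps k n" "x : cell X k" using *(2) by (cases z) auto
  have "set a = {..n}" using *(3) z by (auto simp: boundary_cell)
  then show "EX e. sphere_fill E k sg e & p k e = d k z"
   using lift[OF *(1,4) hom_cell[OF d *(2)] *(5) z(2)] *(6) z by simp
 next
  fix h assume h: "h : hom ?B E" "!!n a. a : cell ?A n ==> h n a = f n a"
   "!!n b. b : cell ?B n ==> p n (h n b) = d n b"
  have "sphere_fill (Fun X E) n s h" by (rule sphere_fill_Fun[OF X s h(1)]) (simp add: h(2) fa)
  moreover have "postcomp X E p n h = d"
   unfolding postcomp_apply[OF h(1)] cmp_def by (rule restr_eqI[OF d]) (simp add: h(3))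
  ultimately show ?thesis by blast
 qed
qed

section \<open>Ordered simplicial complexes\<close>

text \<open>
 A downward closed family \<open>K\<close> of finite sets of vertices presents the simplicial set \<open>cx K\<close> whose
 simplices are the weakly increasing lists with underlying set in \<open>K\<close>.
\<close>

definition complex :: "'v set set => bool" where
 "complex K \<longleftrightarrow> (ALL s:K. ALL t. t <= s --> t ~= {} --> t : K)"

definition cx :: "'v::linorder set set => 'v list sset" where
 "cx K = \<lparr>cell = (%m. {l. length l = Suc m & sorted l & set l : K}), act = (%_ th l. map ((!) l) th)\<rparr>"

lemma cx_cell: "l : cell (cx K) m \<longleftrightarrow> length l = Suc m & sorted l & set l : K"
 by (simp add: cx_def)

lemma cx_act [simp]: "act (cx K) m th l = map ((!) l) th"
 by (simp add: cx_def)

text \<open>Monotonicity is required on each simplex only. This admits foldings of the vertex set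
  that are not monotone as a whole.\<close>

definition cx_map :: "'v::linorder set set => 'w::linorder set set => ('v => 'w) => bool" where
 "cx_map K K' rh \<longleftrightarrow> (ALL s:K. rh ` s : K' & (ALL x:s. ALL y:s. x <= y --> rh x <= rh y))"

definition cx_antimap :: "'v::linorder set set => 'w::linorder set set => ('v => 'w) => bool" where
 "cx_antimap K K' rh \<longleftrightarrow> (ALL s:K. rh ` s : K' & (ALL x:s. ALL y:s. x <= y --> rh y <= rh x))"

lemma complexD: "complex K ==> s : K ==> t <= s ==> t ~= {} ==> t : K"
 by (auto simp: complex_def)

lemma set_map_nth: "th : mono_maps m n ==> length l = Suc n ==> set (map ((!) l) th) <= set l"
 using mono_mapsD(5)[of th m n] by (auto simp: subset_iff less_Suc_eq_le)

lemma sorted_map_nth: "th : mono_maps m n ==> length l = Suc n ==> sorted l ==> sorted (map ((!) l) th)"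
 using mono_mapsD(1,3,4)[of th m n] by (auto simp: sorted_iff_nth_mono less_Suc_eq_le)

lemma map_nth_map_nth:
 "fi : mono_maps k m ==> length th = Suc m ==> map ((!) (map ((!) l) th)) fi = map ((!) l) (th \<cdot> fi)"
 using mono_mapsD(5)[of fi k m] by (auto simp: after_def subset_iff less_Suc_eq_le)

lemma map_nth_id_map: "length l = Suc n ==> map ((!) l) (id_map n) = l"
 by (auto intro!: nth_equalityI)

lemma map_map_nth: "th : mono_maps m n ==> length l = Suc n ==> map rh (map ((!) l) th) = map ((!) (map rh l)) th"
 using mono_mapsD(5)[of th m n] by (auto simp: subset_iff less_Suc_eq_le)

lemma nonempty_cell: "length l = Suc m ==> set l ~= {}"
 by auto

lemma cx_act_cell:
 assumes "complex K" "th : mono_maps m n" "l : cell (cx K) n"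
 shows "map ((!) l) th : cell (cx K) m"
proof -
 have l: "length l = Suc n" "sorted l" "set l : K" using assms(3) by (simp_all add: cx_cell)
 have len: "length (map ((!) l) th) = Suc m" using mono_mapsD(1)[OF assms(2)] by simp
 have "set (map ((!) l) th) : K"
  using complexD[OF assms(1) l(3) set_map_nth[OF assms(2) l(1)] nonempty_cell[OF len]] .
 with len sorted_map_nth[OF assms(2) l(1,2)] show ?thesis by (simp only: cx_cell)
qed

lemma cx_simplicial:
 assumes "complex K" shows "simplicial_set (cx K)"
proof (rule simplicial_setI)
 fix k m n th fi l assume "th : mono_maps m n" "fi : mono_maps k m" "l : cell (cx K) n"
 then show "act (cx K) m fi (act (cx K) n th l) = act (cx K) n (th \<cdot> fi) l"
  using map_nth_map_nth[of fi k m th l] mono_mapsD(1) by (simp del: map_map)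
next
 fix n l assume "l : cell (cx K) n"
 then show "act (cx K) n (id_map n) l = l" using map_nth_id_map[of l n] by (simp add: cx_cell)
qed (use cx_act_cell[OF assms] in simp)

lemma cx_sub:
 assumes "complex K" "K <= L" shows "sub_sset (cx K) (cx L)"
 unfolding sub_sset_def using assms(2) cx_act_cell[OF assms(1)]
 by (auto simp: fun_eq_iff cx_cell)

lemma cx_homI:
 assumes "complex K" "!!n l. l : cell (cx K) n ==> f n l : cell C n"
  and "!!m n th l. th : mono_maps m n ==> l : cell (cx K) n ==> f m (map ((!) l) th) = act C n th (f n l)"
 shows "restr (cx K) f : hom (cx K) C"
 by (rule restr_homI) (use assms cx_act_cell[OF assms(1)] in simp_all)

lemma cx_hom_act: "f : hom (cx K) C ==> th : mono_maps m n ==> l : cell (cx K) n ==>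
  f m (map ((!) l) th) = act C n th (f n l)"
 using hom_act[of f "cx K" C th m n l] by simp

lemma mono_map_cell:
 assumes l: "l : cell (cx K) n" and rh: "cx_map K K' rh"
 shows "map rh l : cell (cx K') n"
proof -
 note mono = rh[unfolded cx_map_def, rule_format, THEN conjunct2, rule_format]
 have "sorted l" "set l : K" "length l = Suc n" using l by (simp_all add: cx_cell)
 moreover have "sorted (map rh l)"
  using \<open>sorted l\<close> mono[OF \<open>set l : K\<close>] unfolding sorted_map
  by (rule sorted_wrt_mono_rel[rotated]) simp
 ultimately show ?thesis using rh by (simp add: cx_cell cx_map_def cx_antimap_def)
qed

lemma antimono_map_cell:
 assumes l: "l : cell (cx K) n" and rh: "cx_antimap K K' rh"
 shows "rev (map rh l) : cell (cx K') n"
proof -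
 note mono = rh[unfolded cx_antimap_def, rule_format, THEN conjunct2, rule_format]
 have "sorted l" "set l : K" "length l = Suc n" using l by (simp_all add: cx_cell)
 moreover have "sorted (rev (map rh l))"
  using \<open>sorted l\<close> mono[OF \<open>set l : K\<close>] unfolding sorted_wrt_rev sorted_wrt_map
  by (rule sorted_wrt_mono_rel[rotated]) simp
 ultimately show ?thesis using rh by (simp add: cx_cell cx_map_def cx_antimap_def)
qed

lemma pull_hom:
 assumes K: "complex K" and f: "f : hom (cx K') C" and rh: "cx_map K K' rh"
 shows "restr (cx K) (%n l. f n (map rh l)) : hom (cx K) C"
proof (rule cx_homI[OF K])
 note c = mono_map_cell[OF _ rh]
 show "f n (map rh l) : cell C n" if "l : cell (cx K) n" for n l
  using hom_cell[OF f c[OF that]] .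
 show "f m (map rh (map ((!) l) th)) = act C n th (f n (map rh l))"
  if "th : mono_maps m n" "l : cell (cx K) n" for m n th l
  using cx_hom_act[OF f that(1) c[OF that(2)]] map_map_nth[OF that(1), of l rh] that(2)
  by (simp add: cx_cell del: map_map)
qed

lemma rev_map_nth:
 assumes "th : mono_maps m n" "length l = Suc n"
 shows "rev (map rh (map ((!) l) th)) = map ((!) (rev (map rh l))) (flip n th)"
proof (rule nth_equalityI)
 fix i assume "i < length (rev (map rh (map ((!) l) th)))"
 then have i: "i <= m" using mono_mapsD(1)[OF assms(1)] by simp
 have t: "th ! (m - i) <= n" using mono_mapsD(3)[OF assms(1)] by simp
 show "rev (map rh (map ((!) l) th)) ! i = map ((!) (rev (map rh l))) (flip n th) ! i"
  using i t mono_mapsD(1)[OF assms(1)] assms(2)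
  by (simp add: rev_nth nth_flip[OF mono_mapsD(1)[OF assms(1)]])
qed simp

lemma pull_op_hom:
 assumes K: "complex K" and f: "f : hom (cx K') C" and rh: "cx_antimap K K' rh"
 shows "restr (cx K) (%n l. f n (rev (map rh l))) : hom (cx K) (op C)"
proof (rule cx_homI[OF K])
 note c = antimono_map_cell[OF _ rh]
 show "f n (rev (map rh l)) : cell (op C) n" if "l : cell (cx K) n" for n l
  using hom_cell[OF f c[OF that]] by simp
 show "f m (rev (map rh (map ((!) l) th))) = act (op C) n th (f n (rev (map rh l)))"
  if "th : mono_maps m n" "l : cell (cx K) n" for m n th l
  using cx_hom_act[OF f flip_mono[OF that(1)] c[OF that(2)]] rev_map_nth[OF that(1), of l rh] that(2)
  by (simp add: cx_cell del: map_map)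
qed

lemma hom_op_op: "f : hom X (op (op Y)) \<longleftrightarrow> f : hom X Y"
 using hom_op_iff op_hom_iff by blast

text \<open>The vertex set of a simplex of the union is a member of \<open>K\<close> or of
  \<open>L\<close>, so a union of complexes is the pushout over their intersection.\<close>

lemma cx_glue:
 assumes K: "complex K" and L: "complex L" and f: "f : hom (cx K) C" and g: "g : hom (cx L) C"
  and eq: "!!n l. l : cell (cx K) n ==> l : cell (cx L) n ==> f n l = g n l"
 obtains h where "h : hom (cx (K Un L)) C" "!!n l. l : cell (cx K) n ==> h n l = f n l"
  "!!n l. l : cell (cx L) n ==> h n l = g n l"
proof -
 have KL: "complex (K Un L)" using K L by (auto simp: complex_def)
 define h where "h = restr (cx (K Un L)) (%n l. if set l : K then f n l else g n l)"
 have hK: "h n l = f n l" if "l : cell (cx K) n" for n l using that by (simp add: h_def cx_cell)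
 have hL: "h n l = g n l" if "l : cell (cx L) n" for n l
  using that eq[of l n] by (cases "set l : K") (simp_all add: h_def cx_cell)
 have un: "l : cell (cx (K Un L)) n \<longleftrightarrow> l : cell (cx K) n | l : cell (cx L) n" for n l
  by (auto simp: cx_cell)
 have "restr (cx (K Un L)) h : hom (cx (K Un L)) C"
 proof (rule cx_homI[OF KL])
  fix n l assume "l : cell (cx (K Un L)) n"
  then show "h n l : cell C n" using un hK hL hom_cell[OF f] hom_cell[OF g] by metis
 next
  fix m n th l assume th: "th : mono_maps m n" and l: "l : cell (cx (K Un L)) n"
  from l un consider "l : cell (cx K) n" | "l : cell (cx L) n" by blast
  then show "h m (map ((!) l) th) = act C n th (h n l)"
  proof cases
   case 1
   show ?thesis using hK[OF 1] hK[OF cx_act_cell[OF K th 1]] cx_hom_act[OF f th 1] by simp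
  next
   case 2
   show ?thesis using hL[OF 2] hL[OF cx_act_cell[OF L th 2]] cx_hom_act[OF g th 2] by simp
  qed
 qed
 moreover have "restr (cx (K Un L)) h = h" unfolding h_def by (simp add: restr_def fun_eq_iff)
 ultimately show thesis using that hK hL by simp
qed

text \<open>The function \<open>f\<close> enters only through its values on simplices of
  \<open>K\<close>, so a formula can be inserted without restricting it first.\<close>

definition extends :: "'a sset => 'v::linorder set set => 'v set set => (nat => 'v list => 'a) => bool" where
 "extends C K L f \<longleftrightarrow> (EX g:hom (cx L) C. ALL n. ALL l:cell (cx K) n. g n l = f n l)"

text \<open>Cobase change: only the overlap of \<open>K\<close> with the new piece \<open>L\<close>
  takes part in the extension problem.\<close>

lemma extends_push:
 assumes K: "complex K" and L: "complex L" and f: "f : hom (cx K) C"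
  and ext: "extends C (K Int L) L f"
 shows "extends C K (K Un L) f"
proof -
 obtain g where g: "g : hom (cx L) C" "!!n l. l : cell (cx (K Int L)) n ==> g n l = f n l"
  using ext by (auto simp: extends_def)
 obtain h where "h : hom (cx (K Un L)) C" "!!n l. l : cell (cx K) n ==> h n l = f n l"
  using cx_glue[OF K L f g(1)] g(2) by (metis cx_cell IntI)
 then show ?thesis by (auto simp: extends_def)
qed

lemma extends_trans:
 assumes "extends C K L f" "K <= L" "!!g. g : hom (cx L) C ==> (!!n l. l : cell (cx K) n ==> g n l = f n l) ==> extends C L M g"
 shows "extends C K M f"
proof -
 obtain g where g: "g : hom (cx L) C" "!!n l. l : cell (cx K) n ==> g n l = f n l"
  using assms(1) by (auto simp: extends_def)
 obtain h where h: "h : hom (cx M) C" "!!n l. l : cell (cx L) n ==> h n l = g n l"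
  using assms(3)[OF g] by (auto simp: extends_def)
 have "h n l = f n l" if "l : cell (cx K) n" for n l
 proof -
  have "l : cell (cx L) n" using that assms(2) by (auto simp: cx_cell)
  then show ?thesis using h(2) g(2)[OF that] by simp
 qed
 then show ?thesis using h(1) unfolding extends_def by blast
qed

text \<open>A retract argument: \<open>f\<close> is pulled back along \<open>rh\<close>, extended to
  \<open>L\<close>, and pulled back along \<open>sg\<close>; on \<open>K'\<close> the two
  relabellings cancel.\<close>

lemma extends_relabel:
 assumes K: "complex K" and L': "complex L'" and KL': "K' <= L'" and f: "f : hom (cx K') C"
  and rh: "cx_map K K' rh" and sg: "cx_map L' L sg" "cx_map K' K sg"
  and inv: "!!s x. s : K' ==> x : s ==> rh (sg x) = x"
  and ext: "extends C K L (restr (cx K) (%n l. f n (map rh l)))"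
 shows "extends C K' L' f"
proof -
 obtain g where g: "g : hom (cx L) C" "!!n l. l : cell (cx K) n ==> g n l = restr (cx K) (%n l. f n (map rh l)) n l"
  using ext unfolding extends_def by metis
 have h: "restr (cx L') (%n l. g n (map sg l)) : hom (cx L') C"
  using pull_hom[OF L' g(1) sg(1)] .
 have "restr (cx L') (%n l. g n (map sg l)) n l = f n l" if l: "l : cell (cx K') n" for n l
 proof -
  have c: "map sg l : cell (cx K) n" using mono_map_cell[OF l sg(2)] .
  have l': "l : cell (cx L') n" using l KL' by (auto simp: cx_cell)
  have "map rh (map sg l) = l" using inv l by (auto simp: cx_cell intro!: map_idI)
  then show ?thesis using g(2)[OF c] c l' by simp
 qed
 then show ?thesis using h unfolding extends_def by blast
qed

section \<open>Simplices and horns on arbitrary vertex sets\<close>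

definition pw :: "'v set => 'v set set" where
 "pw s = {t. t <= s & t ~= {}}"

definition hrn :: "'v set => 'v => 'v set set" where
 "hrn s v = {t. t <= s & t ~= {} & ~ s - {v} <= t}"

lemma complex_pw: "complex (pw s)" and complex_hrn: "complex (hrn s v)"
 unfolding complex_def pw_def hrn_def by blast+

lemma hrn_pw: "hrn s v <= pw s"
 by (auto simp: pw_def hrn_def)

lemma simplex_cx: "\<Delta> n = cx (pw {..n})"
proof -
 have "mono_maps m n = {l. length l = Suc m & sorted l & set l : pw {..n}}" for m
  by (auto simp: mono_maps_def pw_def)
 then show ?thesis by (simp add: simplex_def cx_def after_def[abs_def])
qed

lemma horn_cx: "horn n k = cx (hrn {..n} k)"
proof -
 have "{a : mono_maps m n. ~ {..n} - {k} <= set a} = {l. length l = Suc m & sorted l & set l : hrn {..n} k}" for m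
  by (auto simp: mono_maps_def hrn_def)
 moreover have "act (\<Delta> n) = (%_ th l. map ((!) l) th)" by (simp add: fun_eq_iff after_def)
 ultimately show ?thesis by (simp add: horn_def cx_def)
qed

lemma boundary_cx: "boundary n = cx (pw {..n} - {{..n}})"
proof -
 have "{a : mono_maps m n. set a ~= {..n}} = {l. length l = Suc m & sorted l & set l : pw {..n} - {{..n}}}" for m
  by (auto simp: mono_maps_def pw_def)
 moreover have "act (\<Delta> n) = (%_ th l. map ((!) l) th)" by (simp add: fun_eq_iff after_def)
 ultimately show ?thesis by (simp add: boundary_def cx_def)
qed

abbreviation enum :: "'v::linorder set => nat => 'v" where
 "enum s == (!) (sorted_list_of_set s)"

definition pos :: "'v::linorder set => 'v => nat" where
 "pos s x = (THE i. i < card s & enum s i = x)"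

lemma pos_props:
 assumes "finite s" "x : s" shows "pos s x < card s" "enum s (pos s x) = x"
proof -
 have "EX i. i < card s & enum s i = x"
  using assms by (metis in_set_conv_nth length_sorted_list_of_set set_sorted_list_of_set)
 moreover have "i = j" if "i < card s & enum s i = x" "j < card s & enum s j = x" for i j
  using that nth_eq_iff_index_eq[of "sorted_list_of_set s" i j] by simp
 ultimately have "pos s x < card s & enum s (pos s x) = x"
  unfolding pos_def by (rule_tac theI') blast
 then show "pos s x < card s" "enum s (pos s x) = x" by auto
qed

lemma enum_in: "finite s ==> i < card s ==> enum s i : s"
 by (metis length_sorted_list_of_set nth_mem set_sorted_list_of_set)

lemma enum_less_iff:
 assumes "i < card s" "j < card s" shows "enum s i < enum s j \<longleftrightarrow> i < j"
proof -
 have *: "sorted_wrt (<) (sorted_list_of_set s)" by simp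
 have 1: "enum s i < enum s j" if "i < j" "j < card s" for i j
  using sorted_wrt_nth_less[OF *, of i j] that by simp
 show ?thesis using 1[of i j] 1[of j i] assms by (metis less_asym linorder_neqE_nat)
qed

lemma pos_enum: "i < card s ==> pos s (enum s i) = i"
 unfolding pos_def
 by (rule the_equality) (auto dest: nth_eq_iff_index_eq[THEN iffD1, rotated 3])

lemma pos_less_iff: "finite s ==> x : s ==> y : s ==> pos s x < pos s y \<longleftrightarrow> x < y"
 using enum_less_iff[of "pos s x" s "pos s y"] pos_props[of s x] pos_props[of s y] by simp

lemma pos_le_iff: "finite s ==> x : s ==> y : s ==> pos s x <= pos s y \<longleftrightarrow> x <= y"
 using pos_less_iff[of s y x] by (simp add: linorder_not_less[symmetric])

text \<open>Numbering \<open>s\<close> in increasing order turns the horn into a standard one; the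
  vertices \<open>a\<close> and \<open>b\<close> on either side of \<open>v\<close> make it an inner
  horn.\<close>

lemma inner_horn_extends:
 assumes C: "quasi_category C" and s: "finite s" "v : s" "a : s" "a < v" "b : s" "v < b"
  and f: "f : hom (cx (hrn s v)) C"
 shows "extends C (hrn s v) (pw s) f"
proof -
 define n where "n = card s - 1"
 have n: "card s = Suc n" using s by (simp add: n_def card_gt_0_iff Suc_diff_1[symmetric])
   (metis card_gt_0_iff empty_iff Suc_pred)
 have k: "0 < pos s v" "pos s v < n"
  using pos_less_iff[OF s(1,3,2)] pos_less_iff[OF s(1,2,5)] pos_props(1)[OF s(1,5)] s n by auto
 have img: "pos s ` t <= {..n}" if "t <= s" for t
  using that pos_props(1)[OF s(1)] n by (auto simp: less_Suc_eq_le)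
 have eimg: "enum s ` t <= s" if "t <= {..n}" for t
  using that enum_in[OF s(1)] n by (auto simp: less_Suc_eq_le)
 have h1: "enum s ` t : hrn s v" if t: "t : hrn {..n} (pos s v)" for t
 proof -
  obtain i where i: "i <= n" "i ~= pos s v" "i ~: t" and tn: "t <= {..n}" "t ~= {}" using t by (auto simp: hrn_def)
  have "enum s i ~: enum s ` t"
  proof
   assume "enum s i : enum s ` t"
   then obtain j where j: "j : t" "enum s i = enum s j" by blast
   then have "i = j" using pos_enum[of i s] pos_enum[of j s] i(1) tn(1) n by auto
   with j i show False by simp
  qed
  moreover have "enum s i ~= v" using i pos_enum[of i s] n by auto
  moreover have "enum s i : s" using enum_in[OF s(1)] i n by simp
  ultimately show ?thesis using eimg[OF tn(1)] tn(2) unfolding hrn_def by blast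
 qed
 have h2: "pos s ` t : hrn {..n} (pos s v)" if t: "t : hrn s v" for t
 proof -
  obtain x where x: "x : s" "x ~= v" "x ~: t" and ts: "t <= s" "t ~= {}" using t by (auto simp: hrn_def)
  have inj: "x = y" if "x : s" "y : s" "pos s x = pos s y" for x y
   using that pos_props(2)[OF s(1)] by metis
  have "pos s x ~: pos s ` t" using inj[OF x(1)] x(3) ts(1) by blast
  moreover have "pos s x ~= pos s v" using inj[OF x(1) s(2)] x(2) by blast
  moreover have "pos s x : {..n}" using img[of s] x(1) by blast
  ultimately show ?thesis using img[OF ts(1)] ts(2) unfolding hrn_def by blast
 qed
 have m1: "cx_map (hrn {..n} (pos s v)) (hrn s v) (enum s)"
  unfolding cx_map_def
 proof (intro ballI conjI impI)
  fix t i j assume "t : hrn {..n} (pos s v)" "i : t" "j : t" "i <= j"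
  then show "enum s i <= enum s j" using enum_less_iff[of j s i] n by (auto simp: hrn_def less_Suc_eq_le not_less[symmetric])
 qed (use h1 in blast)
 have mono: "pos s x <= pos s y" if "x : s" "y : s" "x <= y" for x y using pos_le_iff[OF s(1) that(1,2)] that(3) by simp
 have m2: "cx_map (pw s) (pw {..n}) (pos s)"
  unfolding cx_map_def pw_def using img mono by blast
 have m3: "cx_map (hrn s v) (hrn {..n} (pos s v)) (pos s)"
  unfolding cx_map_def
 proof (intro ballI conjI impI)
  fix t x y assume "t : hrn s v" "x : t" "y : t" "x <= y"
  then show "pos s x <= pos s y" using mono[of x y] unfolding hrn_def by blast
 qed (use h2 in blast)
 show ?thesis
 proof (rule extends_relabel[OF complex_hrn complex_pw hrn_pw f m1 m2 m3])
  show "!!t x. t : hrn s v ==> x : t ==> enum s (pos s x) = x" using pos_props(2)[OF s(1)] by (auto simp: hrn_def)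
  let ?f = "restr (cx (hrn {..n} (pos s v))) (%n l. f n (map (enum s) l))"
  have "?f : hom (horn n (pos s v)) C" using pull_hom[OF complex_hrn f m1] by (simp add: horn_cx)
  then obtain g where "g : hom (\<Delta> n) C" "restr (horn n (pos s v)) g = ?f"
   using C k unfolding quasi_category_def by blast
  then show "extends C (hrn {..n} (pos s v)) (pw {..n}) ?f"
   unfolding extends_def simplex_cx horn_cx by (metis restr_apply)
 qed
qed

text \<open>Passing from a horn to its simplex adds only the simplex and the face opposite
  \<open>v\<close>. The filling is kept as a hypothesis so that the argument covers both inner horns
  and outer horns with a degenerate edge.\<close>

lemma horn_push:
 assumes K: "complex K" and f: "f : hom (cx K) C" and s: "a : s" "a ~= v"
  and faces: "!!w. w : s ==> w ~= v ==> s - {w} : K" and new: "s ~: K" "s - {v} ~: K"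
  and ext: "restr (cx (hrn s v)) f : hom (cx (hrn s v)) C ==>
   extends C (hrn s v) (pw s) (restr (cx (hrn s v)) f)"
 shows "complex (K Un {s, s - {v}}) & extends C K (K Un {s, s - {v}}) f"
proof -
 have sub: "hrn s v <= K"
 proof
  fix t assume "t : hrn s v"
  then obtain w where "w : s" "w ~= v" "t <= s - {w}" "t ~= {}" by (auto simp: hrn_def)
  then show "t : K" using complexD[OF K faces] by blast
 qed
 have pw: "t : pw s \<longleftrightarrow> t : hrn s v | t = s | t = s - {v}" for t
  using s unfolding pw_def hrn_def by blast
 have eq: "K Un {s, s - {v}} = K Un pw s" using sub pw by blast
 have int: "K Int pw s = hrn s v" using sub pw new by blast
 have "complex (K Un pw s)" using K complex_pw[of s] unfolding complex_def by blast
 moreover have "extends C K (K Un pw s) f"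
 proof (rule extends_push[OF K complex_pw f], unfold int)
  show "extends C (hrn s v) (pw s) f"
   using ext[OF sub_restr_hom[OF cx_sub[OF complex_hrn sub] f]]
   unfolding extends_def by (metis restr_apply)
 qed
 ultimately show ?thesis using eq by simp
qed

lemma horn_extends_push:
 assumes C: "quasi_category C" and K: "complex K" and f: "f : hom (cx K) C"
  and s: "finite s" "v : s" "a : s" "a < v" "b : s" "v < b"
  and faces: "!!w. w : s ==> w ~= v ==> s - {w} : K" and new: "s ~: K" "s - {v} ~: K"
 shows "complex (K Un {s, s - {v}}) & extends C K (K Un {s, s - {v}}) f"
 by (rule horn_push[OF K f s(3) less_imp_neq[OF s(4)] faces new], assumption, assumption)
  (rule inner_horn_extends[OF C s])

text \<open>
 The simplices outside \<open>K\<close> are matched in pairs \<open>s, s - {v s}\<close> with \<open>v s\<close> an inner vertex of \<open>s\<close>; the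
 function \<open>r\<close> witnesses that the matching is acyclic.
\<close>

lemma matching_extends:
 fixes r :: "'v::linorder set => nat"
 assumes C: "quasi_category C" and K: "complex K" and U: "finite U" and f: "f : hom (cx K) C"
  and inner: "!!s. s : U ==> finite s & v s : s & (EX a:s. a < v s) & (EX b:s. v s < b)"
  and new: "!!s. s : U ==> s ~: K & s - {v s} ~: K"
  and disj: "!!s t. s : U ==> t : U ==> s ~= t - {v t}"
  and inj: "!!s t. s : U ==> t : U ==> s - {v s} = t - {v t} ==> s = t"
  and faces: "!!s w. s : U ==> w : s ==> w ~= v s ==>
   s - {w} : K | (EX t:U. r t < r s & (s - {w} = t | s - {w} = t - {v t}))"
 shows "complex (K Un U Un (%s. s - {v s}) ` U) & extends C K (K Un U Un (%s. s - {v s}) ` U) f"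
proof -
 \<comment> \<open>The claim is generalised to the subsets of \<open>U\<close> that satisfy the face
   condition among themselves; their elements are inserted by increasing \<open>r\<close>.\<close>
 have "V <= U ==> (ALL s:V. ALL w:s. w ~= v s -->
   s - {w} : K | (EX t:V. r t < r s & (s - {w} = t | s - {w} = t - {v t}))) ==>
  complex (K Un V Un (%s. s - {v s}) ` V) & extends C K (K Un V Un (%s. s - {v s}) ` V) f"
  if "finite V" for V
  using that
 proof (induction V rule: finite_ranking_induct[where f = r])
  case empty
  then show ?case using K f by (auto simp: extends_def)
 next
  case (insert s V)
  let ?L = "K Un V Un (%s. s - {v s}) ` V"
  show ?case
  proof (cases "s : V")
   case True
   then have "insert s V = V" by blast
   then show ?thesis using insert by simp
  next
   case False
   have sU: "s : U" and VU: "V <= U" using insert.prems by auto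
   \<comment> \<open>The inserted set \<open>s\<close> has the largest rank, so it cannot be the
     witness for a face of an earlier set.\<close>
   have "ALL s':V. ALL w:s'. w ~= v s' -->
    s' - {w} : K | (EX t:V. r t < r s' & (s' - {w} = t | s' - {w} = t - {v t}))"
   proof (intro ballI impI)
    fix s' w assume s': "s' : V" "w : s'" "w ~= v s'"
    have "r s' <= r s" using insert.hyps(2) s'(1) .
    moreover have "s' - {w} : K | (EX t:insert s V. r t < r s' & (s' - {w} = t | s' - {w} = t - {v t}))"
     using insert.prems(2) s' by blast
    ultimately show "s' - {w} : K | (EX t:V. r t < r s' & (s' - {w} = t | s' - {w} = t - {v t}))"
     by (metis insertE leD)
   qed
   then have IH: "complex ?L" "extends C K ?L f" using insert.IH VU by blast+
   have sf: "s - {w} : ?L" if w: "w : s" "w ~= v s" for w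
   proof -
    have "s - {w} : K | (EX t:insert s V. r t < r s & (s - {w} = t | s - {w} = t - {v t}))"
     using insert.prems(2) w by blast
    then show ?thesis by auto
   qed
   have n1: "s ~: ?L" using new[OF sU] False disj[OF sU] VU by blast
   have n2: "s - {v s} ~: ?L"
   proof
    assume "s - {v s} : ?L"
    then consider "s - {v s} : K" | "s - {v s} : V" | t where "t : V" "s - {v s} = t - {v t}" by blast
    then show False
    proof cases
     case 1 then show False using new[OF sU] by blast
    next
     case 2 then show False using disj[of "s - {v s}" s] sU VU by blast
    next
     case 3 then show False using inj[OF sU, of t] VU False by blast
    qed
   qed
   obtain a b where ab: "finite s" "v s : s" "a : s" "a < v s" "b : s" "v s < b" using inner[OF sU] by blast
   have eq: "K Un insert s V Un (%s. s - {v s}) ` insert s V = ?L Un {s, s - {v s}}" by blast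
   note push = horn_extends_push[OF C IH(1) _ ab sf n1 n2]
   have ext: "extends C K (?L Un {s, s - {v s}}) f"
    by (rule extends_trans[OF IH(2)]) (use push in blast)+
   moreover have "complex (?L Un {s, s - {v s}})"
    using IH(2) push unfolding extends_def by blast
   ultimately show ?thesis unfolding eq by blast
  qed
 qed
 from this[OF U] show ?thesis using faces by blast
qed

text \<open>Order reversal exchanges the horn at \<open>k\<close> with the horn at
  \<open>n - k\<close>, and inner horns remain inner.\<close>

lemma quasi_category_op:
 assumes C: "quasi_category C" shows "quasi_category (op C)"
 unfolding quasi_category_def
proof (intro conjI allI impI ballI)
 have S: "simplicial_set C" using C by (simp add: quasi_category_def)
 then show "simplicial_set (op C)" by simp
 fix n k :: nat and f assume k: "0 < k & k < n" and f: "f : hom (horn n k) (op C)"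
 have fl: "cx_antimap (hrn {..n} (n - k)) (hrn {..n} k) (%t. n - t)" "cx_antimap (hrn {..n} k) (hrn {..n} (n - k)) (%t. n - t)"
  if "0 < k" "k < n" for k
  unfolding cx_antimap_def
 proof (safe intro!: diff_le_mono2)
  have *: "(%t. n - t) ` t : hrn {..n} k" if t: "t : hrn {..n} (n - k)" "k < n" for t k
  proof -
   obtain i where i: "i <= n" "i ~= n - k" "i ~: t" and tn: "t <= {..n}" "t ~= {}" using t(1) by (auto simp: hrn_def)
   have "n - i ~: (%t. n - t) ` t"
   proof
    assume "n - i : (%t. n - t) ` t"
    then obtain j where "j : t" "n - i = n - j" by blast
    moreover from this have "j <= n" using tn by blast
    ultimately have "i = j" using i(1) by linarith
    with \<open>j : t\<close> i show False by simp
   qed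
   moreover have "n - i ~= k" using i t(2) by linarith
   moreover have "n - i : {..n}" by simp
   ultimately have "~ {..n} - {k} <= (%t. n - t) ` t" by blast
   then show ?thesis using tn by (auto simp: hrn_def)
  qed
  show "(%t. n - t) ` t : hrn {..n} k" if "t : hrn {..n} (n - k)" for t using *[OF that] \<open>k < n\<close> by simp
  show "(%t. n - t) ` t : hrn {..n} (n - k)" if "t : hrn {..n} k" for t
   using *[of t "n - k"] that \<open>0 < k\<close> \<open>k < n\<close> by simp
 qed
 have flp: "cx_antimap (pw {..n}) (pw {..n}) (%t. n - t)"
  unfolding cx_antimap_def pw_def by (auto intro: diff_le_mono2)
 let ?f = "restr (cx (hrn {..n} (n - k))) (%m l. f m (rev (map (%t. n - t) l)))"
 have "?f : hom (horn n (n - k)) C"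
  using pull_op_hom[OF complex_hrn f[unfolded horn_cx] fl(1)] k by (simp add: horn_cx hom_op_op)
 moreover have "0 < n - k & n - k < n" using k by auto
 ultimately obtain g where g: "g : hom (\<Delta> n) C" "restr (horn n (n - k)) g = ?f"
  using C unfolding quasi_category_def by blast
 let ?g = "restr (cx (pw {..n})) (%m l. g m (rev (map (%t. n - t) l)))"
 have g': "?g : hom (\<Delta> n) (op C)"
  using pull_op_hom[OF complex_pw g(1)[unfolded simplex_cx] flp] by (simp add: simplex_cx)
 have "restr (horn n k) ?g = f"
 proof (rule restr_eqI[OF f])
  fix m l assume l: "l : cell (horn n k) m"
  then have l': "l : cell (cx (hrn {..n} k)) m" by (simp add: horn_cx)
  have c: "rev (map (%t. n - t) l) : cell (cx (hrn {..n} (n - k))) m"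
   using antimono_map_cell[OF l' fl(2)] k by simp
  have "set l <= {..n}" using l' by (auto simp: cx_cell hrn_def)
  then have ll: "rev (map (%t. n - t) (rev (map (%t. n - t) l))) = l"
   by (auto simp: rev_map[symmetric] intro!: map_idI)
  have "l : cell (cx (pw {..n})) m" using l' subsetD[OF hrn_pw] by (auto simp: cx_cell)
  then have "?g m l = g m (rev (map (%t. n - t) l))" by simp
  also have "... = ?f m (rev (map (%t. n - t) l))" using g(2) c by (metis horn_cx restr_apply)
  also have "... = f m l" using c ll by simp
  finally show "?g m l = f m l" .
 qed
 with g' show "EX g:hom (\<Delta> n) (op C). restr (horn n k) g = f" by blast
qed

section \<open>Joins\<close>

lemma join_cell: "JL x : cell (X \<star> Y) n \<longleftrightarrow> x : cell X n" "JR y : cell (X \<star> Y) n \<longleftrightarrow> y : cell Y n"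
 "JM i j x y : cell (X \<star> Y) n \<longleftrightarrow> n = i + j + 1 & x : cell X i & y : cell Y j"
 by (auto simp: join_sset_def)

lemma join_act_eq: "act (X \<star> Y) = join_act X Y"
 by (simp add: join_sset_def)

lemma join_act_cong: "act X = act X' ==> act Y = act Y' ==> act (X \<star> Y) n th z = act (X' \<star> Y') n th z"
 by (cases z) (simp_all add: join_act_eq Let_def)

text \<open>This bookkeeping underlies the action on mixed simplices of a join: a monotone map is
  cut at \<open>i\<close> into its values in the left block and, shifted, those in the right
  block.\<close>

lemma split_mono:
 assumes "th : mono_maps m (i + j + 1)"
 shows "filter (%t. t <= i) th ~= [] ==> filter (%t. t <= i) th : mono_maps (length (filter (%t. t <= i) th) - 1) i"
  "filter (%t. i < t) th ~= [] ==>
   map (%t. t - Suc i) (filter (%t. i < t) th) : mono_maps (length (filter (%t. i < t) th) - 1) j"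
  "length (filter (%t. t <= i) th) + length (filter (%t. i < t) th) = Suc m"
proof -
 have th: "length th = Suc m" "sorted th" "set th <= {..i + j + 1}" using assms by (auto simp: mono_maps_def)
 show "filter (%t. t <= i) th : mono_maps (length (filter (%t. t <= i) th) - 1) i" if "filter (%t. t <= i) th ~= []"
  using that th(2) unfolding mono_maps_def by (auto simp: sorted_filter[of id, simplified])
 have "sorted (map (%t. t - Suc i) (filter (%t. i < t) th))"
  using sorted_filter[of id th "%t. i < t"] th(2) unfolding sorted_map
  by (auto intro!: sorted_wrt_mono_rel[of _ "(<=)"] diff_le_mono)
 then show "map (%t. t - Suc i) (filter (%t. i < t) th) : mono_maps (length (filter (%t. i < t) th) - 1) j"
  if "filter (%t. i < t) th ~= []"
  using that th(3) unfolding mono_maps_def by (auto simp: subset_iff)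
 have "(%t. i < t) = (%t. ~ t <= i)" by auto
 then show "length (filter (%t. t <= i) th) + length (filter (%t. i < t) th) = Suc m"
  using sum_length_filter_compl[of "%t. t <= i" th] th(1) by simp
qed

lemma join_act_cell:
 assumes X: "simplicial_set X" and Y: "simplicial_set Y" and th: "th : mono_maps m n" and z: "z : cell (X \<star> Y) n"
 shows "act (X \<star> Y) n th z : cell (X \<star> Y) m"
proof (cases z)
 case (JM i j x y)
 then have *: "n = i + j + 1" "x : cell X i" "y : cell Y j" using z by (simp_all add: join_cell)
 note s = split_mono[OF th[unfolded *(1)]]
 let ?l = "filter (%t. t <= i) th" and ?r = "filter (%t. i < t) th"
 consider "?r = []" | "?l = []" "?r ~= []" | "?l ~= []" "?r ~= []" by blast
 then show ?thesis
 proof cases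
  case 1
  then have "?l ~= []" "length ?l = Suc m" using s(3) by (simp_all) (metis Zero_neq_Suc list.size(3))
  then show ?thesis using s(1) sset_cell[OF X _ *(2)] 1 by (simp add: JM join_act_eq join_cell Let_def)
 next
  case 2
  then have "length ?r = Suc m" using s(3) by (simp)
  then show ?thesis using s(2) 2 sset_cell[OF Y _ *(3)] by (simp add: JM join_act_eq join_cell Let_def)
 next
  case 3
  have "0 < length ?l" "0 < length ?r" using 3 by (simp_all)
  then have "m = length ?l - 1 + (length ?r - 1) + 1" using s(3) by linarith
  then show ?thesis using s(1,2) 3 sset_cell[OF X _ *(2)] sset_cell[OF Y _ *(3)]
   by (simp add: JM join_act_eq join_cell Let_def)
 qed
qed (use z assms in \<open>auto simp: join_cell join_act_eq sset_cell\<close>)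

section \<open>Slices\<close>

lemma join_map_over_cell:
 assumes "th : mono_maps m n" "z : cell (\<Delta> m \<star> K) k"
 shows "join_map (%_ a. th \<cdot> a) (%_ y. y) k z : cell (\<Delta> n \<star> K) k"
 using assms(2) by (cases z) (auto simp: join_cell intro: after_mono[OF assms(1)])

lemma over_cell: "h : cell (over K C p) n \<longleftrightarrow> h : hom (\<Delta> n \<star> K) C & (ALL m. ALL y:cell K m. h m (JR y) = p m y)"
 by (simp add: over_def)

lemma over_act: "th : mono_maps m n ==> act (over K C p) k th h =
  restr (\<Delta> m \<star> K) (%m z. h m (join_map (%_ a. th \<cdot> a) (%_ y. y) m z))"
 by (simp add: over_def mono_mapsD(1))

lemma join_map_under_cell:
 assumes "th : mono_maps m n" "z : cell (K \<star> \<Delta> m) k"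
 shows "join_map (%_ y. y) (%_ a. th \<cdot> a) k z : cell (K \<star> \<Delta> n) k"
 using assms(2) by (cases z) (auto simp: join_cell intro: after_mono[OF assms(1)])

lemma join_map_under_act:
 assumes "th : mono_maps m n" "z : cell (K \<star> \<Delta> m) k" "fi : mono_maps j k"
 shows "join_map (%_ y. y) (%_ a. th \<cdot> a) j (act (K \<star> \<Delta> m) k fi z) =
  act (K \<star> \<Delta> n) k fi (join_map (%_ y. y) (%_ a. th \<cdot> a) k z)"
proof (cases z)
 case (JR a)
 then show ?thesis using assms by (simp add: join_cell join_act_eq after_assoc mono_mapsD(1))
next
 case (JM l i y a)
 then have *: "k = l + i + 1" "a : mono_maps i m" using assms(2) by (auto simp: join_cell)
 show ?thesis
  using split_mono(2)[of fi j l i] assms(3) *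
   split_mono(3)[of fi j l i]
  by (auto simp: JM join_act_eq Let_def after_assoc[OF _ mono_mapsD(1)[OF *(2)]])
qed (use assms in \<open>simp add: join_act_eq\<close>)

lemma under_cell: "h : cell (under K C p) n \<longleftrightarrow> h : hom (K \<star> \<Delta> n) C & (ALL m. ALL y:cell K m. h m (JL y) = p m y)"
 by (simp add: under_def)

lemma under_act: "th : mono_maps m n ==> act (under K C p) k th h =
  restr (K \<star> \<Delta> m) (%m z. h m (join_map (%_ y. y) (%_ a. th \<cdot> a) m z))"
 by (simp add: under_def mono_mapsD(1))

lemma under_act_cell:
 assumes K: "simplicial_set K" and th: "th : mono_maps m n" and h: "h : cell (under K C p) n"
 shows "act (under K C p) n th h : cell (under K C p) m"
proof -
 have h': "h : hom (K \<star> \<Delta> n) C" "!!m y. y : cell K m ==> h m (JL y) = p m y" using h by (auto simp: under_cell)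
 have "restr (K \<star> \<Delta> m) (%m z. h m (join_map (%_ y. y) (%_ a. th \<cdot> a) m z)) : hom (K \<star> \<Delta> m) C"
 proof (rule restr_homI)
  fix k z assume z: "z : cell (K \<star> \<Delta> m) k"
  show "h k (join_map (%_ y. y) (%_ a. th \<cdot> a) k z) : cell C k"
   by (rule hom_cell[OF h'(1) join_map_under_cell[OF th z]])
  fix j fi assume fi: "fi : mono_maps j k"
  show "act (K \<star> \<Delta> m) k fi z : cell (K \<star> \<Delta> m) j"
   by (rule join_act_cell[OF K simplex_simplicial fi z])
  show "h j (join_map (%_ y. y) (%_ a. th \<cdot> a) j (act (K \<star> \<Delta> m) k fi z)) =
   act C k fi (h k (join_map (%_ y. y) (%_ a. th \<cdot> a) k z))"
   unfolding join_map_under_act[OF th z fi] by (rule hom_act[OF h'(1) fi join_map_under_cell[OF th z]])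
 qed
 then show ?thesis using h'(2) by (simp add: under_act[OF th] under_cell join_cell)
qed

lemma under_simplicial:
 assumes K: "simplicial_set K" shows "simplicial_set (under K C p)"
proof (rule simplicial_setI)
 fix m n th h assume "th : mono_maps m n" "h : cell (under K C p) n"
 then show "act (under K C p) n th h : cell (under K C p) m" by (rule under_act_cell[OF K])
next
 fix n h assume "h : cell (under K C p) n"
 then have h: "h : hom (K \<star> \<Delta> n) C" by (simp add: under_cell)
 show "act (under K C p) n (id_map n) h = h"
  unfolding under_act[OF id_map_mono]
 proof (rule restr_eqI[OF h])
  fix m z assume "z : cell (K \<star> \<Delta> n) m"
  then have "join_map (%_ y. y) (%_ a. id_map n \<cdot> a) m z = z" by (cases z) (auto simp: join_cell)
  then show "h m (join_map (%_ y. y) (%_ a. id_map n \<cdot> a) m z) = h m z" by simp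
 qed
next
 fix k m n th fi h assume th: "th : mono_maps m n" and fi: "fi : mono_maps k m" and h: "h : cell (under K C p) n"
 show "act (under K C p) m fi (act (under K C p) n th h) = act (under K C p) n (th \<cdot> fi) h"
  unfolding under_act[OF th] under_act[OF fi] under_act[OF after_mono[OF th fi]]
 proof (rule restr_cong)
  fix l z assume z: "z : cell (K \<star> \<Delta> k) l"
  have "join_map (%_ y. y) (%_ a. th \<cdot> a) l (join_map (%_ y. y) (%_ a. fi \<cdot> a) l z) =
   join_map (%_ y. y) (%_ a. th \<cdot> fi \<cdot> a) l z"
   using z by (cases z) (auto simp: join_cell after_assoc mono_mapsD(1)[OF fi])
  then show "restr (K \<star> \<Delta> m) (%l z. h l (join_map (%_ y. y) (%_ a. th \<cdot> a) l z)) l (join_map (%_ y. y) (%_ a. fi \<cdot> a) l z) =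
   h l (join_map (%_ y. y) (%_ a. th \<cdot> fi \<cdot> a) l z)"
   using join_map_under_cell[OF fi z] by simp
 qed
qed

text \<open>Maps \<open>A \<rightarrow> C\<^bsub>p/\<^esub>\<close> for \<open>A \<subseteq> \<Delta> n\<close> correspond to maps \<open>K \<star> A \<rightarrow> C\<close> that restrict to \<open>p\<close> on \<open>K\<close>.\<close>

lemma under_curry:
 assumes K: "simplicial_set K" and p: "p : hom K C" and A: "sub_sset A (\<Delta> n)"
  and f: "f : hom A (under K C p)"
 obtains g where "g : hom (K \<star> A) C" "!!m y. y : cell K m ==> g m (JL y) = p m y"
  "!!k a m z. a : cell A k ==> z : cell (K \<star> \<Delta> k) m ==>
    g m (join_map (%_ y. y) (%_ b. a \<cdot> b) m z) = f k a m z"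
  "ALL h:hom (K \<star> \<Delta> n) C. (ALL m. ALL z:cell (K \<star> A) m. h m z = g m z) -->
    h : cell (under K C p) n & (ALL k. ALL a:cell A k. act (under K C p) n a h = f k a)"
proof -
 have As: "simplicial_set A" using sub_sset_simplicial[OF A] by simp
 have Am: "a : mono_maps k n" if "a : cell A k" for a k using sub_cell[OF A that] by simp
 have Aa: "a \<cdot> th : cell A m" "act A k th a = a \<cdot> th" if "a : cell A k" "th : mono_maps m k" for a k m th
  using sub_closed[OF A that(2,1)] sub_act[OF A] by simp_all
 define g where "g = restr (K \<star> A) (%k z. case z of JR a => f k a k (JR (id_map k)) | JL y => p k y
   | JM j i y a => f i a k (JM j i y (id_map i)))"
 have gL: "g k (JR a) = f k a k (JR (id_map k))" if "a : cell A k" for k a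
  using that by (simp add: g_def join_cell)
 have gR: "g k (JL y) = p k y" if "y : cell K k" for k y
  using that by (simp add: g_def join_cell)
 have gM: "g k (JM j i y a) = f i a k (JM j i y (id_map i))" if "a : cell A i" "y : cell K j" "k = j + i + 1" for k i j a y
  using that by (simp add: g_def join_cell)
 have fc: "f k a : cell (under K C p) k" if "a : cell A k" for k a using hom_cell[OF f that] .
 have fh: "f k a : hom (K \<star> \<Delta> k) C" "!!m y. y : cell K m ==> f k a m (JL y) = p m y" if "a : cell A k" for k a
  using fc[OF that] by (auto simp: under_cell)
 have fa: "f m (a \<cdot> th) j z = f k a j (join_map (%_ y. y) (%_ b. th \<cdot> b) j z)"
  if "a : cell A k" "th : mono_maps m k" "z : cell (K \<star> \<Delta> m) j" for a k m th j z
  using hom_act[OF f that(2,1)] Aa[OF that(1,2)] that(3) by (simp add: under_act[OF that(2)])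
 have gm: "g m (join_map (%_ y. y) (%_ b. a \<cdot> b) m z) = f k a m z"
  if a: "a : cell A k" and z: "z : cell (K \<star> \<Delta> k) m" for k a m z
 proof (cases z)
  case (JR b)
  then have b: "b : mono_maps m k" using z by (simp add: join_cell)
  show ?thesis using gL[OF Aa(1)[OF a b]] fa[OF a b, of "JR (id_map m)" m] b by (simp add: JR join_cell)
 next
  case (JL y)
  then show ?thesis using z gR fh(2)[OF a] by (simp add: join_cell)
 next
  case (JM j i y b)
  then have b: "b : mono_maps i k" "y : cell K j" "m = j + i + 1" using z by (simp_all add: join_cell)
  show ?thesis using gM[OF Aa(1)[OF a b(1)] b(2,3)] fa[OF a b(1), of "JM j i y (id_map i)" m] b by (simp add: JM join_cell)
 qed
 \<comment> \<open>Every simplex outside \<open>K\<close> comes from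
   \<open>K \<star> \<Delta> k\<close> along some \<open>a\<close> in \<open>A\<close>; therefore
   naturality of \<open>g\<close> reduces to that of the slice simplices
   \<open>f k a\<close>.\<close>
 have factor: "EX k a z'. a : cell A k & z' : cell (K \<star> \<Delta> k) m & z = join_map (%_ y. y) (%_ b. a \<cdot> b) m z'"
  if z: "z : cell (K \<star> A) m" "!!y. z ~= JL y" for m z
 proof (cases z)
  case (JR a)
  then have a: "a : cell A m" using z by (simp add: join_cell)
  then show ?thesis using after_id[OF Am[OF a]]
   by (intro exI[of _ m] exI[of _ a] exI[of _ "JR (id_map m)"]) (simp add: JR join_cell)
 next
  case (JM j i y a)
  then have a: "a : cell A i" "y : cell K j" "m = j + i + 1" using z by (simp_all add: join_cell)
  then show ?thesis using after_id[OF Am[OF a(1)]]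
   by (intro exI[of _ i] exI[of _ a] exI[of _ "JM j i y (id_map i)"]) (simp add: JM join_cell)
 qed (use z in blast)
 have "restr (K \<star> A) g : hom (K \<star> A) C"
 proof (rule restr_homI)
  fix m z assume z: "z : cell (K \<star> A) m"
  have "g m z : cell C m & (ALL l fi. fi : mono_maps l m --> g l (act (K \<star> A) m fi z) = act C m fi (g m z))"
  proof (cases "EX y. z = JL y")
   case True
   then obtain y where y: "z = JL y" "y : cell K m" using z by (auto simp: join_cell)
   then show ?thesis using gR hom_cell[OF p] hom_act[OF p] sset_cell[OF K] by (auto simp: join_act_eq)
  next
   case False
   then obtain k a z' where *: "a : cell A k" "z' : cell (K \<star> \<Delta> k) m" "z = join_map (%_ y. y) (%_ b. a \<cdot> b) m z'"
    using factor[OF z] by blast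
   have "g l (act (K \<star> A) m fi z) = act C m fi (g m z)" if fi: "fi : mono_maps l m" for l fi
   proof -
    have "act (K \<star> A) m fi z = act (K \<star> \<Delta> n) m fi z"
     by (rule join_act_cong) (simp_all only: sub_act[OF A])
    also have "... = join_map (%_ y. y) (%_ b. a \<cdot> b) l (act (K \<star> \<Delta> k) m fi z')"
     unfolding *(3) using join_map_under_act[OF Am[OF *(1)] *(2) fi] by simp
    finally show ?thesis
     using gm[OF *(1) join_act_cell[OF K simplex_simplicial fi *(2)]] gm[OF *(1,2)] hom_act[OF fh(1)[OF *(1)] fi *(2)] *(3)
     by simp
   qed
   then show ?thesis using gm[OF *(1,2)] hom_cell[OF fh(1)[OF *(1)] *(2)] *(3) by simp
  qed
  then show "g m z : cell C m" "!!l fi. fi : mono_maps l m ==> g l (act (K \<star> A) m fi z) = act C m fi (g m z)"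
   by blast+
  show "act (K \<star> A) m fi z : cell (K \<star> A) l" if "fi : mono_maps l m" for l fi
   by (rule join_act_cell[OF K As that z])
 qed
 moreover have "restr (K \<star> A) g = g" unfolding g_def by (simp add: restr_def fun_eq_iff)
 ultimately have g: "g : hom (K \<star> A) C" by simp
 have "h : cell (under K C p) n & (ALL k. ALL a:cell A k. act (under K C p) n a h = f k a)"
  if h: "h : hom (K \<star> \<Delta> n) C" "!!m z. z : cell (K \<star> A) m ==> h m z = g m z" for h
 proof (intro conjI allI ballI)
  show "h : cell (under K C p) n" using h gR by (simp add: under_cell join_cell)
  fix k a assume a: "a : cell A k"
  show "act (under K C p) n a h = f k a"
   unfolding under_act[OF Am[OF a]]
  proof (rule restr_eqI[OF fh(1)[OF a]])
   fix m z assume z: "z : cell (K \<star> \<Delta> k) m"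
   have "join_map (%_ y. y) (%_ b. a \<cdot> b) m z : cell (K \<star> A) m"
    using z Aa(1)[OF a] by (cases z) (auto simp: join_cell)
   then show "h m (join_map (%_ y. y) (%_ b. a \<cdot> b) m z) = f k a m z" using h(2) gm[OF a z] by simp
  qed
 qed
 then show thesis using that g gR gm by blast
qed

text \<open>The inverse transposition. Its last clause turns a filler in the slice back into an
  extension of \<open>g\<close>.\<close>

lemma under_uncurry:
 assumes K: "simplicial_set K" and A: "sub_sset A (\<Delta> n)"
  and g: "g : hom (K \<star> A) C" "!!m y. y : cell K m ==> g m (JL y) = p m y"
 obtains f where "f : hom A (under K C p)"
  "!!k a m z. a : cell A k ==> z : cell (K \<star> \<Delta> k) m ==>
    f k a m z = g m (join_map (%_ y. y) (%_ b. a \<cdot> b) m z)"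
  "ALL h:cell (under K C p) n. (ALL k. ALL a:cell A k. act (under K C p) n a h = f k a) -->
    (ALL m. ALL z:cell (K \<star> A) m. h m z = g m z)"
proof -
 have Am: "a : mono_maps k n" if "a : cell A k" for a k using sub_cell[OF A that] by simp
 have Aa: "a \<cdot> th : cell A m" "act A k th a = a \<cdot> th" if "a : cell A k" "th : mono_maps m k" for a k m th
  using sub_closed[OF A that(2,1)] sub_act[OF A] by simp_all
 define f where "f = restr A (%k a. restr (K \<star> \<Delta> k) (%m z. g m (join_map (%_ y. y) (%_ b. a \<cdot> b) m z)))"
 have jc: "join_map (%_ y. y) (%_ b. a \<cdot> b) m z : cell (K \<star> A) m"
  if "a : cell A k" "z : cell (K \<star> \<Delta> k) m" for k a m z
  using that(2) Aa(1)[OF that(1)] by (cases z) (auto simp: join_cell)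
 have fz: "f k a m z = g m (join_map (%_ y. y) (%_ b. a \<cdot> b) m z)" if "a : cell A k" "z : cell (K \<star> \<Delta> k) m" for k a m z
  using that by (simp add: f_def)
 have fk: "restr (K \<star> \<Delta> k) (%m z. g m (join_map (%_ y. y) (%_ b. a \<cdot> b) m z)) : cell (under K C p) k"
  if a: "a : cell A k" for k a
 proof -
  have "restr (K \<star> \<Delta> k) (%m z. g m (join_map (%_ y. y) (%_ b. a \<cdot> b) m z)) : hom (K \<star> \<Delta> k) C"
  proof (rule restr_homI)
   fix m z assume z: "z : cell (K \<star> \<Delta> k) m"
   show "g m (join_map (%_ y. y) (%_ b. a \<cdot> b) m z) : cell C m" by (rule hom_cell[OF g(1) jc[OF a z]])
   fix l fi assume fi: "fi : mono_maps l m"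
   show "act (K \<star> \<Delta> k) m fi z : cell (K \<star> \<Delta> k) l" by (rule join_act_cell[OF K simplex_simplicial fi z])
   have "join_map (%_ y. y) (%_ b. a \<cdot> b) l (act (K \<star> \<Delta> k) m fi z) =
     act (K \<star> \<Delta> n) m fi (join_map (%_ y. y) (%_ b. a \<cdot> b) m z)"
    by (rule join_map_under_act[OF Am[OF a] z fi])
   also have "... = act (K \<star> A) m fi (join_map (%_ y. y) (%_ b. a \<cdot> b) m z)"
    by (rule join_act_cong) (simp_all only: sub_act[OF A])
   finally show "g l (join_map (%_ y. y) (%_ b. a \<cdot> b) l (act (K \<star> \<Delta> k) m fi z)) =
     act C m fi (g m (join_map (%_ y. y) (%_ b. a \<cdot> b) m z))"
    using hom_act[OF g(1) fi jc[OF a z]] by simp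
  qed
  then show ?thesis using g(2) by (simp add: under_cell join_cell)
 qed
 have "f : hom A (under K C p)"
  unfolding f_def
 proof (rule restr_homI)
  fix m k th a assume th: "th : mono_maps m k" and a: "a : cell A k"
  show "act A k th a : cell A m" using Aa[OF a th] by simp
  show "restr (K \<star> \<Delta> m) (%m z. g m (join_map (%_ y. y) (%_ b. act A k th a \<cdot> b) m z)) =
   act (under K C p) k th (restr (K \<star> \<Delta> k) (%m z. g m (join_map (%_ y. y) (%_ b. a \<cdot> b) m z)))"
   unfolding under_act[OF th]
  proof (rule restr_cong)
   fix j z assume z: "z : cell (K \<star> \<Delta> m) j"
   have "join_map (%_ y. y) (%_ b. a \<cdot> b) j (join_map (%_ y. y) (%_ b. th \<cdot> b) j z) =
    join_map (%_ y. y) (%_ b. a \<cdot> th \<cdot> b) j z"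
    using z by (cases z) (auto simp: join_cell after_assoc mono_mapsD(1)[OF th])
   then show "g j (join_map (%_ y. y) (%_ b. act A k th a \<cdot> b) j z) =
    restr (K \<star> \<Delta> k) (%m z. g m (join_map (%_ y. y) (%_ b. a \<cdot> b) m z)) j (join_map (%_ y. y) (%_ b. th \<cdot> b) j z)"
    using join_map_under_cell[OF th z] Aa(2)[OF a th] by simp
  qed
 qed (use fk in simp)
 moreover have "h m z = g m z"
  if h: "h : cell (under K C p) n" "!!k a. a : cell A k ==> act (under K C p) n a h = f k a"
   and z: "z : cell (K \<star> A) m" for h m z
 proof -
  have ev: "h m (join_map (%_ y. y) (%_ b. a \<cdot> b) m z') = g m (join_map (%_ y. y) (%_ b. a \<cdot> b) m z')"
   if "a : cell A k" "z' : cell (K \<star> \<Delta> k) m" for k a z'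
  proof -
   have "act (under K C p) n a h m z' = f k a m z'" using h(2)[OF that(1)] by simp
   then show ?thesis using fz[OF that] that(2) by (simp add: under_act[OF Am[OF that(1)]])
  qed
  show ?thesis
  proof (cases z)
   case (JR a)
   then have "a : cell A m" using z by (simp add: join_cell)
   from ev[OF this, of "JR (id_map m)"] show ?thesis using after_id[OF Am[OF \<open>a : cell A m\<close>]] by (simp add: JR join_cell)
  next
   case (JL y)
   then show ?thesis using h(1) z g(2) by (simp add: under_cell join_cell)
  next
   case (JM j i y a)
   then have a: "a : cell A i" "y : cell K j" "m = j + i + 1" using z by (simp_all add: join_cell)
   from ev[OF this(1), of "JM j i y (id_map i)"] show ?thesis using after_id[OF Am[OF a(1)]] a by (simp add: JM join_cell)
  qed
 qed
 ultimately show thesis using that fz by blast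
qed

section \<open>Isomorphisms of simplicial sets\<close>

definition sset_iso :: "'a sset => 'b sset => (nat => 'a => 'b) => bool" where
 "sset_iso X Y f \<longleftrightarrow> f : hom X Y & (ALL n. bij_betw (f n) (cell X n) (cell Y n))"

lemma sset_iso_hom: "sset_iso X Y f ==> f : hom X Y"
 by (simp add: sset_iso_def)

lemma sset_iso_surj: "sset_iso X Y f ==> y : cell Y n ==> EX x:cell X n. f n x = y"
 unfolding sset_iso_def bij_betw_def by (metis imageE)

text \<open>An isomorphism restricts to simplicial subsets that correspond under it. In the
  applications \<open>X\<close> is a join with a simplex and \<open>A\<close> is this join or the
  join with the boundary.\<close>

lemma sset_iso_push:
 assumes Ph: "sset_iso X Y Ph" and A: "sub_sset A X" and B: "sub_sset B Y"
  and AB: "!!n z. z : cell X n ==> z : cell A n \<longleftrightarrow> Ph n z : cell B n" and g: "g : hom A C"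
 obtains g' where "g' : hom B C" "!!n z. z : cell A n ==> g' n (Ph n z) = g n z"
proof -
 have hom: "Ph : hom X Y" and bij: "bij_betw (Ph n) (cell X n) (cell Y n)" for n
  using Ph by (auto simp: sset_iso_def)
 have ex: "EX z. z : cell A n & Ph n z = y" if "y : cell B n" for n y
 proof -
  have "y : Ph n ` cell X n" using sub_cell[OF B that] bij_betw_imp_surj_on[OF bij] by blast
  then show ?thesis using AB that by blast
 qed
 have inj: "z = z'" if "z : cell A n" "z' : cell A n" "Ph n z = Ph n z'" for n z z'
  using bij_betw_imp_inj_on[OF bij, of n] sub_cell[OF A] that by (auto dest: inj_onD)
 define g' where "g' = restr B (%n y. g n (THE z. z : cell A n & Ph n z = y))"
 have eq: "g' n (Ph n z) = g n z" if z: "z : cell A n" for n z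
 proof -
  have "(THE z'. z' : cell A n & Ph n z' = Ph n z) = z"
   by (rule the_equality) (use z inj in blast)+
  moreover have "Ph n z : cell B n" using AB z sub_cell[OF A z] by blast
  ultimately show ?thesis by (simp add: g'_def)
 qed
 have "restr B g' : hom B C"
 proof (rule restr_homI)
  fix n y assume "y : cell B n"
  then obtain z where z: "z : cell A n" "Ph n z = y" using ex by blast
  then show "g' n y : cell C n" using eq[OF z(1)] hom_cell[OF g z(1)] by simp
  fix m th assume th: "th : mono_maps m n"
  show "act B n th y : cell B m" using sub_closed[OF B th \<open>y : cell B n\<close>] sub_act[OF B] by simp
  have "act B n th y = Ph m (act X n th z)"
   using hom_act[OF hom th sub_cell[OF A z(1)]] sub_act[OF B] z by simp
  then have "g' m (act B n th y) = g m (act A n th z)"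
   using eq[OF sub_closed[OF A th z(1)]] sub_act[OF A] by simp
  then show "g' m (act B n th y) = act C n th (g' n y)"
   using hom_act[OF g th z(1)] eq[OF z(1)] z by simp
 qed
 moreover have "restr B g' = g'" unfolding g'_def by (simp add: restr_def fun_eq_iff)
 ultimately show thesis using that eq by simp
qed

lemma sub_sset_refl [simp]: "simplicial_set X ==> sub_sset X X"
 by (simp add: sub_sset_def sset_cell)

lemma sset_iso_pull:
 assumes Ph: "sset_iso X Y Ph" and A: "sub_sset A X" and B: "sub_sset B Y"
  and AB: "!!n z. z : cell A n ==> Ph n z : cell B n" and g: "g : hom B C"
 shows "restr A (%n z. g n (Ph n z)) : hom A C"
proof (rule restr_homI)
 have hom: "Ph : hom X Y" using Ph by (auto simp: sset_iso_def)
 fix m n th z assume th: "th : mono_maps m n" and z: "z : cell A n"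
 show "act A n th z : cell A m" using sub_closed[OF A th z] sub_act[OF A] by simp
 show "g m (Ph m (act A n th z)) = act C n th (g n (Ph n z))"
  using hom_act[OF g th AB[OF z]] hom_act[OF hom th sub_cell[OF A z]] sub_act[OF A] sub_act[OF B] by simp
qed (use AB hom_cell[OF g] in blast)

section \<open>Joins of complexes\<close>

definition jc :: "('v => 'w) => ('u => 'w) => 'v set set => 'u set set => 'w set set" where
 "jc ka rh S T = {ka ` s Un rh ` t |s t. s : insert {} S & t : insert {} T & ~ (s = {} & t = {})}"

lemma complex_jc:
 assumes "complex S" "complex T" shows "complex (jc ka rh S T)"
 unfolding complex_def
proof (intro ballI allI impI)
 fix r r' assume "r : jc ka rh S T" and r': "r' <= r" "r' ~= {}"
 then obtain s t where *: "r = ka ` s Un rh ` t" "s : insert {} S" "t : insert {} T" by (auto simp: jc_def)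
 let ?s = "{x : s. ka x : r'}" and ?t = "{x : t. rh x : r'}"
 have "?s : insert {} S" "?t : insert {} T"
  using *(2,3) complexD[OF assms(1), of s ?s] complexD[OF assms(2), of t ?t] by auto
 moreover have "r' = ka ` ?s Un rh ` ?t" using r' *(1) by auto
 ultimately show "r' : jc ka rh S T" using r'(2) unfolding jc_def by blast
qed

lemma jc_mono: "S <= S' ==> T <= T' ==> jc ka rh S T <= jc ka rh S' T'"
 unfolding jc_def by blast

definition jmap :: "('v => 'w) => ('u => 'w) => (nat => 'a => 'v list) => (nat => 'b => 'u list) =>
  nat => ('a, 'b) join => 'w list" where
 "jmap ka rh c d n z = (case z of JL x => map ka (c n x) | JR y => map rh (d n y)
   | JM i j x y => map ka (c i x) @ map rh (d j y))"

lemma jmap_simps [simp]: "jmap ka rh c d n (JL x) = map ka (c n x)" "jmap ka rh c d n (JR y) = map rh (d n y)"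
 "jmap ka rh c d n (JM i j x y) = map ka (c i x) @ map rh (d j y)"
 by (simp_all add: jmap_def)

lemma map_nth_append_split:
 assumes "sorted th" "length u = Suc i"
 shows "map ((!) (u @ v)) th = map ((!) u) (filter (%t. t <= i) th) @ map ((!) v) (map (%t. t - Suc i) (filter (%t. i < t) th))"
 using assms
proof (induction th)
 case (Cons t th)
 show ?case
 proof (cases "t <= i")
  case True
  then show ?thesis using Cons by (simp add: nth_append)
 next
  case False
  then have "filter (%t. t <= i) th = []" using Cons.prems by (auto simp: filter_empty_conv)
  then show ?thesis using Cons False by (simp add: nth_append)
 qed
qed simp

text \<open>Since all left codes precede all right codes, concatenating a left and a right sorted
  list gives a sorted list, and every sorted list arises in this way.\<close>

locale join_codes =
 fixes ka :: "'v::linorder => 'w::linorder" and rh :: "'u::linorder => 'w"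
 assumes sm: "strict_mono ka" "strict_mono rh" and less: "!!x y. ka x < rh y"
begin

lemma injs: "inj ka" "inj rh" and neq: "ka x ~= rh y" "rh y ~= ka x"
 using sm less[of x y] strict_mono_imp_inj_on by auto

lemma sorted_join: "sorted (map ka u @ map rh v) \<longleftrightarrow> sorted u & sorted v"
 using less strict_mono_less_eq[OF sm(1)] strict_mono_less_eq[OF sm(2)]
 by (auto simp: sorted_append sorted_wrt_map less_imp_le)

lemma set_join_iff:
 assumes "~ (u = [] & v = [])"
 shows "set (map ka u @ map rh v) : jc ka rh S T \<longleftrightarrow> (u = [] | set u : insert {} S) & (v = [] | set v : insert {} T)"
proof
 assume "set (map ka u @ map rh v) : jc ka rh S T"
 then obtain s t where *: "ka ` set u Un rh ` set v = ka ` s Un rh ` t" "s : insert {} S" "t : insert {} T"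
  by (auto simp: jc_def)
 have 1: "ka ` set u = ka ` s" using *(1) neq by blast
 have 2: "rh ` set v = rh ` t" using *(1) neq by blast
 have "set u = s" "set v = t" using 1 2 injs by (simp_all add: inj_image_eq_iff)
 then show "(u = [] | set u : insert {} S) & (v = [] | set v : insert {} T)" using * by auto
next
 assume *: "(u = [] | set u : insert {} S) & (v = [] | set v : insert {} T)"
 have "set (map ka u @ map rh v) = ka ` set u Un rh ` set v" by simp
 moreover have "set u : insert {} S" "set v : insert {} T" using * by auto
 moreover have "~ (set u = {} & set v = {})" using assms by simp
 ultimately show "set (map ka u @ map rh v) : jc ka rh S T" unfolding jc_def by blast
qed

text \<open>In a sorted list a left code cannot follow a right code.\<close>

lemma jc_split:
 assumes "sorted l" "set l : jc ka rh S T"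
 obtains u v where "l = map ka u @ map rh v"
proof -
 have "set l <= range ka Un range rh" using assms(2) by (auto simp: jc_def)
 with assms(1) have "EX u v. l = map ka u @ map rh v"
 proof (induction l)
  case Nil
  then show ?case by simp
 next
  case (Cons x l)
  then obtain u v where uv: "l = map ka u @ map rh v" by auto
  show ?case
  proof (cases "x : range ka")
   case True
   then obtain a where "x = ka a" by blast
   then have "x # l = map ka (a # u) @ map rh v" using uv by simp
   then show ?thesis by blast
  next
   case False
   then obtain b where b: "x = rh b" using Cons.prems by auto
   have "u = []"
   proof (rule ccontr)
    assume "u ~= []"
    then obtain a u' where "u = a # u'" by (cases u) auto
    then have "rh b <= ka a" using Cons.prems(1) uv b by simp
    then show False using less[of a b] by simp
   qed
   then have "x # l = map ka [] @ map rh (b # v)" using uv b by simp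
   then show ?thesis by blast
  qed
 qed
 then show thesis using that by blast
qed

text \<open>\<open>X'\<close> and \<open>Y'\<close> may be smaller than \<open>X\<close> and
  \<open>Y\<close>: this is how the join with a boundary is recognised inside the join with the
  whole simplex.\<close>

lemma jmap_cell_iff:
 assumes "z : cell (X \<star> Y) m" "!!n x. x : cell X n ==> length (c n x) = Suc n & sorted (c n x) & (x : cell X' n \<longleftrightarrow> set (c n x) : S)"
  "!!n y. y : cell Y n ==> length (d n y) = Suc n & sorted (d n y) & (y : cell Y' n \<longleftrightarrow> set (d n y) : T)"
 shows "jmap ka rh c d m z : cell (cx (jc ka rh S T)) m \<longleftrightarrow> z : cell (X' \<star> Y') m"
proof (cases z)
 case (JL x)
 then have "x : cell X m" using assms(1) by (simp add: join_cell)
 then show ?thesis using assms(2)[of x m] sorted_join[of "c m x" "[]"] set_join_iff[of "c m x" "[]" S T]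
  by (cases "c m x") (auto simp: JL join_cell cx_cell)
next
 case (JR y)
 then have "y : cell Y m" using assms(1) by (simp add: join_cell)
 then show ?thesis using assms(3)[of y m] sorted_join[of "[]" "d m y"] set_join_iff[of "[]" "d m y" S T]
  by (cases "d m y") (auto simp: JR join_cell cx_cell)
next
 case (JM i j x y)
 then have *: "x : cell X i" "y : cell Y j" "m = i + j + 1" using assms(1) by (simp_all add: join_cell)
 then have ne: "c i x ~= []" "d j y ~= []" using assms(2)[of x i] assms(3)[of y j] by auto
 then show ?thesis using assms(2)[OF *(1)] assms(3)[OF *(2)] sorted_join[of "c i x" "d j y"] set_join_iff[of "c i x" "d j y" S T] *
  by (simp add: JM join_cell cx_cell)
qed

text \<open>A sorted list of the join complex splits uniquely into a left and a right part, and the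
  three constructors of \<open>join\<close> record which of the parts are nonempty.\<close>

lemma jmap_iso:
 assumes X: "simplicial_set X" and Y: "simplicial_set Y" and S: "complex S" and T: "complex T"
  and c: "sset_iso X (cx S) c" and d: "sset_iso Y (cx T) d"
 shows "sset_iso (X \<star> Y) (cx (jc ka rh S T)) (restr (X \<star> Y) (jmap ka rh c d))"
proof -
 let ?Z = "cx (jc ka rh S T)"
 have ch: "c : hom X (cx S)" and dh: "d : hom Y (cx T)" using c d by (auto simp: sset_iso_def)
 have cc: "length (c n x) = Suc n & sorted (c n x) & set (c n x) : S" if "x : cell X n" for n x
  using hom_cell[OF ch that] by (simp add: cx_cell)
 have dc: "length (d n x) = Suc n & sorted (d n x) & set (d n x) : T" if "x : cell Y n" for n x
  using hom_cell[OF dh that] by (simp add: cx_cell)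
 have cb: "c n ` cell X n = cell (cx S) n" "inj_on (c n) (cell X n)" for n
  using c by (auto simp: sset_iso_def bij_betw_def)
 have db: "d n ` cell Y n = cell (cx T) n" "inj_on (d n) (cell Y n)" for n
  using d by (auto simp: sset_iso_def bij_betw_def)
 have jcell: "jmap ka rh c d m z : cell ?Z m" if "z : cell (X \<star> Y) m" for m z
  using jmap_cell_iff[of z X Y m c X S d Y T] cc dc that by blast
 have "restr (X \<star> Y) (jmap ka rh c d) : hom (X \<star> Y) ?Z"
 proof (rule restr_homI)
  fix m n th z assume th: "th : mono_maps m n" and z: "z : cell (X \<star> Y) n"
  show "act (X \<star> Y) n th z : cell (X \<star> Y) m" by (rule join_act_cell[OF X Y th z])
  show "jmap ka rh c d m (act (X \<star> Y) n th z) = act ?Z n th (jmap ka rh c d n z)"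
  proof (cases z)
   case (JL x)
   then have x: "x : cell X n" using z by (simp add: join_cell)
   show ?thesis using cx_hom_act hom_act[OF ch th x] cc[OF x] map_map_nth[OF th, of "c n x" ka]
    by (simp add: JL join_act_eq del: map_map)
  next
   case (JR x)
   then have x: "x : cell Y n" using z by (simp add: join_cell)
   show ?thesis using cx_hom_act hom_act[OF dh th x] dc[OF x] map_map_nth[OF th, of "d n x" rh]
    by (simp add: JR join_act_eq del: map_map)
  next
   case (JM i j x y)
   then have *: "n = i + j + 1" "x : cell X i" "y : cell Y j" using z by (simp_all add: join_cell)
   let ?l = "filter (%t. t <= i) th" and ?r = "map (%t. t - Suc i) (filter (%t. i < t) th)"
   note s = split_mono[OF th[unfolded *(1)]]
   have "act ?Z n th (jmap ka rh c d n z) = map ((!) (map ka (c i x))) ?l @ map ((!) (map rh (d j y))) ?r"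
    using map_nth_append_split[of th "map ka (c i x)" i] mono_mapsD(2)[OF th] cc[OF *(2)] by (simp add: JM)
   moreover have "map ((!) (map ka (c i x))) ?l = map ka (c (length ?l - 1) (act X i ?l x))" if "?l ~= []"
    using hom_act[OF ch s(1)[OF that] *(2)] map_map_nth[OF s(1)[OF that], of "c i x" ka] cc[OF *(2)] by simp
   moreover have "map ((!) (map rh (d j y))) ?r = map rh (d (length ?r - 1) (act Y j ?r y))" if "?r ~= []"
    using hom_act[OF dh s(2) *(3)] map_map_nth[OF s(2), of "d j y" rh] dc[OF *(3)] that by simp
   moreover have "length ?r - 1 = m" if "?l = []" using s(3) that by simp
   moreover have "length ?l - 1 = m" if "?r = []" using s(3) that by simp
   moreover have "~ (?l = [] & ?r = [])" using s(3) by auto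
   ultimately show ?thesis
    unfolding JM join_act_eq join_act.simps Let_def by (auto simp del: map_map)
  qed
 qed (rule jcell)
 moreover have "bij_betw (restr (X \<star> Y) (jmap ka rh c d) n) (cell (X \<star> Y) n) (cell ?Z n)" for n
 proof (rule bij_betw_imageI)
  have ml: "map ka u = map ka u' \<longleftrightarrow> u = u'" and mr: "map rh v = map rh v' \<longleftrightarrow> v = v'" for u u' v v'
   using injs by simp_all
  \<comment> \<open>The ranges of the two codes are disjoint, so filtering by membership in the
    range of \<open>ka\<close> recovers both parts.\<close>
  have app: "map ka u @ map rh v = map ka u' @ map rh v' \<longleftrightarrow> u = u' & v = v'" for u u' v v'
  proof
   assume eq: "map ka u @ map rh v = map ka u' @ map rh v'"
   have r: "filter (%x. x : range ka) (map ka u @ map rh v) = map ka u"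
    "filter (%x. x ~: range ka) (map ka u @ map rh v) = map rh v" for u v
    using neq by (auto simp: filter_empty_conv filter_id_conv)
   show "u = u' & v = v'" using r(1)[of u v] r(1)[of u' v'] r(2)[of u v] r(2)[of u' v'] eq ml mr by metis
  qed simp
  show "inj_on (restr (X \<star> Y) (jmap ka rh c d) n) (cell (X \<star> Y) n)"
  proof (rule inj_onI)
   fix z z' assume z: "z : cell (X \<star> Y) n" "z' : cell (X \<star> Y) n"
    and "restr (X \<star> Y) (jmap ka rh c d) n z = restr (X \<star> Y) (jmap ka rh c d) n z'"
   then have eq: "jmap ka rh c d n z = jmap ka rh c d n z'" by simp
   \<comment> \<open>The constructor is replaced by a pair of lists, with the empty list for an
     absent part; cells never give empty lists, so the constructor can be read off again.\<close>
   define P where "P z = (case z of JL x => (c n x, []) | JR y => ([], d n y) | JM i j x y => (c i x, d j y))" for z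
   have "jmap ka rh c d n z = map ka (fst (P z)) @ map rh (snd (P z))" for z
    by (cases z) (simp_all add: P_def)
   then have P: "P z = P z'" using eq app by (metis prod.collapse)
   have nc: "c k x ~= []" "[] ~= c k x" if "x : cell X k" for k x using cc[OF that] by auto
   have nd: "d k x ~= []" "[] ~= d k x" if "x : cell Y k" for k x using dc[OF that] by auto
   have ec: "k = l & x = x'" if "c k x = c l x'" "x : cell X k" "x' : cell X l" for k l x x'
   proof -
    have "k = l" using cc[OF that(2)] cc[OF that(3)] that(1) by simp
    then show ?thesis using that inj_onD[OF cb(2)] by blast
   qed
   have ed: "k = l & x = x'" if "d k x = d l x'" "x : cell Y k" "x' : cell Y l" for k l x x'
   proof -
    have "k = l" using dc[OF that(2)] dc[OF that(3)] that(1) by simp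
    then show ?thesis using that inj_onD[OF db(2)] by blast
   qed
   show "z = z'"
    using P z by (cases z; cases z') (auto simp: P_def join_cell nc nd dest: ec ed)
  qed
  show "restr (X \<star> Y) (jmap ka rh c d) n ` cell (X \<star> Y) n = cell ?Z n"
  proof (intro equalityI subsetI)
   fix l assume "l : restr (X \<star> Y) (jmap ka rh c d) n ` cell (X \<star> Y) n"
   then show "l : cell ?Z n" using jcell by auto
  next
   fix l assume l: "l : cell ?Z n"
   then have l': "length l = Suc n" "sorted l" "set l : jc ka rh S T" by (simp_all add: cx_cell)
   obtain u v where uv: "l = map ka u @ map rh v" using jc_split[OF l'(2,3)] .
   have "~ (u = [] & v = [])" using l'(1) uv by auto
   note st = set_join_iff[OF this, of S T] and so = sorted_join[of u v]
   have u: "u : cell (cx S) (length u - 1)" if "u ~= []" using st so l' uv that by (auto simp: cx_cell)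
   have v: "v : cell (cx T) (length v - 1)" if "v ~= []" using st so l' uv that by (auto simp: cx_cell)
   consider "u = []" "v ~= []" | "u ~= []" "v = []" | "u ~= []" "v ~= []" using \<open>~ _\<close> by blast
   then have "EX z:cell (X \<star> Y) n. jmap ka rh c d n z = l"
   proof cases
    case 1
    then have "v : d n ` cell Y n" using v db(1)[of n] l'(1) uv by simp
    then obtain y where "y : cell Y n" "d n y = v" by blast
    then show ?thesis using 1 uv by (intro bexI[of _ "JR y"]) (simp_all add: join_cell)
   next
    case 2
    then have "u : c n ` cell X n" using u cb(1)[of n] l'(1) uv by simp
    then obtain x where "x : cell X n" "c n x = u" by blast
    then show ?thesis using 2 uv by (intro bexI[of _ "JL x"]) (simp_all add: join_cell)
   next
    case 3
    have "u : c (length u - 1) ` cell X (length u - 1)" using u[OF 3(1)] by (simp only: cb(1))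
    then obtain x where x: "x : cell X (length u - 1)" "c (length u - 1) x = u" by (elim imageE) metis
    have "v : d (length v - 1) ` cell Y (length v - 1)" using v[OF 3(2)] by (simp only: db(1))
    then obtain y where y: "y : cell Y (length v - 1)" "d (length v - 1) y = v" by (elim imageE) metis
    have "0 < length u" "0 < length v" "length u + length v = Suc n" using 3 l'(1) uv by simp_all
    then have "n = length u - 1 + (length v - 1) + 1" by linarith
    then show ?thesis using x y uv
     by (intro bexI[of _ "JM (length u - 1) (length v - 1) x y"]) (simp_all add: join_cell)
   qed
   then show "l : restr (X \<star> Y) (jmap ka rh c d) n ` cell (X \<star> Y) n" by (metis image_eqI restr_apply)
  qed
 qed
 ultimately show ?thesis by (simp add: sset_iso_def)
qed

end

lemma join_sub:
 assumes X: "simplicial_set X" and Y: "simplicial_set Y" and A: "sub_sset A X" and B: "sub_sset B Y"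
 shows "sub_sset (A \<star> B) (X \<star> Y)"
 unfolding sub_sset_def
proof (intro conjI allI ballI)
 show act: "act (A \<star> B) = act (X \<star> Y)"
  using join_act_cong[OF sub_act[OF A] sub_act[OF B]] by (intro ext)
 show "cell (A \<star> B) n <= cell (X \<star> Y) n" for n
 proof
  fix z assume "z : cell (A \<star> B) n"
  then show "z : cell (X \<star> Y) n" using sub_cell[OF A] sub_cell[OF B] by (cases z) (auto simp: join_cell)
 qed
 fix m n th z assume "th : mono_maps m n" "z : cell (A \<star> B) n"
 then show "act (X \<star> Y) n th z : cell (A \<star> B) m"
  using join_act_cell[OF sub_sset_simplicial[OF A X] sub_sset_simplicial[OF B Y]] act by metis
qed

lemma join_left_hom:
 assumes K: "simplicial_set K" and q: "q : hom (K \<star> Y) C"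
 shows "restr K (%m y. q m (JL y)) : hom K C"
proof (rule restr_homI)
 have *: "JL y : cell (K \<star> Y) n" if "y : cell K n" for n y using that by (simp add: join_cell)
 show "q n (JL y) : cell C n" if "y : cell K n" for n y using hom_cell[OF q *[OF that]] .
 show "q m (JL (act K n th y)) = act C n th (q n (JL y))" if "th : mono_maps m n" "y : cell K n" for m n th y
  using hom_act[OF q that(1) *[OF that(2)]] by (simp add: join_act_eq)
qed (use sset_cell[OF K] in blast)

section \<open>Colimits over complexes\<close>

text \<open>The tag \<open>0\<close> puts the vertices of the diagram before the cone vertices,
  which \<open>ccode\<close> tags with \<open>1\<close>. The last entry of \<open>ccode\<close> is
  padding: cones and prisms are to have vertices of the same type.\<close>

definition bcode :: "pair => triple" where
 "bcode x = (0, x)"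

definition ccode :: "nat => triple" where
 "ccode i = (1, i, 0)"

abbreviation jcol :: "(pair) set set => nat set set => (triple) set set" where
 "jcol == jc bcode ccode"

abbreviation bd :: "nat => nat set set" where
 "bd n == pw {..n} - {{..n}}"

interpretation col: join_codes bcode ccode
 by unfold_locales (auto simp: strict_mono_def bcode_def ccode_def)

text \<open>Initiality of the cone \<open>f\<close> in the slice under its base, unfolded: a sphere
  with first vertex \<open>f\<close> is a map on the join with \<open>bd n\<close> that restricts to
  \<open>f\<close>, and a filler is an extension to the join with the full simplex.\<close>

definition ccolim :: "'a sset => (pair) set set => (nat => (triple) list => 'a) => bool" where
 "ccolim C T f \<longleftrightarrow> f : hom (cx (jcol T (pw {..0}))) C &
   (ALL n>0. ALL g:hom (cx (jcol T (bd n))) C.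
    (ALL m. ALL l:cell (cx (jcol T (pw {..0}))) m. g m l = f m l) --> extends C (jcol T (bd n)) (jcol T (pw {..n})) g)"

lemma complex_bd: "complex (bd n)"
 unfolding complex_def pw_def by blast

lemma simplex_iso: "sset_iso (\<Delta> n) (cx (pw {..n})) (idm (\<Delta> n))"
 unfolding sset_iso_def simplex_cx[symmetric]
 by (auto intro!: bij_betw_imageI inj_onI simp: image_iff)

lemma join_iso:
 assumes "simplicial_set K" "complex T" "sset_iso K (cx T) c"
 shows "sset_iso (K \<star> \<Delta> n) (cx (jcol T (pw {..n}))) (restr (K \<star> \<Delta> n) (jmap bcode ccode c (idm (\<Delta> n))))"
 by (rule col.jmap_iso[OF assms(1) simplex_simplicial assms(2) complex_pw assms(3) simplex_iso])

lemma pw0_bd: "0 < n ==> pw {..0} <= bd n"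
proof -
 assume "0 < n"
 then have "{..n} ~= {0}" by (metis atMost_iff le_refl singletonD less_irrefl)
 then show ?thesis by (auto simp: pw_def)
qed

text \<open>Spheres in the slice transpose to maps on \<open>K \<star> boundary n\<close> and are
  then carried along \<open>jmap\<close> to the join complex; after this both sides are the same
  extension problem.\<close>

lemma colimit_iff:
 assumes C: "simplicial_set C" and K: "simplicial_set K" and T: "complex T" and c: "sset_iso K (cx T) c"
  and q: "q : hom (K \<star> \<Delta> 0) C" and f: "f : hom (cx (jcol T (pw {..0}))) C"
  and qf: "!!m z. z : cell (K \<star> \<Delta> 0) m ==> f m (jmap bcode ccode c (%_ a. a) m z) = q m z"
 shows "colimit_diagram K C q \<longleftrightarrow> ccolim C T f"
proof -
 let ?j = "jmap bcode ccode c (%_ a. a)"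
 define p where "p = base_of_cocone K q"
 have py: "p m y = q m (JL y)" if "y : cell K m" for m y using that by (simp add: p_def base_of_cocone_def)
 have p: "p : hom K C"
  unfolding p_def base_of_cocone_def
  by (rule join_left_hom[OF K q])
 have ch: "c : hom K (cx T)" using c by (simp add: sset_iso_def)
 have jid: "jmap bcode ccode c (idm (\<Delta> n)) m z = ?j m z" if "z : cell (K \<star> \<Delta> n) m" for m n z
  using that by (cases z) (simp_all add: join_cell)
 define Ph where "Ph n = restr (K \<star> \<Delta> n) (jmap bcode ccode c (idm (\<Delta> n)))" for n
 have Ph: "sset_iso (K \<star> \<Delta> n) (cx (jcol T (pw {..n}))) (Ph n)" for n
  unfolding Ph_def by (rule join_iso[OF K T c])
 have Phz: "Ph n m z = ?j m z" if "z : cell (K \<star> \<Delta> n) m" for n m z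
  using jid[OF that] that by (simp add: Ph_def)
 have A: "sub_sset (K \<star> boundary n) (K \<star> \<Delta> n)" and A1: "sub_sset (K \<star> \<Delta> n) (K \<star> \<Delta> n)" for n
  using join_sub[OF K simplex_simplicial sub_sset_refl[OF K]] boundary_sub by auto
 have B: "sub_sset (cx (jcol T (bd n))) (cx (jcol T (pw {..n})))" for n
  by (intro cx_sub complex_jc T complex_bd jc_mono) auto
 have B1: "sub_sset (cx (jcol T (pw {..n}))) (cx (jcol T (pw {..n})))" for n
  by (intro cx_sub complex_jc T complex_pw) auto
 have AB: "z : cell (K \<star> boundary n) m \<longleftrightarrow> Ph n m z : cell (cx (jcol T (bd n))) m" if z: "z : cell (K \<star> \<Delta> n) m" for n m z
  unfolding Phz[OF z]
 proof (rule col.jmap_cell_iff[OF z, symmetric])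
  show "length (c k x) = Suc k & sorted (c k x) & (x : cell K k \<longleftrightarrow> set (c k x) : T)" if "x : cell K k" for k x
   using hom_cell[OF ch that] that by (simp add: cx_cell)
  show "length y = Suc k & sorted y & (y : cell (boundary n) k \<longleftrightarrow> set y : bd n)" if "y : cell (\<Delta> n) k" for k y
   using that mono_mapsD[of y k n] by (auto simp: boundary_cx cx_cell)
 qed
 have AB1: "Ph n m z : cell (cx (jcol T (pw {..n}))) m" if z: "z : cell (K \<star> \<Delta> n) m" for n m z
  by (rule hom_cell[OF sset_iso_hom[OF Ph] z])
 have AB2: "z : cell (K \<star> \<Delta> n) m \<longleftrightarrow> Ph n m z : cell (cx (jcol T (pw {..n}))) m" if z: "z : cell (K \<star> \<Delta> n) m" for n m z
  using AB1[OF z] z by simp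
 have base: "EX z. z : cell (K \<star> \<Delta> 0) m & ?j m z = l" if "l : cell (cx (jcol T (pw {..0}))) m" for m l
  using sset_iso_surj[OF Ph[of 0] that] Phz by metis
 have zero: "[0] \<cdot> a = a" if "a : mono_maps m 0" for a m
  using id_after[of a m 0] that by (simp add: id_map_def)
 have jz: "join_map (%_ y. y) (%_ b. [0] \<cdot> b) m z = z" if "z : cell (K \<star> \<Delta> 0) m" for z m
  using that zero by (cases z) (auto simp: join_cell)
 \<comment> \<open>\<open>\<Delta> 0\<close> is included as the vertex \<open>0\<close> of
   \<open>\<Delta> n\<close>, so \<open>K \<star> \<Delta> 0\<close> is contained in
   \<open>K \<star> boundary n\<close> as soon as \<open>n\<close> is positive.\<close>
 have zb: "z : cell (K \<star> boundary n) m" "z : cell (K \<star> \<Delta> n) m" if "z : cell (K \<star> \<Delta> 0) m" "0 < n" for z m n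
 proof -
  have "a : cell (boundary n) k" if "a : mono_maps k 0" for a k
   using boundary_closed[OF vertex_in_boundary[OF \<open>0 < n\<close>] that, of 0] zero[OF that] by simp
  then show "z : cell (K \<star> boundary n) m" using that by (cases z) (auto simp: join_cell)
  then show "z : cell (K \<star> \<Delta> n) m" by (rule sub_cell[OF A])
 qed
 have us: "simplicial_set (under K C p)" by (rule under_simplicial[OF K])
 have q0: "q : cell (under K C p) 0" using q py by (simp add: under_cell)
 have "initial (under K C p) q" if cc: "ccolim C T f"
  unfolding initial_iff[OF us]
 proof (intro conjI allI impI ballI q0)
  fix n s assume n: "(0::nat) < n" and s: "s : hom (boundary n) (under K C p)" "s 0 [0] = q"
  obtain g where g1: "g : hom (K \<star> boundary n) C"
   and gJ: "!!m y. y : cell K m ==> g m (JL y) = p m y"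
   and g2: "!!k a m z. a : cell (boundary n) k ==> z : cell (K \<star> \<Delta> k) m ==> g m (join_map (%_ y. y) (%_ b. a \<cdot> b) m z) = s k a m z"
   and g3: "ALL h:hom (K \<star> \<Delta> n) C. (ALL m. ALL z:cell (K \<star> boundary n) m. h m z = g m z) -->
    h : cell (under K C p) n & (ALL k. ALL a:cell (boundary n) k. act (under K C p) n a h = s k a)"
   by (rule under_curry[OF K p boundary_sub s(1)]) (rule that; (assumption | blast))
  obtain g' where g': "g' : hom (cx (jcol T (bd n))) C" "!!m z. z : cell (K \<star> boundary n) m ==> g' m (Ph n m z) = g m z"
   by (rule sset_iso_push[OF Ph A B AB g1], assumption) (rule that; (assumption | blast))
  have "g' m l = f m l" if l: "l : cell (cx (jcol T (pw {..0}))) m" for m l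
  proof -
   obtain z where z: "z : cell (K \<star> \<Delta> 0) m" "?j m z = l" using base[OF l] by blast
   have "g' m l = g m z" using g'(2)[OF zb(1)[OF z(1) n]] Phz[OF zb(2)[OF z(1) n]] z(2) by simp
   also have "... = q m z" using g2[OF vertex_in_boundary[OF n] z(1), of 0] jz[OF z(1)] s(2) by simp
   finally show ?thesis using qf[OF z(1)] z(2) by simp
  qed
  then have "extends C (jcol T (bd n)) (jcol T (pw {..n})) g'"
   using cc g'(1) n unfolding ccolim_def by blast
  then obtain h where h: "h : hom (cx (jcol T (pw {..n}))) C" "!!m l. l : cell (cx (jcol T (bd n))) m ==> h m l = g' m l"
   unfolding extends_def by blast
  let ?h = "restr (K \<star> \<Delta> n) (%m z. h m (Ph n m z))"
  have h': "?h : hom (K \<star> \<Delta> n) C" by (rule sset_iso_pull[OF Ph A1 B1 AB1 h(1)])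
  have hg: "?h m z = g m z" if z: "z : cell (K \<star> boundary n) m" for m z
  proof -
   have "z : cell (K \<star> \<Delta> n) m" by (rule sub_cell[OF A z])
   then show ?thesis using h(2) AB z g'(2)[OF z] by simp
  qed
  show "EX e. sphere_fill (under K C p) n s e"
   unfolding sphere_fill_def using g3[rule_format, OF h'] hg by blast
 qed
 moreover have "ccolim C T f" if ini: "initial (under K C p) q"
  unfolding ccolim_def
 proof (intro conjI f allI impI ballI)
  fix n g assume n: "(0::nat) < n" and g: "g : hom (cx (jcol T (bd n))) C"
   and gf: "ALL m. ALL l:cell (cx (jcol T (pw {..0}))) m. g m l = f m l"
  let ?g = "restr (K \<star> boundary n) (%m z. g m (Ph n m z))"
  have gh: "?g : hom (K \<star> boundary n) C"
   by (rule sset_iso_pull[OF Ph A B _ g]) (use AB sub_cell[OF A] in blast)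
  have gz: "?g m z = q m z" if z: "z : cell (K \<star> \<Delta> 0) m" for m z
  proof -
   have "?j m z : cell (cx (jcol T (pw {..0}))) m" using AB1[OF z] Phz[OF z] by simp
   then show ?thesis using zb[OF z n] Phz[OF zb(2)[OF z n]] gf qf[OF z] by simp
  qed
  have gp: "?g m (JL y) = p m y" if "y : cell K m" for m y
   using gz[of "JL y" m] that py by (simp add: join_cell)
  obtain s where s: "s : hom (boundary n) (under K C p)"
   "!!k a m z. a : cell (boundary n) k ==> z : cell (K \<star> \<Delta> k) m ==> s k a m z = ?g m (join_map (%_ y. y) (%_ b. a \<cdot> b) m z)"
   "ALL h:cell (under K C p) n. (ALL k. ALL a:cell (boundary n) k. act (under K C p) n a h = s k a) -->
    (ALL m. ALL z:cell (K \<star> boundary n) m. h m z = ?g m z)"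
   by (rule under_uncurry[OF K boundary_sub gh gp], assumption) (rule that; (assumption | blast))
  have v: "[0] : cell (boundary n) 0" using vertex_in_boundary[OF n] by simp
  have "s 0 [0] = q"
  proof (rule hom_eqI[OF _ q])
   show "s 0 [0] : hom (K \<star> \<Delta> 0) C" using hom_cell[OF s(1) v] by (simp add: under_cell)
   show "s 0 [0] m z = q m z" if "z : cell (K \<star> \<Delta> 0) m" for m z
    using s(2)[OF v that] jz[OF that] gz[OF that] by simp
  qed
  then obtain e where e: "sphere_fill (under K C p) n s e" using ini s(1) n unfolding initial_iff[OF us] by blast
  have eh: "e : hom (K \<star> \<Delta> n) C" using sphere_fillD(1)[OF e] by (simp add: under_cell)
  obtain h where h: "h : hom (cx (jcol T (pw {..n}))) C" "!!m z. z : cell (K \<star> \<Delta> n) m ==> h m (Ph n m z) = e m z"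
   by (rule sset_iso_push[OF Ph A1 B1 AB2 eh], assumption) (rule that; (assumption | blast))
  have "h m l = g m l" if l: "l : cell (cx (jcol T (bd n))) m" for m l
  proof -
   have "l : cell (cx (jcol T (pw {..n}))) m" by (rule sub_cell[OF B l])
   then obtain z where z: "z : cell (K \<star> \<Delta> n) m" "Ph n m z = l" using sset_iso_surj[OF Ph] by blast
   then have zb: "z : cell (K \<star> boundary n) m" using AB l by blast
   show ?thesis using h(2)[OF z(1)] s(3)[rule_format, OF sphere_fillD(1)[OF e] sphere_fillD(2)[OF e] zb] z zb by simp
  qed
  then show "extends C (jcol T (bd n)) (jcol T (pw {..n})) g" unfolding extends_def using h(1) by blast
 qed
 ultimately show ?thesis unfolding colimit_diagram_def p_def using q by blast
qed

section \<open>The opposite of a join\<close>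

text \<open>Reversal of a join exchanges its factors. As \<open>\<Delta> n\<close> is its own
  opposite through \<open>flip\<close>, the opposite of \<open>\<Delta> n \<star> K\<close> becomes
  \<open>op K \<star> \<Delta> n\<close>.\<close>

definition sw :: "nat => nat => (nat list, 'k) join => ('k, nat list) join" where
 "sw n m z = (case z of JL a => JR (flip n a) | JR y => JL y | JM i j a y => JM j i y (flip n a))"

lemma sw_simps [simp]: "sw n m (JL a) = JR (flip n a)" "sw n m (JR y) = JL y" "sw n m (JM i j a y) = JM j i y (flip n a)"
 by (simp_all add: sw_def)

lemma flip_boundary: "flip n a : cell (boundary n) m" if "a : cell (boundary n) m"
proof -
 have a: "a : mono_maps m n" "set a ~= {..n}" using that by (simp_all add: boundary_cell)
 have "set (flip n a) ~= {..n}"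
 proof
  assume "set (flip n a) = {..n}"
  then have "set (flip n (flip n a)) = (%t. n - t) ` {..n}" by (simp add: set_flip)
  also have "... = {..n}"
  proof (intro equalityI subsetI)
   fix t assume "t : {..n}"
   then have "t = n - (n - t)" "n - t : {..n}" by auto
   then show "t : (%t. n - t) ` {..n}" by blast
  qed auto
  finally show False using a by simp
 qed
 then show ?thesis using a by (simp add: boundary_cell)
qed

text \<open>A value \<open>t\<close> lies in the left block exactly if \<open>i + j + 1 - t\<close>
  exceeds \<open>j\<close>; so reversal interchanges the two blocks and reverses each of
  them.\<close>

lemma flip_filter:
 assumes "th : mono_maps m (i + j + 1)"
 shows "filter (%t. t <= i) (flip (i + j + 1) th) = flip i (map (%t. t - Suc j) (filter (%t. j < t) th))"
  "map (%t. t - Suc i) (filter (%t. i < t) (flip (i + j + 1) th)) = flip j (filter (%t. t <= j) th)"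
proof -
 have th: "ALL t:set th. t <= i + j + 1" using mono_mapsD(5)[OF assms] by auto
 have "filter (%t. t <= i) (map (%t. i + j + 1 - t) th) = map (%t. i - t) (map (%t. t - Suc j) (filter (%t. j < t) th))"
  using th by (induction th) auto
 then show "filter (%t. t <= i) (flip (i + j + 1) th) = flip i (map (%t. t - Suc j) (filter (%t. j < t) th))"
  by (simp add: flip_def rev_filter[symmetric] del: map_map)
 have "map (%t. t - Suc i) (filter (%t. i < t) (map (%t. i + j + 1 - t) th)) = map (%t. j - t) (filter (%t. t <= j) th)"
  using th by (induction th) auto
 moreover have "map f (filter P (rev l)) = rev (map f (filter P l))" for f :: "nat => nat" and P l
  by (simp add: rev_filter[symmetric] rev_map)
 ultimately show "map (%t. t - Suc i) (filter (%t. i < t) (flip (i + j + 1) th)) = flip j (filter (%t. t <= j) th)"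
  unfolding flip_def by simp
qed

lemma sw_iso:
 assumes K: "simplicial_set K"
 shows "sset_iso (op (\<Delta> n \<star> K)) (op K \<star> \<Delta> n) (restr (\<Delta> n \<star> K) (sw n))"
proof -
 have c: "sw n m z : cell (op K \<star> \<Delta> n) m" if "z : cell (\<Delta> n \<star> K) m" for m z
  using that by (cases z) (auto simp: join_cell)
 have ff: "flip n (flip n a) = a" if "a : mono_maps k n" for k a using that by simp
 have "restr (op (\<Delta> n \<star> K)) (sw n) : hom (op (\<Delta> n \<star> K)) (op K \<star> \<Delta> n)"
 proof (rule restr_homI)
  fix m k th z assume th: "th : mono_maps m k" and z': "z : cell (op (\<Delta> n \<star> K)) k"
  then have z: "z : cell (\<Delta> n \<star> K) k" by simp
  show "act (op (\<Delta> n \<star> K)) k th z : cell (op (\<Delta> n \<star> K)) m"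
   using join_act_cell[OF simplex_simplicial K flip_mono[OF th] z] by simp
  show "sw n m (act (op (\<Delta> n \<star> K)) k th z) = act (op K \<star> \<Delta> n) k th (sw n k z)"
  proof (cases z)
   case (JL a)
   then have a: "a : mono_maps k n" using z by (simp add: join_cell)
   show ?thesis using flip_after[OF flip_mono[OF th] mono_mapsD(1)[OF a], of n] th by (simp add: JL join_act_eq)
  next
   case (JR y)
   then show ?thesis by (simp add: join_act_eq)
  next
   case (JM i j a y)
   then have *: "k = i + j + 1" "a : mono_maps i n" "y : cell K j" using z by (simp_all add: join_cell)
   let ?l = "filter (%t. t <= j) th" and ?r = "map (%t. t - Suc j) (filter (%t. j < t) th)"
   have th': "th : mono_maps m (i + j + 1)" "th : mono_maps m (j + i + 1)" using th * by (simp_all add: add.commute)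
   note f = flip_filter[OF th'(1)] and s = split_mono[OF th'(2)]
   have ne: "~ (?l = [] & ?r = [])" using s(3) by auto
   have fl: "flip n (a \<cdot> flip i ?r) = flip n a \<cdot> ?r" if "?r ~= []"
    using flip_after[OF flip_mono[OF s(2)] mono_mapsD(1)[OF *(2)], of n] s(2) that by simp
   have len: "flip j ?l = [] \<longleftrightarrow> ?l = []" "flip i ?r = [] \<longleftrightarrow> ?r = []" by (simp_all add: flip_def)
   show ?thesis
    unfolding JM op_act join_act_eq join_act.simps Let_def *(1) f sw_simps
    using fl ne len by (auto simp del: map_is_Nil_conv)
  qed
 qed (use c in simp)
 moreover have "restr (op (\<Delta> n \<star> K)) (sw n) = restr (\<Delta> n \<star> K) (sw n)" by (simp add: restr_def)
 moreover have "bij_betw (restr (\<Delta> n \<star> K) (sw n) m) (cell (op (\<Delta> n \<star> K)) m) (cell (op K \<star> \<Delta> n) m)" for m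
 proof (rule bij_betw_byWitness[where f' = "%z. case z of JR a => JL (flip n a) | JL y => JR y | JM j i y a => JM i j (flip n a) y"])
  show "ALL a:cell (op (\<Delta> n \<star> K)) m. (case restr (\<Delta> n \<star> K) (sw n) m a of JR a => JL (flip n a) | JL y => JR y | JM j i y a => JM i j (flip n a) y) = a"
  proof
   fix z assume "z : cell (op (\<Delta> n \<star> K)) m"
   then show "(case restr (\<Delta> n \<star> K) (sw n) m z of JR a => JL (flip n a) | JL y => JR y | JM j i y a => JM i j (flip n a) y) = z"
    by (cases z) (auto simp: join_cell ff)
  qed
  show "ALL a:cell (op K \<star> \<Delta> n) m. restr (\<Delta> n \<star> K) (sw n) m (case a of JR a => JL (flip n a) | JL y => JR y | JM j i y a => JM i j (flip n a) y) = a"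
  proof
   fix z assume "z : cell (op K \<star> \<Delta> n) m"
   then show "restr (\<Delta> n \<star> K) (sw n) m (case z of JR a => JL (flip n a) | JL y => JR y | JM j i y a => JM i j (flip n a) y) = z"
    by (cases z) (auto simp: join_cell ff)
  qed
  show "restr (\<Delta> n \<star> K) (sw n) m ` cell (op (\<Delta> n \<star> K)) m <= cell (op K \<star> \<Delta> n) m" using c by auto
  show "(%z. case z of JR a => JL (flip n a) | JL y => JR y | JM j i y a => JM i j (flip n a) y) ` cell (op K \<star> \<Delta> n) m <= cell (op (\<Delta> n \<star> K)) m"
  proof (rule image_subsetI)
   fix z assume "z : cell (op K \<star> \<Delta> n) m"
   then show "(case z of JR a => JL (flip n a) | JL y => JR y | JM j i y a => JM i j (flip n a) y) : cell (op (\<Delta> n \<star> K)) m"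
    by (cases z) (auto simp: join_cell)
  qed
 qed
 ultimately show ?thesis by (simp add: sset_iso_def)
qed

lemma op_sub: "sub_sset A X ==> sub_sset (op A) (op X)"
 unfolding sub_sset_def by (auto simp: op_def)

lemma (in join_codes) jc_iff:
 "ka ` s Un rh ` t : jc ka rh S T \<longleftrightarrow> s : insert {} S & t : insert {} T & ~ (s = {} & t = {})"
proof
 assume "ka ` s Un rh ` t : jc ka rh S T"
 then obtain s' t' where *: "ka ` s Un rh ` t = ka ` s' Un rh ` t'" "s' : insert {} S" "t' : insert {} T" "~ (s' = {} & t' = {})"
  unfolding jc_def by blast
 have "ka ` s = ka ` s'" "rh ` t = rh ` t'" using *(1) neq by blast+
 then have "s = s'" "t = t'" using injs by (simp_all add: inj_image_eq_iff)
 then show "s : insert {} S & t : insert {} T & ~ (s = {} & t = {})" using * by blast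
qed (unfold jc_def, blast)

text \<open>A second pair of codes, for the join of two standard simplices: the first entry tells
  the factor, the second the vertex.\<close>

definition lcode :: "nat => pair" where "lcode i = (0, i)"
definition rcode :: "nat => pair" where "rcode i = (1, i)"

interpretation lr: join_codes lcode rcode
 by unfold_locales (auto simp: strict_mono_def lcode_def rcode_def)

lemma cx_iso: "complex T ==> sset_iso (cx T) (cx T) (idm (cx T))"
 unfolding sset_iso_def by (auto intro!: bij_betw_imageI inj_onI simp: image_iff idm_hom cx_simplicial)

abbreviation lrj :: "nat => (nat list, nat list) join => (pair) list" where
 "lrj == jmap lcode rcode (%_ a. a) (%_ a. a)"

lemma lr_iso:
 assumes "complex T"
 obtains Ph where "sset_iso (\<Delta> m \<star> cx T) (cx (jc lcode rcode (pw {..m}) T)) Ph"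
  "!!n z. z : cell (\<Delta> m \<star> cx T) n ==> Ph n z = lrj n z"
proof -
 have "jmap lcode rcode (idm (\<Delta> m)) (idm (cx T)) n z = lrj n z" if "z : cell (\<Delta> m \<star> cx T) n" for n z
  using that by (cases z) (simp_all add: join_cell)
 then show thesis
  using that[OF lr.jmap_iso[OF simplex_simplicial cx_simplicial[OF assms] complex_pw assms simplex_iso[of m] cx_iso[OF assms]]]
  by simp
qed

section \<open>Special outer horns\<close>

lemma skips: "skip 0 0 = [1]" "skip 0 (Suc 0) = [0]" "skip 0 1 = [0]" "skip 1 0 = [1, 2]" "skip 1 1 = [0, 2]"
 "skip 1 2 = [0, 1]" "skip (Suc 0) 0 = [1, 2]" "skip (Suc 0) (Suc 0) = [0, 2]" "skip (Suc 0) 2 = [0, 1]"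
 "skip 2 0 = [1, 2, 3]" "skip 2 1 = [0, 2, 3]" "skip 2 (Suc 0) = [0, 2, 3]" "skip 2 2 = [0, 1, 3]" "skip 2 3 = [0, 1, 2]"
 by (simp_all add: skip_def upt_rec numeral_2_eq_2 numeral_3_eq_3)

lemma id_maps: "id_map 0 = [0]" "id_map (Suc 0) = [0, 1]" "id_map 2 = [0, 1, 2]" "id_map 3 = [0, 1, 2, 3]"
 by (simp_all add: id_map_def upt_rec numeral_2_eq_2 numeral_3_eq_3)

lemma finite_pw: "finite s ==> finite (pw s)"
 by (rule finite_subset[of _ "Pow s"]) (auto simp: pw_def)

text \<open>One round of horn fillings at the vertex \<open>v\<close>: each \<open>t\<close> in
  \<open>T\<close> contributes a simplex with part \<open>A\<close> and its face with part
  \<open>A - {v}\<close>.\<close>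

definition up :: "('v set => 'v set => bool) => 'v set => 'v => 'v set set => 'v set => 'v set => bool" where
 "up R A v T B t \<longleftrightarrow> R B t | t : T & (B = A | B = A - {v})"

text \<open>Bookkeeping for complexes on a small explicit set \<open>V\<close> followed by a set
  \<open>W\<close> of arbitrary size: \<open>R\<close> has to distinguish only a few kinds of
  subsets of \<open>W\<close>, so membership can be decided by simplification.\<close>

definition cp :: "'v set => 'v set => ('v set => 'v set => bool) => 'v set set" where
 "cp V W R = {s. s ~= {} & s <= V Un W & (s Int W = {} | R (s Int V) (s Int W))}"

text \<open>All new simplices are matched at \<open>v\<close>, which is inner: a smaller vertex lies
  in \<open>A\<close>, and the vertices of \<open>W\<close> come after it. Removing a vertex of
  \<open>t\<close> leads to a smaller pair or to something already present, so cardinality is an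
  acyclic ranking.\<close>

lemma cp_extends:
 fixes V W :: "nat set"
 assumes C: "quasi_category C" and VW: "finite V" "finite W" "ALL x:V. ALL y:W. x < y"
  and G: "complex (cp V W R) & extends C K (cp V W R) h" and K: "K <= cp V W R"
  and A: "A <= V" "v : A" "EX a:A. a < v" and T: "!!t. t : T ==> t <= W & t ~= {}"
  and new: "!!t. t : T ==> ~ R A t & ~ R (A - {v}) t"
  and old: "!!t a. t : T ==> a : A ==> a ~= v ==> R (A - {a}) t"
  and side: "!!t x. t : T ==> x : t ==> t - {x} = {} | t - {x} : T | R A (t - {x})"
 shows "complex (cp V W (up R A v T)) & extends C K (cp V W (up R A v T)) h"
proof -
 let ?K = "cp V W R" and ?U = "(Un) A ` T"
 have dj: "V Int W = {}" using VW(3) by blast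
 have int: "(B Un t) Int W = t" "(B Un t) Int V = B" if "B <= A" "t <= W" for B t using that dj A(1) by blast+
 have cp: "B Un t : cp V W R' \<longleftrightarrow> B Un t ~= {} & (t = {} | R' B t)" if "B <= A" "t <= W" for B t R'
  using that A(1) unfolding cp_def mem_Collect_eq int[OF that] by blast
 have dv: "A Un t - {a} = (A - {a}) Un t" if "t : T" "a : A" for t a using T[OF that(1)] that(2) A(1) dj by blast
 have dx: "A Un t - {x} = A Un (t - {x})" if "t : T" "x : t" for t x using T[OF that(1)] that(2) A(1) dj by blast
 have L: "cp V W (up R A v T) = ?K Un ?U Un (%s. s - {v}) ` ?U" (is "?l = ?r")
 proof
  show "?l <= ?r"
  proof
   fix s assume s: "s : ?l"
   have sp: "s = s Int V Un s Int W" using s by (auto simp: cp_def)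
   consider "s : ?K" | "s Int W : T" "s Int V = A" | "s Int W : T" "s Int V = A - {v}"
    using s by (auto simp: cp_def up_def)
   then show "s : ?r"
   proof cases
    case 2 then have "s = A Un s Int W" using sp by blast
    then show ?thesis using 2(1) by blast
   next
    case 3 then have "s = A Un s Int W - {v}" using sp dv[OF 3(1) A(2)] by blast
    then show ?thesis using 3(1) by blast
   qed blast
  qed
  have "?K <= ?l" by (auto simp: cp_def up_def)
  moreover have "A Un t : ?l" "A Un t - {v} : ?l" if "t : T" for t
   using T[OF that] cp[of A t] cp[of "A - {v}" t] that A(2) unfolding dv[OF that A(2)] by (auto simp: up_def)
  ultimately show "?r <= ?l" by blast
 qed
 have "complex ?l & extends C ?K ?l g" if g: "g : hom (cx ?K) C" for g
  unfolding L
 proof (rule matching_extends[OF C conjunct1[OF G] _ g, where r = card])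
  have "T <= Pow W" using T by blast
  then show "finite ?U" using VW(2) by (meson finite_Pow_iff finite_imageI finite_subset)
  fix s assume "s : ?U"
  then obtain t where t: "t : T" "s = A Un t" by blast
  have fs: "finite s" using t T VW(1,2) A(1) finite_subset by blast
  obtain y where y: "y : t" "v < y" using T[OF t(1)] A VW(3) by blast
  show "finite s & v : s & (EX a:s. a < v) & (EX b:s. v < b)" using fs y A(2,3) t(2) by blast
  show "s ~: ?K & s - {v} ~: ?K"
   using new[OF t(1)] T[OF t(1)] cp[of A t] cp[of "A - {v}" t] unfolding t(2) dv[OF t(1) A(2)] by blast
  show "s ~= s' - {v}" for s' using A(2) t(2) by blast
  show "s = s'" if "s' : ?U" "s - {v} = s' - {v}" for s' using that A(2) t(2) by blast
  fix x assume x: "x : s" "x ~= v"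
  show "s - {x} : ?K | (EX t:?U. card t < card s & (s - {x} = t | s - {x} = t - {v}))"
  proof (cases "x : A")
   case True
   have "s - {x} : ?K" using old[OF t(1) True x(2)] T[OF t(1)] cp[of "A - {x}" t] unfolding t(2) dv[OF t(1) True] by blast
   then show ?thesis by blast
  next
   case False
   then have xt: "x : t" using x(1) t(2) by blast
   have "A ~= {}" "t - {x} <= W" using A(2) T[OF t(1)] by blast+
   then have "s - {x} : ?K | s - {x} : ?U"
    using side[OF t(1) xt] cp[of A "t - {x}"] unfolding t(2) dx[OF t(1) xt] by blast
   then show ?thesis using card_Diff1_less[OF fs x(1)] by blast
  qed
 qed
 moreover obtain g where "g : hom (cx ?K) C" using G by (auto simp: extends_def)
 moreover have "extends C K ?l h" using extends_trans[OF conjunct2[OF G] K] calculation(1) by blast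
 ultimately show ?thesis by blast
qed

text \<open>
 The first edge of the horn is replaced by the edge \<open>0 \<rightarrow> 3\<close> of a degenerate 3-simplex, and the horn is pulled
 back along \<open>0, 2 \<mapsto> 0\<close> and \<open>1, 3 \<mapsto> 1\<close>; then all missing simplices can be filled in by inner horns.
\<close>

lemma special_outer_horn:
 fixes n :: nat
 assumes C: "quasi_category C" and n: "2 <= n" and f: "f : hom (cx (hrn {..n} 0)) C"
  and x: "x : cell C 0" and e: "f 1 [0, 1] = act C 0 [0, 0] x"
 shows "extends C (hrn {..n} 0) (pw {..n}) f"
proof -
 have Cs: "simplicial_set C" using C by (simp add: quasi_category_def)
 \<comment> \<open>\<open>V\<close> holds two copies of each of the vertices \<open>0\<close> and
   \<open>1\<close> of the horn; \<open>W\<close> consists of the other vertices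
   \<open>2, ..., n\<close>, shifted by two.\<close>
 define V W where "V = {..3::nat}" and "W = {4..n + 2}"
 have W: "finite V" "finite W" "W ~= {}" "V Int W = {}" "ALL x:V. ALL y:W. x < y"
  using n by (auto simp: V_def W_def)
 define rh :: "nat => nat" where "rh j = (if j <= 3 then j mod 2 else j - 2)" for j
 \<comment> \<open>Next to all of \<open>W\<close> the image has to miss the vertex \<open>1\<close>
   in order to lie in the horn; next to a proper part, \<open>{0, 2, 3}\<close> and
   \<open>{1, 3}\<close> are two sets on which \<open>rh\<close> is monotone.\<close>
 define R0 where "R0 A w \<longleftrightarrow> (if w = W then A <= {0, 2} else A <= {0, 2, 3} | A <= {1, 3})" for A w :: "nat set"
 define K1 where "K1 = {s. s ~= {} & s <= V Un W & R0 (s Int V) (s Int W)}"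
 have K1: "complex K1"
  unfolding complex_def
 proof (intro ballI allI impI)
  fix s u :: "nat set" assume s: "s : K1" and u: "u <= s" "u ~= {}"
  have "R0 (u Int V) (u Int W)"
  proof (cases "u Int W = W")
   case True
   then have "s Int W = W" using u(1) by blast
   then have "s Int V <= {0, 2}" using s by (simp add: K1_def R0_def)
   then show ?thesis using True u(1) by (auto simp: R0_def)
  next
   case False
   have "s Int V <= {0, 2, 3} | s Int V <= {1, 3}" using s by (auto simp: K1_def R0_def split: if_splits)
   then have "u Int V <= {0, 2, 3} | u Int V <= {1, 3}" using u(1) by blast
   then show ?thesis using False by (simp add: R0_def)
  qed
  then show "u : K1" using s u by (auto simp: K1_def)
 qed
 have rhh: "cx_map K1 (hrn {..n} 0) rh"
  unfolding cx_map_def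
 proof (intro ballI conjI impI)
  fix s assume s: "s : K1"
  have d: "s Int V <= {0, 2, 3} | s Int V <= {1, 3}" using s by (auto simp: K1_def R0_def split: if_splits)
  fix x y assume xy: "x : s" "y : s" "x <= y"
  have "x <= 3 ==> x : s Int V" "y <= 3 ==> y : s Int V" using xy by (simp_all add: V_def)
  then show "rh x <= rh y" using d xy(3) by (fastforce simp: rh_def)
 next
  fix s assume s: "s : K1"
  have s': "s <= V Un W" "s ~= {}" using s by (auto simp: K1_def)
  then have "rh ` s <= {..n}" using n by (force simp: rh_def V_def W_def)
  moreover have "EX i:{..n} - {0}. i ~: rh ` s"
  proof (cases "s Int W = W")
   case True
   then have "s Int V <= {0, 2}" using s by (simp add: K1_def R0_def)
   then have "1 ~: rh ` s" using s' by (force simp: rh_def V_def W_def)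
   then show ?thesis using n by (intro bexI[of _ 1]) auto
  next
   case False
   then obtain j where j: "j : W" "j ~: s" by blast
   have "j - 2 ~= rh x" if "x : s" for x
   proof -
    have "x ~= j" "4 <= j" "x mod 2 < 2" using that j by (auto simp: W_def)
    then show ?thesis by (auto simp: rh_def simp del: mod_less_divisor)
   qed
   then have "j - 2 ~: rh ` s" by blast
   then show ?thesis using j(1) by (intro bexI[of _ "j - 2"]) (auto simp: W_def)
  qed
  ultimately show "rh ` s : hrn {..n} 0" using s'(2) by (auto simp: hrn_def)
 qed
 let ?h = "%k l. f k (map rh l)"
 \<comment> \<open>On \<open>V\<close> the totally degenerate simplex at \<open>x\<close> is used.
   It agrees with the pulled back horn because the first edge of the horn is degenerate at
   \<open>x\<close>.\<close>
 let ?c = "restr (cx (pw V)) (%k l. yo C 0 x k (map (%_. 0) l))"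
 have ag: "?h k l = ?c k l" if l: "l : cell (cx K1) k" "l : cell (cx (pw V)) k" for k l
 proof -
  have r: "map rh l : cell (cx (hrn {..n} 0)) k" by (rule mono_map_cell[OF l(1) rhh])
  have "rh i <= 1" if "i : V" for i using that by (simp add: rh_def V_def)
  then have m: "map rh l : mono_maps k 1" using l(2) r by (auto simp: mono_maps_def cx_cell pw_def subset_iff)
  have "2 : {..n} - {0}" "(2::nat) ~: set [0, 1]" using n by auto
  then have "~ {..n} - {0} <= set [0, 1]" by blast
  then have c: "[0, 1] : cell (cx (hrn {..n} 0)) 1" using n by (simp add: cx_cell hrn_def)
  have "map ((!) [0, 1]) (map rh l) = map rh l" using id_after[OF m] by (simp add: id_maps after_def)
  then have "?h k l = act C 1 (map rh l) (act C 0 [0, 0] x)" using cx_hom_act[OF f m c] e by metis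
  also have "... = act C 0 ([0, 0] \<cdot> map rh l) x" by (rule sset_act[OF Cs _ m x]) (simp add: mono_maps_def)
  also have "[0, 0] \<cdot> map rh l = map (%_. 0) l" using mono_mapsD(5)[OF m] by (auto simp: after_def subset_iff le_Suc_eq)
  finally show ?thesis using l replicate_mono[of 0 0 k] by (simp add: cx_cell map_replicate_const del: replicate_Suc)
 qed
 have K1R: "K1 Un pw V = cp V W R0" using W(4) by (auto simp: K1_def cp_def pw_def)
 have G0: "complex (cp V W R0) & extends C K1 (cp V W R0) ?h"
 proof
  show "complex (cp V W R0)" using K1 complex_pw[of V] unfolding K1R[symmetric] complex_def by blast
  have ch: "?c : hom (cx (pw V)) C"
   by (rule pull_hom[OF complex_pw yo_hom[OF Cs x, unfolded simplex_cx]]) (auto simp: cx_map_def pw_def)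
  obtain g where "g : hom (cx (cp V W R0)) C" "!!k l. l : cell (cx K1) k ==> g k l = restr (cx K1) ?h k l"
   by (rule cx_glue[OF K1 complex_pw pull_hom[OF K1 f rhh] ch, unfolded K1R]) (use ag in auto)
  then show "extends C K1 (cp V W R0) ?h" by (auto simp: extends_def)
 qed
 define P where "P = {w. w <= W & w ~= {} & w ~= W}"
 have P: "!!w. w : P ==> w ~= W" "W ~: P" "!!w. w : P ==> w <= W & w ~= {}"
  "!!w x. w : P ==> w - {x} ~= W" "!!x. x : W ==> W - {x} ~= W"
  "!!w x. w : P ==> w - {x} : P \<longleftrightarrow> ~ w <= {x}" "!!x. x : W ==> W - {x} : P \<longleftrightarrow> ~ W <= {x}"
  by (auto simp: P_def)
 have K1sub: "K1 <= cp V W R" if "!!B w. R0 B w ==> R B w" for R using that by (auto simp: K1_def cp_def)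
 \<comment> \<open>The rounds \<open>R1\<close> to \<open>R3\<close> supply every part of
   \<open>V\<close> next to a proper nonempty part of \<open>W\<close>; \<open>R4\<close> and
   \<open>R5\<close> every part of \<open>{0, 1, 2}\<close> next to \<open>W\<close> itself;
   \<open>R6\<close> the parts of \<open>{1, 3}\<close>. The last horn, at the vertex
   \<open>1\<close>, yields \<open>{0, 3}\<close> next to \<open>W\<close>, which is a copy of the
   missing simplex.\<close>
 define R1 where "R1 = up R0 {1, 2, 3} 3 P"
 define R2 where "R2 = up R1 {0, 1, 2} 2 P"
 define R3 where "R3 = up R2 {0, 1, 2, 3} 2 P"
 define R4 where "R4 = up R3 {1, 2} 2 {W}"
 define R5 where "R5 = up R4 {0, 1, 2} 2 {W}"
 define R6 where "R6 B w \<longleftrightarrow> R5 B w | B <= {1, 3}" for B w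
 define R7 where "R7 = up R6 {0, 1, 3} 1 {W}"
 have ins: "insert x A = B \<longleftrightarrow> x : B & A <= B & B <= insert x A" for x :: nat and A B by blast
 note Rs = R1_def R2_def R3_def R4_def R5_def R6_def R7_def up_def R0_def
 have Rsub: "R0 B w ==> R0 B w" "R0 B w ==> R1 B w" "R0 B w ==> R2 B w" "R0 B w ==> R3 B w" "R0 B w ==> R4 B w"
  "R0 B w ==> R5 B w" "R0 B w ==> R6 B w" for B w
  by (simp_all add: R1_def R2_def R3_def R4_def R5_def R6_def up_def)
 note step = cp_extends[OF C W(1,2,5), where K = K1 and h = ?h]
 have G1: "complex (cp V W R1) & extends C K1 (cp V W R1) ?h" unfolding R1_def
  by (rule step[OF G0 K1sub[OF Rsub(1)]]) (simp_all add: V_def Rs P W(3) ins insert_Diff_if, auto?)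
 have G2: "complex (cp V W R2) & extends C K1 (cp V W R2) ?h" unfolding R2_def
  by (rule step[OF G1 K1sub[OF Rsub(2)]]) (simp_all add: V_def Rs P W(3) ins insert_Diff_if, auto?)
 have G3: "complex (cp V W R3) & extends C K1 (cp V W R3) ?h" unfolding R3_def
  by (rule step[OF G2 K1sub[OF Rsub(3)]]) (simp_all add: V_def Rs P W(3) ins insert_Diff_if, auto?)
 have G4: "complex (cp V W R4) & extends C K1 (cp V W R4) ?h" unfolding R4_def
  by (rule step[OF G3 K1sub[OF Rsub(4)]]) (simp_all add: V_def Rs P W(3) ins insert_Diff_if, auto?)
 have G5: "complex (cp V W R5) & extends C K1 (cp V W R5) ?h" unfolding R5_def
  by (rule step[OF G4 K1sub[OF Rsub(5)]]) (simp_all add: V_def Rs P W(3) ins insert_Diff_if, auto?)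
 \<comment> \<open>No horn is filled here: the vertex \<open>3\<close> is collapsed to
   \<open>1\<close>. Simplices that contained \<open>3\<close> before lie in \<open>K1\<close>,
   where the map factors through \<open>rh\<close>, and \<open>rh\<close> identifies
   \<open>1\<close> with \<open>3\<close>.\<close>
 have G6: "complex (cp V W R6) & extends C K1 (cp V W R6) ?h"
 proof
  let ?L = "pw ({1, 3} Un W)"
  have L: "cp V W R6 = cp V W R5 Un ?L"
   using W(4) by (auto simp: cp_def R6_def pw_def V_def)
  show "complex (cp V W R6)" using G5 complex_pw[of "{1, 3} Un W"] unfolding L complex_def by blast
  define ka :: "nat => nat" where "ka j = (if j = 3 then 1 else j)" for j
  have kas: "ka ` s Int V <= {1}" "ka ` s Int W = s Int W" "ka ` s <= V Un W" if "s <= {1, 3} Un W" for s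
  proof -
   have "ka x = (if x : W then x else 1)" if "x : {1, 3} Un W" for x using that W(4) by (auto simp: ka_def V_def)
   then have e: "ka ` s = (%x. if x : W then x else 1) ` s" using that by (intro image_cong) auto
   have "1 ~: W" by (simp add: W_def)
   then show "ka ` s Int V <= {1}" "ka ` s Int W = s Int W" "ka ` s <= V Un W"
    unfolding e using W(4) \<open>1 ~: W\<close> by (auto simp: V_def image_iff)
  qed
  have kam: "cx_map ?L (cp V W R5) ka"
   unfolding cx_map_def
  proof (intro ballI conjI impI)
   fix s assume s: "s : ?L"
   have "R5 B W" if "B <= {1}" for B using subset_singletonD[OF that] by (auto simp: Rs)
   moreover have "R5 B w" if "B <= {1}" "w ~= W" for B w using subset_singletonD[OF that(1)] that(2) by (auto simp: Rs)
   ultimately have "R5 (ka ` s Int V) (s Int W)" using kas(1)[of s] s by (cases "s Int W = W") (auto simp: pw_def)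
   then show "ka ` s : cp V W R5" using kas[of s] s by (simp add: cp_def pw_def)
  next
   fix s x y assume "s : ?L" "x : s" "y : s" "x <= y"
   then show "ka x <= ka y" by (auto simp: ka_def pw_def W_def dest!: subsetD)
  qed
  have "extends C (cp V W R5) (cp V W R6) g" if g: "g : hom (cx (cp V W R5)) C"
   and gh: "!!k l. l : cell (cx K1) k ==> g k l = ?h k l" for g
   unfolding L
  proof (rule extends_push[OF conjunct1[OF G5] complex_pw g])
   have "restr (cx ?L) (%k l. g k (map ka l)) : hom (cx ?L) C" by (rule pull_hom[OF complex_pw g kam])
   moreover have "g k (map ka l) = g k l" if l: "l : cell (cx (cp V W R5 Int ?L)) k" for k l
   proof (cases "3 : set l")
    case True
    define s where "s = set l"
    have s: "s : cp V W R5" "s <= {1, 3} Un W" "s ~= {}" using l by (auto simp: s_def cx_cell pw_def)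
    have "~ R5 B W" if "3 : B" for B using that P(2) by (auto simp: Rs)
    moreover have "3 : s Int V" using True by (simp add: s_def V_def)
    ultimately have sW: "s Int W ~= W" using s(1) W(3) by (auto simp: cp_def)
    have sV: "s <= V Un W" "s Int V <= {1, 3}" using s W(4) by (auto simp: V_def)
    have "s : K1" using sW sV s(3) by (simp add: K1_def R0_def)
    moreover have "ka ` s : K1" using sW s(3) kas[OF s(2)] by (auto simp: K1_def R0_def)
    moreover have "map ka l : cell (cx (cp V W R5)) k"
     by (rule mono_map_cell[OF _ kam]) (use l in \<open>auto simp: cx_cell\<close>)
    ultimately have "l : cell (cx K1) k" "map ka l : cell (cx K1) k" using l by (simp_all add: cx_cell s_def)
    moreover have "map rh (map ka l) = map rh l" by (simp add: ka_def rh_def)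
    ultimately show ?thesis using gh by metis
   next
    case False
    then have "map ka l = l" by (auto simp: ka_def intro!: map_idI)
    then show ?thesis by simp
   qed
   ultimately show "extends C (cp V W R5 Int ?L) ?L g" unfolding extends_def
    by (intro bexI[of _ "restr (cx ?L) (%k l. g k (map ka l))"]) (auto simp: cx_cell)
  qed
  then show "extends C K1 (cp V W R6) ?h"
   using extends_trans[OF conjunct2[OF G5], of "cp V W R6"] K1sub[of R5] by (auto simp: Rs)
 qed
 have G7: "complex (cp V W R7) & extends C K1 (cp V W R7) ?h" unfolding R7_def
  by (rule step[OF G6 K1sub[OF Rsub(7)]]) (simp_all add: V_def Rs P W(3) ins insert_Diff_if, auto?)

 then obtain G where G: "G : hom (cx (cp V W R7)) C" "!!k l. l : cell (cx K1) k ==> G k l = ?h k l"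
  by (auto simp: extends_def)
 \<comment> \<open>A section of \<open>rh\<close> that avoids the auxiliary copies \<open>1\<close>
   and \<open>2\<close>.\<close>
 define lr :: "nat => nat" where "lr j = (if j = 0 then 0 else if j = 1 then 3 else j + 2)" for j
 have "mono lr" by (auto simp: mono_def lr_def)
 have lrV: "lr ` s Int V <= {0, 3}" "3 : lr ` s ==> 1 : s" for s by (auto simp: lr_def V_def split: if_splits)
 have lrW: "lr ` s <= V Un W" "!!j. j : {2..n} ==> j ~: s ==> j + 2 : W - lr ` s" if "s <= {..n}" for s
  using that n by (auto simp: lr_def V_def W_def split: if_splits)
 have R7: "R7 B w" if "B <= {0, 3}" for B w
 proof -
  have "B = {} | B = {0} | B = {3} | B = {0, 3}" using that by blast
  then show ?thesis by (elim disjE) (simp_all add: Rs insert_Diff_if)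
 qed
 have lrc: "cx_map (pw {..n}) (cp V W R7) lr"
  unfolding cx_map_def using \<open>mono lr\<close> R7[OF lrV(1)] lrW(1) by (auto simp: pw_def cp_def dest: monoD)
 have rhlr: "map rh (map lr l) = l" for l by (auto simp: rh_def lr_def intro!: map_idI)
 define g where "g = restr (cx (pw {..n})) (%k l. G k (map lr l))"
 have g: "g : hom (cx (pw {..n})) C" unfolding g_def by (rule pull_hom[OF complex_pw G(1) lrc])
 have "g k l = f k l" if l: "l : cell (cx (hrn {..n} 0)) k" for k l
 proof -
  have ln: "set l <= {..n}" using l by (simp add: cx_cell hrn_def)
  have ls: "l : cell (cx (pw {..n})) k" using l by (simp add: cx_cell hrn_def pw_def)
  obtain i where i: "i <= n" "i ~= 0" "i ~: set l" using l by (auto simp: cx_cell hrn_def)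
  have "R0 (lr ` set l Int V) (lr ` set l Int W)"
  proof (cases "i = 1")
   case True
   then show ?thesis using lrV[of "set l"] i(3) by (auto simp: R0_def)
  next
   case False
   then show ?thesis using lrV(1)[of "set l"] lrW(2)[OF ln, of i] i by (auto simp: R0_def)
  qed
  then have "map lr l : cell (cx K1) k"
   using lrW(1)[OF ln] mono_map_cell[OF ls lrc] by (auto simp: cx_cell K1_def)
  from G(2)[OF this] show ?thesis unfolding rhlr using ls by (simp add: g_def)
 qed
 then show ?thesis using g unfolding extends_def by blast
qed

section \<open>Initial and final objects under duality and in pointed categories\<close>

lemma initial_op:
 assumes C: "simplicial_set C" shows "initial (op C) x \<longleftrightarrow> final C x"
proof -
 have fl: "restr (boundary n) (%m a. f m (flip n a)) : hom (boundary n) (op C)" if f: "f : hom (boundary n) C" for f n and C :: "'a sset"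
 proof (rule restr_homI)
  fix m k th a assume th: "th : mono_maps m k" and a: "a : cell (boundary n) k"
  show "act (boundary n) k th a : cell (boundary n) m" by (rule sset_cell[OF boundary_simplicial th a])
  have am: "a : mono_maps k n" using a by (simp add: boundary_cell)
  show "f m (flip n (act (boundary n) k th a)) = act (op C) k th (f k (flip n a))"
   using hom_act[OF f flip_mono[OF th] flip_boundary[OF a]] flip_after[OF th mono_mapsD(1)[OF am], of n] by simp
 qed (use hom_cell[OF f flip_boundary] in simp)
 have fill: "EX e. sphere_fill C n f e"
  if "sphere_fill (op C) n (restr (boundary n) (%m a. f m (flip n a))) e" for C :: "'a sset" and n f e
 proof -
  have "sphere_fill C n f e"
   unfolding sphere_fill_def
  proof (intro conjI allI ballI)
   show "e : cell C n" using sphere_fillD(1)[OF that] by simp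
   fix m a assume a: "a : cell (boundary n) m"
   have am: "a : mono_maps m n" using a by (simp add: boundary_cell)
   show "act C n a e = f m a" using sphere_fillD(2)[OF that flip_boundary[OF a]] flip_boundary[OF a] flip_flip[OF am] by simp
  qed
  then show ?thesis by blast
 qed
 have ends: "flip n [n] = [0]" "flip n [0] = [n]" for n by (simp_all add: flip_def)
 have "(ALL n>0. ALL f:hom (boundary n) (op C). f 0 [0] = x --> (EX e. sphere_fill (op C) n f e)) \<longleftrightarrow>
  (ALL n>0. ALL f:hom (boundary n) C. f 0 [n] = x --> (EX e. sphere_fill C n f e))"
 proof (intro iffI allI impI ballI)
  fix n f assume *: "ALL n>0. ALL f:hom (boundary n) (op C). f 0 [0] = x --> (EX e. sphere_fill (op C) n f e)"
   and n: "(0::nat) < n" and f: "f : hom (boundary n) C" "f 0 [n] = x"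
  have "restr (boundary n) (%m a. f m (flip n a)) 0 [0] = x" using vertex_in_boundary[OF n, of 0] f(2) ends by simp
  then show "EX e. sphere_fill C n f e" using * n fl[OF f(1)] fill by blast
 next
  fix n f assume *: "ALL n>0. ALL f:hom (boundary n) C. f 0 [n] = x --> (EX e. sphere_fill C n f e)"
   and n: "(0::nat) < n" and f: "f : hom (boundary n) (op C)" "f 0 [0] = x"
  let ?f = "restr (boundary n) (%m a. f m (flip n a))"
  have "?f 0 [n] = x" using vertex_in_boundary[OF n, of n] f(2) ends by simp
  moreover have "?f : hom (boundary n) C" using fl[OF f(1)] hom_op_op by blast
  ultimately obtain e where e: "sphere_fill C n ?f e" using * n by blast
  have "sphere_fill (op (op C)) n ?f e"
   unfolding sphere_fill_def
  proof (intro conjI allI ballI)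
   fix m a assume a: "a : cell (boundary n) m"
   have am: "a : mono_maps m n" using a by (simp add: boundary_cell)
   show "act (op (op C)) n a e = ?f m a" using sphere_fillD(2)[OF e a] flip_flip[OF am] by simp
  qed (use sphere_fillD(1)[OF e] in simp)
  then show "EX e. sphere_fill (op C) n f e" by (rule fill)
 qed
 then show ?thesis unfolding initial_iff[OF op_simplicial[OF C]] final_iff[OF C] by simp
qed

lemma final_op:
 assumes C: "simplicial_set C" shows "final (op C) x \<longleftrightarrow> initial C x"
proof -
 have 1: "hom (boundary n) (op (op C)) = hom (boundary n) C" for n using hom_op_op by blast
 have 2: "sphere_fill (op (op C)) n f e \<longleftrightarrow> sphere_fill C n f e" for n f e
 proof -
  have "flip n (flip n a) = a" if "a : cell (boundary n) m" for m a
   using that flip_flip[of a m n] by (simp add: boundary_cell)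
  then show ?thesis by (auto simp: sphere_fill_def)
 qed
 have "initial (op (op C)) x \<longleftrightarrow> initial C x"
  unfolding initial_iff[OF C] initial_iff[OF op_simplicial[OF op_simplicial[OF C]]] 1 2 by simp
 then show ?thesis using initial_op[OF op_simplicial[OF C]] by blast
qed

text \<open>
 Vertices \<open>0\<close> and \<open>2\<close> lie over \<open>y\<close> and \<open>1\<close> over the zero object \<open>z\<close>: a sphere with first vertex \<open>2\<close> is moved along
 \<open>y \<rightarrow> z \<rightarrow> y\<close>.
\<close>

lemma final_imp_initial:
 assumes C: "quasi_category C" and z: "initial C z" "final C z" and y: "final C y"
 shows "initial C y"
proof -
 have Cs: "simplicial_set C" using C by (simp add: quasi_category_def)
 show ?thesis
  unfolding initial_iff[OF Cs]
 proof (intro conjI allI impI ballI)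
  show "y : cell C 0" using y by (simp add: final_def)
  fix n s assume n: "(0::nat) < n" and s: "s : hom (boundary n) C" "s 0 [0] = y"
  have sc: "s : hom (cx (bd n)) C" using s(1) by (simp add: boundary_cx)
  define V W where "V = {..2::nat}" and "W = {3..n + 2}"
  have W: "finite V" "finite W" "W ~= {}" "V Int W = {}" "ALL x:V. ALL y:W. x < y"
   using n by (auto simp: V_def W_def)
  \<comment> \<open>Truncated subtraction: \<open>0\<close>, \<open>1\<close> and \<open>2\<close>
    all go to the first vertex of the sphere, and the remaining vertices are shifted.\<close>
  define rh :: "nat => nat" where "rh j = j - 2" for j
  define R0 where "R0 A w \<longleftrightarrow> A = {} | w ~= W & A <= {0, 2}" for A w :: "nat set"
  define K1 where "K1 = {s. s ~= {} & s <= V Un W & R0 (s Int V) (s Int W)}"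
  have K1: "complex K1" unfolding complex_def K1_def R0_def by blast
  have rhh: "cx_map K1 (bd n) rh"
   unfolding cx_map_def
  proof (intro ballI conjI impI)
   fix s assume s: "s : K1"
   have s': "s <= V Un W" "s ~= {}" using s by (auto simp: K1_def)
   then have "rh ` s <= {..n}" by (force simp: rh_def V_def W_def)
   moreover have "rh ` s ~= {..n}"
   proof
    assume e: "rh ` s = {..n}"
    have "j : s" if "j : W" for j
    proof -
     have "j - 2 : rh ` s" unfolding e using that by (auto simp: W_def)
     then obtain x where "x : s" "j - 2 = x - 2" by (auto simp: rh_def)
     moreover from this have "j = x" using that unfolding W_def atLeastAtMost_iff by linarith
     ultimately show ?thesis by simp
    qed
    then have "s Int V = {}" using s by (auto simp: K1_def R0_def)
    moreover have "0 : rh ` s" unfolding e by simp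
    ultimately show False using s' by (auto simp: rh_def V_def W_def subset_iff)
   qed
   ultimately show "rh ` s : bd n" using s'(2) by (auto simp: pw_def)
  qed (simp add: rh_def)
  let ?h = "%k l. s k (map rh l)"
  have hK: "restr (cx K1) ?h : hom (cx K1) C" by (rule pull_hom[OF K1 sc rhh])
  have cR0: "complex (cp V W R0)" unfolding complex_def cp_def R0_def by blast
  have sub0: "K1 <= cp V W R0" by (auto simp: K1_def cp_def)
  \<comment> \<open>The simplices on \<open>V\<close> alone are filled by finality: the last vertex
    of a new one goes to \<open>y\<close> or to \<open>z\<close>, and both are final.\<close>
  obtain f0 where f0: "f0 : hom (cx (cp V W R0)) C" "!!k l. l : cell (cx K1) k ==> f0 k l = restr (cx K1) ?h k l"
   "!!l. l : cell (cx (cp V W R0)) 0 ==> l ~: cell (cx K1) 0 ==> f0 0 l = z"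
  proof (rule final_extension[OF cx_simplicial[OF cR0] Cs cx_sub[OF K1 sub0] hK z(2)])
   fix k l assume l: "l : cell (cx (cp V W R0)) k" "l ~: cell (cx K1) k" "act (cx (cp V W R0)) k [k] l : cell (cx K1) 0"
   have "set l <= V Un W" "~ R0 (set l Int V) (set l Int W)" "set l Int W = {} | R0 (set l Int V) (set l Int W)"
    using l(1,2) by (auto simp: cx_cell cp_def K1_def)
   then have "set l <= V" by blast
   moreover have "l ! k : set l" "{l ! k} : K1" using l by (auto simp: cx_cell)
   ultimately have "l ! k : {0, 2}" using W(4) by (auto simp: K1_def R0_def)
   then have "map rh [l ! k] = [0]" by (auto simp: rh_def)
   then show "final C (restr (cx K1) ?h 0 (act (cx (cp V W R0)) k [k] l))" using l(3) s(2) y by simp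
  qed blast
  define R1 where "R1 A w \<longleftrightarrow> A <= {1} | w ~= W & (A <= {0, 2} | A <= {1, 2})" for A w :: "nat set"
  have cR1: "complex (cp V W R1)" unfolding complex_def cp_def R1_def by blast
  have R01: "R0 A w ==> R1 A w" for A w by (auto simp: R0_def R1_def)
  have sub1: "cp V W R0 <= cp V W R1" using R01 by (auto simp: cp_def)
  \<comment> \<open>All simplices added here start at the vertex \<open>1\<close>, which has been
    sent to the initial object \<open>z\<close>.\<close>
  obtain f1 where f1: "f1 : hom (cx (cp V W R1)) C" "!!k l. l : cell (cx (cp V W R0)) k ==> f1 k l = f0 k l"
  proof (rule initial_extension[OF cx_simplicial[OF cR1] Cs cx_sub[OF cR0 sub1] f0(1) z(1)])
   fix k l assume l: "l : cell (cx (cp V W R1)) k" "l ~: cell (cx (cp V W R0)) k"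
    "act (cx (cp V W R1)) k [0] l : cell (cx (cp V W R0)) 0"
   have "1 : A & 0 ~: A" if "R1 A w" "~ R0 A w" for A w
   proof -
    from that consider "A <= {1}" "A ~= {}" | "A <= {1, 2}" "~ A <= {0, 2}" by (auto simp: R0_def R1_def)
    then show ?thesis by cases auto
   qed
   moreover have "R1 (set l Int V) (set l Int W)" "~ R0 (set l Int V) (set l Int W)" using l(1,2) by (auto simp: cx_cell cp_def)
   ultimately have "1 : set l" "0 ~: set l Int V" by blast+
   then have "1 : set l" "0 ~: set l" by (simp_all add: V_def)
   then obtain j where j: "j < length l" "l ! j = 1" by (auto simp: in_set_conv_nth)
   then have "l ! 0 <= 1" "l ! 0 : set l" using l(1) sorted_nth_mono[of l 0 j] by (auto simp: cx_cell)
   then have "l ! 0 = 1" using \<open>0 ~: set l\<close> by (metis le_eq_less_or_eq less_one)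
   moreover have "[1] ~: cell (cx K1) 0" by (simp add: cx_cell K1_def R0_def V_def)
   ultimately show "initial C (f0 0 (act (cx (cp V W R1)) k [0] l))" using f0(3) l(3) z(1) by simp
  qed blast
  define P where "P = {w. w <= W & w ~= {} & w ~= W}"
  have P: "!!w. w : P ==> w ~= W" "W ~: P" "!!w. w : P ==> w <= W & w ~= {}"
   "!!w x. w : P ==> w - {x} : P \<longleftrightarrow> ~ w <= {x}" "!!x. x : W ==> W - {x} : P \<longleftrightarrow> ~ W <= {x}"
   by (auto simp: P_def)
  have ins: "insert x A = B \<longleftrightarrow> x : B & A <= B & B <= insert x A" for x :: nat and A B by blast
  \<comment> \<open>Two rounds of inner horns now reach \<open>{0}\<close> next to all of
    \<open>W\<close>, a copy of the simplex that is missing from the sphere.\<close>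
  define R2 where "R2 = up R1 {0, 1, 2} 2 P"
  define R3 where "R3 = up R2 {0, 1} 1 {W}"
  note Rs = R0_def R1_def R2_def R3_def up_def
  have sub: "K1 <= cp V W R1" "K1 <= cp V W R2" using R01 by (auto simp: K1_def cp_def R2_def up_def)
  have G1: "complex (cp V W R1) & extends C K1 (cp V W R1) ?h"
   unfolding extends_def using cR1 f1 f0(2) sub0 by (intro conjI bexI[of _ f1]) (auto simp: cx_cell)
  have G2: "complex (cp V W R2) & extends C K1 (cp V W R2) ?h" unfolding R2_def
   by (rule cp_extends[OF C W(1,2,5) G1 sub(1)]) (simp_all add: V_def Rs P W(3) ins insert_Diff_if, auto?)
  have "complex (cp V W R3) & extends C K1 (cp V W R3) ?h" unfolding R3_def
   by (rule cp_extends[OF C W(1,2,5) G2 sub(2)]) (simp_all add: V_def Rs P W(3) ins insert_Diff_if, auto?)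
  then obtain G where G: "G : hom (cx (cp V W R3)) C" "!!k l. l : cell (cx K1) k ==> G k l = ?h k l"
   by (auto simp: extends_def)
  define lr :: "nat => nat" where "lr j = (if j = 0 then 0 else j + 2)" for j
  have rhlr: "map rh (map lr l) = l" for l by (auto simp: rh_def lr_def intro!: map_idI)
  have lrV: "lr ` s Int V = s Int {0}" "s <= {..n} ==> lr ` s <= V Un W" for s
   by (auto simp: lr_def V_def W_def image_iff split: if_splits)
  have R3: "R3 B w" if "B <= {0}" for B w using subset_singletonD[OF that] by (auto simp: Rs insert_Diff_if)
  have lrc: "cx_map (pw {..n}) (cp V W R3) lr"
   unfolding cx_map_def
  proof (intro ballI conjI impI)
   show "lr ` s : cp V W R3" if "s : pw {..n}" for s
    using that R3[of "s Int {0}"] lrV by (simp add: pw_def cp_def)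
  qed (simp add: lr_def)
  let ?g = "restr (cx (pw {..n})) (%k l. G k (map lr l))"
  have g: "?g : hom (\<Delta> n) C" unfolding simplex_cx by (rule pull_hom[OF complex_pw G(1) lrc])
  have gs: "?g k l = s k l" if l: "l : cell (boundary n) k" for k l
  proof -
   have l': "set l <= {..n}" "set l ~= {..n}" "l : cell (cx (pw {..n})) k" using l by (auto simp: boundary_cx cx_cell pw_def)
   have "lr ` set l Int W = W ==> 0 ~: set l"
   proof
    assume W: "lr ` set l Int W = W" and 0: "0 : set l"
    have "j : set l" if "j <= n" for j
    proof (cases j)
     case (Suc i)
     then have "j + 2 : lr ` set l" using W that by (auto simp: W_def)
     then show ?thesis using Suc by (auto simp: lr_def split: if_splits)
    qed (use 0 in simp)
    then show False using l' by auto
   qed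
   then have "R0 (lr ` set l Int V) (lr ` set l Int W)" unfolding lrV R0_def by blast
   then have "map lr l : cell (cx K1) k"
    using lrV(2)[OF l'(1)] mono_map_cell[OF l'(3) lrc] by (auto simp: cx_cell K1_def)
   from G(2)[OF this] show ?thesis unfolding rhlr using l'(3) by simp
  qed
  have "sphere_fill C n s (?g n (id_map n))"
   unfolding sphere_fill_def
  proof (intro conjI allI ballI)
   show "?g n (id_map n) : cell C n" by (rule hom_cell[OF g]) simp
   show "act C n a (?g n (id_map n)) = s m a" if "a : cell (boundary n) m" for m a
    using gs[OF that] hom_yo[OF g, of a m] that by (simp add: boundary_cell)
  qed
  then show "EX e. sphere_fill C n s e" by blast
 qed
qed

lemma initial_imp_final:
 assumes C: "quasi_category C" and z: "initial C z" "final C z" and y: "initial C y"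
 shows "final C y"
proof -
 have Cs: "simplicial_set C" using C by (simp add: quasi_category_def)
 show ?thesis
  using final_imp_initial[OF quasi_category_op[OF C], of z y] z y unfolding initial_op[OF Cs] final_op[OF Cs] by blast
qed

section \<open>Limits as colimits in the opposite\<close>

lemma initial_iso_imp:
 assumes X: "simplicial_set X" and Y: "simplicial_set Y" and Ph: "sset_iso X Y Ph" and x: "x : cell X 0"
  and ini: "initial Y (Ph 0 x)"
 shows "initial X x"
 unfolding initial_iff[OF X]
proof (intro conjI allI impI ballI x)
 note h = sset_iso_hom[OF Ph]
 fix n f assume n: "(0::nat) < n" and f: "f : hom (boundary n) X" "f 0 [0] = x"
 have "cmp (boundary n) Ph f : hom (boundary n) Y" by (rule cmp_hom[OF f(1) h boundary_simplicial])
 moreover have "cmp (boundary n) Ph f 0 [0] = Ph 0 x" using f(2) vertex_in_boundary[OF n, of 0] by simp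
 ultimately obtain e where e: "sphere_fill Y n (cmp (boundary n) Ph f) e" using ini n unfolding initial_iff[OF Y] by blast
 obtain d where d: "d : cell X n" "Ph n d = e" using sset_iso_surj[OF Ph sphere_fillD(1)[OF e]] by blast
 have "act X n a d = f m a" if a: "a : cell (boundary n) m" for m a
 proof -
  have am: "a : mono_maps m n" using a by (simp add: boundary_cell)
  have "Ph m (act X n a d) = Ph m (f m a)" using hom_act[OF h am d(1)] d(2) sphere_fillD(2)[OF e a] a by simp
  then show ?thesis using Ph sset_cell[OF X am d(1)] hom_cell[OF f(1) a] unfolding sset_iso_def bij_betw_def inj_on_def by blast
 qed
 then show "EX e. sphere_fill X n f e" using d(1) unfolding sphere_fill_def by blast
qed

lemma initial_iso_iff:
 assumes X: "simplicial_set X" and Y: "simplicial_set Y" and Ph: "sset_iso X Y Ph" and x: "x : cell X 0"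
 shows "initial Y (Ph 0 x) \<longleftrightarrow> initial X x"
proof
 note h = sset_iso_hom[OF Ph]
 assume ini: "initial X x"
 have bij: "bij_betw (Ph n) (cell X n) (cell Y n)" for n using Ph by (simp add: sset_iso_def)
 \<comment> \<open>The inverse isomorphism is the identity of \<open>X\<close> pushed forward along
   \<open>Ph\<close>.\<close>
 obtain Psi where Psi: "Psi : hom Y X" "!!n z. z : cell X n ==> Psi n (Ph n z) = idm X n z"
  by (rule sset_iso_push[OF Ph sub_sset_refl[OF X] sub_sset_refl[OF Y] _ idm_hom[OF X]])
   (use hom_cell[OF h] in blast)+
 have inv: "Psi n (Ph n z) = z" if "z : cell X n" for n z using Psi(2)[OF that] that by simp
 have "Ph n (Psi n y) = y" if "y : cell Y n" for n y
  using sset_iso_surj[OF Ph that] inv by metis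
 then have "bij_betw (Psi n) (cell Y n) (cell X n)" for n
  using inv hom_cell[OF Psi(1)] hom_cell[OF h] by (intro bij_betw_byWitness[where f' = "Ph n"]) auto
 then have "sset_iso Y X Psi" using Psi(1) by (simp add: sset_iso_def)
 from initial_iso_imp[OF Y X this hom_cell[OF h x]] show "initial Y (Ph 0 x)" using inv[OF x] ini by simp
qed (rule initial_iso_imp[OF assms])

text \<open>Simplices of the two slices are maps on joins that \<open>sw\<close> identifies. The
  reversal built into \<open>sw\<close> is what turns the action of one slice into the opposite
  action of the other.\<close>

lemma op_slice_iso:
 assumes K: "simplicial_set K"
 shows "sset_iso (under (op K) (op C) p) (op (over K C p))
  (restr (under (op K) (op C) p) (%n h. restr (\<Delta> n \<star> K) (%m z. h m (sw n m z))))" (is "sset_iso ?U ?O ?Psi")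
proof -
 have sub: "sub_sset (op (\<Delta> n \<star> K)) (op (\<Delta> n \<star> K))" "sub_sset (op K \<star> \<Delta> n) (op K \<star> \<Delta> n)" for n
  by (intro op_sub join_sub; use K in simp)+
 have swc: "sw n m z : cell (op K \<star> \<Delta> n) m" if "z : cell (\<Delta> n \<star> K) m" for m n z
  using that by (cases z) (auto simp: join_cell)
 have swr: "restr (\<Delta> n \<star> K) (sw n) m z = sw n m z" if "z : cell (\<Delta> n \<star> K) m" for m n z using that by simp
 have hh: "h : hom (op K \<star> \<Delta> n) (op C)" "!!m y. y : cell K m ==> h m (JL y) = p m y" if "h : cell ?U n" for n h
  using that by (auto simp: under_cell)
 have c: "restr (\<Delta> n \<star> K) (%m z. h m (sw n m z)) : cell ?O n" if h: "h : cell ?U n" for n h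
 proof -
  have "restr (op (\<Delta> n \<star> K)) (%m z. h m (restr (\<Delta> n \<star> K) (sw n) m z)) : hom (op (\<Delta> n \<star> K)) (op C)"
   by (rule sset_iso_pull[OF sw_iso[OF K] sub _ hh(1)[OF h]]) (use swc in simp)
  also have "restr (op (\<Delta> n \<star> K)) (%m z. h m (restr (\<Delta> n \<star> K) (sw n) m z)) = restr (\<Delta> n \<star> K) (%m z. h m (sw n m z))"
   by (auto simp: restr_def fun_eq_iff)
  finally show ?thesis using hh(2)[OF h] by (simp add: over_cell op_hom_iff join_cell)
 qed
 have "?Psi : hom ?U ?O"
 proof (rule restr_homI)
  fix m n th h assume th: "th : mono_maps m n" and h: "h : cell ?U n"
  show "act ?U n th h : cell ?U m" by (rule under_act_cell[OF op_simplicial[OF K] th h])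
  show "restr (\<Delta> m \<star> K) (%k z. act ?U n th h k (sw m k z)) = act ?O n th (restr (\<Delta> n \<star> K) (%k z. h k (sw n k z)))"
   unfolding op_act over_act[OF flip_mono[OF th]] under_act[OF th]
  proof (rule restr_cong)
   fix k z assume z: "z : cell (\<Delta> m \<star> K) k"
   have fl: "flip n (flip n th \<cdot> a) = th \<cdot> flip m a" if "a : mono_maps j m" for a j
    using flip_after[OF that mono_mapsD(1)[OF flip_mono[OF th]], of n] th by simp
   have "sw n k (join_map (%_ a. flip n th \<cdot> a) (%_ y. y) k z) = join_map (%_ y. y) (%_ a. th \<cdot> a) k (sw m k z)"
    using z fl by (cases z) (auto simp: join_cell)
   then show "restr (op K \<star> \<Delta> m) (%k z. h k (join_map (%_ y. y) (%_ a. th \<cdot> a) k z)) k (sw m k z) =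
    restr (\<Delta> n \<star> K) (%k z. h k (sw n k z)) k (join_map (%_ a. flip n th \<cdot> a) (%_ y. y) k z)"
    using swc[OF z] join_map_over_cell[OF flip_mono[OF th] z] by simp
  qed
 qed (rule c)
 moreover have "bij_betw (?Psi n) (cell ?U n) (cell ?O n)" for n
 proof (rule bij_betw_imageI)
  show "inj_on (?Psi n) (cell ?U n)"
  proof (rule inj_onI)
   fix g h assume gh: "g : cell ?U n" "h : cell ?U n" "?Psi n g = ?Psi n h"
   show "g = h"
   proof (rule hom_eqI[OF hh(1)[OF gh(1)] hh(1)[OF gh(2)]])
    fix m y assume "y : cell (op K \<star> \<Delta> n) m"
    then obtain z where z: "z : cell (\<Delta> n \<star> K) m" "sw n m z = y" using sset_iso_surj[OF sw_iso[OF K]] by fastforce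
    have "?Psi n g m z = ?Psi n h m z" using gh(3) by simp
    then show "g m y = h m y" using gh(1,2) z by simp
   qed
  qed
  show "?Psi n ` cell ?U n = cell ?O n"
  proof (intro equalityI subsetI)
   fix g assume "g : cell ?O n"
   then have g: "g : hom (\<Delta> n \<star> K) C" "!!m y. y : cell K m ==> g m (JR y) = p m y" by (auto simp: over_cell)
   have g': "g : hom (op (\<Delta> n \<star> K)) (op C)" using g(1) by (simp add: op_hom_iff)
   obtain h where h: "h : hom (op K \<star> \<Delta> n) (op C)" "!!m z. z : cell (op (\<Delta> n \<star> K)) m ==> h m (restr (\<Delta> n \<star> K) (sw n) m z) = g m z"
    by (rule sset_iso_push[OF sw_iso[OF K] sub _ g']) (use swc in simp_all)
   have hz: "h m (sw n m z) = g m z" if "z : cell (\<Delta> n \<star> K) m" for m z using h(2)[of z m] that by simp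
   have hU: "h : cell ?U n" using h(1) hz[of "JR _"] g(2) by (simp add: under_cell join_cell)
   have "restr (\<Delta> n \<star> K) (%m z. h m (sw n m z)) = g" by (rule restr_eqI[OF g(1) hz])
   then show "g : ?Psi n ` cell ?U n" using hU by (intro image_eqI[OF _ hU]) simp
  qed (use c in auto)
 qed
 ultimately show ?thesis by (simp add: sset_iso_def)
qed

text \<open>The simplicial identities are carried over, simplex by simplex, from the slice under the
  opposite diagram.\<close>

lemma over_simplicial:
 assumes K: "simplicial_set K" shows "simplicial_set (over K C p)"
proof -
 let ?U = "under (op K) (op C) p" and ?O = "over K C p"
 note U = under_simplicial[OF op_simplicial[OF K], of "op C" p] and iso = op_slice_iso[OF K, of C p]
 have S: "act ?O n th y : cell ?O m & act ?O n (id_map n) y = y &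
   (ALL k. ALL fi:mono_maps k m. act ?O m fi (act ?O n th y) = act ?O n (th \<cdot> fi) y)"
  if y: "y : cell ?O n" and th: "th : mono_maps m n" for n m y th
 proof -
  obtain f where f: "f : hom ?U (op ?O)" "EX x:cell ?U n. f n x = y"
   using sset_iso_surj[OF iso, of y n] sset_iso_hom[OF iso] y by auto
  then obtain x where x: "x : cell ?U n" "f n x = y" by blast
  have fa: "act ?O k fi (f k z) = f j (act ?U k (flip k fi) z)" if "fi : mono_maps j k" "z : cell ?U k" for fi j k z
   using hom_act[OF f(1) flip_mono[OF that(1)] that(2)] that(1) by simp
  note fl = flip_mono[OF th] and c = sset_cell[OF U flip_mono[OF th] x(1)]
  have "act ?O m fi (act ?O n th y) = act ?O n (th \<cdot> fi) y" if fi: "fi : mono_maps k m" for fi k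
   using fa[OF th x(1)] fa[OF fi c] fa[OF after_mono[OF th fi] x(1)] sset_act[OF U fl flip_mono[OF fi] x(1)] x(2)
    flip_after[OF fi mono_mapsD(1)[OF th], of n] by simp
  moreover have "act ?O n (id_map n) y = y" using fa[OF id_map_mono x(1)] sset_id[OF U x(1)] x(2) by simp
  moreover have "act ?O n th y : cell ?O m" using fa[OF th x(1)] hom_cell[OF f(1) c] x(2) by simp
  ultimately show ?thesis by blast
 qed
 show ?thesis by (rule simplicial_setI) (use S id_map_mono in blast)+
qed

text \<open>A final vertex of an over-slice is an initial vertex of its opposite, and this opposite
  is an under-slice by \<open>op_slice_iso\<close>.\<close>

lemma limit_iff_colimit_op:
 assumes C: "simplicial_set C" and K: "simplicial_set K"
  and q: "q : hom (\<Delta> 0 \<star> K) C" and q': "q' : hom (op K \<star> \<Delta> 0) (op C)"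
  and eq: "!!m z. z : cell (\<Delta> 0 \<star> K) m ==> q' m (sw 0 m z) = q m z"
 shows "limit_diagram K C q \<longleftrightarrow> colimit_diagram (op K) (op C) q'"
proof -
 have p: "base_of_cocone (op K) q' = base_of_cone K q"
  unfolding base_of_cocone_def base_of_cone_def using eq[of "JR _"] by (auto simp: restr_def fun_eq_iff join_cell)
 let ?p = "base_of_cone K q" and ?U = "under (op K) (op C) (base_of_cone K q)"
 have q0: "q' : cell ?U 0" using q' unfolding p[symmetric] by (simp add: under_cell base_of_cocone_def)
 have "restr (\<Delta> 0 \<star> K) (%m z. q' m (sw 0 m z)) = q" by (rule restr_eqI[OF q eq])
 then have "initial (op (over K C ?p)) q \<longleftrightarrow> initial ?U q'"
  using initial_iso_iff[OF under_simplicial[OF op_simplicial[OF K]] op_simplicial[OF over_simplicial[OF K]] op_slice_iso[OF K] q0] q0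
  by simp
 then show ?thesis unfolding limit_diagram_def colimit_diagram_def p using q q' initial_op[OF over_simplicial[OF K]] by blast
qed

text \<open>A cone that is described by a map \<open>f\<close> on the join complex is simplicial
  because it is a pullback of \<open>f\<close>. This spares a direct verification for the
  tautological cones of Kan extensions.\<close>

lemma colimit_cone_hom:
 assumes K: "simplicial_set K" and T: "complex T" and c: "sset_iso K (cx T) c"
  and f: "f : hom (cx (jcol T (pw {..0}))) C"
  and qf: "!!m z. z : cell (K \<star> \<Delta> 0) m ==> f m (jmap bcode ccode c (%_ a. a) m z) = q m z"
 shows "restr (K \<star> \<Delta> 0) q : hom (K \<star> \<Delta> 0) C"
proof -
 let ?Ph = "restr (K \<star> \<Delta> 0) (jmap bcode ccode c (idm (\<Delta> 0)))"
 note Ph = join_iso[OF K T c, of 0]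
 have A: "sub_sset (K \<star> \<Delta> 0) (K \<star> \<Delta> 0)" by (rule join_sub) (use K in simp_all)
 have J: "complex (jcol T (pw {..0}))" by (rule complex_jc[OF T complex_pw])
 have "restr (K \<star> \<Delta> 0) (%m z. f m (?Ph m z)) : hom (K \<star> \<Delta> 0) C"
  by (rule sset_iso_pull[OF Ph A sub_sset_refl[OF cx_simplicial[OF J]] _ f]) (rule hom_cell[OF sset_iso_hom[OF Ph]])
 moreover have "restr (K \<star> \<Delta> 0) (%m z. f m (?Ph m z)) = restr (K \<star> \<Delta> 0) q"
 proof (rule restr_cong)
  fix m z assume z: "z : cell (K \<star> \<Delta> 0) m"
  have "jmap bcode ccode c (idm (\<Delta> 0)) m z = jmap bcode ccode c (%_ a. a) m z"
   using z by (cases z) (simp_all add: join_cell)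
  then show "f m (?Ph m z) = q m z" using z qf[OF z] by simp
 qed
 ultimately show ?thesis by simp
qed

lemma limit_iff:
 assumes C: "simplicial_set C" and K: "simplicial_set K" and T: "complex T" and c: "sset_iso (op K) (cx T) c"
  and q: "q : hom (\<Delta> 0 \<star> K) C" and f: "f : hom (cx (jcol T (pw {..0}))) (op C)"
  and qf: "!!m z. z : cell (\<Delta> 0 \<star> K) m ==> f m (jmap bcode ccode c (%_ a. a) m (sw 0 m z)) = q m z"
 shows "limit_diagram K C q \<longleftrightarrow> ccolim (op C) T f"
proof -
 have swc: "sw 0 m z : cell (op K \<star> \<Delta> 0) m" if "z : cell (\<Delta> 0 \<star> K) m" for m z
  using that by (cases z) (auto simp: join_cell)
 let ?q = "restr (op K \<star> \<Delta> 0) (%m z. f m (jmap bcode ccode c (%_ a. a) m z))"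
 have q': "?q : hom (op K \<star> \<Delta> 0) (op C)" by (rule colimit_cone_hom[OF op_simplicial[OF K] T c f refl])
 show ?thesis
  using limit_iff_colimit_op[OF C K q q'] swc qf colimit_iff[OF op_simplicial[OF C] op_simplicial[OF K] T c q' f] by simp
qed

section \<open>Colimits of diagrams with a greatest vertex\<close>

lemma hrn_image:
 assumes "inj_on rh s" "v : s" "t : hrn s v" shows "rh ` t : hrn (rh ` s) (rh v)"
proof -
 obtain i where i: "i : s" "i ~= v" "i ~: t" and t: "t <= s" "t ~= {}" using assms(3) by (auto simp: hrn_def)
 have "rh i ~: rh ` t" using inj_on_image_mem_iff[OF assms(1) i(1) t(1)] i(3) by simp
 moreover have "rh i ~= rh v" using inj_onD[OF assms(1)] i assms(2) by blast
 ultimately show ?thesis using i(1) t unfolding hrn_def by blast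
qed

text \<open>The missing simplices are matched at the greatest vertex \<open>w\<close> of the
  diagram. If a smaller vertex of the diagram is present, this is an inner horn. The one exception
  is an outer horn, and its first edge, from \<open>w\<close> to the cone point, is degenerate by
  assumption.\<close>

lemma ccolim_top:
 assumes C: "quasi_category C" and W: "finite W" "w : W" "!!x. x : W ==> x <= w"
  and f: "f : hom (cx (jcol (pw W) (pw {..0}))) C" and x: "x : cell C 0" "f 1 [bcode w, ccode 0] = act C 0 [0, 0] x"
 shows "ccolim C (pw W) f"
 unfolding ccolim_def
proof (intro conjI f allI impI ballI)
 fix n g assume n: "(0::nat) < n" and g: "g : hom (cx (jcol (pw W) (bd n))) C"
  and gf: "ALL m. ALL l:cell (cx (jcol (pw W) (pw {..0}))) m. g m l = f m l"
 let ?K = "jcol (pw W) (bd n)"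
 have Kc: "complex ?K" by (rule complex_jc[OF complex_pw complex_bd])
 define s0 where "s0 = bcode ` {w} Un ccode ` {..n}"
 have diffc: "bcode ` a Un ccode ` {..n} - {ccode i} = bcode ` a Un ccode ` ({..n} - {i})" for a i
  unfolding image_set_diff[OF col.injs(2)] using col.neq by blast
 have diffb: "bcode ` a Un ccode ` {..n} - {bcode x} = bcode ` (a - {x}) Un ccode ` {..n}" for a x
  unfolding image_set_diff[OF col.injs(1)] using col.neq by blast
 have bdm: "{..n} - {i} : bd n" if "i <= n" for i
 proof -
  have "(if i = 0 then n else 0) : {..n} - {i}" using n by auto
  then show ?thesis using that unfolding pw_def by blast
 qed
 have Kb: "bcode ` a Un ccode ` ({..n} - {i}) : ?K" if "a <= W" "i <= n" for a i
  unfolding col.jc_iff using bdm[OF that(2)] that(1) by (auto simp: pw_def)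
 have notK: "bcode ` a Un ccode ` {..n} ~: ?K" for a
  unfolding col.jc_iff by auto
 \<comment> \<open>The exceptional pair: \<open>w\<close> is the first vertex of \<open>s0\<close>.
   In the numbering \<open>0\<close> for \<open>w\<close> and \<open>Suc j\<close> for
   \<open>ccode j\<close>, the degenerate edge becomes the edge from \<open>0\<close> to
   \<open>1\<close>.\<close>
 have step1: "complex (?K Un {s0, s0 - {bcode w}}) & extends C ?K (?K Un {s0, s0 - {bcode w}}) g"
 proof (rule horn_push[OF Kc g])
  show "ccode 0 : s0" "ccode 0 ~= bcode w" using col.neq by (auto simp: s0_def)
  show "s0 ~: ?K" "s0 - {bcode w} ~: ?K" unfolding s0_def diffb by (rule notK)+
  show "s0 - {x} : ?K" if x: "x : s0" "x ~= bcode w" for x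
  proof -
   obtain i where i: "i <= n" "x = ccode i" using x by (auto simp: s0_def)
   show ?thesis unfolding s0_def i(2) diffc by (rule Kb) (use W(2) i(1) in auto)
  qed
  let ?g = "restr (cx (hrn s0 (bcode w))) g"
  assume gh: "?g : hom (cx (hrn s0 (bcode w))) C"
  define rh where "rh i = (case i of 0 => bcode w | Suc j => ccode j)" for i
  define sg :: "triple => nat" where "sg x = (if fst x = 0 then 0 else Suc (fst (snd x)))" for x
  have sgrh: "sg (rh i) = i" for i by (simp add: sg_def rh_def bcode_def ccode_def split: nat.split)
  have rhsg: "rh (sg x) = x" if "x : s0" for x using that by (auto simp: s0_def sg_def rh_def bcode_def ccode_def)
  have rhs: "rh ` {..Suc n} = s0"
  proof -
   have "{..Suc n} = insert 0 (Suc ` {..n})" by (rule atMost_Suc_eq_insert_0)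
   then have "rh ` {..Suc n} = insert (rh 0) ((%i. rh (Suc i)) ` {..n})" by (simp add: image_image)
   then show ?thesis by (simp add: rh_def s0_def)
  qed
  have sgs: "sg ` s0 = {..Suc n}" unfolding rhs[symmetric] image_image sgrh by simp
  have irh: "inj_on rh {..Suc n}" by (rule inj_on_inverseI) (rule sgrh)
  have isg: "inj_on sg s0" by (rule inj_on_inverseI) (rule rhsg)
  have ws: "bcode w : s0" "rh 0 = bcode w" "sg (bcode w) = 0" by (auto simp: s0_def rh_def sg_def bcode_def)
  have rhm: "rh i <= rh j" if "i <= j" for i j using that by (auto simp: rh_def bcode_def ccode_def split: nat.split)
  have sgm: "sg x <= sg y" if "x : s0" "y : s0" "x <= y" for x y using that by (auto simp: s0_def sg_def bcode_def ccode_def)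
  have hrns: "t <= s0" if "t : hrn s0 (bcode w)" for t using that unfolding hrn_def by blast
  have c1: "cx_map (hrn {..Suc n} 0) (hrn s0 (bcode w)) rh"
   unfolding cx_map_def using hrn_image[OF irh, of 0] rhs ws rhm by auto
  have c3: "cx_map (hrn s0 (bcode w)) (hrn {..Suc n} 0) sg"
   unfolding cx_map_def
  proof (intro ballI conjI impI)
   show "sg ` t : hrn {..Suc n} 0" if "t : hrn s0 (bcode w)" for t using hrn_image[OF isg ws(1) that] sgs ws by simp
   show "sg x <= sg y" if "t : hrn s0 (bcode w)" "x : t" "y : t" "x <= y" for t x y
    using sgm[OF _ _ that(4)] hrns[OF that(1)] that(2,3) by blast
  qed
  have c2: "cx_map (pw s0) (pw {..Suc n}) sg"
   unfolding cx_map_def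
  proof (intro ballI conjI impI)
   show "sg ` t : pw {..Suc n}" if "t : pw s0" for t using that unfolding sgs[symmetric] pw_def by blast
   show "sg x <= sg y" if "t : pw s0" "x : t" "y : t" "x <= y" for t x y
    using sgm[OF _ _ that(4)] that(1-3) unfolding pw_def by blast
  qed
  show "extends C (hrn s0 (bcode w)) (pw s0) ?g"
  proof (rule extends_relabel[OF complex_hrn complex_pw hrn_pw gh c1 c2 c3])
   show "rh (sg x) = x" if "t : hrn s0 (bcode w)" "x : t" for t x using rhsg hrns[OF that(1)] that(2) by blast
   let ?h = "restr (cx (hrn {..Suc n} 0)) (%k l. ?g k (map rh l))"
   have h: "?h : hom (cx (hrn {..Suc n} 0)) C" by (rule pull_hom[OF complex_hrn gh c1])
   have c: "[0, 1] : cell (cx (hrn {..Suc n} 0)) 1"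
   proof -
    have "2 : {..Suc n} - {0}" "(2::nat) ~: {0, 1}" using n by auto
    then have "~ {..Suc n} - {0} <= {0, 1}" by blast
    then show ?thesis by (simp add: cx_cell hrn_def)
   qed
   have "?h 1 [0, 1] = ?g 1 (map rh [0, 1])" using c by simp
   also have "map rh [0, 1] = [bcode w, ccode 0]" by (simp add: rh_def)
   also have "?g 1 [bcode w, ccode 0] = g 1 [bcode w, ccode 0]"
    using mono_map_cell[OF c c1] by (simp add: rh_def)
   also have "... = f 1 [bcode w, ccode 0]"
   proof -
    have "bcode ` {w} Un ccode ` {0} : jcol (pw W) (pw {..0})" unfolding col.jc_iff using W(2) by (simp add: pw_def)
    then have "[bcode w, ccode 0] : cell (cx (jcol (pw W) (pw {..0}))) 1"
     using col.less[of w 0] by (simp add: cx_cell insert_commute)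
    then show ?thesis using gf by blast
   qed
   finally have "?h 1 [0, 1] = act C 0 [0, 0] x" using x(2) by simp
   then show "extends C (hrn {..Suc n} 0) (pw {..Suc n}) ?h" using special_outer_horn[OF C _ h x(1)] n by simp
  qed
 qed
 let ?K1 = "?K Un {s0, s0 - {bcode w}}"
 \<comment> \<open>The remaining pairs: each contains a nonempty set \<open>a\<close> of vertices
   below \<open>w\<close>, which makes \<open>w\<close> inner.\<close>
 define U where "U = (%a. bcode ` (insert w a) Un ccode ` {..n}) ` pw (W - {w})"
 have Leq: "?K1 Un U Un (%s. s - {bcode w}) ` U = jcol (pw W) (pw {..n})"
 proof (intro equalityI subsetI)
  have full: "bcode ` a Un ccode ` {..n} : jcol (pw W) (pw {..n})" if "a <= W" for a
   unfolding col.jc_iff using that by (auto simp: pw_def)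
  have "?K <= jcol (pw W) (pw {..n})" by (rule jc_mono) auto
  moreover have "U <= jcol (pw W) (pw {..n})"
   unfolding U_def
  proof (rule image_subsetI)
   fix a assume "a : pw (W - {w})"
   then have "insert w a <= W" using W(2) by (auto simp: pw_def)
   then show "bcode ` insert w a Un ccode ` {..n} : jcol (pw W) (pw {..n})" by (rule full)
  qed
  moreover have "(%s. s - {bcode w}) ` U <= jcol (pw W) (pw {..n})"
   unfolding U_def image_image diffb
  proof (rule image_subsetI)
   fix a assume "a : pw (W - {w})"
   then have "insert w a - {w} <= W" by (auto simp: pw_def)
   then show "bcode ` (insert w a - {w}) Un ccode ` {..n} : jcol (pw W) (pw {..n})" by (rule full)
  qed
  moreover have "s0 : jcol (pw W) (pw {..n})" "s0 - {bcode w} : jcol (pw W) (pw {..n})"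
   unfolding s0_def diffb using full[of "{w}"] full[of "{w} - {w}"] W(2) by simp_all
  ultimately show "r : jcol (pw W) (pw {..n})" if "r : ?K1 Un U Un (%s. s - {bcode w}) ` U" for r using that by blast
  fix r assume "r : jcol (pw W) (pw {..n})"
  then obtain a b where r: "r = bcode ` a Un ccode ` b" "a : insert {} (pw W)" "b : insert {} (pw {..n})" "~ (a = {} & b = {})"
   unfolding jc_def by blast
  show "r : ?K1 Un U Un (%s. s - {bcode w}) ` U"
  proof (cases "b = {..n}")
   case False
   then have "r : ?K" unfolding r(1) col.jc_iff using r by blast
   then show ?thesis by blast
  next
   case True
   have aW: "a <= W" using r(2) by (auto simp: pw_def)
   show ?thesis
   proof (cases "a - {w} = {}")
    case True
    then have "a = {w} | a = {w} - {w}" by blast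
    then have "r = s0 | r = s0 - {bcode w}" unfolding s0_def diffb r(1) \<open>b = _\<close> by blast
    then show ?thesis by blast
   next
    case False
    then have "a - {w} : pw (W - {w})" using aW by (auto simp: pw_def)
    then have u: "bcode ` (insert w (a - {w})) Un ccode ` {..n} : U" unfolding U_def by (rule imageI)
    show ?thesis
    proof (cases "w : a")
     case True
     then have "insert w (a - {w}) = a" by blast
     then show ?thesis using u r(1) \<open>b = _\<close> by simp
    next
     case False
     then have "a = insert w (a - {w}) - {w}" by blast
     then have "r = bcode ` (insert w (a - {w})) Un ccode ` {..n} - {bcode w}" unfolding diffb r(1) \<open>b = _\<close> by simp
     then show ?thesis using u by blast
    qed
   qed
  qed
 qed
 have step2: "extends C ?K1 (?K1 Un U Un (%s. s - {bcode w}) ` U) h" if h: "h : hom (cx ?K1) C" for h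
 proof (rule conjunct2[OF matching_extends[OF C _ _ h, where r = card]])
  show "complex ?K1" using step1 by blast
  show "finite U" unfolding U_def using W(1) finite_pw by blast
  fix s assume "s : U"
  then obtain a where a: "a <= W - {w}" "a ~= {}" "s = bcode ` (insert w a) Un ccode ` {..n}" by (auto simp: U_def pw_def)
  have fa: "finite a" using a(1) W(1) finite_subset by blast
  obtain x where x: "x : a" using a(2) by blast
  then have "x < w" using W(3)[of x] a(1) by (auto simp: less_le)
  then have "bcode x < bcode w" "bcode w < ccode 0" using col.less by (simp_all add: bcode_def)
  then show "finite s & bcode w : s & (EX a:s. a < bcode w) & (EX b:s. bcode w < b)"
   using fa x unfolding a(3) by auto
  have wa: "w ~: a" "insert w a - {w} = a" using a(1) by blast+
  have nK: "s ~: ?K" "s - {bcode w} ~: ?K" unfolding a(3) diffb using notK by blast+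
  have ne: "bcode ` b Un ccode ` {..n} = bcode ` b' Un ccode ` {..n} \<longleftrightarrow> b = b'" for b b'
  proof
   assume "bcode ` b Un ccode ` {..n} = bcode ` b' Un ccode ` {..n}"
   then have "bcode ` b = bcode ` b'" using col.neq by blast
   then show "b = b'" using col.injs(1) by (simp add: inj_image_eq_iff)
  qed simp
  show "s ~: ?K1 & s - {bcode w} ~: ?K1"
   using nK wa x unfolding a(3) s0_def diffb Un_iff insert_iff ne by auto
  have ws: "bcode w : s" using a(3) by blast
  fix s' assume "s' : U"
  then have ws': "bcode w : s'" unfolding U_def by blast
  show "s ~= s' - {bcode w}" using ws by blast
  show "s = s'" if "s - {bcode w} = s' - {bcode w}" using that ws ws' by blast
 next
  fix s y assume "s : U" and y: "y : s" "y ~= bcode w"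
  then obtain a where a: "a <= W - {w}" "a ~= {}" "s = bcode ` (insert w a) Un ccode ` {..n}" by (auto simp: U_def pw_def)
  have "finite a" using a(1) W(1) finite_subset by blast
  then have fs: "finite s" unfolding a(3) by simp
  from y(1) y(2) a(3) consider i where "i <= n" "y = ccode i" | x where "x : a" "y = bcode x" by auto
  then show "s - {y} : ?K1 | (EX t:U. card t < card s & (s - {y} = t | s - {y} = t - {bcode w}))"
  proof cases
   case 1
   have "insert w a <= W" using a(1) W(2) by blast
   then have "s - {y} : ?K" unfolding a(3) 1(2) diffc using Kb 1(1) by blast
   then show ?thesis by blast
  next
   case 2
   have eq: "insert w a - {x} = insert w (a - {x})" using 2(1) a(1) by blast
   have sy: "s - {y} = bcode ` (insert w (a - {x})) Un ccode ` {..n}" unfolding a(3) 2(2) diffb eq ..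
   show ?thesis
   proof (cases "a - {x} = {}")
    case True
    show ?thesis unfolding sy True s0_def by blast
   next
    case False
    then have "a - {x} : pw (W - {w})" using a(1) by (auto simp: pw_def)
    then have "s - {y} : U" unfolding sy U_def by blast
    moreover have "card (s - {y}) < card s" using fs y(1) by (rule card_Diff1_less)
    ultimately show ?thesis by blast
   qed
  qed
 qed
 show "extends C ?K (jcol (pw W) (pw {..n})) g"
  by (rule extends_trans[OF conjunct2[OF step1]]) (use step2 Leq in auto)
qed

section \<open>Extension over the prism on a colimit square\<close>

text \<open>Chains in the product order on \<open>[n] \<times> [1] \<times> [1]\<close>, of which the lexicographic order is a linear extension.\<close>

definition ple :: "triple => triple => bool" where
 "ple x y \<longleftrightarrow> fst x <= fst y & fst (snd x) <= fst (snd y) & snd (snd x) <= snd (snd y)"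

lemma ple_le: "ple x y ==> x <= y"
 by (cases x; cases y) (auto simp: ple_def)

definition pchain :: "(triple) set => bool" where
 "pchain s \<longleftrightarrow> (ALL x:s. ALL y:s. ple x y | ple y x)"

definition prism :: "nat => (triple) set set" where
 "prism n = {s. s ~= {} & s <= {..n} \<times> {..1} \<times> {..1} & pchain s}"

text \<open>The part on which a map is given beforehand: everything over the boundary of
  \<open>\<Delta> n\<close>, and over the interior the square without its vertex
  \<open>(1, 1)\<close>.\<close>

definition prism0 :: "nat => (triple) set set" where
 "prism0 n = {s : prism n. fst ` s ~= {..n} | (1, 1) ~: snd ` s}"

definition span_cx :: "(pair) set set" where
 "span_cx = {t. t ~= {} & t <= {(0, 0), (1, 0), (0, 1)} & ~ {(1, 0), (0, 1)} <= t}"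

text \<open>The map from the join of the span with \<open>\<Delta> n\<close> to the prism: the
  diagram is placed at level \<open>0\<close>, and the cone vertices on the line over
  \<open>(1, 1)\<close>.\<close>

definition uncode :: "triple => triple" where
 "uncode x = (if fst x = 0 then x else (fst (snd x), 1, 1))"

lemma complex_prism: "complex (prism n)"
 unfolding complex_def prism_def pchain_def by blast

lemma complex_prism0: "complex (prism0 n)"
 unfolding complex_def
proof (intro ballI allI impI)
 fix s t assume "s : prism0 n" and t: "t <= s" "t ~= {}"
 then have s: "s : prism n" "fst ` s ~= {..n} | (1, 1) ~: snd ` s" by (auto simp: prism0_def)
 have tp: "t : prism n" using complexD[OF complex_prism s(1) t] .
 have "fst ` s <= {..n}" using s(1) by (auto simp: prism_def)
 moreover have "fst ` t <= fst ` s" "snd ` t <= snd ` s" using t by blast+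
 ultimately have "fst ` t ~= {..n} | (1, 1) ~: snd ` t" using s(2) by blast
 then show "t : prism0 n" using tp by (simp add: prism0_def)
qed

lemma finite_prism: "s : prism n ==> finite s" "finite (prism n)"
proof -
 have f: "finite ({..n} \<times> {..1::nat} \<times> {..1::nat})" by simp
 show "finite s" if "s : prism n" using that finite_subset[OF _ f] by (auto simp: prism_def)
 have "prism n <= Pow ({..n} \<times> {..1} \<times> {..1})" by (auto simp: prism_def)
 then show "finite (prism n)" using finite_subset f by blast
qed

lemma complex_span_cx: "complex span_cx"
 unfolding complex_def span_cx_def by blast

section \<open>The pivot of a simplex of the prism\<close>

definition lev :: "(triple) set => nat" where
 "lev s = (LEAST i. (i, 1, 1) : s)"

definition top_at :: "(triple) set => pair" where
 "top_at s = Max {x. (lev s - 1, x) : s}"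

text \<open>The highest vertex on the level before \<open>(1, 1)\<close> is first reached, moved up
  by one level. For \<open>s\<close> in \<open>prism_mid n\<close> it lies strictly between that
  vertex and \<open>(lev s, 1, 1)\<close>, hence is an inner vertex.\<close>

definition pivot :: "(triple) set => triple" where
 "pivot s = (lev s, top_at s)"

text \<open>The missing simplices that reach \<open>(1, 1)\<close> only at a positive level. They
  can be filled in any quasi-category; those that contain \<open>(0, 1, 1)\<close> are left to the
  colimit property.\<close>

definition prism_mid :: "nat => (triple) set set" where
 "prism_mid n = {s : prism n. fst ` s = {..n} & (0, 1, 1) ~: s & (1, 1) : snd ` s}"

context
 fixes n :: nat and s :: "(triple) set"
 assumes s: "s : prism_mid n"
begin

lemma mid_props: "s : prism n" "fst ` s = {..n}" "(0, 1, 1) ~: s" "finite s" "pchain s" "s <= {..n} \<times> {..1} \<times> {..1}"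
 using s finite_prism by (auto simp: prism_mid_def prism_def)

lemma lev_props: "(lev s, 1, 1) : s" "i < lev s ==> (i, 1, 1) ~: s" "0 < lev s" "lev s <= n"
proof -
 obtain i where "(i, 1, 1) : s" using s by (auto simp: prism_mid_def)
 then show 1: "(lev s, 1, 1) : s" unfolding lev_def by (rule LeastI)
 show "i < lev s ==> (i, 1, 1) ~: s" for i unfolding lev_def by (rule not_less_Least)
 show "0 < lev s" using 1 mid_props(3) by (cases "lev s") auto
 show "lev s <= n" using 1 mid_props(6) by auto
qed

lemma top_props: "(lev s - 1, top_at s) : s" "(lev s - 1, x) : s ==> ple (lev s - 1, x) (lev s - 1, top_at s)"
proof -
 have fin: "finite {x. (lev s - 1, x) : s}"
 proof (rule finite_subset)
  show "{x. (lev s - 1, x) : s} <= snd ` s" by force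
  show "finite (snd ` s)" using mid_props(4) by simp
 qed
 have "lev s - 1 : fst ` s" using mid_props(2) lev_props(4) by auto
 then have ne: "{x. (lev s - 1, x) : s} ~= {}" by force
 show 1: "(lev s - 1, top_at s) : s" using Max_in[OF fin ne] unfolding top_at_def by simp
 assume x: "(lev s - 1, x) : s"
 then have "x <= top_at s" using Max_ge[OF fin] unfolding top_at_def by simp
 moreover have "ple (lev s - 1, x) (lev s - 1, top_at s) | ple (lev s - 1, top_at s) (lev s - 1, x)"
  using mid_props(5) 1 x unfolding pchain_def by blast
 ultimately show "ple (lev s - 1, x) (lev s - 1, top_at s)"
  by (cases x; cases "top_at s") (auto simp: ple_def)
qed

lemma top_not_apex: "top_at s ~= (1, 1)"
 using lev_props(2)[of "lev s - 1"] lev_props(3) top_props(1) by auto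

lemma pivot_neq: "pivot s ~= (lev s, 1, 1)"
 using top_not_apex by (auto simp: pivot_def)

text \<open>Above the level of the pivot a vertex must be an apex \<open>(1, 1)\<close>, as it is
  comparable with \<open>(lev s, 1, 1)\<close>. On that level and below, comparability follows from
  that with the vertex beneath the pivot.\<close>

lemma pivot_comparable:
 assumes "z : s" shows "ple z (pivot s) | ple (pivot s) z"
proof -
 obtain i x where z: "z = (i, x)" by (cases z)
 have c: "ple z (lev s - 1, top_at s) | ple (lev s - 1, top_at s) z"
  using mid_props(5) top_props(1) assms unfolding pchain_def by blast
 have c': "ple z (lev s, 1, 1) | ple (lev s, 1, 1) z"
  using mid_props(5) lev_props(1) assms unfolding pchain_def by blast
 consider "i < lev s - 1" | "i = lev s - 1" | "i = lev s" | "lev s < i" by linarith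
 then show ?thesis
 proof cases
  case 1
  then show ?thesis using c by (auto simp: z ple_def pivot_def)
 next
  case 2
  then show ?thesis using top_props(2)[of x] assms by (auto simp: z ple_def pivot_def)
 next
  case 3
  then show ?thesis using c lev_props(3) by (auto simp: z ple_def pivot_def)
 next
  case 4
  then have "x = (1, 1)" using c' mid_props(6) assms by (cases x) (auto simp: z ple_def)
  moreover have "fst (top_at s) <= 1" "snd (top_at s) <= 1" using top_props(1) mid_props(6) by (cases "top_at s", auto)+
  ultimately show ?thesis using 4 by (auto simp: z ple_def pivot_def)
 qed
qed

lemma lev_eqI: "(lev s, 1, 1) : t ==> (!!i. (i, 1, 1) : t ==> (i, 1, 1) : s) ==> lev t = lev s"
 unfolding lev_def[of t] using lev_props(2) by (intro Least_equality) (auto simp: not_less[symmetric])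

text \<open>The pivot depends only on the first apex vertex and on the level before it. Inserting or
  removing the pivot affects neither, so toggling it is an involution.\<close>

lemma pivot_eqI:
 assumes "(lev s, 1, 1) : t" "!!i. (i, 1, 1) : t ==> (i, 1, 1) : s" "!!x. (lev s - 1, x) : t \<longleftrightarrow> (lev s - 1, x) : s"
 shows "pivot t = pivot s"
 using lev_eqI[OF assms(1,2)] assms(3) by (simp add: pivot_def top_at_def)

lemma insert_pivot: "insert (pivot s) s : prism_mid n" "pivot (insert (pivot s) s) = pivot s"
proof -
 have p1: "pivot s : {..n} \<times> {..1} \<times> {..1}"
  using top_props(1) mid_props(6) lev_props(4) by (auto simp: pivot_def)
 have "pchain (insert (pivot s) s)"
  using mid_props(5) pivot_comparable by (auto simp: pchain_def ple_def)
 moreover have "fst ` insert (pivot s) s = {..n}" using mid_props(2) p1 by auto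
 moreover have "(0, 1, 1) ~= pivot s" using lev_props(3) by (auto simp: pivot_def)
 moreover have "(1, 1) : snd ` insert (pivot s) s" using s by (auto simp: prism_mid_def)
 ultimately show "insert (pivot s) s : prism_mid n"
  using p1 mid_props unfolding prism_mid_def prism_def by blast
 show "pivot (insert (pivot s) s) = pivot s"
 proof (rule pivot_eqI)
  show "(i, 1, 1) : s" if "(i, 1, 1) : insert (pivot s) s" for i using that top_not_apex by (auto simp: pivot_def)
  show "(lev s - 1, x) : insert (pivot s) s \<longleftrightarrow> (lev s - 1, x) : s" for x using lev_props(3) by (auto simp: pivot_def)
 qed (use lev_props(1) in simp)
qed

lemma remove_pivot: "s - {pivot s} : prism_mid n" "pivot (s - {pivot s}) = pivot s"
proof -
 have a: "(lev s, 1, 1) : s - {pivot s}" using lev_props(1) pivot_neq by auto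
 have "fst ` (s - {pivot s}) = {..n}"
 proof -
  have "lev s : fst ` (s - {pivot s})" using a by force
  moreover have "fst (pivot s) = lev s" by (simp add: pivot_def)
  ultimately have "fst ` s <= fst ` (s - {pivot s})" by (metis (no_types) DiffI image_eqI image_subsetI singletonD)
  then show ?thesis using mid_props(2) by blast
 qed
 moreover have "s - {pivot s} : prism n" using complexD[OF complex_prism mid_props(1), of "s - {pivot s}"] a by blast
 moreover have "(1, 1) : snd ` (s - {pivot s})" using a by force
 ultimately show "s - {pivot s} : prism_mid n" using mid_props(3) by (simp add: prism_mid_def)
 show "pivot (s - {pivot s}) = pivot s"
  by (rule pivot_eqI) (use a lev_props(3) in \<open>auto simp: pivot_def\<close>)
qed

end

lemma filter_insert_remove: "~ P p ==> {z : insert p (S - {w}). P z} = {z : S. P z} - {w}"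
 by auto

lemma prism_step1:
 assumes C: "quasi_category C" and n: "0 < n" and u: "u : hom (cx (prism0 n)) C"
 shows "extends C (prism0 n) (prism0 n Un prism_mid n) u"
proof -
 define U where "U = {s : prism_mid n. pivot s : s}"
 \<comment> \<open>\<open>B\<close> exceeds every value of \<open>card s + card (low s)\<close>, so
   a rise of \<open>lev\<close> dominates the rank. The summand \<open>card (low s)\<close> serves
   for faces that lose a vertex below the level of the pivot: there the insertion of the new pivot
   may restore the cardinality.\<close>
 define B where "B = Suc (2 * card ({..n} \<times> {..1::nat} \<times> {..1::nat}))"
 define low where "low s = {z : s. fst z < lev s}" for s :: "(triple) set"
 define r where "r s = (n - lev s) * B + card s + card (low s)" for s
 have UM: "s : prism_mid n" "pivot s : s" if "s : U" for s using that by (auto simp: U_def)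
 have eq: "prism0 n Un U Un (%s. s - {pivot s}) ` U = prism0 n Un prism_mid n"
 proof (intro equalityI subsetI)
  fix s assume "s : prism0 n Un prism_mid n"
  then show "s : prism0 n Un U Un (%s. s - {pivot s}) ` U"
  proof
   assume s: "s : prism_mid n"
   show ?thesis
   proof (cases "pivot s : s")
    case False
    let ?t = "insert (pivot s) s"
    have "?t : U" using insert_pivot[OF s] by (simp add: U_def)
    moreover have "s = ?t - {pivot ?t}" using insert_pivot(2)[OF s] False by auto
    ultimately show ?thesis by blast
   qed (use s in \<open>simp add: U_def\<close>)
  qed simp
 qed (use UM remove_pivot in auto)
 have disj: "s ~: prism0 n" if "s : prism_mid n" for s using that by (simp add: prism_mid_def prism0_def)
 have bound: "card s <= card ({..n} \<times> {..1::nat} \<times> {..1::nat})" if "s : prism n" for s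
  using that by (intro card_mono) (auto simp: prism_def)
 have lb: "card (low s) <= card s" if "finite s" for s using that by (intro card_mono) (auto simp: low_def)
 have "extends C (prism0 n) (prism0 n Un U Un (%s. s - {pivot s}) ` U) u"
 proof (rule conjunct2[OF matching_extends[OF C complex_prism0 _ u, where r = r]])
  show "finite U" using finite_prism(2)[of n] by (rule finite_subset[rotated]) (auto simp: U_def prism_mid_def)
  fix s assume "s : U"
  note sM = UM[OF this]
  have "(lev s - 1, top_at s) < pivot s" using lev_props(3)[OF sM(1)] by (simp add: pivot_def)
  moreover have "pivot s < (lev s, 1, 1)"
  proof -
   have "ple (pivot s) (lev s, 1, 1)" using sM(2) mid_props(6)[OF sM(1)] by (auto simp: pivot_def ple_def)
   from ple_le[OF this] show ?thesis using pivot_neq[OF sM(1)] by (simp add: less_le)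
  qed
  ultimately show "finite s & pivot s : s & (EX a:s. a < pivot s) & (EX b:s. pivot s < b)"
   using sM mid_props(4)[OF sM(1)] top_props(1)[OF sM(1)] lev_props(1)[OF sM(1)] by blast
  show "s ~: prism0 n & s - {pivot s} ~: prism0 n" using disj sM(1) remove_pivot(1) by blast
  fix t assume "t : U"
  note tM = UM[OF this]
  show "s ~= t - {pivot t}"
  proof
   assume e: "s = t - {pivot t}"
   then have "pivot s = pivot t" using remove_pivot(2)[OF tM(1)] by simp
   then show False using sM(2) e by blast
  qed
  assume e: "s - {pivot s} = t - {pivot t}"
  then have "pivot s = pivot t" using remove_pivot(2)[OF tM(1)] remove_pivot(2)[OF sM(1)] by metis
  then show "s = t" using e sM(2) tM(2) by (metis insert_Diff)
 next
  fix s w assume "s : U" and w: "w : s" "w ~= pivot s"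
  note sM = UM[OF \<open>s : U\<close>]
  let ?s = "s - {w}"
  have sn: "?s : prism n" using complexD[OF complex_prism mid_props(1)[OF sM(1)], of ?s] sM(2) w(2) by blast
  have fs: "finite s" using mid_props(4)[OF sM(1)] .
  show "?s : prism0 n | (EX t:U. r t < r s & (?s = t | ?s = t - {pivot t}))"
  proof (cases "?s : prism0 n")
   case False
   then have m: "?s : prism_mid n" using sn mid_props(3)[OF sM(1)] by (auto simp: prism_mid_def prism0_def)
   define t where "t = insert (pivot ?s) ?s"
   have tU: "t : U" using insert_pivot[OF m] by (simp add: t_def U_def)
   have tm: "t : prism_mid n" using UM tU by blast
   have pt: "pivot t = pivot ?s" using insert_pivot(2)[OF m] by (simp add: t_def)
   then have lt: "lev t = lev ?s" by (simp add: pivot_def)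
   have st: "?s = t | ?s = t - {pivot t}" unfolding pt unfolding t_def by (cases "pivot ?s : ?s") auto
   have ct: "card t <= card s"
   proof -
    have "card t <= Suc (card ?s)" unfolding t_def by (rule card_insert_le_m1) simp_all
    also have "Suc (card ?s) = card s" by (rule card_Suc_Diff1[OF fs w(1)])
    finally show ?thesis .
   qed
   have "r t < r s"
   proof (cases "w = (lev s, 1, 1)")
    \<comment> \<open>Without its first apex vertex the simplex reaches \<open>(1, 1)\<close> later,
      so the leading term of the rank drops by at least \<open>B\<close>.\<close>
    case True
    have "(lev ?s, 1, 1) : s" using lev_props(1)[OF m] by blast
    then have "lev s <= lev ?s" using lev_props(2)[OF sM(1)] by (metis not_less)
    moreover have "lev s ~= lev ?s" using lev_props(1)[OF m] True by auto
    ultimately have "Suc (n - lev t) <= n - lev s" using lev_props(4)[OF m] lt by linarith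
    then have "Suc (n - lev t) * B <= (n - lev s) * B" by (rule mult_le_mono1)
    moreover have "card t + card (low t) < B"
     using bound[OF mid_props(1)[OF tm]] lb[OF mid_props(4)[OF tm]] unfolding B_def by linarith
    ultimately show ?thesis unfolding r_def by simp
   next
    case False
    have ls: "lev ?s = lev s" using lev_eqI[OF sM(1), of ?s] lev_props(1)[OF sM(1)] False by blast
    have fp: "fst (pivot ?s) = lev s" using ls by (simp add: pivot_def)
    have "~ fst (pivot ?s) < lev s" using fp by simp
    then have lowt: "low t = low s - {w}" unfolding low_def lt ls unfolding t_def by (rule filter_insert_remove)
    show ?thesis
    proof (cases "fst w < lev s")
     case True
     then have "w : low s" using w(1) by (simp add: low_def)
     moreover have "finite (low s)" using fs by (simp add: low_def)
     ultimately have "card (low t) < card (low s)" unfolding lowt by (intro card_Diff1_less)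
     then show ?thesis unfolding r_def lt ls using ct by simp
    next
     \<comment> \<open>The pivot is unchanged and still present, so the face is itself the larger
       member of its pair and has fewer vertices.\<close>
     case wl: False
     have "pivot ?s = pivot s"
     proof (rule pivot_eqI[OF sM(1)])
      show "(lev s, 1, 1) : ?s" using lev_props(1)[OF sM(1)] False by blast
      show "(lev s - 1, x) : ?s \<longleftrightarrow> (lev s - 1, x) : s" for x using wl lev_props(3)[OF sM(1)] by auto
     qed blast
     then have "t = ?s" unfolding t_def using sM(2) w(2) by auto
     then have "card t < card s" using card_Diff1_less[OF fs w(1)] by simp
     moreover have "low t = low s" unfolding lowt using wl by (auto simp: low_def)
     ultimately show ?thesis unfolding r_def lt ls by simp
    qed
   qed
   then show ?thesis using tU st by blast
  qed simp
 qed
 then show ?thesis using eq by simp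
qed

lemma uncode_simps [simp]: "uncode (bcode x) = (0, x)" "uncode (ccode i) = (i, 1, 1)"
 by (simp_all add: uncode_def bcode_def ccode_def)

lemma uncode_img: "uncode ` (bcode ` a Un ccode ` b) = Pair 0 ` a Un (%i. (i, 1, 1)) ` b"
 by (simp add: image_Un image_image)

lemma uncode_prism:
 assumes "a : insert {} span_cx" "b <= {..n}" "~ (a = {} & b = {})"
 shows "Pair 0 ` a Un (%i. (i, 1, 1)) ` b : prism n"
proof -
 have a: "a <= {(0, 0), (1, 0), (0, 1)}" "~ {(1, 0), (0, 1)} <= a" using assms(1) by (auto simp: span_cx_def)
 have "pchain (Pair 0 ` a Un (%i. (i, 1, 1)) ` b)"
  unfolding pchain_def
 proof (intro ballI)
  fix x y assume x: "x : Pair 0 ` a Un (%i. (i, 1, 1)) ` b" and y: "y : Pair 0 ` a Un (%i. (i, 1, 1)) ` b"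
  have A: "ple (0, p) (0, q) | ple (0, q) (0, p)" if "p : a" "q : a" for p q
  proof -
   have "p : {(0, 0), (1, 0), (0, 1)}" "q : {(0, 0), (1, 0), (0, 1)}" "~ (p = (1, 0) & q = (0, 1))" "~ (p = (0, 1) & q = (1, 0))"
    using that a by blast+
   then show ?thesis by (auto simp: ple_def)
  qed
  have B: "ple (0, p) (i, 1, 1)" if "p : a" for p i
  proof -
   have "p : {(0, 0), (1, 0), (0, 1)}" using that a by blast
   then show ?thesis by (auto simp: ple_def)
  qed
  have D: "ple (i, 1, 1) (j, 1, 1) | ple (j, 1, 1) (i, 1, 1)" for i j :: nat by (auto simp: ple_def)
  show "ple x y | ple y x" using x y by (elim UnE imageE) (use A B D in blast)+
 qed
 moreover have "Pair 0 ` a Un (%i. (i, 1, 1)) ` b <= {..n} \<times> {..1} \<times> {..1}" using a(1) assms(2) by auto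
 ultimately show ?thesis using assms(3) by (auto simp: prism_def)
qed

text \<open>After \<open>prism_step1\<close> the missing simplices contain \<open>(0, 1, 1)\<close>
  and meet every level. Being chains, they meet the positive levels in \<open>(1, 1)\<close> only.
  So they belong to the join of the span at level \<open>0\<close> with the line over
  \<open>(1, 1)\<close>, which is attached along the join with \<open>bd n\<close>; there the
  colimit property applies.\<close>

lemma prism_extends:
 assumes C: "quasi_category C" and n: "0 < n" and u: "u : hom (cx (prism0 n)) C"
  and colim: "ccolim C span_cx (restr (cx (jcol span_cx (pw {..0}))) (%m l. u m (map uncode l)))"
 shows "extends C (prism0 n) (prism n) u"
proof (rule extends_trans[OF prism_step1[OF C n u]])
 let ?L = "prism0 n Un prism_mid n"
 let ?T = "span_cx"
 fix h assume h: "h : hom (cx ?L) C" "!!m l. l : cell (cx (prism0 n)) m ==> h m l = u m l"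
 define J where "J = (%r. uncode ` r) ` jcol ?T (pw {..n})"
 have ne: "fst ` s = {..n} ==> s ~= {}" for s :: "(triple) set" by auto
 have Lc: "s : ?L \<longleftrightarrow> s : prism n & (fst ` s ~= {..n} | (0, 1, 1) ~: s)" for s
  by (auto simp: prism0_def prism_mid_def image_iff)
 have Lcx: "complex ?L"
  unfolding complex_def
 proof (intro ballI allI impI)
  fix s t assume s: "s : ?L" and t: "t <= s" "t ~= {}"
  then have sp: "s : prism n" "fst ` s ~= {..n} | (0, 1, 1) ~: s" unfolding Lc by blast+
  have "fst ` s <= {..n}" using sp(1) by (auto simp: prism_def)
  moreover have "fst ` t <= fst ` s" using t by blast
  ultimately show "t : ?L" unfolding Lc using complexD[OF complex_prism sp(1) t] sp(2) t(1) by blast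
 qed
 have Jin: "Pair 0 ` a Un (%i. (i, 1, 1)) ` b : J"
  if "a : insert {} ?T" "b <= {..n}" "~ (a = {} & b = {})" for a b
 proof -
  have "bcode ` a Un ccode ` b : jcol ?T (pw {..n})" unfolding col.jc_iff using that by (auto simp: pw_def)
  then have "uncode ` (bcode ` a Un ccode ` b) : J" unfolding J_def by (rule imageI)
  then show ?thesis unfolding uncode_img .
 qed
 have Jout: "EX a b. s = Pair 0 ` a Un (%i. (i, 1, 1)) ` b & a : insert {} ?T & b <= {..n} & ~ (a = {} & b = {})" if "s : J" for s
 proof -
  obtain r where r: "r : jcol ?T (pw {..n})" "s = uncode ` r" using \<open>s : J\<close> by (auto simp: J_def)
  then obtain a b where ab: "r = bcode ` a Un ccode ` b" "a : insert {} ?T" "b : insert {} (pw {..n})" "~ (a = {} & b = {})"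
   unfolding jc_def by blast
  have "b <= {..n}" using ab(3) by (auto simp: pw_def)
  have "s = Pair 0 ` a Un (%i. (i, 1, 1)) ` b" unfolding r(2) ab(1) uncode_img ..
  then show ?thesis using \<open>b <= {..n}\<close> ab(2,4) by (intro exI conjI)
 qed
 have apex: "(1, 1) ~: a" if "a : insert {} ?T" for a using that by (auto simp: span_cx_def)
 have Jp: "J <= prism n"
 proof
  fix s assume "s : J"
  then obtain a b where ab: "s = Pair 0 ` a Un (%i. (i, 1, 1)) ` b" "a : insert {} ?T" "b <= {..n}" "~ (a = {} & b = {})" using Jout by metis
  then show "s : prism n" using uncode_prism by metis
 qed
 have Jc: "complex J"
  unfolding complex_def
 proof (intro ballI allI impI)
  fix s t assume "s : J" and t: "t <= s" "t ~= {}"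
  then obtain a b where ab: "s = Pair 0 ` a Un (%i. (i, 1, 1)) ` b" "a : insert {} ?T" "b <= {..n}" using Jout by metis
  let ?a = "{x : a. (0, x) : t}" and ?b = "{i : b. (i, 1, 1) : t}"
  have "?a : insert {} ?T" using ab(2) complexD[OF complex_span_cx, of a ?a] by auto
  moreover have "?b <= {..n}" using ab(3) by auto
  moreover have eq: "t = Pair 0 ` ?a Un (%i. (i, 1, 1)) ` ?b" using t(1) ab(1) by auto
  moreover have "~ (?a = {} & ?b = {})" using eq t(2) by blast
  ultimately show "t : J" using Jin[of ?a ?b] by simp
 qed
 have LJ: "?L Un J = prism n"
 proof (intro equalityI subsetI)
  fix s assume sp: "s : prism n"
  show "s : ?L Un J"
  proof (cases "s : ?L")
   case False
   then have s: "fst ` s = {..n}" "(0, 1, 1) : s" using sp unfolding Lc by auto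
   have sub: "s <= {..n} \<times> {..1} \<times> {..1}" "pchain s" using sp by (auto simp: prism_def)
   let ?a = "{x. (0, x) : s & x ~= (1, 1)}"
   have pos: "x = (1, 1)" if "(i, x) : s" "0 < i" for i x
   proof -
    have "ple (i, x) (0, 1, 1) | ple (0, 1, 1) (i, x)" using sub(2) s(2) that unfolding pchain_def by blast
    then show ?thesis using that sub(1) by (cases x) (auto simp: ple_def)
   qed
   have all: "(i, 1, 1) : s" if "i <= n" for i
   proof -
    have "i : fst ` s" using s(1) that by simp
    then obtain x where "(i, x) : s" by force
    then show ?thesis using pos s(2) by (cases "i = 0") auto
   qed
   have "s = Pair 0 ` ?a Un (%i. (i, 1, 1)) ` {..n}"
   proof (intro equalityI subsetI)
    fix z assume z: "z : s"
    obtain i x where ix: "z = (i, x)" by (cases z)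
    have "i <= n" using z sub(1) ix by auto
    show "z : Pair 0 ` ?a Un (%i. (i, 1, 1)) ` {..n}"
    proof (cases "x = (1, 1)")
     case True
     then show ?thesis using ix \<open>i <= n\<close> by auto
    next
     case False
     then have "i = 0" using pos z ix by blast
     then show ?thesis using z ix False by auto
    qed
   qed (use all in auto)
   moreover have "?a : insert {} ?T"
   proof -
    have "?a <= {(0, 0), (1, 0), (0, 1)}" using sub(1) by (auto simp: le_Suc_eq)
    moreover have "~ {(1, 0), (0, 1)} <= ?a"
    proof
     assume "{(1, 0), (0, 1)} <= ?a"
     then have "(0, 1, 0) : s" "(0, 0, 1) : s" by auto
     then have "ple (0, 1, 0) (0, 0, 1) | ple (0, 0, 1) (0, 1, 0)" using sub(2) unfolding pchain_def by blast
     then show False by (simp add: ple_def)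
    qed
    ultimately show ?thesis by (auto simp: span_cx_def)
   qed
   ultimately have "s : J" using Jin[of ?a "{..n}"] by simp
   then show ?thesis by blast
  qed simp
 qed (use Jp Lc in auto)
 \<comment> \<open>The inverse of \<open>uncode\<close> on \<open>J\<close>. The vertex
   \<open>(0, 1, 1)\<close> lies at level \<open>0\<close> but has to count as the first cone
   vertex.\<close>
 define co :: "triple => triple" where
  "co z = (if snd z = (1, 1) then ccode (fst z) else bcode (snd z))" for z
 have co: "co (i, 1, 1) = ccode i" "x ~= (1, 1) ==> co (0, x) = bcode x" for i x by (simp_all add: co_def)
 have coimg: "co ` (Pair 0 ` a Un (%i. (i, 1, 1)) ` b) = bcode ` a Un ccode ` b" if "a : insert {} ?T" for a b
 proof -
  have "co (0, x) = bcode x" if "x : a" for x using apex[OF \<open>a : _\<close>] that co(2) by metis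
  then have "(%x. co (0, x)) ` a = bcode ` a" by (intro image_cong) auto
  then show ?thesis by (simp only: image_Un image_image co(1))
 qed
 have unco: "uncode (co z) = z" if "s : J" "z : s" for s z
 proof -
  obtain a b where ab: "s = Pair 0 ` a Un (%i. (i, 1, 1)) ` b" "a : insert {} ?T" using Jout[OF \<open>s : J\<close>] by metis
  have "z = (0, x) ==> x : a ==> uncode (co z) = z" for x using apex[OF ab(2)] co(2)[of x] by (metis uncode_simps(1))
  moreover have "uncode (co (i, 1, 1)) = (i, 1, 1)" for i unfolding co(1) by simp
  ultimately show ?thesis using that(2) unfolding ab(1) by (elim UnE imageE) metis+
 qed
 have comono: "co y <= co z" if "s : J" "y : s" "z : s" "y <= z" for s y z
 proof -
  obtain a b where ab: "s = Pair 0 ` a Un (%i. (i, 1, 1)) ` b" "a : insert {} ?T" using Jout[OF \<open>s : J\<close>] by metis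
  have ax: "x ~= (1, 1)" "x <= (1, 1)" if "x : a" for x using that ab(2) by (auto simp: span_cx_def)
  from that(2,3) show ?thesis unfolding ab(1)
  proof (elim UnE imageE)
   fix x x' assume "y = (0, x)" "x : a" "z = (0, x')" "x' : a"
   then show ?thesis using that(4) ax(1) co(2)[of x] co(2)[of x'] by (simp add: bcode_def)
  next
   fix x i assume "y = (0, x)" "x : a" "z = (i, 1, 1)"
   then show ?thesis using ax(1)[of x] co(1)[of i] co(2)[of x] by (simp add: bcode_def ccode_def)
  next
   fix x i assume *: "y = (i, 1, 1)" "z = (0, x)" "x : a"
   then have "(1, 1) <= x" using that(4) by auto
   then show ?thesis using ax[OF *(3)] by simp
  next
   fix i i' assume "y = (i, 1, 1)" "z = (i', 1, 1)"
   then show ?thesis using that(4) co(1)[of i] co(1)[of i'] by (auto simp: ccode_def)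
  qed
 qed
 have uncmono: "uncode y <= uncode z" if "r : jcol ?T (pw {..n})" "y : r" "z : r" "y <= z" for r y z
 proof -
  obtain a b where ab: "r = bcode ` a Un ccode ` b" "a : insert {} ?T" using \<open>r : _\<close> unfolding jc_def by blast
  have ax: "x <= (1, 1)" if "x : a" for x using that ab(2) by (auto simp: span_cx_def)
  from that(2,3) show ?thesis unfolding ab(1)
  proof (elim UnE imageE)
   fix x i assume "y = bcode x" "x : a" "z = ccode i"
   then show ?thesis using ax by simp
  next
   fix x i assume "y = ccode i" "z = bcode x"
   then show ?thesis using that(4) by (simp add: bcode_def ccode_def)
  qed (use that(4) in \<open>auto simp: bcode_def ccode_def uncode_def\<close>)
 qed
 \<comment> \<open>A simplex of \<open>J\<close> fails to be in \<open>?L\<close> exactly if its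
   vertical part is the whole line, so the intersection is the join with the boundary.\<close>
 have LJK: "?L Int J = (%r. uncode ` r) ` jcol ?T (bd n)"
 proof (intro equalityI subsetI)
  fix s assume "s : ?L Int J"
  then obtain a b where ab: "s = Pair 0 ` a Un (%i. (i, 1, 1)) ` b" "a : insert {} ?T" "b <= {..n}" "~ (a = {} & b = {})" and sL: "s : ?L"
   using Jout by (metis IntE)
  have "b ~= {..n}"
  proof
   assume b: "b = {..n}"
   have "fst ` s = {..n}" unfolding ab(1) b by (auto simp: image_Un image_image)
   moreover have "(0, 1, 1) : s" unfolding ab(1) b by auto
   ultimately show False using sL unfolding Lc by blast
  qed
  then have "bcode ` a Un ccode ` b : jcol ?T (bd n)" unfolding col.jc_iff using ab by (auto simp: pw_def)
  then show "s : (%r. uncode ` r) ` jcol ?T (bd n)" unfolding ab(1) uncode_img[symmetric] by (rule imageI)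
 next
  fix s assume "s : (%r. uncode ` r) ` jcol ?T (bd n)"
  then obtain r where r: "r : jcol ?T (bd n)" "s = uncode ` r" by blast
  then obtain a b where ab: "r = bcode ` a Un ccode ` b" "a : insert {} ?T" "b : insert {} (bd n)" "~ (a = {} & b = {})"
   unfolding jc_def by blast
  have b: "b <= {..n}" "b ~= {..n}" using ab(3) by (auto simp: pw_def)
  have s: "s = Pair 0 ` a Un (%i. (i, 1, 1)) ` b" using r(2) ab(1) uncode_img by simp
  have sJ: "s : J" unfolding s using Jin[OF ab(2) b(1) ab(4)] by simp
  have "fst ` s ~= {..n} | (0, 1, 1) ~: s"
  proof (cases "0 : b")
   case True
   then have "fst ` s = b" unfolding s by (force simp: image_Un image_image)
   then show ?thesis using b(2) by simp
  next
   case False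
   then show ?thesis unfolding s using apex[OF ab(2)] by auto
  qed
  then show "s : ?L Int J" unfolding Int_iff Lc using sJ Jp by blast
 qed
 have JJ: "cx_map (jcol ?T (bd n)) (?L Int J) uncode"
  unfolding cx_map_def
 proof (intro ballI conjI impI)
  show "uncode ` r : ?L Int J" if "r : jcol ?T (bd n)" for r unfolding LJK using that by blast
  have sub: "jcol ?T (bd n) <= jcol ?T (pw {..n})" by (rule jc_mono) auto
  show "uncode y <= uncode z" if "r : jcol ?T (bd n)" "y : r" "z : r" "y <= z" for r y z
   using uncmono subsetD[OF sub that(1)] that(2-4) by blast
 qed
 have coJ: "co ` s : jcol ?T (pw {..n})" if "s : J" for s
 proof -
  obtain a b where ab: "s = Pair 0 ` a Un (%i. (i, 1, 1)) ` b" "a : insert {} ?T" "b <= {..n}" "~ (a = {} & b = {})" using Jout[OF \<open>s : J\<close>] by metis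
  show ?thesis unfolding ab(1) coimg[OF ab(2)] col.jc_iff using ab by (auto simp: pw_def)
 qed
 have coLJ: "co ` s : jcol ?T (bd n)" if "s : ?L Int J" for s
 proof -
  obtain r where r: "r : jcol ?T (bd n)" "s = uncode ` r" using \<open>s : ?L Int J\<close> unfolding LJK by blast
  obtain a b where ab: "r = bcode ` a Un ccode ` b" "a : insert {} ?T" using r(1) unfolding jc_def by blast
  have "co ` s = r" unfolding r(2) ab(1) uncode_img using coimg[OF ab(2)] by simp
  then show ?thesis using r(1) by simp
 qed
 have ext: "extends C (?L Int J) J (restr (cx (?L Int J)) h)"
 proof (rule extends_relabel[where rh = uncode and sg = co, OF _ Jc _ _ JJ])
  show "complex (jcol ?T (bd n))" by (rule complex_jc[OF complex_span_cx complex_bd])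
  have LJc: "complex (?L Int J)" using Lcx Jc unfolding complex_def by blast
  have LJs: "sub_sset (cx (?L Int J)) (cx ?L)" by (rule cx_sub[OF LJc]) blast
  show hL: "restr (cx (?L Int J)) h : hom (cx (?L Int J)) C" by (rule sub_restr_hom[OF LJs h(1)])
  show "cx_map J (jcol ?T (pw {..n})) co" unfolding cx_map_def using coJ comono by blast
  show "cx_map (?L Int J) (jcol ?T (bd n)) co" unfolding cx_map_def using coLJ comono by blast
  show "uncode (co x) = x" if "s : ?L Int J" "x : s" for s x using unco that by blast
  let ?g = "restr (cx (jcol ?T (bd n))) (%k l. restr (cx (?L Int J)) h k (map uncode l))"
  have g: "?g : hom (cx (jcol ?T (bd n))) C"
   by (rule pull_hom[OF complex_jc[OF complex_span_cx complex_bd] hL JJ])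
  have "?g m l = restr (cx (jcol ?T (pw {..0}))) (%m l. u m (map uncode l)) m l" if l: "l : cell (cx (jcol ?T (pw {..0}))) m" for m l
  proof -
   have sub: "jcol ?T (pw {..0}) <= jcol ?T (bd n)" by (rule jc_mono[OF order_refl pw0_bd[OF n]])
   have l': "l : cell (cx (jcol ?T (bd n))) m" using l sub by (auto simp: cx_cell)
   have c: "map uncode l : cell (cx (?L Int J)) m" by (rule mono_map_cell[OF l' JJ])
   \<comment> \<open>The cone with point \<open>0\<close> lies at level \<open>0\<close>, which is
     not all of \<open>{..n}\<close> since \<open>n\<close> is positive; hence it belongs to
     \<open>prism0 n\<close>, where \<open>h\<close> agrees with \<open>u\<close>.\<close>
   have sl: "set l : jcol ?T (pw {..0})" using l by (simp add: cx_cell)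
   then obtain a b where ab: "set l = bcode ` a Un ccode ` b" "a : insert {} ?T" "b : insert {} (pw {..0})" "~ (a = {} & b = {})"
    unfolding jc_def by blast
   have "fst ` uncode ` set l <= {0}" unfolding ab(1) uncode_img using ab(3) by (auto simp: pw_def)
   then have "fst ` set (map uncode l) ~= {..n}" using n by auto
   then have "map uncode l : cell (cx (prism0 n)) m" using c Jp by (auto simp: cx_cell prism0_def)
   then show ?thesis using h(2) l l' c by simp
  qed
  then show "extends C (jcol ?T (bd n)) (jcol ?T (pw {..n})) ?g"
   using colim g n unfolding ccolim_def by blast
 qed blast
 have "extends C ?L (?L Un J) h"
  by (rule extends_push[OF Lcx Jc h(1)]) (use ext in \<open>unfold extends_def, metis restr_apply\<close>)
 then show "extends C ?L (prism n) h" unfolding LJ .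
qed blast

section \<open>Full subcategories of the square\<close>

definition le2 :: "pair => pair => bool" where
 "le2 x y \<longleftrightarrow> fst x <= fst y & snd x <= snd y"

text \<open>The nerve of the subposet \<open>W\<close>, presented as a complex with respect to the
  lexicographic order.\<close>

definition chn :: "(pair) set => (pair) set set" where
 "chn W = {t. t ~= {} & t <= W & (ALL x:t. ALL y:t. le2 x y | le2 y x)}"

abbreviation vx :: "(pair) set => sq set" where
 "vx W == (%x. ([fst x], [snd x])) ` W"

abbreviation sqs :: "(pair) set => sq sset" where
 "sqs W == full_sub Sq (vx W)"

abbreviation usq :: "(pair) set" where
 "usq == {..1} \<times> {..1}"

text \<open>A simplex of the square is a pair of lists; its transpose is the chain of its
  vertices.\<close>

definition zp :: "sq => (pair) list" where
 "zp s = zip (fst s) (snd s)"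

definition unz :: "(pair) list => sq" where
 "unz l = (map fst l, map snd l)"

lemma le2_refl [simp]: "le2 x x" and le2_trans: "le2 x y ==> le2 y z ==> le2 x z"
 by (auto simp: le2_def)

lemma le2_le: "le2 x y ==> x <= y"
 by (cases x; cases y) (auto simp: le2_def)

lemma complex_chn: "complex (chn W)"
 unfolding complex_def chn_def by blast

lemma chn_le: "t : chn W ==> x : t ==> y : t ==> x <= y ==> le2 x y"
 unfolding chn_def by (metis (mono_tags, lifting) antisym le2_le le2_refl mem_Collect_eq)

lemma zp_unz [simp]: "zp (unz l) = l"
 by (simp add: zp_def unz_def zip_map_fst_snd)

lemma Sq_simplicial [simp, intro]: "simplicial_set Sq"
 by (auto simp: Sq_def)

lemma sqs_simplicial [simp, intro]: "simplicial_set (sqs W)"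
 by (rule full_sub_simplicial) simp

lemma Sq_cell: "s : cell Sq n \<longleftrightarrow> fst s : mono_maps n 1 & snd s : mono_maps n 1"
 by (cases s) (simp add: Sq_def)

lemma Sq_act: "act Sq n th s = (fst s \<cdot> th, snd s \<cdot> th)"
 by (cases s) (simp add: Sq_def)

lemma sqs_cell: "s : cell (sqs W) n \<longleftrightarrow> s : cell Sq n & set (zp s) <= W"
proof -
 have "(ALL i<=n. act Sq n [i] s : vx W) \<longleftrightarrow> set (zp s) <= W" if s: "s : cell Sq n"
 proof -
  have l: "length (fst s) = Suc n" "length (snd s) = Suc n" using s mono_mapsD(1) by (auto simp: Sq_cell)
  have "act Sq n [i] s : vx W \<longleftrightarrow> (fst s ! i, snd s ! i) : W" for i
   by (force simp: Sq_act)
  then show ?thesis using l by (auto simp: zp_def set_zip less_Suc_eq_le)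
 qed
 then show ?thesis by (auto simp: full_sub_cell)
qed

lemma zp_length: "s : cell Sq n ==> length (zp s) = Suc n" "s : cell Sq n ==> unz (zp s) = s"
 using mono_mapsD(1) by (auto simp: Sq_cell zp_def unz_def)

lemma zp_nth: "s : cell Sq n ==> i <= n ==> zp s ! i = (fst s ! i, snd s ! i)"
 using mono_mapsD(1) by (auto simp: Sq_cell zp_def)

lemma zp_act:
 assumes "s : cell Sq n" "th : mono_maps m n" shows "zp (act Sq n th s) = map ((!) (zp s)) th"
proof (rule nth_equalityI)
 have "act Sq n th s : cell Sq m" using assms sset_cell[OF Sq_simplicial] by blast
 then show l: "length (zp (act Sq n th s)) = length (map ((!) (zp s)) th)"
  using zp_length mono_mapsD(1)[OF assms(2)] by simp
 fix i assume "i < length (zp (act Sq n th s))"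
 then have i: "i <= m" "i < length th" using l mono_mapsD(1)[OF assms(2)] by auto
 then show "zp (act Sq n th s) ! i = map ((!) (zp s)) th ! i"
  using zp_nth[OF \<open>act Sq n th s : _\<close> i(1)] zp_nth[OF assms(1) mono_mapsD(3)[OF assms(2) i(1)]] by (simp add: Sq_act)
qed

lemma unz_act: "th : mono_maps m n ==> length l = Suc n ==> unz (map ((!) l) th) = act Sq n th (unz l)"
 using mono_mapsD(1,3)[of th m n] by (auto simp: unz_def Sq_act after_def less_Suc_eq_le in_set_conv_nth)

lemma zp_cell:
 assumes "s : cell (sqs W) n" shows "zp s : cell (cx (chn W)) n"
proof -
 have s: "s : cell Sq n" "set (zp s) <= W" using assms by (simp_all add: sqs_cell)
 have m: "fst s : mono_maps n 1" "snd s : mono_maps n 1" using s(1) by (simp_all add: Sq_cell)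
 have le: "le2 (zp s ! i) (zp s ! j)" if "i <= j" "j <= n" for i j
  using that zp_nth[OF s(1)] mono_mapsD(1,2)[OF m(1)] mono_mapsD(1,2)[OF m(2)] by (simp add: le2_def sorted_nth_mono)
 have "sorted (zp s)" unfolding sorted_iff_nth_mono using le le2_le zp_length(1)[OF s(1)] by (simp add: less_Suc_eq_le)
 moreover have "le2 x y | le2 y x" if "x : set (zp s)" "y : set (zp s)" for x y
  using that le zp_length(1)[OF s(1)] by (metis in_set_conv_nth less_Suc_eq_le nat_le_linear)
 moreover have "set (zp s) ~= {}" using zp_length(1)[OF s(1)] by (metis Suc_neq_Zero list.set_sel(1) length_0_conv empty_iff)
 ultimately show ?thesis using zp_length(1)[OF s(1)] s(2) by (simp add: cx_cell chn_def)
qed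

lemma unz_cell:
 assumes W: "W <= usq" and l: "l : cell (cx (chn W)) n" shows "unz l : cell (sqs W) n"
proof -
 have l': "length l = Suc n" "sorted l" "set l : chn W" using l by (simp_all add: cx_cell)
 have le: "le2 (l ! i) (l ! j)" if "i <= j" "j <= n" for i j
  using chn_le[OF l'(3)] that l'(1,2) by (simp add: sorted_nth_mono)
 have s: "set l <= W" using l'(3) by (simp add: chn_def)
 then have "set (map fst l) <= {..1}" "set (map snd l) <= {..1}" using W by auto
 moreover have "sorted (map fst l)" "sorted (map snd l)"
  unfolding sorted_iff_nth_mono using le l'(1) by (auto simp: le2_def)
 ultimately show ?thesis using l'(1) s by (simp add: sqs_cell Sq_cell mono_maps_def unz_def[of l]) (metis unz_def zp_unz)
qed

lemma unz_hom:
 assumes "W <= usq" shows "restr (cx (chn W)) (%_. unz) : hom (cx (chn W)) (sqs W)"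
 by (rule cx_homI[OF complex_chn unz_cell[OF assms]]) (auto simp: cx_cell intro: unz_act)

lemma zp_hom: "restr (sqs W) (%_. zp) : hom (sqs W) (cx (chn W))"
 by (rule restr_homI[OF zp_cell]) (use sset_cell[OF sqs_simplicial, of _ _ _ _ W] zp_act in \<open>auto simp: sqs_cell\<close>)

lemma Sq_vertex: "s : cell Sq 0 ==> s = ([fst (zp s ! 0)], [snd (zp s ! 0)])"
 by (cases s) (auto simp: Sq_cell mono_maps_0 zp_def)

lemma sqs_usq: "sqs usq = Sq"
proof -
 have "cell (sqs usq) n = cell Sq n" for n
 proof (intro set_eqI iffI)
  fix s assume s: "s : cell Sq n"
  have "set (zp s) <= set (fst s) \<times> set (snd s)" unfolding zp_def by (auto dest: set_zip_leftD set_zip_rightD)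
  then show "s : cell (sqs usq) n" using s by (auto simp: sqs_cell Sq_cell mono_maps_def)
 qed (simp add: sqs_cell)
 then have "cell (sqs usq) = cell Sq" by (rule ext)
 then show ?thesis by (simp add: full_sub_def)
qed

lemma sqs_sqs: "V <= W ==> full_sub (sqs W) (vx V) = sqs V"
 by (simp add: full_sub_full_sub Int_absorb1 image_mono)

lemma sqs_sub: "V <= W ==> sub_sset (sqs V) (sqs W)"
 using full_sub_sub[OF sqs_simplicial, of W "vx V"] sqs_sqs by simp

section \<open>Maps from a join of two simplices to the square\<close>

lemma join_act_vertex:
 assumes "z : cell (\<Delta> m \<star> \<Delta> n) k" "t <= k"
 shows "act (\<Delta> m \<star> \<Delta> n) k [t] z = (if fst (lrj k z ! t) = 0 then JL [snd (lrj k z ! t)] else JR [snd (lrj k z ! t)])"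
proof (cases z)
 case (JL a)
 then have "a : mono_maps k m" using assms(1) by (simp add: join_cell)
 then show ?thesis using mono_mapsD(1)[of a k m] assms(2) by (simp add: JL join_act_eq lcode_def)
next
 case (JR a)
 then have "a : mono_maps k n" using assms(1) by (simp add: join_cell)
 then show ?thesis using mono_mapsD(1)[of a k n] assms(2) by (simp add: JR join_act_eq rcode_def)
next
 case (JM i j a b)
 then have k: "k = i + j + 1" "a : mono_maps i m" "b : mono_maps j n" using assms(1) by (simp_all add: join_cell)
 then show ?thesis using mono_mapsD(1)[OF k(2)] mono_mapsD(1)[OF k(3)] assms(2)
  by (auto simp: JM join_act_eq lcode_def rcode_def nth_append Let_def)
qed

text \<open>The square is the nerve of a poset, so each simplex in the image is determined by its
  vertices, and these are images of vertices of the join.\<close>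

lemma join_chain:
 assumes h: "h : hom (\<Delta> m \<star> \<Delta> n) (sqs W)" and z: "z : cell (\<Delta> m \<star> \<Delta> n) k"
 shows "zp (h k z) = map (%x. zp (h 0 (if fst x = 0 then JL [snd x] else JR [snd x])) ! 0) (lrj k z)"
proof -
 have len: "length (lrj k z) = Suc k"
  using z mono_mapsD(1) by (cases z) (auto simp: join_cell)
 have c: "h k z : cell Sq k" using hom_cell[OF h z] by (simp add: sqs_cell)
 show ?thesis
 proof (rule nth_equalityI)
  show "length (zp (h k z)) = length (map (%x. zp (h 0 (if fst x = 0 then JL [snd x] else JR [snd x])) ! 0) (lrj k z))"
   using len zp_length(1)[OF c] by simp
  fix t assume "t < length (zp (h k z))"
  then have t: "t <= k" using zp_length(1)[OF c] by simp
  then have tm: "[t] : mono_maps 0 k" by simp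
  have "zp (h k z) ! t = zp (act Sq k [t] (h k z)) ! 0" using zp_act[OF c tm] by simp
  also have "act Sq k [t] (h k z) = h 0 (act (\<Delta> m \<star> \<Delta> n) k [t] z)" using hom_act[OF h tm z] by simp
  finally show "zp (h k z) ! t = map (%x. zp (h 0 (if fst x = 0 then JL [snd x] else JR [snd x])) ! 0) (lrj k z) ! t"
   using join_act_vertex[OF z t] t len by simp
 qed
qed

text \<open>Conversely, a vertex map that is monotone on the simplices of the join complex already
  gives a simplicial map, since the join is isomorphic to this complex.\<close>

lemma chain_join:
 assumes W: "W <= usq" and rh: "cx_map (jc lcode rcode (pw {..m}) (pw {..n})) (chn W) rh"
 shows "restr (\<Delta> m \<star> \<Delta> n) (%k z. unz (map rh (lrj k z))) : hom (\<Delta> m \<star> \<Delta> n) (sqs W)"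
proof -
 let ?J = "jc lcode rcode (pw {..m}) (pw {..n})"
 obtain Ph where Ph: "sset_iso (\<Delta> m \<star> \<Delta> n) (cx ?J) Ph" "!!k z. z : cell (\<Delta> m \<star> \<Delta> n) k ==> Ph k z = lrj k z"
  using lr_iso[OF complex_pw, of m "{..n}"] unfolding simplex_cx[symmetric] by metis
 have J: "complex ?J" by (rule complex_jc[OF complex_pw complex_pw])
 have D: "sub_sset (\<Delta> m \<star> \<Delta> n) (\<Delta> m \<star> \<Delta> n)" by (rule join_sub) simp_all
 have g: "restr (cx ?J) (%k l. restr (cx (chn W)) (%_. unz) k (map rh l)) : hom (cx ?J) (sqs W)"
  by (rule pull_hom[OF J unz_hom[OF W] rh])
 have "restr (\<Delta> m \<star> \<Delta> n) (%k z. restr (cx ?J) (%k l. restr (cx (chn W)) (%_. unz) k (map rh l)) k (Ph k z)) : hom (\<Delta> m \<star> \<Delta> n) (sqs W)"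
  by (rule sset_iso_pull[OF Ph(1) D sub_sset_refl[OF cx_simplicial[OF J]] _ g])
   (rule hom_cell[OF sset_iso_hom[OF Ph(1)]])
 moreover have "restr (\<Delta> m \<star> \<Delta> n) (%k z. unz (map rh (lrj k z))) =
   restr (\<Delta> m \<star> \<Delta> n) (%k z. restr (cx ?J) (%k l. restr (cx (chn W)) (%_. unz) k (map rh l)) k (Ph k z))"
 proof (rule restr_cong)
  fix k z assume z: "z : cell (\<Delta> m \<star> \<Delta> n) k"
  then have l: "lrj k z : cell (cx ?J) k" using hom_cell[OF sset_iso_hom[OF Ph(1)] z] Ph(2) by simp
  show "unz (map rh (lrj k z)) = restr (cx ?J) (%k l. restr (cx (chn W)) (%_. unz) k (map rh l)) k (Ph k z)"
   using l mono_map_cell[OF l rh] Ph(2)[OF z] by simp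
 qed
 ultimately show ?thesis by simp
qed

abbreviation jrho :: "(pair) list => (pair) list => pair => pair" where
 "jrho A B x == if fst x = 0 then A ! snd x else B ! snd x"

lemma lrj_set:
 assumes "z : cell (\<Delta> m \<star> \<Delta> n) k" "x : set (lrj k z)"
 shows "(fst x = 0 & snd x <= m) | (fst x = 1 & snd x <= n)"
proof -
 have s: "set a <= {..i}" if "a : mono_maps k i" for a k i using that by (simp add: mono_maps_def)
 show ?thesis
  using assms s by (cases z) (fastforce simp: join_cell lcode_def rcode_def)+
qed

lemma join_chain_ends:
 assumes h: "h : hom (\<Delta> m \<star> \<Delta> n) (sqs W)" and z: "z : cell (\<Delta> m \<star> \<Delta> n) k"
 shows "zp (h k z) = map (jrho (zp (h m (JL (id_map m)))) (zp (h n (JR (id_map n))))) (lrj k z)"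
proof -
 have "JL (id_map m) : cell (\<Delta> m \<star> \<Delta> n) m" "JR (id_map n) : cell (\<Delta> m \<star> \<Delta> n) n" by (simp_all add: join_cell)
 note c = join_chain[OF h this(1)] join_chain[OF h this(2)]
 have "jrho (zp (h m (JL (id_map m)))) (zp (h n (JR (id_map n)))) x = zp (h 0 (if fst x = 0 then JL [snd x] else JR [snd x])) ! 0"
  if "x : set (lrj k z)" for x
  using lrj_set[OF z that] unfolding c by (auto simp: lcode_def rcode_def)
 then show ?thesis unfolding join_chain[OF h z] by (intro map_cong refl) simp
qed

lemma join_chain_le:
 assumes h: "h : hom (\<Delta> m \<star> \<Delta> n) (sqs W)" and ij: "i <= m" "j <= n"
 shows "le2 (zp (h m (JL (id_map m))) ! i) (zp (h n (JR (id_map n))) ! j)"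
proof -
 let ?z = "JM 0 0 [i] [j] :: (nat list, nat list) join"
 have z: "?z : cell (\<Delta> m \<star> \<Delta> n) 1" using ij by (simp add: join_cell)
 have e: "zp (h 1 ?z) = [zp (h m (JL (id_map m))) ! i, zp (h n (JR (id_map n))) ! j]"
  using join_chain_ends[OF h z] by (simp add: lcode_def rcode_def)
 have "zp (h 1 ?z) : cell (cx (chn W)) 1" by (rule zp_cell[OF hom_cell[OF h z]])
 then show ?thesis unfolding e by (auto simp: cx_cell intro: chn_le)
qed

lemma join_hom_eqI:
 assumes "h : hom (\<Delta> m \<star> \<Delta> n) (sqs W)" "h' : hom (\<Delta> m \<star> \<Delta> n) (sqs W)"
  and "zp (h m (JL (id_map m))) = zp (h' m (JL (id_map m)))" "zp (h n (JR (id_map n))) = zp (h' n (JR (id_map n)))"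
 shows "h = h'"
proof (rule hom_eqI[OF assms(1,2)])
 fix k z assume z: "z : cell (\<Delta> m \<star> \<Delta> n) k"
 have "h k z : cell Sq k" "h' k z : cell Sq k" using hom_cell[OF assms(1) z] hom_cell[OF assms(2) z] by (simp_all add: sqs_cell)
 moreover have "zp (h k z) = zp (h' k z)"
  unfolding join_chain_ends[OF assms(1) z] join_chain_ends[OF assms(2) z] assms(3,4) ..
 ultimately show "h k z = h' k z" using zp_length(2) by metis
qed

text \<open>In the nerve of a poset a join of two chains exists as soon as everything in the first
  lies below everything in the second. Together with \<open>join_hom_eqI\<close> this turns
  simplices of slices into chains.\<close>

lemma join_hom_exists:
 assumes W: "W <= usq" and A: "A : cell (cx (chn W)) m" and B: "B : cell (cx (chn W)) n"
  and AB: "!!x y. x : set A ==> y : set B ==> le2 x y"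
 obtains h where "h : hom (\<Delta> m \<star> \<Delta> n) (sqs W)" "zp (h m (JL (id_map m))) = A" "zp (h n (JR (id_map n))) = B"
  "!!k z. z : cell (\<Delta> m \<star> \<Delta> n) k ==> zp (h k z) = map (jrho A B) (lrj k z)"
proof -
 have A': "length A = Suc m" "sorted A" "set A : chn W" and B': "length B = Suc n" "sorted B" "set B : chn W"
  using A B by (simp_all add: cx_cell)
 have Al: "le2 (A ! i) (A ! j)" if "i <= j" "j <= m" for i j
  using chn_le[OF A'(3)] that A'(1,2) by (simp add: sorted_nth_mono)
 have Bl: "le2 (B ! i) (B ! j)" if "i <= j" "j <= n" for i j
  using chn_le[OF B'(3)] that B'(1,2) by (simp add: sorted_nth_mono)
 have rh: "cx_map (jc lcode rcode (pw {..m}) (pw {..n})) (chn W) (jrho A B)"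
  unfolding cx_map_def
 proof (intro ballI conjI impI)
  fix s assume s: "s : jc lcode rcode (pw {..m}) (pw {..n})"
  then obtain a b where ab: "s = lcode ` a Un rcode ` b" "a <= {..m}" "b <= {..n}" unfolding jc_def pw_def by blast
  have mem: "(fst x = 0 & snd x <= m) | (fst x = 1 & snd x <= n)" if "x : s" for x
   using that ab by (auto simp: lcode_def rcode_def)
  have le: "le2 (jrho A B x) (jrho A B y)" if xy: "x : s" "y : s" "x <= y" for x y
  proof -
   have "le2 (A ! i) (B ! j)" if "i <= m" "j <= n" for i j using AB A'(1) B'(1) that by simp
   moreover have "fst x < fst y | fst x = fst y & snd x <= snd y" using xy(3) by (cases x; cases y) auto
   ultimately show ?thesis using mem[OF xy(1)] mem[OF xy(2)] Al Bl by auto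
  qed
  show "jrho A B x <= jrho A B y" if "x : s" "y : s" "x <= y" for x y using le2_le[OF le[OF that]] .
  have "s ~= {}" using s unfolding jc_def pw_def by blast
  moreover have "jrho A B x : W" if "x : s" for x
  proof -
   have "jrho A B x : set A Un set B" using mem[OF that] A'(1) B'(1) by auto
   then show ?thesis using A'(3) B'(3) unfolding chn_def by blast
  qed
  moreover have "le2 (jrho A B x) (jrho A B y) | le2 (jrho A B y) (jrho A B x)" if "x : s" "y : s" for x y
   using le[OF that] le[OF that(2,1)] linear by blast
  ultimately show "jrho A B ` s : chn W" unfolding chn_def by blast
 qed
 let ?h = "restr (\<Delta> m \<star> \<Delta> n) (%k z. unz (map (jrho A B) (lrj k z)))"
 have c: "JL (id_map m) : cell (\<Delta> m \<star> \<Delta> n) m" "JR (id_map n) : cell (\<Delta> m \<star> \<Delta> n) n" by (simp_all add: join_cell)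
 have n: "map (%x. l ! x) (id_map k) = l" if "length l = Suc k" for l :: "(pair) list" and k
  using that by (intro nth_equalityI) (auto simp: id_map_def simp del: upt_Suc)
 show thesis
 proof (rule that[OF chain_join[OF W rh]])
  show "zp (?h m (JL (id_map m))) = A" "zp (?h n (JR (id_map n))) = B"
   using c n[OF A'(1)] n[OF B'(1)] by (simp_all add: lcode_def rcode_def comp_def)
 qed simp
qed

lemma zp_pt: "zp ([fst w], [snd w]) = [w]" "zp (act Sq 0 a ([fst w], [snd w])) = replicate (Suc k) w" if "a : mono_maps k 0"
proof -
 show 1: "zp ([fst w], [snd w]) = [w]" by (simp add: zp_def)
 have a: "a = replicate (Suc k) 0" by (rule mono_maps_target_0[OF that replicate_mono[OF order_refl]])
 show "zp (act Sq 0 a ([fst w], [snd w])) = replicate (Suc k) w"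
  unfolding a by (simp add: Sq_act after_def zp_def map_replicate_const zip_replicate del: replicate_Suc)
qed

lemma id_map_0: "id_map 0 = [0]"
 by (simp add: id_map_def)

abbreviation below :: "(pair) set => pair => (pair) set set" where
 "below V w == chn {y : V. le2 y w}"

abbreviation pt :: "pair => sq" where
 "pt w == ([fst w], [snd w])"

text \<open>The reflection of the square that exchanges its top and its right edge.\<close>

definition rv :: "pair => pair" where
 "rv x = (1 - snd x, 1 - fst x)"

lemma rv_rv: "x : usq ==> rv (rv x) = x"
 by (cases x) (auto simp: rv_def)

lemma rv_le2: "le2 x y ==> le2 (rv y) (rv x)"
 by (auto simp: le2_def rv_def)

lemma rv_antimap:
 assumes "rv ` X <= Y" shows "cx_antimap (chn X) (chn Y) rv"
 unfolding cx_antimap_def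
proof (intro ballI conjI impI)
 fix s assume s: "s : chn X"
 show "rv ` s : chn Y" using s assms rv_le2 unfolding chn_def by blast
 show "rv y <= rv x" if "x : s" "y : s" "x <= y" for x y using le2_le[OF rv_le2[OF chn_le[OF s that]]] .
qed

lemma const_pt:
 assumes "a : mono_maps k 0" shows "zp (const_map (sqs W) (pt w) k a) = replicate (Suc k) w"
 using assms zp_pt(2)[OF assms] by (simp add: const_map_def)

section \<open>Relative slices over and under a vertex of the square\<close>

context
 fixes W V :: "(pair) set" and w :: "pair"
 assumes W: "W <= usq" and V: "V <= W" and w: "w : W"
begin

lemma pt_chn: "[w] : cell (cx (chn W)) 0"
 using w by (simp add: cx_cell chn_def)

lemma const_cell: "const_map (sqs W) (pt w) : hom (\<Delta> 0) (sqs W)"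
proof -
 have "pt w : cell (sqs W) 0" using unz_cell[OF W pt_chn] by (simp add: unz_def)
 from yo_hom[OF sqs_simplicial this] show ?thesis by (simp add: const_map_def yo_def)
qed

lemma const_eqI: "s : cell (sqs W) k ==> a : mono_maps k 0 ==> zp s = replicate (Suc k) w ==> s = const_map (sqs W) (pt w) k a"
 using const_pt[of a k W w] hom_cell[OF const_cell, of a k] zp_length(2)[of s k] zp_length(2)[of "const_map (sqs W) (pt w) k a" k]
 by (simp add: sqs_cell del: replicate_Suc)

lemma rel_over_cell:
 "h : cell (rel_over (sqs W) (vx V) (pt w)) n \<longleftrightarrow>
  h : hom (\<Delta> n \<star> \<Delta> 0) (sqs W) & zp (h 0 (JR (id_map 0))) = [w] & set (zp (h n (JL (id_map n)))) <= V"
proof -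
 let ?K = "over (\<Delta> 0) (sqs W) (const_map (sqs W) (pt w))"
 have "(ALL m. ALL a:cell (\<Delta> 0) m. h m (JR a) = const_map (sqs W) (pt w) m a) \<longleftrightarrow> zp (h 0 (JR (id_map 0))) = [w]"
  if h: "h : hom (\<Delta> n \<star> \<Delta> 0) (sqs W)"
 proof
  assume "ALL m. ALL a:cell (\<Delta> 0) m. h m (JR a) = const_map (sqs W) (pt w) m a"
  then show "zp (h 0 (JR (id_map 0))) = [w]" using const_pt[OF id_map_mono] by (simp add: id_map_0)
 next
  assume e: "zp (h 0 (JR (id_map 0))) = [w]"
  show "ALL m. ALL a:cell (\<Delta> 0) m. h m (JR a) = const_map (sqs W) (pt w) m a"
  proof (intro allI ballI)
   fix m a assume "a : cell (\<Delta> 0) m"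
   then have a: "a : mono_maps m 0" by simp
   then have c: "JR a : cell (\<Delta> n \<star> \<Delta> 0) m" by (simp add: join_cell)
   have "a = replicate (Suc m) 0" by (rule mono_maps_target_0[OF a replicate_mono[OF order_refl]])
   then have "zp (h m (JR a)) = replicate (Suc m) w"
    unfolding join_chain_ends[OF h c] e by (simp add: rcode_def map_replicate_const)
   then show "h m (JR a) = const_map (sqs W) (pt w) m a" using const_eqI[OF hom_cell[OF h c] a] by blast
  qed
 qed
 moreover have "act ?K n [i] h 0 (JL [0]) : vx V \<longleftrightarrow> zp (h n (JL (id_map n))) ! i : V"
  if h: "h : hom (\<Delta> n \<star> \<Delta> 0) (sqs W)" and i: "i <= n" for i
 proof -
  have c: "JL [i] : cell (\<Delta> n \<star> \<Delta> 0) 0" "JL [0] : cell (\<Delta> 0 \<star> \<Delta> 0) 0" using i by (simp_all add: join_cell)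
  have "act ?K n [i] h 0 (JL [0]) = h 0 (JL [i])" using i c by (simp add: over_act[of "[i]" 0 n])
  moreover have "zp (h 0 (JL [i])) = [zp (h n (JL (id_map n))) ! i]"
   using join_chain_ends[OF h c(1)] by (simp add: lcode_def)
  moreover have "h 0 (JL [i]) = pt (zp (h 0 (JL [i])) ! 0)"
   using Sq_vertex hom_cell[OF h c(1)] by (simp add: sqs_cell)
  moreover have "pt y : vx V \<longleftrightarrow> y : V" for y by force
  ultimately show ?thesis by simp
 qed
 moreover have "(ALL i<=n. zp (h n (JL (id_map n))) ! i : V) \<longleftrightarrow> set (zp (h n (JL (id_map n)))) <= V"
  if h: "h : hom (\<Delta> n \<star> \<Delta> 0) (sqs W)"
 proof -
  have "JL (id_map n) : cell (\<Delta> n \<star> \<Delta> 0) n" by (simp add: join_cell)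
  then have "length (zp (h n (JL (id_map n)))) = Suc n" using zp_length(1) hom_cell[OF h] by (simp add: sqs_cell)
  then show ?thesis by (auto simp: set_conv_nth less_Suc_eq_le)
 qed
 ultimately show ?thesis unfolding rel_over_def full_sub_cell over_cell by (auto simp del: simplex_cell)
qed

text \<open>A simplex of the slice is a chain in \<open>V\<close> followed by \<open>w\<close>, so
  the slice is the nerve of the part of \<open>V\<close> below \<open>w\<close>.\<close>

lemma rel_over_iso:
 "sset_iso (rel_over (sqs W) (vx V) (pt w)) (cx (below V w))
  (restr (rel_over (sqs W) (vx V) (pt w)) (%n h. zp (h n (JL (id_map n)))))"
proof -
 let ?K = "rel_over (sqs W) (vx V) (pt w)"
 let ?c = "%n h. zp (h n (JL (id_map n)))"
 have c1: "JL th : cell (\<Delta> n \<star> \<Delta> 0) m" if "th : mono_maps m n" for th m n using that by (simp add: join_cell)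
 have Ks: "simplicial_set ?K" unfolding rel_over_def by (intro full_sub_simplicial over_simplicial simplex_simplicial)
 have im: "?c n h : cell (cx (below V w)) n" if h: "h : cell ?K n" for n h
 proof -
  have h': "h : hom (\<Delta> n \<star> \<Delta> 0) (sqs W)" "zp (h 0 (JR (id_map 0))) = [w]" "set (?c n h) <= V" using h rel_over_cell by auto
  have z: "?c n h : cell (cx (chn W)) n" using zp_cell[OF hom_cell[OF h'(1) c1[OF id_map_mono]]] .
  have "le2 y w" if y: "y : set (?c n h)" for y
  proof -
   obtain i where "i <= n" "y = ?c n h ! i" using y z by (auto simp: in_set_conv_nth cx_cell less_Suc_eq_le)
   then show ?thesis using join_chain_le[OF h'(1), of i 0] h'(2) by simp
  qed
  then show ?thesis using z h'(3) unfolding cx_cell chn_def by blast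
 qed
 have "restr ?K ?c : hom ?K (cx (below V w))"
 proof (rule restr_homI[OF im])
  fix m n th h assume th: "th : mono_maps m n" and h: "h : cell ?K n"
  show "act ?K n th h : cell ?K m" using sset_cell[OF Ks th h] .
  have h': "h : hom (\<Delta> n \<star> \<Delta> 0) (sqs W)" using h rel_over_cell by blast
  have "act ?K n th h m (JL (id_map m)) = h m (JL th)"
   using th c1[OF id_map_mono, of m] by (simp add: rel_over_def over_act[OF th])
  then show "?c m (act ?K n th h) = act (cx (below V w)) n th (?c n h)"
   using join_chain_ends[OF h' c1[OF th]] by (simp add: lcode_def)
 qed
 moreover have "inj_on (?c n) (cell ?K n)" for n
 proof (rule inj_onI)
  fix h h' assume "h : cell ?K n" "h' : cell ?K n" "?c n h = ?c n h'"
  then show "h = h'" unfolding rel_over_cell by (intro join_hom_eqI[of h n 0 W h']) auto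
 qed
 moreover have "EX h:cell ?K n. ?c n h = l" if l: "l : cell (cx (below V w)) n" for n l
 proof -
  have A: "l : cell (cx (chn W)) n" using l V unfolding cx_cell chn_def by blast
  have lV: "set l <= V" using l by (auto simp: cx_cell chn_def)
  obtain h where "h : hom (\<Delta> n \<star> \<Delta> 0) (sqs W)" "zp (h n (JL (id_map n))) = l" "zp (h 0 (JR (id_map 0))) = [w]"
   by (rule join_hom_exists[OF W A pt_chn]) (use l in \<open>auto simp: cx_cell chn_def\<close>)
  then show ?thesis using lV by (intro bexI[of _ h]) (auto simp: rel_over_cell)
 qed
 ultimately show ?thesis unfolding sset_iso_def bij_betw_def inj_on_def
  using im by (force simp: image_iff)
qed

lemma rel_under_cell:
 "h : cell (rel_under (sqs W) (vx V) (pt w)) n \<longleftrightarrow>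
  h : hom (\<Delta> 0 \<star> \<Delta> n) (sqs W) & zp (h 0 (JL (id_map 0))) = [w] & set (zp (h n (JR (id_map n)))) <= V"
proof -
 let ?K = "under (\<Delta> 0) (sqs W) (const_map (sqs W) (pt w))"
 have "(ALL m. ALL a:cell (\<Delta> 0) m. h m (JL a) = const_map (sqs W) (pt w) m a) \<longleftrightarrow> zp (h 0 (JL (id_map 0))) = [w]"
  if h: "h : hom (\<Delta> 0 \<star> \<Delta> n) (sqs W)"
 proof
  assume "ALL m. ALL a:cell (\<Delta> 0) m. h m (JL a) = const_map (sqs W) (pt w) m a"
  then show "zp (h 0 (JL (id_map 0))) = [w]" using const_pt[OF id_map_mono] by (simp add: id_map_0)
 next
  assume e: "zp (h 0 (JL (id_map 0))) = [w]"
  show "ALL m. ALL a:cell (\<Delta> 0) m. h m (JL a) = const_map (sqs W) (pt w) m a"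
  proof (intro allI ballI)
   fix m a assume "a : cell (\<Delta> 0) m"
   then have a: "a : mono_maps m 0" by simp
   then have c: "JL a : cell (\<Delta> 0 \<star> \<Delta> n) m" by (simp add: join_cell)
   have "a = replicate (Suc m) 0" by (rule mono_maps_target_0[OF a replicate_mono[OF order_refl]])
   then have "zp (h m (JL a)) = replicate (Suc m) w"
    unfolding join_chain_ends[OF h c] e by (simp add: lcode_def map_replicate_const)
   then show "h m (JL a) = const_map (sqs W) (pt w) m a" using const_eqI[OF hom_cell[OF h c] a] by blast
  qed
 qed
 moreover have "act ?K n [i] h 0 (JR [0]) : vx V \<longleftrightarrow> zp (h n (JR (id_map n))) ! i : V"
  if h: "h : hom (\<Delta> 0 \<star> \<Delta> n) (sqs W)" and i: "i <= n" for i
 proof -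
  have c: "JR [i] : cell (\<Delta> 0 \<star> \<Delta> n) 0" "JR [0] : cell (\<Delta> 0 \<star> \<Delta> 0) 0" using i by (simp_all add: join_cell)
  have "act ?K n [i] h 0 (JR [0]) = h 0 (JR [i])" using i c by (simp add: under_act[of "[i]" 0 n])
  moreover have "zp (h 0 (JR [i])) = [zp (h n (JR (id_map n))) ! i]"
   using join_chain_ends[OF h c(1)] by (simp add: rcode_def)
  moreover have "h 0 (JR [i]) = pt (zp (h 0 (JR [i])) ! 0)"
   using Sq_vertex hom_cell[OF h c(1)] by (simp add: sqs_cell)
  moreover have "pt y : vx V \<longleftrightarrow> y : V" for y by force
  ultimately show ?thesis by simp
 qed
 moreover have "(ALL i<=n. zp (h n (JR (id_map n))) ! i : V) \<longleftrightarrow> set (zp (h n (JR (id_map n)))) <= V"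
  if h: "h : hom (\<Delta> 0 \<star> \<Delta> n) (sqs W)"
 proof -
  have "JR (id_map n) : cell (\<Delta> 0 \<star> \<Delta> n) n" by (simp add: join_cell)
  then have "length (zp (h n (JR (id_map n)))) = Suc n" using zp_length(1) hom_cell[OF h] by (simp add: sqs_cell)
  then show ?thesis by (auto simp: set_conv_nth less_Suc_eq_le)
 qed
 ultimately show ?thesis unfolding rel_under_def full_sub_cell under_cell by (auto simp del: simplex_cell)
qed

text \<open>The reflection \<open>rv\<close> reverses the order. The opposite of the slice under
  \<open>w\<close> thereby becomes the nerve of reflected vertices below \<open>rv w\<close>, and
  right Kan extensions can be treated as left ones.\<close>

lemma rel_under_op_iso:
 "sset_iso (op (rel_under (sqs W) (vx V) (pt w))) (cx (below (rv ` V) (rv w)))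
  (restr (rel_under (sqs W) (vx V) (pt w)) (%n h. rev (map rv (zp (h n (JR (id_map n)))))))"
proof -
 let ?K = "rel_under (sqs W) (vx V) (pt w)"
 let ?c = "%n h. zp (h n (JR (id_map n)))"
 let ?X = "{y : V. le2 w y}" and ?Y = "{y : rv ` V. le2 y (rv w)}"
 have c1: "JR th : cell (\<Delta> 0 \<star> \<Delta> n) m" if "th : mono_maps m n" for th m n using that by (simp add: join_cell)
 have Ks: "simplicial_set ?K" unfolding rel_under_def by (intro full_sub_simplicial under_simplicial simplex_simplicial)
 have Vu: "V <= usq" "w : usq" using V W w by blast+
 have a1: "cx_antimap (chn ?X) (chn ?Y) rv" by (rule rv_antimap) (use Vu rv_le2 in auto)
 have a2: "cx_antimap (chn ?Y) (chn ?X) rv"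
 proof (rule rv_antimap)
  have "rv y : ?X" if "y : ?Y" for y
  proof -
   obtain v where v: "v : V" "y = rv v" "le2 y (rv w)" using \<open>y : ?Y\<close> by blast
   then show ?thesis using rv_le2[OF v(3)] rv_rv Vu by auto
  qed
  then show "rv ` ?Y <= ?X" by blast
 qed
 have im: "?c n h : cell (cx (chn ?X)) n" if h: "h : cell ?K n" for n h
 proof -
  have h': "h : hom (\<Delta> 0 \<star> \<Delta> n) (sqs W)" "zp (h 0 (JL (id_map 0))) = [w]" "set (?c n h) <= V" using h rel_under_cell by auto
  have z: "?c n h : cell (cx (chn W)) n" using zp_cell[OF hom_cell[OF h'(1) c1[OF id_map_mono]]] .
  have "le2 w y" if y: "y : set (?c n h)" for y
  proof -
   obtain i where "i <= n" "y = ?c n h ! i" using y z by (auto simp: in_set_conv_nth cx_cell less_Suc_eq_le)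
   then show ?thesis using join_chain_le[OF h'(1), of 0 i] h'(2) by simp
  qed
  then show ?thesis using z h'(3) unfolding cx_cell chn_def by blast
 qed
 let ?d = "%n h. rev (map rv (?c n h))"
 have im': "?d n h : cell (cx (chn ?Y)) n" if "h : cell ?K n" for n h using antimono_map_cell[OF im[OF that] a1] .
 have "restr (op ?K) ?d : hom (op ?K) (cx (chn ?Y))"
 proof (rule restr_homI)
  show "?d n h : cell (cx (chn ?Y)) n" if "h : cell (op ?K) n" for n h using im' that by simp
  fix m n th h assume th: "th : mono_maps m n" and h: "h : cell (op ?K) n"
  show "act (op ?K) n th h : cell (op ?K) m" using sset_cell[OF op_simplicial[OF Ks] th h] .
  have f: "flip n th : mono_maps m n" using th by simp
  have h': "h : hom (\<Delta> 0 \<star> \<Delta> n) (sqs W)" using h rel_under_cell by simp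
  have len: "length (?c n h) = Suc n" using im h by (simp add: cx_cell)
  have "act (op ?K) n th h m (JR (id_map m)) = h m (JR (flip n th))"
   using f c1[OF id_map_mono, of m] by (simp add: rel_under_def under_act[OF f])
  then have "?c m (act (op ?K) n th h) = map ((!) (?c n h)) (flip n th)"
   using join_chain_ends[OF h' c1[OF f]] by (simp add: rcode_def)
  then have "?d m (act (op ?K) n th h) = map (%t. rv (?c n h ! (n - t))) th" by (simp add: flip_def rev_map)
  also have "... = map ((!) (?d n h)) th"
   using len mono_mapsD(1,3)[OF th] by (auto simp: rev_nth in_set_conv_nth less_Suc_eq_le)
  finally show "?d m (act (op ?K) n th h) = act (cx (chn ?Y)) n th (?d n h)" by simp
 qed
 moreover have "inj_on (?d n) (cell ?K n)" for n
 proof (rule inj_onI)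
  fix h h' assume h: "h : cell ?K n" "h' : cell ?K n" "?d n h = ?d n h'"
  have "set (?c n h) <= usq" "set (?c n h') <= usq" using h(1,2) Vu unfolding rel_under_cell by blast+
  then have "map rv (map rv (?c n h)) = ?c n h" "map rv (map rv (?c n h')) = ?c n h'" by (auto intro!: map_idI simp: rv_rv subset_iff simp del: mem_Sigma_iff)
  then have "?c n h = ?c n h'" using h(3) by (metis rev_rev_ident)
  then show "h = h'" using h(1,2) unfolding rel_under_cell by (intro join_hom_eqI[of h 0 n W h']) auto
 qed
 moreover have "EX h:cell ?K n. ?d n h = l" if l: "l : cell (cx (chn ?Y)) n" for n l
 proof -
  let ?l = "rev (map rv l)"
  have lX: "?l : cell (cx (chn ?X)) n" using antimono_map_cell[OF l a2] .
  then have B: "?l : cell (cx (chn W)) n" using V unfolding cx_cell chn_def by blast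
  have lV: "set ?l <= V" "!!y. y : set ?l ==> le2 w y" using lX unfolding cx_cell chn_def by blast+
  have "set l <= rv ` V" using l unfolding cx_cell chn_def by blast
  then have "map rv (map rv l) = l" using Vu by (intro map_idI[of l "%x. rv (rv x)", folded map_map[of rv rv, unfolded comp_def]]) (auto simp: rv_def)
  then have e: "rev (map rv ?l) = l" by (simp add: rev_map)
  obtain h where "h : hom (\<Delta> 0 \<star> \<Delta> n) (sqs W)" "zp (h 0 (JL (id_map 0))) = [w]" "zp (h n (JR (id_map n))) = ?l"
   by (rule join_hom_exists[OF W pt_chn B]) (use lV(2) in auto)
  then show ?thesis using lV(1) e by (intro bexI[of _ h]) (auto simp: rel_under_cell)
 qed
 ultimately show ?thesis unfolding sset_iso_def bij_betw_def inj_on_def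
  using im' by (force simp: image_iff restr_def)
qed

end

lemma limit_cone_hom:
 assumes K: "simplicial_set K" and T: "complex T" and c: "sset_iso (op K) (cx T) c"
  and f: "f : hom (cx (jcol T (pw {..0}))) (op C)"
  and qf: "!!m z. z : cell (\<Delta> 0 \<star> K) m ==> f m (jmap bcode ccode c (%_ a. a) m (sw 0 m z)) = q m z"
 shows "restr (\<Delta> 0 \<star> K) q : hom (\<Delta> 0 \<star> K) C"
proof -
 let ?Ph = "restr (\<Delta> 0 \<star> K) (sw 0)"
 note Ph = sw_iso[OF K, of 0]
 let ?g = "restr (op K \<star> \<Delta> 0) (%m z. f m (jmap bcode ccode c (%_ a. a) m z))"
 have g: "?g : hom (op K \<star> \<Delta> 0) (op C)" by (rule colimit_cone_hom[OF op_simplicial[OF K] T c f refl])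
 have A: "sub_sset (op (\<Delta> 0 \<star> K)) (op (\<Delta> 0 \<star> K))" by (rule op_sub[OF join_sub]) (use K in simp_all)
 have B: "sub_sset (op K \<star> \<Delta> 0) (op K \<star> \<Delta> 0)" by (rule join_sub) (use K in simp_all)
 have sc: "?Ph m z : cell (op K \<star> \<Delta> 0) m" if "z : cell (op (\<Delta> 0 \<star> K)) m" for m z
  by (rule hom_cell[OF sset_iso_hom[OF Ph] that])
 have "restr (op (\<Delta> 0 \<star> K)) (%m z. ?g m (?Ph m z)) : hom (op (\<Delta> 0 \<star> K)) (op C)"
  by (rule sset_iso_pull[OF Ph A B sc g])
 moreover have "restr (op (\<Delta> 0 \<star> K)) (%m z. ?g m (?Ph m z)) = restr (op (\<Delta> 0 \<star> K)) q"
 proof (rule restr_cong)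
  fix m z assume z: "z : cell (op (\<Delta> 0 \<star> K)) m"
  show "?g m (?Ph m z) = q m z" using qf[of z m] sc[OF z] z by simp
 qed
 ultimately show ?thesis unfolding op_hom_iff by (simp add: restr_def)
qed

section \<open>Pointwise description of Kan extensions on the square\<close>

text \<open>The tautological cone on vertices: the diagram stays in place and all cone vertices go
  to \<open>w\<close>.\<close>

definition vtx :: "pair => triple => pair" where
 "vtx w x = (if fst x = 0 then snd x else w)"

lemma vtx_simps [simp]: "vtx w (bcode y) = y" "vtx w (ccode i) = w"
 by (simp_all add: vtx_def bcode_def ccode_def)

lemma vtx_comp [simp]: "vtx w \<circ> bcode = (%y. y)" "vtx w \<circ> ccode = (%_. w)"
 by (simp_all add: comp_def)

definition ff :: "pair => (pair) set set => (nat => sq => 'a) => nat => (triple) list => 'a" where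
 "ff w T F = restr (cx (jcol T (pw {..0}))) (%m l. F m (unz (map (vtx w) l)))"

text \<open>The pointwise condition for a left Kan extension, with the relative slices replaced by
  the isomorphic complexes \<open>below V w\<close>.\<close>

definition LK :: "'a sset => (pair) set => (pair) set => (nat => sq => 'a) => bool" where
 "LK C W V F \<longleftrightarrow> (ALL w:W. ccolim C (below V w) (ff w (below V w) F))"

definition sqf :: "sq => sq" where
 "sqf s = (flip 1 (snd s), flip 1 (fst s))"

text \<open>The diagram in \<open>op C\<close> that corresponds to \<open>F\<close> under the
  reflection of the square.\<close>

definition fl :: "(pair) set => (nat => sq => 'a) => nat => sq => 'a" where
 "fl W F = restr (sqs (rv ` W)) (%m s. F m (sqf s))"

lemma vtx_map:
 assumes V: "V <= W" and w: "w : W"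
 shows "cx_map (jcol (below V w) (pw {..0})) (chn W) (vtx w)"
 unfolding cx_map_def
proof (intro ballI conjI impI)
 fix s assume s: "s : jcol (below V w) (pw {..0})"
 then obtain a b where ab: "s = bcode ` a Un ccode ` b" "a : insert {} (below V w)" unfolding jc_def by blast
 have le: "le2 (vtx w x) (vtx w y)" if xy: "x : s" "y : s" "x <= y" for x y
 proof -
  have aw: "le2 p w" if "p : a" for p using ab(2) that unfolding chn_def by blast
  have aa: "le2 p q" if "p : a" "q : a" "p <= q" for p q using ab(2) chn_le that by blast
  have bb: "bcode p <= bcode q ==> p <= q" for p q using col.sm(1) strict_mono_less_eq by blast
  have cb: "~ ccode i <= bcode p" for i p using col.less[of p i] by simp
  from xy(1,2) show ?thesis unfolding ab(1)
   by (elim UnE imageE) (use xy(3) aw aa bb cb in simp_all)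
 qed
 show "vtx w x <= vtx w y" if "x : s" "y : s" "x <= y" for x y using le2_le[OF le[OF that]] .
 have "s ~= {}" using s unfolding jc_def by blast
 moreover have "vtx w ` s <= W"
 proof -
  have "a <= W" using ab(2) V unfolding chn_def by blast
  moreover have "vtx w ` s = a Un (%_. w) ` b" unfolding ab(1) by (simp add: image_Un image_image)
  ultimately show ?thesis using w by (simp add: image_subset_iff)
 qed
 moreover have "le2 (vtx w x) (vtx w y) | le2 (vtx w y) (vtx w x)" if "x : s" "y : s" for x y
  using le[OF that] le[OF that(2,1)] linear by blast
 ultimately show "vtx w ` s : chn W" unfolding chn_def by blast
qed

lemma cx_sq_hom:
 assumes W: "W <= usq" and F: "F : hom (sqs W) C"
 shows "restr (cx (chn W)) (%m l. F m (unz l)) : hom (cx (chn W)) C"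
proof -
 have "restr (cx (chn W)) (%m l. F m (unz l)) = cmp (cx (chn W)) F (restr (cx (chn W)) (%_. unz))"
  unfolding cmp_def by (rule restr_cong) simp
 then show ?thesis using cmp_hom[OF unz_hom[OF W] F cx_simplicial[OF complex_chn]] by simp
qed

lemma ff_hom:
 assumes W: "W <= usq" and F: "F : hom (sqs W) C" and V: "V <= W" and w: "w : W"
 shows "ff w (below V w) F : hom (cx (jcol (below V w) (pw {..0}))) C"
proof -
 note v = vtx_map[OF V w]
 have J: "complex (jcol (below V w) (pw {..0}))" by (rule complex_jc[OF complex_chn complex_pw])
 have "ff w (below V w) F = restr (cx (jcol (below V w) (pw {..0}))) (%m l. restr (cx (chn W)) (%m l. F m (unz l)) m (map (vtx w) l))"
  unfolding ff_def by (rule restr_cong) (simp add: mono_map_cell[OF _ v])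
 then show ?thesis using pull_hom[OF J cx_sq_hom[OF W F] v] by simp
qed

lemma sqs_cell_0: "W <= usq ==> cell (sqs W) 0 = vx W"
proof (intro equalityI subsetI)
 fix s assume "s : cell (sqs W) 0"
 then have s: "s : cell Sq 0" "set (zp s) <= W" by (simp_all add: sqs_cell)
 have "zp s ! 0 : W" using s zp_length(1)[OF s(1)] by auto
 then show "s : vx W" using Sq_vertex[OF s(1)] by blast
next
 fix s assume W: "W <= usq" and "s : vx W"
 then obtain w where "w : W" "s = pt w" by blast
 then show "s : cell (sqs W) 0" using W by (auto simp: sqs_cell Sq_cell zp_def)
qed

text \<open>The tautological cone over the slice at \<open>w\<close> takes a mixed simplex to the
  chain in \<open>V\<close> followed by copies of \<open>w\<close>, and this is the list at which
  \<open>ff\<close> evaluates \<open>F\<close>.\<close>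

lemma left_kan_iff:
 assumes C: "simplicial_set C" and W: "W <= usq" and V: "V <= W" and F: "F : hom (sqs W) C"
 shows "left_kan (sqs W) (vx V) C F \<longleftrightarrow> LK C W V F"
proof -
 have "colimit_diagram (rel_over (sqs W) (vx V) (pt w)) C (cmp (rel_over (sqs W) (vx V) (pt w) \<star> \<Delta> 0) F (over_cone (sqs W) (pt w)))
   \<longleftrightarrow> ccolim C (below V w) (ff w (below V w) F)" if w: "w : W" for w
 proof -
  let ?K = "rel_over (sqs W) (vx V) (pt w)" and ?o = "over_cone (sqs W) (pt w)"
  let ?c = "restr ?K (%n h. zp (h n (JL (id_map n))))"
  note iso = rel_over_iso[OF W V w] and f = ff_hom[OF W F V w]
  have Ks: "simplicial_set ?K" unfolding rel_over_def by (intro full_sub_simplicial over_simplicial simplex_simplicial)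
  have h: "h : hom (\<Delta> n \<star> \<Delta> 0) (sqs W)" "zp (h 0 (JR (id_map 0))) = [w]" if "h : cell ?K n" for h n
   using that rel_over_cell[OF W V w] by blast+
  have o: "zp (?o m z) = map (vtx w) (jmap bcode ccode ?c (%_ a. a) m z) & ?o m z : cell Sq m" if z: "z : cell (?K \<star> \<Delta> 0) m" for m z
  proof (cases z)
   case (JL k)
   then have k: "k : cell ?K m" using z by (simp add: join_cell)
   have "JL (id_map m) : cell (\<Delta> m \<star> \<Delta> 0) m" by (simp add: join_cell)
   then show ?thesis using k hom_cell[OF h(1)[OF k]] by (simp add: JL sqs_cell)
  next
   case (JR a)
   then have a: "a : mono_maps m 0" using z by (simp add: join_cell)
   then show ?thesis using zp_pt(2)[OF a] mono_mapsD(1)[OF a] sset_cell[OF Sq_simplicial a, of "pt w"] w W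
    by (auto simp: JR map_replicate_const Sq_cell simp del: replicate_Suc)
  next
   case (JM i j k a)
   then have m: "m = i + j + 1" and k: "k : cell ?K i" and a: "a : mono_maps j 0" using z by (simp_all add: join_cell)
   have c: "JM i j (id_map i) a : cell (\<Delta> i \<star> \<Delta> 0) m" using m a by (simp add: join_cell)
   have c': "JL (id_map i) : cell (\<Delta> i \<star> \<Delta> 0) i" by (simp add: join_cell)
   have a0: "set a <= {0}" using a by (auto simp: mono_maps_def)
   have "zp (k i (JL (id_map i))) = map (jrho (zp (k i (JL (id_map i)))) (zp (k 0 (JR (id_map 0))))) (map lcode (id_map i))"
    using join_chain_ends[OF h(1)[OF k] c'] by simp
   moreover have "map (jrho (zp (k i (JL (id_map i)))) (zp (k 0 (JR (id_map 0))))) (map rcode a) = map (%_. w) a"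
    using a0 h(2)[OF k] by (auto simp: rcode_def)
   ultimately have "zp (k m (JM i j (id_map i) a)) = zp (k i (JL (id_map i))) @ map (%_. w) a"
    using join_chain_ends[OF h(1)[OF k] c] by simp
   then show ?thesis using k hom_cell[OF h(1)[OF k] c] by (simp add: JM sqs_cell)
  qed
  have qf: "ff w (below V w) F m (jmap bcode ccode ?c (%_ a. a) m z) = F m (?o m z)" if z: "z : cell (?K \<star> \<Delta> 0) m" for m z
  proof -
   have "restr (?K \<star> \<Delta> 0) (jmap bcode ccode ?c (idm (\<Delta> 0))) m z = jmap bcode ccode ?c (%_ a. a) m z"
    using z by (cases z) (simp_all add: join_cell)
   then have "jmap bcode ccode ?c (%_ a. a) m z : cell (cx (jcol (below V w) (pw {..0}))) m"
    using hom_cell[OF sset_iso_hom[OF join_iso[OF Ks complex_chn iso, of 0]] z] by simp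
   then show ?thesis using o[OF z] zp_length(2)[of "?o m z" m] by (simp add: ff_def)
  qed
  have q: "cmp (?K \<star> \<Delta> 0) F ?o : hom (?K \<star> \<Delta> 0) C"
   unfolding cmp_def by (rule colimit_cone_hom[OF Ks complex_chn iso f qf])
  show ?thesis by (rule colimit_iff[OF C Ks complex_chn iso q f]) (simp add: qf)
 qed
 then show ?thesis unfolding left_kan_def LK_def sqs_cell_0[OF W] using F by simp
qed

lemma rv_usq: "W <= usq ==> rv ` W <= usq"
 by (auto simp: rv_def)

lemma rv_image: "W <= usq ==> rv ` rv ` W = W"
 using rv_rv by (force simp: image_image)

lemma sqf_unz: "sqf (unz l) = unz (rev (map rv l))"
 by (simp add: sqf_def unz_def flip_def rev_map rv_def)

lemma sqf_cell:
 assumes W: "W <= usq" and s: "s : cell (sqs W) n" shows "sqf s : cell (sqs (rv ` W)) n"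
proof -
 have "rev (map rv (zp s)) : cell (cx (chn (rv ` W))) n"
  by (rule antimono_map_cell[OF zp_cell[OF s] rv_antimap]) simp
 from unz_cell[OF rv_usq[OF W] this] show ?thesis
  unfolding sqf_unz[symmetric] using zp_length(2)[of s n] s by (simp add: sqs_cell)
qed

lemma sqf_sqf: "s : cell Sq n ==> sqf (sqf s) = s"
 using flip_flip[of "fst s" n 1] flip_flip[of "snd s" n 1] by (simp add: sqf_def Sq_cell)

lemma sqf_act:
 assumes "s : cell Sq n" "th : mono_maps m n" shows "sqf (act Sq n th s) = act Sq n (flip n th) (sqf s)"
 using assms mono_mapsD(1) flip_after[OF assms(2)] by (auto simp: sqf_def Sq_act Sq_cell)

lemma fl_hom:
 assumes W: "W <= usq" and F: "F : hom (sqs W) C"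
 shows "fl W F : hom (sqs (rv ` W)) (op C)"
 unfolding fl_def
proof (rule restr_homI)
 have c: "sqf s : cell (sqs W) n" if "s : cell (sqs (rv ` W)) n" for s n
  using sqf_cell[OF rv_usq[OF W] that] by (simp add: rv_image[OF W])
 show "F n (sqf s) : cell (op C) n" if "s : cell (sqs (rv ` W)) n" for s n
  using hom_cell[OF F c[OF that]] by simp
 show "act (sqs (rv ` W)) n th s : cell (sqs (rv ` W)) m" if "th : mono_maps m n" "s : cell (sqs (rv ` W)) n" for m n th s
  using sset_cell[OF sqs_simplicial that] .
 show "F m (sqf (act (sqs (rv ` W)) n th s)) = act (op C) n th (F n (sqf s))"
  if th: "th : mono_maps m n" and s: "s : cell (sqs (rv ` W)) n" for m n th s
  using hom_act[OF F flip_mono[OF th] c[OF s]] sqf_act[OF _ th, of s] s by (simp add: sqs_cell)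
qed

text \<open>The comparison for left Kan extensions after reversal: the tautological cone now begins
  with copies of \<open>w\<close>, and \<open>sw\<close>, \<open>rv\<close> and the reversal of
  lists move them to the end.\<close>

lemma right_kan_iff:
 assumes C: "simplicial_set C" and W: "W <= usq" and V: "V <= W" and F: "F : hom (sqs W) C"
 shows "right_kan (sqs W) (vx V) C F \<longleftrightarrow> LK (op C) (rv ` W) (rv ` V) (fl W F)"
proof -
 have "limit_diagram (rel_under (sqs W) (vx V) (pt w)) C (cmp (\<Delta> 0 \<star> rel_under (sqs W) (vx V) (pt w)) F (under_cone (sqs W) (pt w)))
   \<longleftrightarrow> ccolim (op C) (below (rv ` V) (rv w)) (ff (rv w) (below (rv ` V) (rv w)) (fl W F))" if w: "w : W" for w
 proof -
  let ?K = "rel_under (sqs W) (vx V) (pt w)" and ?o = "under_cone (sqs W) (pt w)"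
  let ?c = "restr ?K (%n h. rev (map rv (zp (h n (JR (id_map n))))))"
  let ?T = "below (rv ` V) (rv w)"
  have V': "rv ` V <= rv ` W" and w': "rv w : rv ` W" using V w by blast+
  note iso = rel_under_op_iso[OF W V w] and f = ff_hom[OF rv_usq[OF W] fl_hom[OF W F] V' w']
  have Ks: "simplicial_set ?K" unfolding rel_under_def by (intro full_sub_simplicial under_simplicial simplex_simplicial)
  have h: "h : hom (\<Delta> 0 \<star> \<Delta> n) (sqs W)" "zp (h 0 (JL (id_map 0))) = [w]" "set (zp (h n (JR (id_map n)))) <= usq" if "h : cell ?K n" for h n
   using that V W unfolding rel_under_cell[OF W V w] by blast+
  have rw: "rv (rv w) = w" using rv_rv W w by blast
  have rl: "map rv (map rv l) = l" if "set l <= usq" for l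
   using that by (induction l) (auto simp: rv_rv simp del: mem_Sigma_iff)
  have o: "?o m z : cell (sqs W) m & zp (?o m z) = rev (map rv (map (vtx (rv w)) (jmap bcode ccode ?c (%_ a. a) m (sw 0 m z))))"
   if z: "z : cell (\<Delta> 0 \<star> ?K) m" for m z
  proof (cases z)
   case (JR k)
   then have k: "k : cell ?K m" using z by (simp add: join_cell)
   have "JR (id_map m) : cell (\<Delta> 0 \<star> \<Delta> m) m" by (simp add: join_cell)
   then show ?thesis using k hom_cell[OF h(1)[OF k]] rl[OF h(3)[OF k]] by (simp add: JR rev_map comp_def)
  next
   case (JL a)
   then have a: "a : mono_maps m 0" using z by (simp add: join_cell)
   have "pt w : cell (sqs W) 0" using sqs_cell_0[OF W] w by blast
   then show ?thesis using zp_pt(2)[OF a] mono_mapsD(1)[OF a] sset_cell[OF sqs_simplicial a] rw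
    by (simp add: JL map_replicate_const comp_def del: replicate_Suc)
  next
   case (JM i j a k)
   then have m: "m = i + j + 1" and k: "k : cell ?K j" and a: "a : mono_maps i 0" using z by (simp_all add: join_cell)
   have c: "JM i j a (id_map j) : cell (\<Delta> 0 \<star> \<Delta> j) m" using m a by (simp add: join_cell)
   have c': "JR (id_map j) : cell (\<Delta> 0 \<star> \<Delta> j) j" by (simp add: join_cell)
   have a0: "set a <= {0}" using a by (auto simp: mono_maps_def)
   have "zp (k j (JR (id_map j))) = map (jrho (zp (k 0 (JL (id_map 0)))) (zp (k j (JR (id_map j))))) (map rcode (id_map j))"
    using join_chain_ends[OF h(1)[OF k] c'] by simp
   moreover have "map (jrho (zp (k 0 (JL (id_map 0)))) (zp (k j (JR (id_map j))))) (map lcode a) = map (%_. w) a"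
    using a0 h(2)[OF k] by (auto simp: lcode_def)
   ultimately have "zp (k m (JM i j a (id_map j))) = map (%_. w) a @ zp (k j (JR (id_map j)))"
    using join_chain_ends[OF h(1)[OF k] c] by simp
   moreover have "rev (map (%_. w) (flip 0 a)) = map (%_. w) a" by (simp add: map_replicate_const)
   ultimately show ?thesis using k hom_cell[OF h(1)[OF k] c] rl[OF h(3)[OF k]] rw
    by (simp add: JM rev_map comp_def)
  qed
  have qf: "ff (rv w) ?T (fl W F) m (jmap bcode ccode ?c (%_ a. a) m (sw 0 m z)) = F m (?o m z)" if z: "z : cell (\<Delta> 0 \<star> ?K) m" for m z
  proof -
   let ?z = "sw 0 m z" and ?l = "jmap bcode ccode ?c (%_ a. a) m (sw 0 m z)"
   have zc: "?z : cell (op ?K \<star> \<Delta> 0) m" using z by (cases z) (auto simp: join_cell)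
   then have "restr (op ?K \<star> \<Delta> 0) (jmap bcode ccode ?c (idm (\<Delta> 0))) m ?z = ?l"
    by (cases ?z) (simp_all add: join_cell)
   then have l: "?l : cell (cx (jcol ?T (pw {..0}))) m"
    using hom_cell[OF sset_iso_hom[OF join_iso[OF op_simplicial[OF Ks] complex_chn iso, of 0]] zc] by simp
   have "map (vtx (rv w)) ?l : cell (cx (chn (rv ` W))) m" by (rule mono_map_cell[OF l vtx_map[OF V' w']])
   then have "unz (map (vtx (rv w)) ?l) : cell (sqs (rv ` W)) m" by (rule unz_cell[OF rv_usq[OF W]])
   then have "ff (rv w) ?T (fl W F) m ?l = F m (sqf (unz (map (vtx (rv w)) ?l)))" using l by (simp add: ff_def fl_def)
   also have "sqf (unz (map (vtx (rv w)) ?l)) = unz (zp (?o m z))" unfolding sqf_unz using o[OF z] by simp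
   also have "... = ?o m z" by (rule zp_length(2)[of _ m]) (use o[OF z] in \<open>simp add: sqs_cell\<close>)
   finally show ?thesis .
  qed
  have q: "cmp (\<Delta> 0 \<star> ?K) F ?o : hom (\<Delta> 0 \<star> ?K) C"
   unfolding cmp_def by (rule limit_cone_hom[OF Ks complex_chn iso f qf])
  show ?thesis by (rule limit_iff[OF C Ks complex_chn iso q f]) (simp add: qf)
 qed
 then show ?thesis unfolding right_kan_def LK_def sqs_cell_0[OF W] using F by simp
qed

text \<open>Among the vertices of \<open>V\<close> below it, \<open>w\<close> is the greatest, and
  the cone edge from \<open>w\<close> to \<open>w\<close> is degenerate; so
  \<open>ccolim_top\<close> applies. By \<open>lin\<close> the complex \<open>below V w\<close> is a
  full simplex.\<close>

lemma ccolim_below_member: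
 assumes C: "quasi_category C" and W: "W <= usq" and F: "F : hom (sqs W) C" and V: "V <= W" and w: "w : V"
  and lin: "!!x y. x : V ==> y : V ==> le2 x w ==> le2 y w ==> le2 x y | le2 y x"
 shows "ccolim C (below V w) (ff w (below V w) F)"
proof -
 have Cs: "simplicial_set C" using C by (simp add: quasi_category_def)
 let ?X = "{y : V. le2 y w}"
 have eq: "below V w = pw ?X" using lin unfolding chn_def pw_def by blast
 have fin: "finite ?X"
 proof (rule finite_subset)
  show "?X <= usq" using V W by blast
 qed simp
 have wW: "w : W" using w V by blast
 have f: "ff w (pw ?X) F : hom (cx (jcol (pw ?X) (pw {..0}))) C" using ff_hom[OF W F V wW] eq by simp
 have p: "pt w : cell (sqs W) 0" using sqs_cell_0[OF W] wW by blast
 have m: "[0, 0] : mono_maps 1 0" by (simp add: mono_maps_def)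
 have c: "[bcode w, ccode 0] : cell (cx (jcol (pw ?X) (pw {..0}))) 1"
 proof -
  have "bcode ` {w} Un ccode ` {0} : jcol (pw ?X) (pw {..0})" unfolding col.jc_iff using w by (simp add: pw_def)
  then show ?thesis using col.less[of w 0] by (simp add: cx_cell insert_commute)
 qed
 have "ff w (pw ?X) F 1 [bcode w, ccode 0] = F 1 (act (sqs W) 0 [0, 0] (pt w))"
  using c by (simp add: ff_def unz_def Sq_act after_def)
 also have "... = act C 0 [0, 0] (F 0 (pt w))" by (rule hom_act[OF F m p])
 finally have "ff w (pw ?X) F 1 [bcode w, ccode 0] = act C 0 [0, 0] (F 0 (pt w))" .
 from ccolim_top[OF C fin _ _ f hom_cell[OF F p] this] show ?thesis unfolding eq using w le2_le by simp
qed

lemma extends_boundary_iff: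
 assumes C: "simplicial_set C" and f: "f : hom (boundary n) C"
 shows "extends C (bd n) (pw {..n}) f \<longleftrightarrow> (EX g:hom (\<Delta> n) C. restr (boundary n) g = f)"
proof
 assume "extends C (bd n) (pw {..n}) f"
 then obtain g where g: "g : hom (\<Delta> n) C" "!!m l. l : cell (boundary n) m ==> g m l = f m l"
  unfolding extends_def simplex_cx[symmetric] boundary_cx[symmetric] by blast
 then show "EX g:hom (\<Delta> n) C. restr (boundary n) g = f" using restr_eqI[OF f g(2)] by blast
next
 assume "EX g:hom (\<Delta> n) C. restr (boundary n) g = f"
 then show "extends C (bd n) (pw {..n}) f"
  unfolding extends_def simplex_cx[symmetric] boundary_cx[symmetric] using restr_apply by metis
qed

text \<open>Over the empty diagram the join with a simplex is the simplex itself; after relabelling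
  the cone vertices the extension problem is that of an initial object.\<close>

lemma ccolim_empty:
 assumes C: "simplicial_set C" and W: "W <= usq" and F: "F : hom (sqs W) C" and V: "V <= W" and w: "w : W"
  and empty: "!!x. x : V ==> ~ le2 x w"
 shows "ccolim C (below V w) (ff w (below V w) F) \<longleftrightarrow> initial C (F 0 (pt w))"
proof -
 have eq: "below V w = {}" using empty unfolding chn_def by blast
 have f: "ff w {} F : hom (cx (jcol {} (pw {..0}))) C" using ff_hom[OF W F V w] eq by simp
 have J: "jcol {} S = (`) ccode ` S" if "{} ~: S" for S using that unfolding jc_def by auto
 have ne: "{} ~: bd n" "{} ~: pw {..n}" for n by (auto simp: pw_def)
 have cb: "complex (bd n)" and cJ: "complex (jcol {} (bd n))" "complex (jcol {} (pw {..n}))" for n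
  by (simp_all add: complex_bd complex_jc complex_def[of "{}"] complex_pw)
 have sub: "jcol {} (bd n) <= jcol {} (pw {..n})" "bd n <= pw {..n}" for n using jc_mono[OF order_refl[of "{}"], of "bd n"] by blast+
 define sg :: "triple => nat" where "sg x = fst (snd x)" for x
 have sgc: "sg (ccode i) = i" for i by (simp add: sg_def ccode_def)
 have c1: "cx_map S (jcol {} S) ccode" if "{} ~: S" for S
  using col.sm(2) by (auto simp: cx_map_def J[OF that] strict_mono_less_eq)
 have c2: "cx_map (jcol {} S) S sg" if "{} ~: S" for S
 proof -
  have "sg ` ccode ` b = b" for b by (simp add: image_image sgc)
  then show ?thesis using col.sm(2) by (auto simp: cx_map_def J[OF that] strict_mono_less_eq sgc)
 qed
 have l0: "[ccode 0] : cell (cx (jcol {} (pw {..0}))) 0"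
 proof -
  have "ccode ` {0} : jcol {} (pw {..0})" unfolding J[OF ne(2)] by (rule imageI) (simp add: pw_def)
  then show ?thesis by (simp add: cx_cell)
 qed
 have f0: "ff w {} F 0 [ccode 0] = F 0 (pt w)" using l0 by (simp add: ff_def unz_def)
 \<comment> \<open>Over the empty diagram the cone consists of one vertex and its degeneracies, so a
   map on it is determined by a single value.\<close>
 have det: "h m l = ff w {} F m l" if h: "h : hom (cx K) C" "jcol {} (pw {..0}) <= K" and e: "h 0 [ccode 0] = F 0 (pt w)"
   and l: "l : cell (cx (jcol {} (pw {..0}))) m" for h K m l
 proof -
  have len: "length l = Suc m" and "set l : jcol {} (pw {..0})" using l by (simp_all add: cx_cell)
  then obtain b where b: "set l = ccode ` b" "b : pw {..0}" unfolding J[OF ne(2)] by blast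
  have "b <= {0}" using b(2) by (auto simp: pw_def)
  then have "set l <= {ccode 0}" using b(1) by blast
  then have "l ! i = ccode 0" if "i <= m" for i using that len nth_mem[of i l] by fastforce
  then have lr: "l = map ((!) [ccode 0]) (replicate (Suc m) 0)"
   using len by (intro nth_equalityI) (simp_all del: replicate_Suc)
  have r: "replicate (Suc m) 0 : mono_maps m 0" by (rule replicate_mono) simp
  have l0': "[ccode 0] : cell (cx K) 0" using l0 h(2) by (auto simp: cx_cell)
  show ?thesis
   unfolding lr cx_hom_act[OF h(1) r l0'] cx_hom_act[OF f r l0] e f0 ..
 qed
 have sub0: "pw {..0} <= bd n" if "0 < n" for n using pw0_bd that .
 have "ccolim C {} (ff w {} F) \<longleftrightarrow> initial C (F 0 (pt w))"
 proof
  assume cc: "ccolim C {} (ff w {} F)"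
  show "initial C (F 0 (pt w))"
   unfolding initial_def
  proof (intro conjI allI impI ballI)
   have "pt w : cell (sqs W) 0" using sqs_cell_0[OF W] w by blast
   then show "F 0 (pt w) : cell C 0" by (rule hom_cell[OF F])
   fix n g assume n: "(0::nat) < n" and g: "g : hom (boundary n) C" "g 0 [0] = F 0 (pt w)"
   have g': "g : hom (cx (bd n)) C" using g(1) by (simp add: boundary_cx)
   let ?h = "restr (cx (jcol {} (bd n))) (%m l. g m (map sg l))"
   have h: "?h : hom (cx (jcol {} (bd n))) C" by (rule pull_hom[OF cJ(1) g' c2[OF ne(1)]])
   have s0: "jcol {} (pw {..0}) <= jcol {} (bd n)" by (rule jc_mono[OF order_refl sub0[OF n]])
   have "[ccode 0] : cell (cx (jcol {} (bd n))) 0" using l0 s0 by (auto simp: cx_cell)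
   then have "?h 0 [ccode 0] = F 0 (pt w)" using g(2) by (simp add: sgc)
   then have "extends C (jcol {} (bd n)) (jcol {} (pw {..n})) ?h"
    using cc det[OF h s0] n h unfolding ccolim_def by blast
   then have "extends C (bd n) (pw {..n}) g"
    by (rule extends_relabel[OF cJ(1) complex_pw sub(2) g' c2[OF ne(1)] c1[OF ne(2)] c1[OF ne(1)], rotated]) (simp add: sgc)
   then show "EX h:hom (\<Delta> n) C. restr (boundary n) h = g" using extends_boundary_iff[OF C g(1)] by blast
  qed
 next
  assume ini: "initial C (F 0 (pt w))"
  show "ccolim C {} (ff w {} F)"
   unfolding ccolim_def
  proof (intro conjI f allI impI ballI)
   fix n g assume n: "(0::nat) < n" and g: "g : hom (cx (jcol {} (bd n))) C"
    and gf: "ALL m. ALL l:cell (cx (jcol {} (pw {..0}))) m. g m l = ff w {} F m l"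
   let ?h = "restr (cx (bd n)) (%m l. g m (map ccode l))"
   have h: "?h : hom (cx (bd n)) C" by (rule pull_hom[OF cb g c1[OF ne(1)]])
   then have h': "?h : hom (boundary n) C" by (simp add: boundary_cx)
   have "{0} : bd n" using sub0[OF n] by (auto simp: pw_def)
   then have "[0] : cell (cx (bd n)) 0" by (simp add: cx_cell)
   then have "?h 0 [0] = F 0 (pt w)" using gf l0 f0 by simp
   then have "EX k:hom (\<Delta> n) C. restr (boundary n) k = ?h" using ini n h' unfolding initial_def by blast
   then have "extends C (bd n) (pw {..n}) ?h" using extends_boundary_iff[OF C h'] by blast
   then show "extends C (jcol {} (bd n)) (jcol {} (pw {..n})) g"
   proof (rule extends_relabel[OF cb cJ(2) sub(1) g c1[OF ne(1)] c2[OF ne(2)] c2[OF ne(1)], rotated])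
    fix s x assume "s : jcol {} (bd n)" "x : s"
    then show "ccode (sg x) = x" unfolding J[OF ne(1)] using sgc by auto
   qed
  qed
 qed
 then show ?thesis unfolding eq .
qed

section \<open>Kan conditions for the span and the cospan\<close>

abbreviation wtop :: "(pair) set" where "wtop == {(0, 0), (1, 0)}"
abbreviation wright :: "(pair) set" where "wright == {(1, 0), (1, 1)}"
abbreviation wspan :: "(pair) set" where "wspan == insert (0, 1) wtop"
abbreviation wcospan :: "(pair) set" where "wcospan == insert (0, 1) wright"

lemma edges_vx: "top_edge = vx wtop" "right_edge = vx wright" "span = vx wspan" "cospan = vx wcospan"
 by (auto simp: top_edge_def right_edge_def span_def cospan_def)

lemma rv_sets: "rv ` wtop = wright" "rv ` wright = wtop" "rv ` wspan = wcospan" "rv ` wcospan = wspan" "rv ` usq = usq"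
proof -
 show "rv ` usq = usq" using rv_usq[OF order_refl] rv_image[OF order_refl] by (metis image_mono subset_antisym)
qed (auto simp: rv_def)

lemma w_sub: "wtop <= wspan" "wright <= wcospan" "wspan <= usq" "wcospan <= usq" "wtop <= usq" "wright <= usq"
 by auto

lemma usq_cases: "w : usq ==> w : wspan | w = (1, 1)"
 by (cases w) (auto simp: le_Suc_eq)

text \<open>The only incomparable vertices of the span are \<open>(1, 0)\<close> and
  \<open>(0, 1)\<close>.\<close>

lemma below_apex: "below wspan (1, 1) = span_cx"
proof -
 have "{y : wspan. le2 y (1, 1)} = wspan" by (auto simp: le2_def)
 moreover have "(ALL x:t. ALL y:t. le2 x y | le2 y x) \<longleftrightarrow> ~ {(1, 0), (0, 1)} <= t" if t: "t <= wspan" for t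
 proof
  assume "ALL x:t. ALL y:t. le2 x y | le2 y x"
  moreover have "~ (le2 (1, 0) (0, 1) | le2 (0, 1) (1, 0))" by (simp add: le2_def)
  ultimately show "~ {(1, 0), (0, 1)} <= t" by blast
 next
  assume a: "~ {(1, 0), (0, 1)} <= t"
  have "le2 x y | le2 y x" if "x : wspan" "y : wspan" "~ (x = (1, 0) & y = (0, 1))" "~ (x = (0, 1) & y = (1, 0))" for x y
   using that by (auto simp: le2_def)
  note d = this
  show "ALL x:t. ALL y:t. le2 x y | le2 y x"
  proof (intro ballI)
   fix x y assume xy: "x : t" "y : t"
   have "~ (x = (1, 0) & y = (0, 1))" "~ (x = (0, 1) & y = (1, 0))" using xy a by auto
   from d[OF subsetD[OF t xy(1)] subsetD[OF t xy(2)] this] show "le2 x y | le2 y x" .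
  qed
 qed
 ultimately show ?thesis unfolding chn_def span_cx_def by (auto simp: insert_commute)
qed

text \<open>At vertices of the span the pointwise condition holds by
  \<open>ccolim_below_member\<close>, which leaves the condition at \<open>(1, 1)\<close>.\<close>

lemma LK_span:
 assumes C: "quasi_category C" and F: "F : hom Sq C"
 shows "LK C usq wspan F \<longleftrightarrow> ccolim C span_cx (ff (1, 1) span_cx F)"
proof -
 have F': "F : hom (sqs usq) C" using F sqs_usq by simp
 have "ccolim C (below wspan w) (ff w (below wspan w) F)" if w: "w : wspan" for w
  by (rule ccolim_below_member[OF C order_refl F' w_sub(3) w]) (use w in \<open>auto simp: le2_def\<close>)
 moreover have "(ALL w:usq. P w) \<longleftrightarrow> P (1, 1)" if P: "!!w. w : wspan ==> P w" for P
 proof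
  assume "P (1, 1)"
  then show "ALL w:usq. P w" using P usq_cases by metis
 qed simp
 ultimately show ?thesis unfolding LK_def below_apex[symmetric] by presburger
qed

text \<open>No vertex of the right edge lies below \<open>(0, 1)\<close>, so the colimit at this
  vertex is taken over the empty diagram.\<close>

lemma LK_cospan:
 assumes C: "quasi_category C" and F: "F : hom (sqs wcospan) C"
 shows "LK C wcospan wright F \<longleftrightarrow> initial C (F 0 ([0], [1]))"
proof -
 have Cs: "simplicial_set C" using C by (simp add: quasi_category_def)
 have "ccolim C (below wright w) (ff w (below wright w) F)" if w: "w : wright" for w
  by (rule ccolim_below_member[OF C w_sub(4) F w_sub(2) w]) (use w in \<open>auto simp: le2_def\<close>)
 moreover have "ccolim C (below wright (0, 1)) (ff (0, 1) (below wright (0, 1)) F) \<longleftrightarrow> initial C (F 0 (pt (0, 1)))"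
  by (rule ccolim_empty[OF Cs w_sub(4) F w_sub(2)]) (auto simp: le2_def)
 ultimately show ?thesis unfolding LK_def by simp
qed

text \<open>This says that \<open>F\<close> is a pushout square; the zero at the corner is a
  separate condition.\<close>

definition cofib :: "'a sset => (nat => sq => 'a) => bool" where
 "cofib C F \<longleftrightarrow> ccolim C span_cx (ff (1, 1) span_cx F)"

lemma kan_iffs:
 assumes C: "quasi_category C"
 shows "left_kan Sq span C F \<longleftrightarrow> F : hom Sq C & cofib C F"
  and "right_kan Sq cospan C F \<longleftrightarrow> F : hom Sq C & cofib (op C) (fl usq F)"
  and "right_kan (full_sub Sq span) top_edge C F \<longleftrightarrow> F : hom (sqs wspan) C & final C (F 0 ([0], [1]))"
  and "left_kan (full_sub Sq cospan) right_edge C F \<longleftrightarrow> F : hom (sqs wcospan) C & initial C (F 0 ([0], [1]))"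
proof -
 have Cs: "simplicial_set C" using C by (simp add: quasi_category_def)
 have Co: "quasi_category (op C)" by (rule quasi_category_op[OF C])
 note u = order_refl[of usq]
 show "left_kan Sq span C F \<longleftrightarrow> F : hom Sq C & cofib C F"
  using left_kan_iff[OF Cs u w_sub(3), of F] LK_span[OF C, of F] unfolding sqs_usq edges_vx cofib_def
  by (auto simp: left_kan_def)
 have "fl usq F : hom Sq (op C)" if "F : hom Sq C" using fl_hom[OF u, of F C] that by (simp only: sqs_usq rv_sets)
 then show "right_kan Sq cospan C F \<longleftrightarrow> F : hom Sq C & cofib (op C) (fl usq F)"
  using right_kan_iff[OF Cs u w_sub(4), of F] LK_span[OF Co, of "fl usq F"] unfolding sqs_usq edges_vx rv_sets cofib_def
  by (auto simp: right_kan_def)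
 have "fl wspan F 0 ([0], [1]) = F 0 ([0], [1])"
 proof -
  have "([0], [1]) : cell (sqs (rv ` wspan)) 0" unfolding rv_sets sqs_cell_0[OF w_sub(4)] by simp
  then show ?thesis by (simp add: fl_def sqf_def flip_def)
 qed
 moreover have "fl wspan F : hom (sqs wcospan) (op C)" if "F : hom (sqs wspan) C"
  using fl_hom[OF w_sub(3) that] by (simp only: rv_sets)
 ultimately show "right_kan (full_sub Sq span) top_edge C F \<longleftrightarrow> F : hom (sqs wspan) C & final C (F 0 ([0], [1]))"
  using right_kan_iff[OF Cs w_sub(3,1), of F] LK_cospan[OF Co, of "fl wspan F"] initial_op[OF Cs] unfolding edges_vx rv_sets
  by (auto simp: right_kan_def)
 show "left_kan (full_sub Sq cospan) right_edge C F \<longleftrightarrow> F : hom (sqs wcospan) C & initial C (F 0 ([0], [1]))"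
  using left_kan_iff[OF Cs w_sub(4,2), of F] LK_cospan[OF C, of F] unfolding edges_vx by (auto simp: left_kan_def)
qed

section \<open>Existence of cofiber squares\<close>

text \<open>Finite colimits are assumed for diagrams whose simplices are natural numbers, so the
  chains of the span are renamed through \<open>to_nat\<close>.\<close>

definition ncx :: "nat sset" where
 "ncx = \<lparr>cell = (%n. to_nat ` cell (cx span_cx) n),
   act = (%n th x. to_nat (act (cx span_cx) n th (from_nat x :: (pair) list)))\<rparr>"

abbreviation ndec :: "nat => nat => (pair) list" where
 "ndec == restr ncx (%_. from_nat)"

lemma span_simplicial: "simplicial_set (cx span_cx)"
 by (rule cx_simplicial[OF complex_span_cx])

lemma ncx_cell: "cell ncx n = to_nat ` cell (cx span_cx) n"
 by (simp add: ncx_def)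

lemma ncx_act: "act ncx n th (to_nat l) = to_nat (act (cx span_cx) n th l)"
 by (simp add: ncx_def)

lemma ncx_simplicial: "simplicial_set ncx"
proof (rule simplicial_setI)
 note S = span_simplicial
 show "act ncx n th x : cell ncx m" if "th : mono_maps m n" "x : cell ncx n" for m n th x
  using that sset_cell[OF S] by (auto simp only: ncx_cell ncx_act)
 show "act ncx n (id_map n) x = x" if "x : cell ncx n" for n x
  using that sset_id[OF S] by (auto simp only: ncx_cell ncx_act)
 show "act ncx m fi (act ncx n th x) = act ncx n (th \<cdot> fi) x"
  if "th : mono_maps m n" "fi : mono_maps k m" "x : cell ncx n" for k m n th fi x
  using that sset_act[OF S that(1,2)] by (auto simp only: ncx_cell ncx_act)
qed

lemma ncx_iso: "sset_iso ncx (cx span_cx) ndec"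
proof -
 have "ndec : hom ncx (cx span_cx)"
  by (rule restr_homI) (use sset_cell[OF ncx_simplicial] in \<open>auto simp only: ncx_cell ncx_act from_nat_to_nat\<close>)
 moreover have "bij_betw (ndec n) (cell ncx n) (cell (cx span_cx) n)" for n
  by (rule bij_betwI[where g = to_nat]) (auto simp: ncx_cell)
 ultimately show ?thesis by (simp add: sset_iso_def)
qed

text \<open>A sorted list with repetitions is a degeneracy of the increasing enumeration of its
  entries. Hence nondegenerate simplices are lists without repetition, and over a finite vertex set
  there are finitely many.\<close>

lemma nondegenerate_distinct:
 assumes K: "complex K" and l: "l : cell (cx K) n" and nd: "~ distinct l"
 obtains m th y where "m < n" "th : mono_maps n m" "y : cell (cx K) m" "l = act (cx K) m th y"
proof -
 let ?s = "set l"
 have l': "length l = Suc n" "sorted l" "?s : K" using l by (simp_all add: cx_cell)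
 have ne: "?s ~= {}" using l'(1) by auto
 then obtain m where m: "card ?s = Suc m" by (metis List.finite_set card_0_eq not0_implies_Suc)
 have "card ?s < length l" using nd card_distinct[of l] card_length[of l] by linarith
 then have mn: "m < n" using m l'(1) by simp
 have pos: "pos ?s x <= m" "enum ?s (pos ?s x) = x" if "x : ?s" for x
  using pos_props[OF List.finite_set that] m by auto
 have th: "map (pos ?s) l : mono_maps n m"
 proof (rule mono_mapsI)
  show "map (pos ?s) l ! i <= map (pos ?s) l ! j" if "i <= j" "j <= n" for i j
   using that l'(1,2) pos_le_iff[OF List.finite_set, of "l ! i" l "l ! j"] by (simp add: sorted_nth_mono)
  show "map (pos ?s) l ! i <= m" if "i <= n" for i using that l'(1) pos(1)[of "l ! i"] by simp
 qed (simp add: l')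
 have y: "sorted_list_of_set ?s : cell (cx K) m" using l'(3) m by (simp add: cx_cell)
 have "l = act (cx K) m (map (pos ?s) l) (sorted_list_of_set ?s)"
  by (simp add: map_idI pos(2))
 then show thesis by (rule that[OF mn th y])
qed

lemma finite_ncx: "finite_sset ncx"
proof -
 let ?D = "{l :: (pair) list. set l <= wspan & distinct l}"
 have "{(n, x). nondegenerate ncx n x} <= (%l. (length l - 1, to_nat l)) ` ?D"
 proof clarify
  fix n x assume nd: "nondegenerate ncx n x"
  then have "x : cell ncx n" by (simp add: nondegenerate_def)
  then obtain l where l: "l : cell (cx span_cx) n" "x = to_nat l" by (auto simp: ncx_cell)
  have "distinct l"
  proof (rule ccontr)
   assume "~ distinct l"
   from nondegenerate_distinct[OF complex_span_cx l(1) this] obtain m th y where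
    y: "m < n" "th : mono_maps n m" "y : cell (cx span_cx) m" "l = act (cx span_cx) m th y" .
   then have "x = act ncx m th (to_nat y)" "to_nat y : cell ncx m" unfolding l(2) ncx_act ncx_cell by auto
   then show False using nd y(1,2) unfolding nondegenerate_def by blast
  qed
  moreover have "set l <= wspan" "n = length l - 1" using l(1) by (auto simp: cx_cell span_cx_def)
  ultimately show "(n, x) : (%l. (length l - 1, to_nat l)) ` ?D" using l(2) by blast
 qed
 moreover have "finite ((%l. (length l - 1, to_nat l)) ` ?D)" by (intro finite_imageI finite_subset_distinct) simp
 ultimately show ?thesis using ncx_simplicial by (simp add: finite_sset_def finite_subset)
qed

lemma finite_op:
 assumes "finite_sset X" shows "finite_sset (op X)"
proof -
 have "nondegenerate X n x" if nd: "nondegenerate (op X) n x" for n x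
  unfolding nondegenerate_def
 proof (intro conjI allI impI ballI)
  show "x : cell X n" using nd by (simp add: nondegenerate_def)
  fix m th y assume "m < n" "th : mono_maps n m" "y : cell X m"
  then have "x ~= act (op X) m (flip m th) y" using nd flip_mono unfolding nondegenerate_def op_cell by blast
  then show "x ~= act X m th y" using \<open>th : _\<close> by simp
 qed
 then have "{(n, x). nondegenerate (op X) n x} <= {(n, x). nondegenerate X n x}" by blast
 then show ?thesis using assms unfolding finite_sset_def using finite_subset by blast
qed

text \<open>Existence of pushouts in a form that dualises well: the same statement about
  \<open>op C\<close> provides pullbacks in \<open>C\<close>.\<close>

definition exT :: "'a sset => bool" where
 "exT C \<longleftrightarrow> (ALL u:hom (cx span_cx) C. EX f. ccolim C span_cx f &
   (ALL m. ALL l:cell (cx span_cx) m. f m (map bcode l) = u m l))"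

lemma ncx_pull:
 assumes "u : hom (cx span_cx) C"
 shows "restr ncx (%m x. u m (ndec m x)) : hom ncx C"
 by (rule hom_compose[OF sset_iso_hom[OF ncx_iso] assms ncx_simplicial])

lemma colimit_ccolim:
 assumes C: "simplicial_set C" and K: "simplicial_set K" and c: "sset_iso K (cx span_cx) ndec" and q: "colimit_diagram K C q"
  and u: "!!m l. l : cell (cx span_cx) m ==> to_nat l : cell K m & q m (JL (to_nat l)) = u m l"
 shows "EX f. ccolim C span_cx f & (ALL m. ALL l:cell (cx span_cx) m. f m (map bcode l) = u m l)"
proof -
 have qh: "q : hom (K \<star> \<Delta> 0) C" using q by (simp add: colimit_diagram_def)
 let ?Ph = "restr (K \<star> \<Delta> 0) (jmap bcode ccode ndec (idm (\<Delta> 0)))"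
 note Ph = join_iso[OF K complex_span_cx c, of 0]
 have A: "sub_sset (K \<star> \<Delta> 0) (K \<star> \<Delta> 0)" by (rule join_sub) (use K in simp_all)
 have J: "complex (jcol span_cx (pw {..0}))" by (rule complex_jc[OF complex_span_cx complex_pw])
 have AB: "z : cell (K \<star> \<Delta> 0) n \<longleftrightarrow> ?Ph n z : cell (cx (jcol span_cx (pw {..0}))) n" if "z : cell (K \<star> \<Delta> 0) n" for n z
  using hom_cell[OF sset_iso_hom[OF Ph] that] that by simp
 obtain f where f: "f : hom (cx (jcol span_cx (pw {..0}))) C" "!!n z. z : cell (K \<star> \<Delta> 0) n ==> f n (?Ph n z) = q n z"
  by (rule sset_iso_push[OF Ph A sub_sset_refl[OF cx_simplicial[OF J]] AB qh], assumption) (rule that; (assumption | blast))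
 have qf: "f m (jmap bcode ccode ndec (%_ a. a) m z) = q m z" if z: "z : cell (K \<star> \<Delta> 0) m" for m z
 proof -
  have "jmap bcode ccode ndec (idm (\<Delta> 0)) m z = jmap bcode ccode ndec (%_ a. a) m z"
   using z by (cases z) (simp_all add: join_cell)
  then show ?thesis using f(2)[OF z] z by simp
 qed
 have "ccolim C span_cx f" using colimit_iff[OF C K complex_span_cx c qh f(1) qf] q by blast
 moreover have "f m (map bcode l) = u m l" if l: "l : cell (cx span_cx) m" for m l
 proof -
  have "ndec m (to_nat l) = l" using l by (auto simp: ncx_cell)
  then show ?thesis using qf[of "JL (to_nat l)" m] u[OF l] by (simp add: join_cell)
 qed
 ultimately show ?thesis by blast
qed

lemma finite_colimits_exT:
 assumes C: "simplicial_set C" and "has_finite_colimits C"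
 shows "exT C"
 unfolding exT_def
proof
 fix u assume u: "u : hom (cx span_cx) C"
 let ?p = "restr ncx (%m x. u m (ndec m x))"
 obtain q where q: "colimit_diagram ncx C q" "base_of_cocone ncx q = ?p"
  using assms(2) finite_ncx ncx_pull[OF u] unfolding has_finite_colimits_def by blast
 show "EX f. ccolim C span_cx f & (ALL m. ALL l:cell (cx span_cx) m. f m (map bcode l) = u m l)"
 proof (rule colimit_ccolim[OF C ncx_simplicial ncx_iso q(1)])
  fix m l assume "l : cell (cx span_cx) m"
  then have t: "to_nat l : cell ncx m" by (auto simp: ncx_cell)
  then have "q m (JL (to_nat l)) = ?p m (to_nat l)" unfolding q(2)[symmetric] base_of_cocone_def by simp
  then show "to_nat l : cell ncx m & q m (JL (to_nat l)) = u m l" using t by simp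
 qed
qed

text \<open>A span in \<open>op C\<close> is a diagram of shape \<open>op ncx\<close> in
  \<open>C\<close>; its limit cone becomes a colimit cone in the opposite.\<close>

lemma finite_limits_exT:
 assumes C: "simplicial_set C" and "has_finite_limits C"
 shows "exT (op C)"
 unfolding exT_def
proof
 fix u assume u: "u : hom (cx span_cx) (op C)"
 let ?K = "op ncx"
 let ?p = "restr ncx (%m x. u m (ndec m x))"
 have Ks: "simplicial_set ?K" by (rule op_simplicial[OF ncx_simplicial])
 have p: "?p : hom ?K C" using ncx_pull[OF u] hom_op_iff by blast
 obtain q where q: "limit_diagram ?K C q" "base_of_cone ?K q = ?p"
  using assms(2) finite_op[OF finite_ncx] p unfolding has_finite_limits_def by blast
 have qh: "q : hom (\<Delta> 0 \<star> ?K) C" using q(1) by (simp add: limit_diagram_def)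
 then have qh': "q : hom (op (\<Delta> 0 \<star> ?K)) (op C)" using op_hom_iff by blast
 have c: "sset_iso (op ?K) (cx span_cx) ndec"
 proof -
  have "ndec : hom (op ?K) (cx span_cx)" unfolding hom_op_iff hom_op_op by (rule sset_iso_hom[OF ncx_iso])
  then show ?thesis using ncx_iso by (simp add: sset_iso_def)
 qed
 have A: "sub_sset (op (\<Delta> 0 \<star> ?K)) (op (\<Delta> 0 \<star> ?K))" by (rule op_sub[OF join_sub]) (use Ks in simp_all)
 have B: "sub_sset (op ?K \<star> \<Delta> 0) (op ?K \<star> \<Delta> 0)" by (rule join_sub) (use op_simplicial[OF Ks] in simp_all)
 obtain q' where q': "q' : hom (op ?K \<star> \<Delta> 0) (op C)" "!!n z. z : cell (op (\<Delta> 0 \<star> ?K)) n ==> q' n (restr (\<Delta> 0 \<star> ?K) (sw 0) n z) = q n z"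
  by (rule sset_iso_push[OF sw_iso[OF Ks] A B _ qh']) (use hom_cell[OF sset_iso_hom[OF sw_iso[OF Ks]]] in blast)+
 have qs: "q' m (sw 0 m z) = q m z" if "z : cell (\<Delta> 0 \<star> ?K) m" for m z using q'(2)[of z m] that by simp
 show "EX f. ccolim (op C) span_cx f & (ALL m. ALL l:cell (cx span_cx) m. f m (map bcode l) = u m l)"
 proof (rule colimit_ccolim[OF op_simplicial[OF C] op_simplicial[OF Ks] c])
  show "colimit_diagram (op ?K) (op C) q'" using limit_iff_colimit_op[OF C Ks qh q'(1) qs] q(1) by blast
  fix m l assume "l : cell (cx span_cx) m"
  then have t: "to_nat l : cell ncx m" by (auto simp: ncx_cell)
  then have "q' m (JL (to_nat l)) = q m (JR (to_nat l))" using qs[of "JR (to_nat l)" m] by (simp add: join_cell)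
  also have "... = ?p m (to_nat l)" using t unfolding q(2)[symmetric] base_of_cone_def by simp
  finally show "to_nat l : cell (op ?K) m & q' m (JL (to_nat l)) = u m l" using t by simp
 qed
qed

text \<open>The square is the join of the span with its vertex \<open>(1, 1)\<close>, which
  therefore receives the code of the cone point.\<close>

definition acode :: "pair => triple" where
 "acode y = (if y = (1, 1) then ccode 0 else bcode y)"

lemma chn_wspan: "chn wspan = span_cx"
proof -
 have "{y : wspan. le2 y (1, 1)} = wspan" by (auto simp: le2_def)
 then show ?thesis using below_apex by simp
qed

lemma acode_map: "cx_map (chn usq) (jcol span_cx (pw {..0})) acode"
 unfolding cx_map_def
proof (intro ballI conjI impI)
 fix s assume s: "s : chn usq"
 let ?a = "s - {(1, 1)}" and ?b = "if (1, 1) : s then {0} else {}"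
 have e: "acode ` s = bcode ` ?a Un ccode ` ?b"
 proof -
  have "acode ` ?a = bcode ` ?a" by (rule image_cong) (simp_all add: acode_def)
  moreover have "acode (1, 1) = ccode 0" by (simp only: acode_def simp_thms if_True)
  moreover have "s = (if (1, 1) : s then insert (1, 1) ?a else ?a)" by auto
  ultimately show ?thesis by (smt (verit) image_insert image_empty insert_is_Un sup_commute sup_bot_right)
 qed
 have s': "s ~= {}" "s <= usq" "!!x y. x : s ==> y : s ==> le2 x y | le2 y x" using s unfolding chn_def by blast+
 have "?a <= wspan"
 proof
  fix x assume "x : ?a"
  then show "x : wspan" using usq_cases[of x] s'(2) by blast
 qed
 then have "?a : insert {} (chn wspan)" using s'(3) unfolding chn_def by blast
 then show "acode ` s : jcol span_cx (pw {..0})"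
  unfolding e col.jc_iff chn_wspan[symmetric] using s'(1) by (auto simp: pw_def)
 show "acode x <= acode y" if "x : s" "y : s" "x <= y" for x y
 proof -
  have le: "le2 x y" by (rule chn_le[OF s that])
  show ?thesis
  proof (cases "x = (1, 1)")
   case True
   then have "y = (1, 1)" using le s'(2) that(2) by (cases y) (auto simp: le2_def)
   then show ?thesis using True by simp
  next
   case False
   then show ?thesis using that(3) less_imp_le[OF col.less[of x 0]] col.sm(1) by (simp add: acode_def strict_mono_less_eq)
  qed
 qed
qed

text \<open>A colimit cone over the span is already a square once its vertices are recoded.\<close>

lemma cofib_exists:
 assumes ex: "exT C" and u: "u : hom (sqs wspan) C"
 obtains F where "F : hom Sq C" "cofib C F" "!!m s. s : cell (sqs wspan) m ==> F m s = u m s"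
proof -
 let ?u = "restr (cx span_cx) (%m l. u m (unz l))"
 let ?J = "jcol span_cx (pw {..0})"
 have "?u : hom (cx span_cx) C" using cx_sq_hom[OF w_sub(3) u] chn_wspan by simp
 then obtain f where f: "ccolim C span_cx f" "!!m l. l : cell (cx span_cx) m ==> f m (map bcode l) = ?u m l"
  using ex unfolding exT_def by blast
 have fh: "f : hom (cx ?J) C" using f(1) by (simp add: ccolim_def)
 let ?G = "restr (cx (chn usq)) (%m l. f m (map acode l))"
 have G: "?G : hom (cx (chn usq)) C" by (rule pull_hom[OF complex_chn fh acode_map])
 define F where "F = cmp Sq ?G (restr Sq (%_. zp))"
 have zh: "restr Sq (%_. zp) : hom Sq (cx (chn usq))" using zp_hom[of usq] unfolding sqs_usq .
 have F: "F : hom Sq C" unfolding F_def by (rule cmp_hom[OF zh G Sq_simplicial])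
 have Fs: "F m s = f m (map acode (zp s))" if "s : cell Sq m" for m s
  using that hom_cell[OF zh that] by (simp add: F_def)
 \<comment> \<open>On the codes of the cone, \<open>acode\<close> undoes \<open>vtx (1, 1)\<close>;
   so the cone of \<open>F\<close> at \<open>(1, 1)\<close> is the chosen colimit cone.\<close>
 have "ff (1, 1) span_cx F = f"
  unfolding ff_def
 proof (rule restr_eqI[OF fh])
  fix m l assume l: "l : cell (cx ?J) m"
  have "cx_map ?J (chn usq) (vtx (1, 1))" using vtx_map[of wspan usq "(1, 1)"] below_apex by simp
  then have v: "map (vtx (1, 1)) l : cell (cx (chn usq)) m" by (rule mono_map_cell[OF l])
  have "unz (map (vtx (1, 1)) l) : cell Sq m" using unz_cell[OF order_refl v] by (simp only: sqs_usq)
  then have e: "F m (unz (map (vtx (1, 1)) l)) = f m (map acode (map (vtx (1, 1)) l))" by (simp add: Fs)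
  have "set l : ?J" using l by (simp add: cx_cell)
  then obtain a b where ab: "set l = bcode ` a Un ccode ` b" "a : insert {} span_cx" "b : insert {} (pw {..0})" unfolding jc_def by blast
  have "(1, 1) ~: a" using ab(2) by (auto simp: span_cx_def)
  then have "acode y = bcode y" if "y : a" for y using that by (auto simp: acode_def)
  moreover have "acode (1, 1) = ccode i" if "i : b" for i using ab(3) that by (auto simp: acode_def pw_def)
  ultimately have "acode (vtx (1, 1) x) = x" if "x : set l" for x
   using that unfolding ab(1) by (elim UnE imageE) (simp_all only: vtx_simps)
  then have "map acode (map (vtx (1, 1)) l) = l" by (simp add: map_idI)
  then show "F m (unz (map (vtx (1, 1)) l)) = f m l" using e by simp
 qed
 then have "cofib C F" using f(1) by (simp add: cofib_def)
 moreover have "F m s = u m s" if s: "s : cell (sqs wspan) m" for m s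
 proof -
  have sq: "s : cell Sq m" "set (zp s) <= wspan" using s unfolding sqs_cell by blast+
  have l: "zp s : cell (cx span_cx) m" using zp_cell[OF s] chn_wspan by simp
  have "(1, 1) ~: wspan" by auto
  then have "(1, 1) ~: set (zp s)" using sq(2) by blast
  then have e: "map acode (zp s) = map bcode (zp s)" by (auto simp: acode_def)
  show ?thesis unfolding Fs[OF sq(1)] e using f(2)[OF l] l zp_length(2)[OF sq(1)] by simp
 qed
 ultimately show thesis using that F by blast
qed

section \<open>Extension of natural transformations along the square\<close>

text \<open>\<open>(0, 1)\<close> is maximal in the span, so a chain that contains it ends with
  it.\<close>

lemma corner_last:
 assumes s: "s : cell (sqs wspan) m" "s ~: cell (sqs wtop) m"
 shows "act Sq m [m] s = ([0], [1])"
proof -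
 have s': "s : cell Sq m" "set (zp s) <= wspan" "~ set (zp s) <= wtop" using s unfolding sqs_cell by blast+
 have ch: "length (zp s) = Suc m" "sorted (zp s)" "set (zp s) : chn wspan" using zp_cell[OF s(1)] by (simp_all add: cx_cell)
 have "(0, 1) : set (zp s)" using s'(2,3) by blast
 then obtain i where i: "i <= m" "zp s ! i = (0, 1)" using ch(1) by (auto simp: in_set_conv_nth less_Suc_eq_le)
 have "le2 (0, 1) (zp s ! m)" using chn_le[OF ch(3) nth_mem nth_mem sorted_nth_mono[OF ch(2)], of i m] i ch(1) by simp
 moreover have "zp s ! m : wspan" by (rule subsetD[OF s'(2) nth_mem]) (simp add: ch(1))
 ultimately have "zp s ! m = (0, 1)" by (auto simp: le2_def)
 then show ?thesis using zp_nth[OF s'(1), of m] by (simp add: Sq_act)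
qed

lemma prod_rel_mono:
 assumes "E <= U" "U <= W"
 shows "simplicial_set (prod_rel n (sqs W) (sqs U))"
  "sub_sset (prod_rel n (sqs W) (sqs E)) (prod_rel n (sqs W) (sqs U))"
proof -
 note prod_rel_sub[OF sqs_simplicial sqs_sub[OF assms(2)], of n]
  prod_rel_sub[OF sqs_simplicial sqs_sub[OF order_trans[OF assms]], of n]
 then have Us: "simplicial_set (prod_rel n (sqs W) (sqs U))" and As: "sub_sset (prod_rel n (sqs W) (sqs E)) (\<Delta> n \<otimes> sqs W)"
  using sub_sset_simplicial prod_simplicial[OF simplex_simplicial sqs_simplicial] by blast+
 show "simplicial_set (prod_rel n (sqs W) (sqs U))" by (rule Us)
 show "sub_sset (prod_rel n (sqs W) (sqs E)) (prod_rel n (sqs W) (sqs U))"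
  using sub_closed[OF As] sub_act[OF As] sub_cell[OF sqs_sub[OF assms(1)]]
  by (auto simp: sub_sset_def prod_rel_def)
qed

text \<open>A simplex outside the given part surjects onto \<open>\<Delta> n\<close> and contains
  the corner, so its last vertex is the corner over \<open>n\<close>. Finality at this single vertex
  therefore fills everything.\<close>

lemma corner_final_extension:
 assumes C: "simplicial_set C" and W: "wspan <= W" and u: "u : hom (prod_rel n (sqs W) (sqs wtop)) C"
  and fin: "final C (u 0 ([n], [0], [1]))"
 obtains u' where "u' : hom (prod_rel n (sqs W) (sqs wspan)) C"
  "!!m z. z : cell (prod_rel n (sqs W) (sqs wtop)) m ==> u' m z = u m z"
proof -
 let ?A = "prod_rel n (sqs W) (sqs wtop)" and ?B = "prod_rel n (sqs W) (sqs wspan)"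
 note Bs = prod_rel_mono(1)[OF w_sub(1) W, of n] and A = prod_rel_mono(2)[OF w_sub(1) W, of n]
 have "final C (u 0 (act ?B m [m] b))" if b: "b : cell ?B m" "b ~: cell ?A m" for m b
 proof -
  obtain a s where z: "b = (a, s)" by (cases b)
  have a: "a : mono_maps m n" "set a = {..n}" and s: "s : cell (sqs wspan) m" "s ~: cell (sqs wtop) m"
   using b unfolding z prod_rel_cell boundary_cell by blast+
  have "act Sq m [m] s = ([0], [1])" by (rule corner_last[OF s])
  then have "act ?B m [m] b = ([n], [0], [1])"
   using mono_full_ends(2)[OF a] by (simp add: z prod_rel_act)
  then show ?thesis using fin by simp
 qed
 note last = this
 show thesis
 proof (rule final_extension[OF Bs C A u fin])
  show "final C (u 0 (act ?B m [m] b))" if "b : cell ?B m" "b ~: cell ?A m" for m b by (rule last[OF that])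
 qed (rule that; assumption)
qed

text \<open>In the cospan, \<open>(0, 1)\<close> is minimal, so a chain that contains it starts with
  it.\<close>

lemma corner_first:
 assumes s: "s : cell (sqs wcospan) m" "s ~: cell (sqs wright) m"
 shows "act Sq m [0] s = ([0], [1])"
proof -
 have s': "s : cell Sq m" "set (zp s) <= wcospan" "~ set (zp s) <= wright" using s unfolding sqs_cell by blast+
 have ch: "length (zp s) = Suc m" "sorted (zp s)" "set (zp s) : chn wcospan" using zp_cell[OF s(1)] by (simp_all add: cx_cell)
 have "(0, 1) : set (zp s)" using s'(2,3) by blast
 then obtain i where i: "i <= m" "zp s ! i = (0, 1)" using ch(1) by (auto simp: in_set_conv_nth less_Suc_eq_le)
 have "le2 (zp s ! 0) (0, 1)" using chn_le[OF ch(3) nth_mem nth_mem sorted_nth_mono[OF ch(2)], of 0 i] i ch(1) by simp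
 moreover have "zp s ! 0 : wcospan" by (rule subsetD[OF s'(2) nth_mem]) (simp add: ch(1))
 ultimately have "zp s ! 0 = (0, 1)" by (auto simp: le2_def)
 then show ?thesis using zp_nth[OF s'(1), of 0] by (simp add: Sq_act)
qed

lemma corner_initial_extension:
 assumes C: "simplicial_set C" and W: "wcospan <= W" and u: "u : hom (prod_rel n (sqs W) (sqs wright)) C"
  and ini: "initial C (u 0 ([0], [0], [1]))"
 obtains u' where "u' : hom (prod_rel n (sqs W) (sqs wcospan)) C"
  "!!m z. z : cell (prod_rel n (sqs W) (sqs wright)) m ==> u' m z = u m z"
proof -
 let ?A = "prod_rel n (sqs W) (sqs wright)" and ?B = "prod_rel n (sqs W) (sqs wcospan)"
 note Bs = prod_rel_mono(1)[OF w_sub(2) W, of n] and A = prod_rel_mono(2)[OF w_sub(2) W, of n]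
 have "initial C (u 0 (act ?B m [0] b))" if b: "b : cell ?B m" "b ~: cell ?A m" for m b
 proof -
  obtain a s where z: "b = (a, s)" by (cases b)
  have a: "a : mono_maps m n" "set a = {..n}" and s: "s : cell (sqs wcospan) m" "s ~: cell (sqs wright) m"
   using b unfolding z prod_rel_cell boundary_cell by blast+
  have "act Sq m [0] s = ([0], [1])" by (rule corner_first[OF s])
  then have "act ?B m [0] b = ([0], [0], [1])"
   using mono_full_ends(1)[OF a] by (simp add: z prod_rel_act)
  then show ?thesis using ini by simp
 qed
 note last = this
 show thesis
 proof (rule initial_extension[OF Bs C A u ini])
  show "initial C (u 0 (act ?B m [0] b))" if "b : cell ?B m" "b ~: cell ?A m" for m b by (rule last[OF that])
 qed (rule that; assumption)
qed

section \<open>Simplices of the prism over the square as chains\<close>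

definition uz3 :: "(triple) list => nat list \<times> sq" where
 "uz3 l = (map fst l, unz (map snd l))"

definition z3 :: "nat list \<times> sq => (triple) list" where
 "z3 x = zip (fst x) (zp (snd x))"

lemma ple_iff: "ple x y \<longleftrightarrow> fst x <= fst y & le2 (snd x) (snd y)"
 by (simp add: ple_def le2_def)

lemma pchain_le: "pchain s ==> x : s ==> y : s ==> x <= y ==> ple x y"
 unfolding pchain_def using ple_le by (metis antisym ple_iff order_refl le2_refl)

text \<open>The span is the square without \<open>(1, 1)\<close>; for this reason
  \<open>prism0 n\<close> corresponds to the domain of the pushout-product with the span.\<close>

lemma z3_cell:
 assumes "x : cell (\<Delta> n \<otimes> Sq) m"
 shows "z3 x : cell (cx (prism n)) m" "uz3 (z3 x) = x"
  "z3 x : cell (cx (prism0 n)) m \<longleftrightarrow> x : cell (prod_rel n Sq (sqs wspan)) m"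
proof -
 obtain a s where x: "x = (a, s)" by (cases x)
 have a: "a : mono_maps m n" and s: "s : cell Sq m" using assms by (simp_all add: x)
 have l: "length a = Suc m" "length (zp s) = Suc m" "length (z3 x) = Suc m" using mono_mapsD(1)[OF a] zp_length(1)[OF s] by (simp_all add: x z3_def)
 have su: "set (zp s) <= usq" using s sqs_cell[of s usq m] unfolding sqs_usq by blast
 have ch: "sorted (zp s)" "set (zp s) : chn usq" using zp_cell[of s usq m] s by (simp_all only: sqs_usq cx_cell)
 have le: "ple (z3 x ! i) (z3 x ! j)" if ij: "i <= j" "j <= m" for i j
 proof -
  have "a ! i <= a ! j" using mono_mapsD(2)[OF a] l ij by (simp add: sorted_nth_mono)
  moreover have "le2 (zp s ! i) (zp s ! j)" using chn_le[OF ch(2)] ch(1) l ij by (simp add: sorted_nth_mono)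
  ultimately show ?thesis using l ij by (simp add: ple_iff x z3_def)
 qed
 have f: "map fst (z3 x) = a" "map snd (z3 x) = zp s" using l by (simp_all add: x z3_def)
 then have fs: "fst ` set (z3 x) = set a" "snd ` set (z3 x) = set (zp s)" by (metis list.set_map)+
 have "sorted (z3 x)" unfolding sorted_iff_nth_mono using le ple_le l(3) by (simp add: less_Suc_eq_le)
 moreover have "pchain (set (z3 x))"
  unfolding pchain_def
 proof (intro ballI)
  fix y z assume "y : set (z3 x)" "z : set (z3 x)"
  then obtain i j where "i <= m" "j <= m" "y = z3 x ! i" "z = z3 x ! j" using l(3) by (auto simp: in_set_conv_nth less_Suc_eq_le)
  then show "ple y z | ple z y" using le nat_le_linear by blast
 qed
 moreover have "set (z3 x) ~= {}" using l(3) by auto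
 moreover have "set (z3 x) <= {..n} \<times> {..1} \<times> {..1}"
 proof
  fix y assume "y : set (z3 x)"
  then have "fst y : set a" "snd y : set (zp s)" using fs by blast+
  then have "fst y : {..n}" "snd y : usq" using a su by (auto simp: mono_maps_def)
  then show "y : {..n} \<times> {..1} \<times> {..1}" by (cases y) simp
 qed
 ultimately have p: "set (z3 x) : prism n" and srt: "sorted (z3 x)" unfolding prism_def by blast+
 then show "z3 x : cell (cx (prism n)) m" using l by (simp add: cx_cell)
 show "uz3 (z3 x) = x" using f zp_length(2)[OF s] by (simp add: uz3_def x)
 have "(1, 1) ~: set (zp s) \<longleftrightarrow> s : cell (sqs wspan) m"
 proof -
  have 1: "(1, 1) ~: wspan" by auto
  have 2: "y : wspan" if "(1, 1) ~: set (zp s)" "y : set (zp s)" for y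
   using usq_cases[OF subsetD[OF su that(2)]] that by metis
  have "set (zp s) <= wspan \<longleftrightarrow> (1, 1) ~: set (zp s)"
  proof
   assume "set (zp s) <= wspan"
   then show "(1, 1) ~: set (zp s)" using 1 by (rule contra_subsetD)
  next
   assume n: "(1, 1) ~: set (zp s)"
   show "set (zp s) <= wspan" by (rule subsetI) (rule 2[OF n])
  qed
  then show ?thesis unfolding sqs_cell using s by blast
 qed
 then show "z3 x : cell (cx (prism0 n)) m \<longleftrightarrow> x : cell (prod_rel n Sq (sqs wspan)) m"
  using p srt l a s fs unfolding cx_cell prism0_def x prod_rel_cell boundary_cell by simp
qed

lemma uz3_cell:
 assumes "l : cell (cx (prism n)) m"
 shows "uz3 l : cell (\<Delta> n \<otimes> Sq) m" "z3 (uz3 l) = l"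
proof -
 have l: "length l = Suc m" "sorted l" "pchain (set l)" "set l <= {..n} \<times> usq" using assms by (auto simp: cx_cell prism_def)
 have le: "ple (l ! i) (l ! j)" if "i <= j" "j <= m" for i j
  using pchain_le[OF l(3)] that l(1,2) by (simp add: sorted_nth_mono)
 have "map fst l : mono_maps m n"
 proof (rule mono_mapsI)
  show "map fst l ! i <= map fst l ! j" if "i <= j" "j <= m" for i j using le[OF that] that l(1) by (simp add: ple_iff)
  show "map fst l ! i <= n" if "i <= m" for i using subsetD[OF l(4) nth_mem[of i l]] that l(1) by (auto simp: mem_Times_iff)
 qed (simp add: l)
 moreover have "map snd l : cell (cx (chn usq)) m"
 proof -
  have "sorted (map snd l)" unfolding sorted_iff_nth_mono using le le2_le l(1) by (simp add: ple_iff less_Suc_eq_le)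
  moreover have "snd ` set l : chn usq" using l unfolding chn_def pchain_def ple_iff by fastforce
  ultimately show ?thesis using l(1) by (simp add: cx_cell)
 qed
 then have "unz (map snd l) : cell Sq m" using unz_cell[OF order_refl] sqs_usq by metis
 ultimately show "uz3 l : cell (\<Delta> n \<otimes> Sq) m" by (simp add: uz3_def)
 show "z3 (uz3 l) = l" by (simp add: z3_def uz3_def zip_map_fst_snd)
qed

lemma map_map_nth_general: "(!!i. i : set th ==> i < length l) ==> map f (map ((!) l) th) = map ((!) (map f l)) th"
 by simp

lemma uz3_act: "th : mono_maps k m ==> length l = Suc m ==> uz3 (map ((!) l) th) = act (\<Delta> n \<otimes> Sq) m th (uz3 l)"
proof -
 assume th: "th : mono_maps k m" and l: "length l = Suc m"
 have "i < length l" if "i : set th" for i using that th l by (auto simp: mono_maps_def)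
 note e = map_map_nth_general[of th, OF this]
 show ?thesis using unz_act[OF th, of "map snd l"] l by (simp add: uz3_def after_def e del: map_map)
qed

lemma z3_act:
 assumes x: "x : cell (\<Delta> n \<otimes> Sq) m" and th: "th : mono_maps k m"
 shows "z3 (act (\<Delta> n \<otimes> Sq) m th x) = map ((!) (z3 x)) th"
proof -
 note c = z3_cell(1,2)[OF x]
 have "length (z3 x) = Suc m" using c(1) by (simp add: cx_cell)
 then have "act (\<Delta> n \<otimes> Sq) m th x = uz3 (map ((!) (z3 x)) th)" using uz3_act[OF th] c(2) by metis
 then show ?thesis using uz3_cell(2)[OF cx_act_cell[OF complex_prism th c(1)]] by simp
qed

text \<open>This is \<open>prism_extends\<close> carried back from chains to the product. The join
  of the span with a vertex sits at level \<open>0\<close> of the prism, so it is the first square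
  that has to be a pushout.\<close>

lemma cofib_extension:
 assumes C: "quasi_category C" and n: "0 < n" and u: "u : hom (prod_rel n Sq (sqs wspan)) C"
  and colim: "ccolim C span_cx (restr (cx (jcol span_cx (pw {..0}))) (%m l. u m (replicate (Suc m) 0, unz (map (vtx (1, 1)) l))))"
 obtains H where "H : hom (\<Delta> n \<otimes> Sq) C" "!!m z. z : cell (prod_rel n Sq (sqs wspan)) m ==> H m z = u m z"
proof -
 let ?P = "prod_rel n Sq (sqs wspan)"
 have sub: "sub_sset (sqs wspan) Sq" by (rule full_sub_sub) simp
 have Ps: "sub_sset ?P (\<Delta> n \<otimes> Sq)" by (rule prod_rel_sub[OF Sq_simplicial sub])
 have c0: "uz3 l : cell ?P m" if "l : cell (cx (prism0 n)) m" for l m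
 proof -
  have "l : cell (cx (prism n)) m" using that by (simp add: cx_cell prism0_def)
  from z3_cell(3)[OF uz3_cell(1)[OF this]] uz3_cell(2)[OF this] show ?thesis using that by simp
 qed
 let ?v = "restr (cx (prism0 n)) (%m l. u m (uz3 l))"
 have v: "?v : hom (cx (prism0 n)) C"
 proof (rule cx_homI[OF complex_prism0])
  show "u m (uz3 l) : cell C m" if "l : cell (cx (prism0 n)) m" for m l by (rule hom_cell[OF u c0[OF that]])
  show "u k (uz3 (map ((!) l) th)) = act C m th (u m (uz3 l))" if th: "th : mono_maps k m" and l: "l : cell (cx (prism0 n)) m" for k m th l
  proof -
   have "uz3 (map ((!) l) th) = act ?P m th (uz3 l)" unfolding sub_act[OF Ps] using uz3_act[OF th, of l n] l by (simp add: cx_cell)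
   then show ?thesis using hom_act[OF u th c0[OF l]] by simp
  qed
 qed
 let ?J = "jcol span_cx (pw {..0})"
 have "restr (cx ?J) (%m l. ?v m (map uncode l)) = restr (cx ?J) (%m l. u m (replicate (Suc m) 0, unz (map (vtx (1, 1)) l)))"
 proof (rule restr_cong)
  fix m l assume l: "l : cell (cx ?J) m"
  have l': "length l = Suc m" "sorted l" "set l : ?J" using l by (simp_all add: cx_cell)
  then obtain a b where ab: "set l = bcode ` a Un ccode ` b" "a : insert {} span_cx" "b : insert {} (pw {..0})" "~ (a = {} & b = {})" unfolding jc_def by blast
  have b: "b <= {0}" using ab(3) by (auto simp: pw_def)
  have x: "fst x = 0 & snd x = y ==> x = (0, y)" for x :: "triple" and y by (cases x) simp
  have e: "uncode x = (0, vtx (1, 1) x)" if "x : set l" for x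
   using that b unfolding ab(1) by (auto simp del: One_nat_def)
  have "uz3 (map uncode l) = (map (%_. 0) l, unz (map (vtx (1, 1)) l))"
   using e by (auto simp: uz3_def comp_def intro!: arg_cong[of _ _ unz])
  also have "map (%_. 0) l = replicate (Suc m) 0" using l'(1) by (simp add: map_replicate_const)
  finally have u1: "uz3 (map uncode l) = (replicate (Suc m) 0, unz (map (vtx (1, 1)) l))" .
  have "b <= {..n}" using b by auto
  then have p: "uncode ` set l : prism n" unfolding ab(1) uncode_img by (rule uncode_prism[OF ab(2) _ ab(4)])
  have "fst ` uncode ` set l <= {0}" using e by auto
  then have "fst ` uncode ` set l ~= {..n}" using n by auto
  then have "uncode ` set l : prism0 n" using p by (simp add: prism0_def)
  moreover have "sorted (map uncode l)"
  proof -
   have "mono_on (set l) (vtx (1, 1))"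
   proof -
    have "cx_map ?J (chn usq) (vtx (1, 1))" using vtx_map[of wspan usq "(1, 1)"] below_apex by simp
    then show ?thesis using l'(3) unfolding cx_map_def by (auto intro!: mono_onI)
   qed
   then have "sorted_wrt (%x y. uncode x <= uncode y) l"
    using l'(2) e by (auto intro!: sorted_wrt_mono_rel[OF _ l'(2)] dest: mono_onD)
   then show ?thesis by (simp add: sorted_map)
  qed
  ultimately have "map uncode l : cell (cx (prism0 n)) m" using l'(1) by (simp add: cx_cell)
  then show "?v m (map uncode l) = u m (replicate (Suc m) 0, unz (map (vtx (1, 1)) l))" using u1 by simp
 qed
 then have "extends C (prism0 n) (prism n) ?v" using prism_extends[OF C n v] colim by simp
 then obtain g where g: "g : hom (cx (prism n)) C" "!!m l. l : cell (cx (prism0 n)) m ==> g m l = ?v m l" unfolding extends_def by blast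
 have D: "simplicial_set (\<Delta> n \<otimes> Sq)" by (rule prod_simplicial) simp_all
 have H: "restr (\<Delta> n \<otimes> Sq) (%m x. g m (z3 x)) : hom (\<Delta> n \<otimes> Sq) C"
 proof (rule restr_homI)
  show "g m (z3 x) : cell C m" if "x : cell (\<Delta> n \<otimes> Sq) m" for m x by (rule hom_cell[OF g(1) z3_cell(1)[OF that]])
  show "act (\<Delta> n \<otimes> Sq) m th x : cell (\<Delta> n \<otimes> Sq) k" if "th : mono_maps k m" "x : cell (\<Delta> n \<otimes> Sq) m" for k m th x
   using sset_cell[OF D that] .
  show "g k (z3 (act (\<Delta> n \<otimes> Sq) m th x)) = act C m th (g m (z3 x))" if "th : mono_maps k m" "x : cell (\<Delta> n \<otimes> Sq) m" for k m th x
   using cx_hom_act[OF g(1) that(1) z3_cell(1)[OF that(2)]] z3_act[OF that(2,1)] by simp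
 qed
 show thesis
 proof (rule that[OF H])
  fix m z assume z: "z : cell ?P m"
  have zc: "z : cell (\<Delta> n \<otimes> Sq) m" by (rule sub_cell[OF Ps z])
  then have "z3 z : cell (cx (prism0 n)) m" using z3_cell(3) z by blast
  then show "restr (\<Delta> n \<otimes> Sq) (%m x. g m (z3 x)) m z = u m z" using g(2) z3_cell(2)[OF zc] zc by (simp del: prod_cell)
 qed
qed

text \<open>The reversal of the prism in both factors; it exchanges the levels \<open>0\<close> and
  \<open>n\<close> and the span with the cospan.\<close>

definition psf :: "nat => nat list \<times> sq => nat list \<times> sq" where
 "psf n x = (flip n (fst x), sqf (snd x))"

lemma psf_act:
 assumes "x : cell (\<Delta> n \<otimes> Sq) m" "th : mono_maps k m"
 shows "psf n (act (\<Delta> n \<otimes> Sq) m th x) = act (\<Delta> n \<otimes> Sq) m (flip m th) (psf n x)"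
 using assms flip_after[OF assms(2), of "fst x" n] mono_mapsD(1)[of "fst x" m n] sqf_act[of "snd x" m th k]
 by (cases x) (simp add: psf_def)

lemma psf_hom:
 assumes X: "sub_sset X (\<Delta> n \<otimes> Sq)" and Y: "sub_sset Y (\<Delta> n \<otimes> Sq)" and f: "f : hom Y C"
  and XY: "!!m x. x : cell X m ==> psf n x : cell Y m"
 shows "restr X (%m x. f m (psf n x)) : hom X (op C)"
proof (rule restr_homI)
 show "f m (psf n x) : cell (op C) m" if "x : cell X m" for m x using hom_cell[OF f XY[OF that]] by simp
 fix k m th x assume th: "th : mono_maps k m" and x: "x : cell X m"
 show "act X m th x : cell X k" using sub_closed[OF X th x] sub_act[OF X] by simp
 show "f k (psf n (act X m th x)) = act (op C) m th (f m (psf n x))"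
  using hom_act[OF f flip_mono[OF th] XY[OF x]] psf_act[OF sub_cell[OF X x] th] sub_act[OF X] sub_act[OF Y] by simp
qed

lemma psf_cell:
 assumes "x : cell (\<Delta> n \<otimes> Sq) m"
 shows "psf n x : cell (\<Delta> n \<otimes> Sq) m" "psf n (psf n x) = x"
  "W <= usq ==> x : cell (prod_rel n Sq (sqs W)) m ==> psf n x : cell (prod_rel n Sq (sqs (rv ` W))) m"
proof -
 obtain a s where x: "x = (a, s)" by (cases x)
 have a: "a : mono_maps m n" and s: "s : cell Sq m" using assms by (simp_all add: x)
 have s': "sqf s : cell Sq m" using sqf_cell[of usq s m] s by (simp only: rv_sets sqs_usq order_refl)
 show "psf n x : cell (\<Delta> n \<otimes> Sq) m" using a s' by (simp add: x psf_def)
 show "psf n (psf n x) = x" using a s sqf_sqf by (simp add: x psf_def)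
 show "psf n x : cell (prod_rel n Sq (sqs (rv ` W))) m" if W: "W <= usq" and xc: "x : cell (prod_rel n Sq (sqs W)) m"
 proof -
  have "a : cell (boundary n) m | s : cell (sqs W) m" using xc unfolding x prod_rel_cell by blast
  then have "flip n a : cell (boundary n) m | sqf s : cell (sqs (rv ` W)) m"
   using flip_boundary sqf_cell[OF W] by blast
  then show ?thesis using flip_mono[OF a] s' unfolding x psf_def fst_conv snd_conv prod_rel_cell by blast
 qed
qed

lemma replicate_boundary:
 assumes "i <= n" "0 < n" shows "replicate (Suc m) i : cell (boundary n) m"
proof -
 have "(if i = 0 then n else 0) : {..n} - {i}" using assms by auto
 then have "{i} ~= {..n}" by blast
 moreover have "set (replicate (Suc m) i) = {i}" by (rule set_replicate) simp
 ultimately show ?thesis using replicate_mono[OF assms(1), of m] by (simp add: boundary_cell del: replicate_Suc set_replicate)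
qed

text \<open>The extension problem for the cospan is that for the span in \<open>op C\<close>,
  transported along \<open>psf\<close>. As the levels are reversed, it is the last square that has
  to be a pullback.\<close>

lemma fib_extension:
 assumes C: "quasi_category C" and n: "0 < n" and u: "u : hom (prod_rel n Sq (sqs wcospan)) C"
  and colim: "ccolim (op C) span_cx (restr (cx (jcol span_cx (pw {..0}))) (%m l. u m (replicate (Suc m) n, sqf (unz (map (vtx (1, 1)) l)))))"
 obtains H where "H : hom (\<Delta> n \<otimes> Sq) C" "!!m z. z : cell (prod_rel n Sq (sqs wcospan)) m ==> H m z = u m z"
proof -
 let ?S = "prod_rel n Sq (sqs wspan)" and ?T = "prod_rel n Sq (sqs wcospan)" and ?D = "\<Delta> n \<otimes> Sq"
 have sub: "sub_sset (sqs W) Sq" for W by (rule full_sub_sub) simp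
 have S: "sub_sset ?S ?D" and T: "sub_sset ?T ?D" by (rule prod_rel_sub[OF Sq_simplicial sub])+
 have D: "sub_sset ?D ?D" by (rule sub_sset_refl[OF prod_simplicial]) simp_all
 have ST: "psf n x : cell ?T m" if "x : cell ?S m" for x m
  using psf_cell(3)[OF sub_cell[OF S that] w_sub(3) that] unfolding rv_sets .
 have TS: "psf n x : cell ?S m" if "x : cell ?T m" for x m
  using psf_cell(3)[OF sub_cell[OF T that] w_sub(4) that] unfolding rv_sets .
 let ?u = "restr ?S (%m x. u m (psf n x))"
 have u': "?u : hom ?S (op C)" by (rule psf_hom[OF S T u ST])
 let ?J = "jcol span_cx (pw {..0})"
 have e: "restr (cx ?J) (%m l. ?u m (replicate (Suc m) 0, unz (map (vtx (1, 1)) l))) =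
   restr (cx ?J) (%m l. u m (replicate (Suc m) n, sqf (unz (map (vtx (1, 1)) l))))"
 proof (rule restr_cong)
  fix m l assume l: "l : cell (cx ?J) m"
  have "cx_map ?J (chn usq) (vtx (1, 1))" using vtx_map[of wspan usq "(1, 1)"] below_apex by simp
  then have "unz (map (vtx (1, 1)) l) : cell (sqs usq) m" by (rule unz_cell[OF order_refl mono_map_cell[OF l]])
  then have "unz (map (vtx (1, 1)) l) : cell Sq m" unfolding sqs_usq .
  moreover have "replicate (Suc m) 0 : cell (boundary n) m" by (rule replicate_boundary[OF _ n]) simp
  moreover have "flip n (replicate (Suc m) 0) = replicate (Suc m) n" by (simp add: flip_def del: replicate_Suc)
  ultimately show "?u m (replicate (Suc m) 0, unz (map (vtx (1, 1)) l)) = u m (replicate (Suc m) n, sqf (unz (map (vtx (1, 1)) l)))"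
   unfolding psf_def by (subst restr_apply) (simp_all only: prod_rel_cell boundary_cell fst_conv snd_conv simp_thms)
 qed
 obtain H where H: "H : hom ?D (op C)" "!!m z. z : cell ?S m ==> H m z = ?u m z"
  by (rule cofib_extension[OF quasi_category_op[OF C] n u' colim[folded e]]) (rule that; (assumption | blast))
 let ?H = "restr ?D (%m x. H m (psf n x))"
 have "?H : hom ?D (op (op C))" by (rule psf_hom[OF D D H(1) psf_cell(1)])
 then have "?H : hom ?D C" using hom_op_op by blast
 moreover have "?H m z = u m z" if z: "z : cell ?T m" for m z
 proof -
  have zc: "z : cell ?D m" by (rule sub_cell[OF T z])
  have "?H m z = ?u m (psf n z)" using H(2)[OF TS[OF z]] zc by (simp only: restr_apply)
  also have "... = u m z" using TS[OF z] psf_cell(2)[OF zc] by (simp only: restr_apply)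
  finally show ?thesis .
 qed
 ultimately show thesis by (rule that)
qed

section \<open>Lifting along restriction functors\<close>

lemma map_of_vertex_eval: "x : cell X m ==> map_of_vertex X h m x = h m (replicate (Suc m) 0, x)"
 by (simp add: map_of_vertex_def)

text \<open>A list with constant value \<open>i\<close> is a degeneracy of the vertex
  \<open>[i]\<close>, so over it the transposed sphere shows the diagram at that vertex.\<close>

lemma sphere_vertex:
 assumes s: "s : hom (boundary n) (Fun X C)" and n: "0 < n" and i: "i <= n" and x: "x : cell X m"
 shows "s m (replicate (Suc m) i) m (id_map m, x) = map_of_vertex X (s 0 [i]) m x"
proof -
 have b: "[i] : cell (boundary n) 0" using replicate_boundary[OF i n, of 0] by simp
 have r: "replicate (Suc m) 0 : mono_maps m 0" by (rule replicate_mono) simp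
 have "act (boundary n) 0 (replicate (Suc m) 0) [i] = replicate (Suc m) i" by (simp add: after_def del: replicate_Suc)
 then show ?thesis using hom_Fun_eval[OF s r b x] map_of_vertex_eval[OF x] by metis
qed

text \<open>Lifting a sphere along restriction is the same as extending from the domain of the
  pushout-product. The diagrams at the vertices of the sphere are passed on to \<open>ext\<close>,
  since the universal properties are properties of these diagrams.\<close>

lemma precomp_lift:
 assumes X: "simplicial_set X" and X': "simplicial_set X'" and Y: "sub_sset Y X"
  and j: "!!m x. x : cell X' m ==> j m x : cell X m"
   "!!m k th x. x : cell X' m ==> th : mono_maps k m ==> j k (act X' m th x) = act X m th (j m x)"
  and r: "!!m x. x : cell Y m ==> r m x : cell X' m & j m (r m x) = x"
   "!!m x. x : cell X' m ==> j m x : cell Y m & r m (j m x) = x"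
  and n: "0 < n" and s: "s : hom (boundary n) (Fun X C)" and d: "d : hom (\<Delta> n \<otimes> X') C"
  and pd: "!!m a. a : cell (boundary n) m ==> precomp X' X C j m (s m a) = act (Fun X' C) n a d"
  and ext: "!!u. u : hom (prod_rel n X Y) C ==>
   (!!i m x. i <= n ==> x : cell X m ==> u m (replicate (Suc m) i, x) = map_of_vertex X (s 0 [i]) m x) ==>
   EX H:hom (\<Delta> n \<otimes> X) C. ALL m. ALL z:cell (prod_rel n X Y) m. H m z = u m z"
 shows "EX H. sphere_fill (Fun X C) n s H & precomp X' X C j n H = d"
proof -
 obtain u where u: "u : hom (prod_rel n X Y) C"
  "!!m a x. a : cell (boundary n) m ==> x : cell X m ==> u m (a, x) = s m a m (id_map m, x)"
  "!!m a x. a : mono_maps m n ==> x : cell X' m ==> u m (a, j m x) = d m (a, x)"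
  by (rule precomp_lift_glue[OF X X' Y j r s d pd], assumption+) (rule that; (assumption | blast))
 have "u m (replicate (Suc m) i, x) = map_of_vertex X (s 0 [i]) m x" if i: "i <= n" and x: "x : cell X m" for i m x
 proof -
  show ?thesis using u(2)[OF replicate_boundary[OF i n] x] sphere_vertex[OF s n i x] by simp
 qed
 from ext[OF u(1) this] obtain H where H: "H : hom (\<Delta> n \<otimes> X) C" "!!m z. z : cell (prod_rel n X Y) m ==> H m z = u m z"
  by blast
 have "sphere_fill (Fun X C) n s H"
 proof (rule sphere_fill_Fun[OF X s H(1)])
  fix m a x assume a: "a : cell (boundary n) m" and x: "x : cell X m"
  then have "(a, x) : cell (prod_rel n X Y) m" by (simp add: prod_rel_cell boundary_cell)
  then show "H m (a, x) = s m a m (id_map m, x)" using H(2) u(2)[OF a x] by simp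
 qed
 moreover have "precomp X' X C j n H = d"
 proof (rule precomp_lift_fill[OF X X' j H(1) d])
  fix m a x assume a: "a : mono_maps m n" and x: "x : cell X' m"
  then have "(a, j m x) : cell (prod_rel n X Y) m" using j(1)[OF x] r(2)[OF x] by (simp add: prod_rel_cell)
  then show "H m (a, j m x) = d m (a, x)" using H(2) u(3)[OF a x] by simp
 qed
 ultimately show ?thesis by blast
qed

lemma map_of_vertex_hom:
 assumes X: "simplicial_set X" and d: "d : hom (\<Delta> 0 \<otimes> X) C" shows "map_of_vertex X d : hom X C"
 unfolding map_of_vertex_def
proof (rule restr_homI)
 have r: "replicate (Suc m) 0 : mono_maps m 0" for m by (rule replicate_mono) simp
 show "d m (replicate (Suc m) 0, x) : cell C m" if "x : cell X m" for m x
  using hom_cell[OF d] r that by simp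
 show "act X m th x : cell X k" if "th : mono_maps k m" "x : cell X m" for k m th x using sset_cell[OF X that] .
 show "d k (replicate (Suc k) 0, act X m th x) = act C m th (d m (replicate (Suc m) 0, x))"
  if "th : mono_maps k m" "x : cell X m" for k m th x
 proof -
  have "replicate (Suc m) 0 \<cdot> th = replicate (Suc k) 0" by (rule mono_maps_target_0[OF after_mono[OF r that(1)] r])
  then show ?thesis using hom_act[OF d that(1), of "(replicate (Suc m) 0, x)"] r that by simp
 qed
qed

lemma vertex_of_hom:
 assumes X: "simplicial_set X" and F: "F : hom X C" shows "vertex_of X F : hom (\<Delta> 0 \<otimes> X) C"
 unfolding vertex_of_def
 by (rule restr_homI) (use hom_cell[OF F] hom_act[OF F] sset_cell[OF X] after_mono in auto)

lemma map_of_vertex_of: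
 assumes "F : hom X C" shows "map_of_vertex X (vertex_of X F) = F"
 unfolding map_of_vertex_def
proof (rule restr_eqI[OF assms])
 have r: "replicate (Suc m) 0 : mono_maps m 0" for m by (rule replicate_mono) simp
 show "vertex_of X F m (replicate (Suc m) 0, x) = F m x" if "x : cell X m" for m x
  using r that by (simp add: vertex_of_def)
qed

text \<open>An instance of \<open>section_extension\<close> for the restriction functor:
  \<open>zero\<close> provides the extension of single diagrams, \<open>suc\<close> that of
  transformations. The property \<open>P\<close> stands for the Kan condition on objects.\<close>

lemma kan_section_exists:
 assumes C: "simplicial_set C" and X: "simplicial_set X" and AV: "full_sub X V = A"
  and zero: "!!D. D : hom A C ==> EX F:hom X C. P F & (ALL m. ALL x:cell A m. F m x = D m x)"
  and suc: "!!n F u. 0 < n ==> (!!i. i <= n ==> P (F i)) ==> u : hom (prod_rel n X A) C ==>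
   (!!i m x. i <= n ==> x : cell X m ==> u m (replicate (Suc m) i, x) = F i m x) ==>
   EX H:hom (\<Delta> n \<otimes> X) C. ALL m. ALL z:cell (prod_rel n X A) m. H m z = u m z"
 shows "EX S. kan_section X V C S & (ALL u:cell (Fun (full_sub X V) C) 0.
  map_of_vertex X (S 0 u) : hom X C & P (map_of_vertex X (S 0 u)))"
proof -
 have A: "sub_sset A X" unfolding AV[symmetric] by (rule full_sub_sub[OF X])
 have As: "simplicial_set A" by (rule sub_sset_simplicial[OF A X])
 let ?p = "precomp A X C (%_ x. x)"
 have ph: "?p : hom (Fun X C) (Fun A C)" by (rule precomp_hom[OF As X]) (use sub_cell[OF A] sub_act[OF A] in simp_all)
 show ?thesis
 proof (rule section_extension[OF Fun_simplicial[OF X] Fun_simplicial[OF As] ph, where G = "%e. P (map_of_vertex X e)"])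
 show "EX e:cell (Fun X C) 0. ?p 0 e = d & P (map_of_vertex X e)" if "d : cell (Fun A C) 0" for d
 proof -
  have d: "d : hom (\<Delta> 0 \<otimes> A) C" using that by simp
  obtain F where F: "F : hom X C" "P F" "!!m x. x : cell A m ==> F m x = map_of_vertex A d m x"
   using zero[OF map_of_vertex_hom[OF As d]] by blast
  have v: "vertex_of X F : hom (\<Delta> 0 \<otimes> X) C" by (rule vertex_of_hom[OF X F(1)])
  have "?p 0 (vertex_of X F) = d"
   unfolding precomp_apply[OF v]
  proof (rule restr_eqI[OF d])
   fix m z assume "z : cell (\<Delta> 0 \<otimes> A) m"
   then obtain a x where z: "z = (a, x)" "a : mono_maps m 0" "x : cell A m" by (cases z) auto
   have "a = replicate (Suc m) 0" by (rule mono_maps_target_0[OF z(2) replicate_mono]) simp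
   then show "(case z of (a, x) => vertex_of X F m (a, x)) = d m z"
    using z F(3) sub_cell[OF A] by (simp add: vertex_of_def map_of_vertex_eval)
  qed
  then show ?thesis using v F(2) map_of_vertex_of[OF F(1)] by (intro bexI[of _ "vertex_of X F"]) simp_all
 qed
 fix n d s assume n: "(0::nat) < n" and d: "d : cell (Fun A C) n" and s: "s : hom (boundary n) (Fun X C)"
  and sd: "!!m a. a : cell (boundary n) m ==> ?p m (s m a) = act (Fun A C) n a d"
  and G: "!!i. i <= n ==> P (map_of_vertex X (s 0 [i]))"
 have d': "d : hom (\<Delta> n \<otimes> A) C" using d by simp
 show "EX e. sphere_fill (Fun X C) n s e & ?p n e = d"
 proof (rule precomp_lift[OF X As A _ _ _ _ n s d', where r = "%_ x. x"])
  show "x : cell X m" if "x : cell A m" for m x using sub_cell[OF A that] .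
  show "act A m th x = act X m th x" for m th x using sub_act[OF A] by simp
  show "x : cell A m & x = x" "x : cell A m & x = x" if "x : cell A m" for m x using that by simp_all
  show "?p m (s m a) = act (Fun A C) n a d" if "a : cell (boundary n) m" for m a by (rule sd[OF that])
  show "EX H:hom (\<Delta> n \<otimes> X) C. ALL m. ALL z:cell (prod_rel n X A) m. H m z = u m z"
   if "u : hom (prod_rel n X A) C"
    "!!i m x. i <= n ==> x : cell X m ==> u m (replicate (Suc m) i, x) = map_of_vertex X (s 0 [i]) m x" for u
   by (rule suc[OF n G that])
 qed
 next
  fix S assume S: "S : hom (Fun A C) (Fun X C)" "cmp (Fun A C) ?p S = idm (Fun A C)"
   "!!u. u : cell (Fun A C) 0 ==> P (map_of_vertex X (S 0 u))"
  have "map_of_vertex X (S 0 u) : hom X C" if "u : cell (Fun A C) 0" for u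
   by (rule map_of_vertex_hom[OF X]) (use hom_cell[OF S(1) that] in simp)
  then show ?thesis using S unfolding kan_section_def AV by blast
 qed
qed

section \<open>The Kan extension functors\<close>

lemma prod_rel_self: "prod_rel n X X = \<Delta> n \<otimes> X"
 by (auto simp: prod_rel_def prod_sset_def fun_eq_iff)

lemma corner_new: "([0], [1]) ~: cell (sqs wtop) 0" "([0], [1]) ~: cell (sqs wright) 0"
 "([0], [1]) : cell (sqs wspan) 0" "([0], [1]) : cell (sqs wcospan) 0"
 using sqs_cell_0[OF w_sub(5)] sqs_cell_0[OF w_sub(6)] sqs_cell_0[OF w_sub(3)] sqs_cell_0[OF w_sub(4)] by auto

lemma vtx_Sq: "l : cell (cx (jcol span_cx (pw {..0}))) m ==> unz (map (vtx (1, 1)) l) : cell Sq m"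
proof -
 assume l: "l : cell (cx (jcol span_cx (pw {..0}))) m"
 have "cx_map (jcol span_cx (pw {..0})) (chn usq) (vtx (1, 1))" using vtx_map[of wspan usq "(1, 1)"] below_apex by simp
 then have "unz (map (vtx (1, 1)) l) : cell (sqs usq) m" by (rule unz_cell[OF order_refl mono_map_cell[OF l]])
 then show ?thesis unfolding sqs_usq .
qed

lemma fl_apply: "s : cell Sq m ==> fl usq F m s = F m (sqf s)"
 unfolding fl_def rv_sets sqs_usq by simp

lemma sqf_Sq: "s : cell Sq m ==> sqf s : cell Sq m"
 using sqf_cell[of usq s m] by (simp only: rv_sets sqs_usq order_refl)

lemma final_corner_extends:
 assumes C: "simplicial_set C" and D: "D : hom (sqs wtop) C" and z: "final C z"
 shows "EX F:hom (sqs wspan) C. final C (F 0 ([0], [1])) & (ALL m. ALL x:cell (sqs wtop) m. F m x = D m x)"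
proof (rule final_extension[OF sqs_simplicial C sqs_sub[OF w_sub(1)] D z])
 fix m b assume "b : cell (sqs wspan) m" "b ~: cell (sqs wtop) m" "act (sqs wspan) m [m] b : cell (sqs wtop) 0"
 then have "([0], [1]) : cell (sqs wtop) 0" using corner_last[of b m] by (simp del: insert_iff)
 then show "final C (D 0 (act (sqs wspan) m [m] b))" using corner_new by blast
next
 fix F assume F: "F : hom (sqs wspan) C" "!!m x. x : cell (sqs wtop) m ==> F m x = D m x"
  "!!b. b : cell (sqs wspan) 0 ==> b ~: cell (sqs wtop) 0 ==> F 0 b = z"
 have "F 0 ([0], [1]) = z" by (rule F(3)[OF corner_new(3,1)])
 then show ?thesis using F z by blast
qed

lemma initial_corner_extends:
 assumes C: "simplicial_set C" and D: "D : hom (sqs wright) C" and z: "initial C z"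
 shows "EX F:hom (sqs wcospan) C. initial C (F 0 ([0], [1])) & (ALL m. ALL x:cell (sqs wright) m. F m x = D m x)"
proof (rule initial_extension[OF sqs_simplicial C sqs_sub[OF w_sub(2)] D z])
 fix m b assume "b : cell (sqs wcospan) m" "b ~: cell (sqs wright) m" "act (sqs wcospan) m [0] b : cell (sqs wright) 0"
 then have "([0], [1]) : cell (sqs wright) 0" using corner_first[of b m] by (simp del: insert_iff)
 then show "initial C (D 0 (act (sqs wcospan) m [0] b))" using corner_new by blast
next
 fix F assume F: "F : hom (sqs wcospan) C" "!!m x. x : cell (sqs wright) m ==> F m x = D m x"
  "!!b. b : cell (sqs wcospan) 0 ==> b ~: cell (sqs wright) 0 ==> F 0 b = z"
 have "F 0 ([0], [1]) = z" by (rule F(3)[OF corner_new(4,2)])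
 then show ?thesis using F z by blast
qed

text \<open>A pullback square is the reflection of a pushout square in \<open>op C\<close>, and the
  reflection is an involution on \<open>Sq\<close>.\<close>

lemma fib_exists:
 assumes ex: "exT (op C)" and u: "u : hom (sqs wcospan) C"
 shows "EX F:hom Sq C. cofib (op C) (fl usq F) & (ALL m. ALL s:cell (sqs wcospan) m. F m s = u m s)"
proof -
 have u': "fl wcospan u : hom (sqs wspan) (op C)" using fl_hom[OF w_sub(4) u] unfolding rv_sets .
 obtain G where G: "G : hom Sq (op C)" "cofib (op C) G" "!!m s. s : cell (sqs wspan) m ==> G m s = fl wcospan u m s"
  by (rule cofib_exists[OF ex u']) (rule that; (assumption | blast))
 have F: "fl usq G : hom Sq C"
  using fl_hom[OF order_refl, of G "op C"] G(1) unfolding rv_sets sqs_usq hom_op_op by blast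
 have "fl usq (fl usq G) = G"
  unfolding fl_def[of usq "fl usq G"] rv_sets sqs_usq
  by (rule restr_eqI[OF G(1)]) (simp only: fl_apply sqf_Sq sqf_sqf)
 moreover have "fl usq G m s = u m s" if s: "s : cell (sqs wcospan) m" for m s
 proof -
  have sq: "s : cell Sq m" using s unfolding sqs_cell by blast
  have s': "sqf s : cell (sqs wspan) m" using sqf_cell[OF w_sub(4) s] unfolding rv_sets .
  have "fl usq G m s = fl wcospan u m (sqf s)" using fl_apply[OF sq] G(3)[OF s'] by metis
  also have "... = u m (sqf (sqf s))" using s' unfolding fl_def rv_sets by (rule restr_apply)
  finally show ?thesis unfolding sqf_sqf[OF sq] .
 qed
 ultimately have "cofib (op C) (fl usq (fl usq G)) & (ALL m. ALL s:cell (sqs wcospan) m. fl usq G m s = u m s)" using G(2) by simp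
 then show ?thesis using F by (rule bexI)
qed

lemma final_corner_transformation:
 assumes C: "simplicial_set C" and W: "wspan <= W" and u: "u : hom (prod_rel n (sqs W) (sqs wtop)) C"
  and un: "u 0 ([n], ([0], [1])) = F 0 ([0], [1])" and F: "final C (F 0 ([0], [1]))"
 shows "EX u':hom (prod_rel n (sqs W) (sqs wspan)) C. ALL m. ALL z:cell (prod_rel n (sqs W) (sqs wtop)) m. u' m z = u m z"
proof -
 have "final C (u 0 ([n], [0], [1]))" using un F by simp
 then show ?thesis by (rule corner_final_extension[OF C W u]) blast
qed

lemma initial_corner_transformation:
 assumes C: "simplicial_set C" and W: "wcospan <= W" and u: "u : hom (prod_rel n (sqs W) (sqs wright)) C"
  and un: "u 0 ([0], ([0], [1])) = F 0 ([0], [1])" and F: "initial C (F 0 ([0], [1]))"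
 shows "EX u':hom (prod_rel n (sqs W) (sqs wcospan)) C. ALL m. ALL z:cell (prod_rel n (sqs W) (sqs wright)) m. u' m z = u m z"
proof -
 have "initial C (u 0 ([0], [0], [1]))" using un F by simp
 then show ?thesis by (rule corner_initial_extension[OF C W u]) blast
qed

lemma cofib_transformation:
 assumes C: "quasi_category C" and n: "0 < n" and u: "u : hom (prod_rel n Sq (sqs wspan)) C"
  and u0: "!!m x. x : cell Sq m ==> u m (replicate (Suc m) 0, x) = F m x" and F: "cofib C F"
 shows "EX H:hom (\<Delta> n \<otimes> Sq) C. ALL m. ALL z:cell (prod_rel n Sq (sqs wspan)) m. H m z = u m z"
proof -
 have "restr (cx (jcol span_cx (pw {..0}))) (%m l. u m (replicate (Suc m) 0, unz (map (vtx (1, 1)) l))) = ff (1, 1) span_cx F"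
  unfolding ff_def by (rule restr_cong) (rule u0[OF vtx_Sq])
 then have "ccolim C span_cx (restr (cx (jcol span_cx (pw {..0}))) (%m l. u m (replicate (Suc m) 0, unz (map (vtx (1, 1)) l))))"
  using F unfolding cofib_def by metis
 then show ?thesis by (rule cofib_extension[OF C n u]) blast
qed

lemma fib_transformation:
 assumes C: "quasi_category C" and n: "0 < n" and u: "u : hom (prod_rel n Sq (sqs wcospan)) C"
  and un: "!!m x. x : cell Sq m ==> u m (replicate (Suc m) n, x) = F m x" and F: "cofib (op C) (fl usq F)"
 shows "EX H:hom (\<Delta> n \<otimes> Sq) C. ALL m. ALL z:cell (prod_rel n Sq (sqs wcospan)) m. H m z = u m z"
proof -
 have "restr (cx (jcol span_cx (pw {..0}))) (%m l. u m (replicate (Suc m) n, sqf (unz (map (vtx (1, 1)) l)))) = ff (1, 1) span_cx (fl usq F)"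
  unfolding ff_def
 proof (rule restr_cong)
  fix m l assume "l : cell (cx (jcol span_cx (pw {..0}))) m"
  then have s: "unz (map (vtx (1, 1)) l) : cell Sq m" by (rule vtx_Sq)
  show "u m (replicate (Suc m) n, sqf (unz (map (vtx (1, 1)) l))) = fl usq F m (unz (map (vtx (1, 1)) l))"
   unfolding fl_apply[OF s] by (rule un[OF sqf_Sq[OF s]])
 qed
 then have "ccolim (op C) span_cx (restr (cx (jcol span_cx (pw {..0}))) (%m l. u m (replicate (Suc m) n, sqf (unz (map (vtx (1, 1)) l)))))"
  using F unfolding cofib_def by metis
 then show ?thesis by (rule fib_extension[OF C n u]) blast
qed

lemma replicate_1: "replicate (Suc 0) i = [i]"
 by simp

text \<open>The corner is supplied by the zero object and the rest of the square by
  \<open>exT\<close>. Transformations extend because of a property of one end only: the last vertex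
  for the final corner and for pullbacks, the first vertex for the initial corner and for
  pushouts.\<close>

lemma kan_functors_exist:
 assumes C: "quasi_category C" and z: "initial C z" "final C z" and ex: "exT C" "exT (op C)"
 shows "EX R. right_kan_functor (full_sub Sq span) top_edge C R"
  and "EX L. left_kan_functor Sq span C L"
  and "EX L. left_kan_functor (full_sub Sq cospan) right_edge C L"
  and "EX R. right_kan_functor Sq cospan C R"
proof -
 have Cs: "simplicial_set C" using C by (simp add: quasi_category_def)
 note k = kan_iffs[OF C, unfolded edges_vx]
 have sub: "sub_sset (sqs W) Sq" for W by (rule full_sub_sub) simp
 note Sqs = sqs_simplicial
 show "EX R. right_kan_functor (full_sub Sq span) top_edge C R"
  unfolding right_kan_functor_def edges_vx k(3)
 proof (rule kan_section_exists[OF Cs Sqs sqs_sqs[OF w_sub(1)], where P = "%F. final C (F 0 ([0], [1]))"])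
  fix n F u assume P: "!!i. i <= n ==> final C (F i 0 ([0], [1]))" and u: "u : hom (prod_rel n (sqs wspan) (sqs wtop)) C"
   and uv: "!!i m x. i <= n ==> x : cell (sqs wspan) m ==> u m (replicate (Suc m) i, x) = F i m x"
  show "EX H:hom (\<Delta> n \<otimes> sqs wspan) C. ALL m. ALL x:cell (prod_rel n (sqs wspan) (sqs wtop)) m. H m x = u m x"
   using final_corner_transformation[where F = "F n", OF Cs order_refl u uv[OF order_refl corner_new(3), unfolded replicate_1] P[OF order_refl]]
   unfolding prod_rel_self .
 qed (rule final_corner_extends[OF Cs _ z(2)])
 show "EX L. left_kan_functor (full_sub Sq cospan) right_edge C L"
  unfolding left_kan_functor_def edges_vx k(4)
 proof (rule kan_section_exists[OF Cs Sqs sqs_sqs[OF w_sub(2)], where P = "%F. initial C (F 0 ([0], [1]))"])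
  fix n F u assume P: "!!i. i <= n ==> initial C (F i 0 ([0], [1]))" and u: "u : hom (prod_rel n (sqs wcospan) (sqs wright)) C"
   and uv: "!!i m x. i <= n ==> x : cell (sqs wcospan) m ==> u m (replicate (Suc m) i, x) = F i m x"
  show "EX H:hom (\<Delta> n \<otimes> sqs wcospan) C. ALL m. ALL x:cell (prod_rel n (sqs wcospan) (sqs wright)) m. H m x = u m x"
   using initial_corner_transformation[where F = "F 0", OF Cs order_refl u uv[OF le0 corner_new(4), unfolded replicate_1] P[OF le0]]
   unfolding prod_rel_self .
 qed (rule initial_corner_extends[OF Cs _ z(1)])
 show "EX L. left_kan_functor Sq span C L"
  unfolding left_kan_functor_def edges_vx k(1)
 proof (rule kan_section_exists[OF Cs Sq_simplicial refl, where P = "cofib C"])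
  show "EX F:hom Sq C. cofib C F & (ALL m. ALL x:cell (sqs wspan) m. F m x = D m x)"
   if "D : hom (sqs wspan) C" for D by (rule cofib_exists[OF ex(1) that]) blast
  fix n F u assume n: "(0::nat) < n" and P: "!!i. i <= n ==> cofib C (F i)" and u: "u : hom (prod_rel n Sq (sqs wspan)) C"
   and uv: "!!i m x. i <= n ==> x : cell Sq m ==> u m (replicate (Suc m) i, x) = F i m x"
  show "EX H:hom (\<Delta> n \<otimes> Sq) C. ALL m. ALL x:cell (prod_rel n Sq (sqs wspan)) m. H m x = u m x"
   by (rule cofib_transformation[OF C n u uv[OF le0] P[OF le0]])
 qed
 show "EX L. right_kan_functor Sq cospan C L"
  unfolding right_kan_functor_def edges_vx k(2)
 proof (rule kan_section_exists[OF Cs Sq_simplicial refl, where P = "%F. cofib (op C) (fl usq F)"])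
  fix n F u assume n: "(0::nat) < n" and P: "!!i. i <= n ==> cofib (op C) (fl usq (F i))"
   and u: "u : hom (prod_rel n Sq (sqs wcospan)) C"
   and uv: "!!i m x. i <= n ==> x : cell Sq m ==> u m (replicate (Suc m) i, x) = F i m x"
  show "EX H:hom (\<Delta> n \<otimes> Sq) C. ALL m. ALL x:cell (prod_rel n Sq (sqs wcospan)) m. H m x = u m x"
   by (rule fib_transformation[OF C n u uv[OF order_refl] P[OF order_refl]])
 qed (rule fib_exists[OF ex(2)])
qed

section \<open>Lifting along the restrictions to the two edges\<close>

lemma replicate_after: "th : mono_maps k m ==> replicate (Suc m) i \<cdot> th = replicate (Suc k) i"
 using mono_mapsD(1,3)[of th k m] by (intro nth_equalityI) (auto simp del: replicate_Suc simp: less_Suc_eq_le)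

lemma incl_cell: "a : mono_maps m 1 ==> incl_top m a : cell Sq m" "a : mono_maps m 1 ==> incl_right m a : cell Sq m"
 using replicate_mono[of 0 1 m] replicate_mono[of 1 1 m] by (simp_all add: incl_top_def incl_right_def Sq_cell del: replicate_Suc One_nat_def)

lemma incl_act:
 assumes "th : mono_maps k m"
 shows "incl_top k (a \<cdot> th) = act Sq m th (incl_top m a)" "incl_right k (a \<cdot> th) = act Sq m th (incl_right m a)"
 using replicate_after[OF assms] by (simp_all add: incl_top_def incl_right_def Sq_act del: replicate_Suc)

text \<open>One coordinate is constant along each edge, so the projection to the other coordinate
  inverts the inclusion of the edge.\<close>

lemma edge_coords:
 "s : cell (sqs wtop) m \<longleftrightarrow> fst s : mono_maps m 1 & incl_top m (fst s) = s"
 "s : cell (sqs wright) m \<longleftrightarrow> snd s : mono_maps m 1 & incl_right m (snd s) = s"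
proof -
 obtain a b where s: "s = (a, b)" by (cases s)
 have rs: "set (replicate (Suc m) i) = {i}" for i :: nat by (rule set_replicate) simp
 have rep: "b = replicate (Suc m) i \<longleftrightarrow> length b = Suc m & set b <= {i}" for b and i :: nat
  using rs replicate_eqI[of b "Suc m" i] by (metis length_replicate order_refl singletonD subsetD)
 have zs: "set a <= P ==> set (zp (a, b)) <= P \<times> {i} \<longleftrightarrow> set b <= {i}" "set b <= P ==> set (zp (a, b)) <= {i} \<times> P \<longleftrightarrow> set a <= {i}"
  if "a : mono_maps m 1" "b : mono_maps m 1" for i P
 proof -
  have "length a = length b" using that mono_mapsD(1) by metis
  then have "fst ` set (zp (a, b)) = set a" "snd ` set (zp (a, b)) = set b"
   unfolding list.set_map[symmetric] zp_def by simp_all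
  then show "set a <= P ==> set (zp (a, b)) <= P \<times> {i} \<longleftrightarrow> set b <= {i}" "set b <= P ==> set (zp (a, b)) <= {i} \<times> P \<longleftrightarrow> set a <= {i}"
   by force+
 qed
 have P: "set a <= {0, 1}" if "a : mono_maps m 1" for a using that by (auto simp: mono_maps_def)
 have w: "wtop = {0, 1} \<times> {0}" "wright = {1} \<times> {0, 1}" by auto
 have len: "length c = Suc m" if "c : mono_maps m 1" for c using mono_mapsD(1)[OF that] .
 have top1: "set (zp (a, b)) <= {0, 1} \<times> {0} \<longleftrightarrow> replicate (Suc m) 0 = b" if ab: "a : mono_maps m 1" "b : mono_maps m 1"
  unfolding zs(1)[OF ab P[OF ab(1)]] using rep[of b 0] len[OF ab(2)] by auto
 have top2: "replicate (Suc m) 0 : mono_maps m 1" by (rule replicate_mono) simp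
 show "s : cell (sqs wtop) m \<longleftrightarrow> fst s : mono_maps m 1 & incl_top m (fst s) = s"
  unfolding s sqs_cell w Sq_cell fst_conv snd_conv incl_top_def prod.inject
  using top1 top2 by metis
 have right1: "set (zp (a, b)) <= {1} \<times> {0, 1} \<longleftrightarrow> replicate (Suc m) 1 = a" if ab: "a : mono_maps m 1" "b : mono_maps m 1"
  unfolding zs(2)[OF ab P[OF ab(2)]] using rep[of a 1] len[OF ab(1)] by auto
 have right2: "replicate (Suc m) 1 : mono_maps m 1" by (rule replicate_mono) simp
 show "s : cell (sqs wright) m \<longleftrightarrow> snd s : mono_maps m 1 & incl_right m (snd s) = s"
  unfolding s sqs_cell w Sq_cell fst_conv snd_conv incl_right_def prod.inject
  using right1 right2 by metis
qed

text \<open>The first step adds the corner, the second the remaining vertex of the square. Values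
  over a vertex \<open>i\<close> of \<open>\<Delta> n\<close> lie over the boundary; they survive
  the first step and supply the hypothesis of the second.\<close>

lemma two_step_extension:
 assumes n: "0 < n" and EU: "E <= U" and i: "i <= n" and uv: "!!m x. x : cell Sq m ==> u m (replicate (Suc m) i, x) = F m x"
  and ex1: "EX u':hom (prod_rel n Sq (sqs U)) C. ALL m. ALL z:cell (prod_rel n Sq (sqs E)) m. u' m z = u m z"
  and ex2: "!!u'. u' : hom (prod_rel n Sq (sqs U)) C ==> (!!m x. x : cell Sq m ==> u' m (replicate (Suc m) i, x) = F m x) ==>
   EX H:hom (\<Delta> n \<otimes> Sq) C. ALL m. ALL z:cell (prod_rel n Sq (sqs U)) m. H m z = u' m z"
 shows "EX H:hom (\<Delta> n \<otimes> Sq) C. ALL m. ALL z:cell (prod_rel n Sq (sqs E)) m. H m z = u m z"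
proof -
 obtain u' where u': "u' : hom (prod_rel n Sq (sqs U)) C" "!!m z. z : cell (prod_rel n Sq (sqs E)) m ==> u' m z = u m z"
  using ex1 by blast
 have "u' m (replicate (Suc m) i, x) = F m x" if x: "x : cell Sq m" for m x
 proof -
  have "(replicate (Suc m) i, x) : cell (prod_rel n Sq (sqs E)) m"
   using replicate_boundary[OF i n] x unfolding prod_rel_cell boundary_cell by blast
  from u'(2)[OF this] uv[OF x] show ?thesis by (rule trans)
 qed
 from ex2[OF u'(1) this] obtain H where H: "H : hom (\<Delta> n \<otimes> Sq) C" "!!m z. z : cell (prod_rel n Sq (sqs U)) m ==> H m z = u' m z"
  by blast
 have "z : cell (prod_rel n Sq (sqs U)) m" if "z : cell (prod_rel n Sq (sqs E)) m" for z m
  using that sub_cell[OF sqs_sub[OF EU]] by (cases z) (auto simp only: prod_rel_cell)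
 then show ?thesis using H u'(2) by (intro bexI[of _ H]) auto
qed

text \<open>For the top edge the corner is added by finality in the last square, then
  \<open>(1, 1)\<close> by the colimit property of the first square. For the right edge the corner
  is added by initiality in the first square, then \<open>(0, 0)\<close> by the limit property of
  the last one.\<close>

lemma edge_lifts:
 assumes C: "quasi_category C" and n: "0 < n" and s: "s : hom (boundary n) (Fun Sq C)" and d: "d : hom (\<Delta> n \<otimes> \<Delta> 1) C"
 shows "(!!m a. a : cell (boundary n) m ==> precomp (\<Delta> 1) Sq C incl_top m (s m a) = act (Fun (\<Delta> 1) C) n a d) ==>
   cofib C (map_of_vertex Sq (s 0 [0])) ==> final C (map_of_vertex Sq (s 0 [n]) 0 ([0], [1])) ==>
   EX H. sphere_fill (Fun Sq C) n s H & precomp (\<Delta> 1) Sq C incl_top n H = d"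
  and "(!!m a. a : cell (boundary n) m ==> precomp (\<Delta> 1) Sq C incl_right m (s m a) = act (Fun (\<Delta> 1) C) n a d) ==>
   initial C (map_of_vertex Sq (s 0 [0]) 0 ([0], [1])) ==> cofib (op C) (fl usq (map_of_vertex Sq (s 0 [n]))) ==>
   EX H. sphere_fill (Fun Sq C) n s H & precomp (\<Delta> 1) Sq C incl_right n H = d"
proof -
 have Cs: "simplicial_set C" using C by (simp add: quasi_category_def)
 have sub: "sub_sset (sqs W) Sq" for W by (rule full_sub_sub) simp
 have cor: "([0], [1]) : cell Sq 0" by (simp add: Sq_cell)
 show "EX H. sphere_fill (Fun Sq C) n s H & precomp (\<Delta> 1) Sq C incl_top n H = d"
  if pd: "!!m a. a : cell (boundary n) m ==> precomp (\<Delta> 1) Sq C incl_top m (s m a) = act (Fun (\<Delta> 1) C) n a d"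
   and A: "cofib C (map_of_vertex Sq (s 0 [0]))" and Z: "final C (map_of_vertex Sq (s 0 [n]) 0 ([0], [1]))"
 proof (rule precomp_lift[OF Sq_simplicial simplex_simplicial sub[of wtop] _ _ _ _ n s d pd, where r = "%_. fst"])
  fix u assume u: "u : hom (prod_rel n Sq (sqs wtop)) C"
   and uv: "!!i m x. i <= n ==> x : cell Sq m ==> u m (replicate (Suc m) i, x) = map_of_vertex Sq (s 0 [i]) m x"
  show "EX H:hom (\<Delta> n \<otimes> Sq) C. ALL m. ALL z:cell (prod_rel n Sq (sqs wtop)) m. H m z = u m z"
   by (rule two_step_extension[OF n w_sub(1) le0 uv[OF le0]
    final_corner_transformation[where F = "map_of_vertex Sq (s 0 [n])", OF Cs w_sub(3), unfolded sqs_usq, OF u uv[OF order_refl cor, unfolded replicate_1] Z]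
    cofib_transformation[OF C n _ _ A]]) assumption+
 qed (use incl_cell(1) incl_act(1) edge_coords(1) in \<open>auto simp: incl_top_def simp del: replicate_Suc One_nat_def\<close>)
 show "EX H. sphere_fill (Fun Sq C) n s H & precomp (\<Delta> 1) Sq C incl_right n H = d"
  if pd: "!!m a. a : cell (boundary n) m ==> precomp (\<Delta> 1) Sq C incl_right m (s m a) = act (Fun (\<Delta> 1) C) n a d"
   and Z: "initial C (map_of_vertex Sq (s 0 [0]) 0 ([0], [1]))" and B: "cofib (op C) (fl usq (map_of_vertex Sq (s 0 [n])))"
 proof (rule precomp_lift[OF Sq_simplicial simplex_simplicial sub[of wright] _ _ _ _ n s d pd, where r = "%_. snd"])
  fix u assume u: "u : hom (prod_rel n Sq (sqs wright)) C"
   and uv: "!!i m x. i <= n ==> x : cell Sq m ==> u m (replicate (Suc m) i, x) = map_of_vertex Sq (s 0 [i]) m x"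
  show "EX H:hom (\<Delta> n \<otimes> Sq) C. ALL m. ALL z:cell (prod_rel n Sq (sqs wright)) m. H m z = u m z"
   by (rule two_step_extension[OF n w_sub(2) order_refl uv[OF order_refl]
    initial_corner_transformation[where F = "map_of_vertex Sq (s 0 [0])", OF Cs w_sub(4), unfolded sqs_usq, OF u uv[OF le0 cor, unfolded replicate_1] Z]
    fib_transformation[OF C n _ _ B]]) assumption+
 qed (use incl_cell(2) incl_act(2) edge_coords(2) in \<open>auto simp: incl_right_def simp del: replicate_Suc One_nat_def\<close>)
qed

section \<open>Adjunctions from lifting properties\<close>

text \<open>Two prescribed end points form a sphere in \<open>E\<close>, and a filler of it is the
  edge wanted.\<close>

lemma edge_lift:
 assumes E: "simplicial_set E" and D: "simplicial_set D" and p: "p : hom E D" and x: "x : cell E 0" and y: "y : cell E 0"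
  and d: "d : cell D 1" "act D 1 [0] d = p 0 x" "act D 1 [1] d = p 0 y"
  and lift: "!!s. s : hom (boundary 1) E ==> (!!m a. a : cell (boundary 1) m ==> p m (s m a) = act D 1 a d) ==>
   s 0 [0] = x ==> s 0 [1] = y ==> EX e. sphere_fill E 1 s e & p 1 e = d"
 obtains e where "e : cell E 1" "act E 1 [0] e = x" "act E 1 [1] e = y" "p 1 e = d"
proof -
 have yc: "(if i = 0 then y else x) : cell E 0" for i :: nat using x y by simp
 obtain s where s: "s : hom (boundary (Suc 0)) E" "!!i. i <= Suc 0 ==> s 0 (skip 0 i) = (if i = 0 then y else x)"
  by (rule sphere_glue[OF E, of 0 "%i. if i = 0 then y else x"]) (use yc in \<open>auto intro: that\<close>)
 have s': "s : hom (boundary 1) E" using s(1) by simp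
 have sv: "s 0 [0] = x" "s 0 [1] = y" using s(2)[of 1] s(2)[of 0] by (simp_all add: skips)
 have ps: "cmp (boundary (Suc 0)) p s : hom (boundary (Suc 0)) D" by (rule cmp_hom[OF s(1) p boundary_simplicial])
 have "p m (s m a) = act D 1 a d" if a: "a : cell (boundary 1) m" for m a
 proof -
  have a': "a : cell (boundary (Suc 0)) m" using a by simp
  have "act D (Suc 0) a d = cmp (boundary (Suc 0)) p s m a"
  proof (rule hom_faces_eq[OF boundary_sub boundary_faces order_refl D ps _ _ a'])
   show "d : cell D (Suc 0)" using d(1) by simp
   show "act D (Suc 0) (skip 0 i) d = cmp (boundary (Suc 0)) p s 0 (skip 0 i)" if i: "i : {..Suc 0}" for i
   proof -
    have "i = 0 | i = 1" using i by auto
    then show ?thesis using skip_in_boundary[of 0 0] skip_in_boundary[of 1 0] d(2,3) sv by (auto simp: skips)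
   qed
  qed
  then show ?thesis using a' by simp
 qed
 from lift[OF s' this sv] obtain e where e: "sphere_fill E 1 s e" "p 1 e = d" by blast
 have "act E 1 [0] e = x" "act E 1 [1] e = y"
  using sphere_fillD(2)[OF e(1), of "[0]" 0] sphere_fillD(2)[OF e(1), of "[1]" 0] vertex_in_boundary[of 1] sv by simp_all
 then show thesis using that sphere_fillD(1)[OF e(1)] e(2) by blast
qed

lemma triangle_lift:
 assumes E: "simplicial_set E" and D: "simplicial_set D" and p: "p : hom E D"
  and e: "e01 : cell E 1" "e12 : cell E 1" "e02 : cell E 1"
  and v: "act E 1 [0] e01 = act E 1 [0] e02" "act E 1 [1] e01 = act E 1 [0] e12" "act E 1 [1] e12 = act E 1 [1] e02"
  and d: "d : cell D 2" "act D 2 [0, 1] d = p 1 e01" "act D 2 [1, 2] d = p 1 e12" "act D 2 [0, 2] d = p 1 e02"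
  and lift: "!!s. s : hom (boundary 2) E ==> (!!m a. a : cell (boundary 2) m ==> p m (s m a) = act D 2 a d) ==>
   s 0 [0] = act E 1 [0] e01 ==> s 0 [2] = act E 1 [1] e12 ==> EX t. sphere_fill E 2 s t & p 2 t = d"
 obtains t where "t : cell E 2" "act E 2 [0, 1] t = e01" "act E 2 [1, 2] t = e12" "act E 2 [0, 2] t = e02" "p 2 t = d"
proof -
 \<comment> \<open>The face with index \<open>i\<close> is the edge opposite the vertex
   \<open>i\<close>.\<close>
 let ?y = "%i. if i = 0 then e12 else if i = 1 then e02 else e01"
 have le2: "i = 0 | i = 1 | i = 2" if "i <= Suc 1" for i using that by auto
 have comp: "act E 1 (skip l i) (?y j) = act E 1 (skip l (j - 1)) (?y i)" if "1 = Suc l" "j <= Suc 1" "i < j" for i j l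
 proof -
  have "l = 0" "(i = 0 & j = 1) | (i = 0 & j = 2) | (i = 1 & j = 2)" using that by auto
  then show ?thesis using v by (auto simp: skips)
 qed
 obtain s where s: "s : hom (boundary (Suc 1)) E" "!!i. i <= Suc 1 ==> s 1 (skip 1 i) = ?y i"
  by (rule sphere_glue[OF E, of 1 ?y]) (use e comp in \<open>auto intro: that simp del: One_nat_def\<close>)
 have two: "Suc 1 = 2" by simp
 have s': "s : hom (boundary 2) E" using s(1) unfolding two .
 have se: "s 1 [1, 2] = e12" "s 1 [0, 2] = e02" "s 1 [0, 1] = e01" using s(2)[of 0] s(2)[of 1] s(2)[of 2] by (simp_all add: skips)
 have b: "[1, 2] : cell (boundary 2) 1" "[0, 2] : cell (boundary 2) 1" "[0, 1] : cell (boundary 2) 1"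
  using skip_in_boundary[of 0 1] skip_in_boundary[of 1 1] skip_in_boundary[of 2 1] unfolding two by (simp_all add: skips)
 have sv: "s 0 [0] = act E 1 [0] e01" "s 0 [2] = act E 1 [1] e12"
  using hom_act[OF s' _ b(3), of "[0]" 0] hom_act[OF s' _ b(1), of "[1]" 0] se by (simp_all add: after_def)
 have ps: "cmp (boundary (Suc 1)) p s : hom (boundary (Suc 1)) D" by (rule cmp_hom[OF s(1) p boundary_simplicial])
 have "p m (s m a) = act D 2 a d" if a: "a : cell (boundary 2) m" for m a
 proof -
  have a': "a : cell (boundary (Suc 1)) m" using a unfolding two .
  have "act D (Suc 1) a d = cmp (boundary (Suc 1)) p s m a"
  proof (rule hom_faces_eq[OF boundary_sub boundary_faces order_refl D ps _ _ a'])
   show "d : cell D (Suc 1)" using d(1) unfolding two .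
   show "act D (Suc 1) (skip 1 i) d = cmp (boundary (Suc 1)) p s 1 (skip 1 i)" if i: "i : {..Suc 1}" for i
   proof -
    have "i = 0 | i = 1 | i = 2" using i le2 by blast
    then show ?thesis unfolding two using b d(2-4) se by (elim disjE) (simp_all only: skips cmp_apply)
   qed
  qed
  then show ?thesis using a unfolding two by simp
 qed
 from lift[OF s' this sv] obtain t where t: "sphere_fill E 2 s t" "p 2 t = d" by blast
 show thesis
  by (rule that[of t]) (use sphere_fillD(1)[OF t(1)] sphere_fillD(2)[OF t(1)] b se t(2) in simp_all)
qed

lemma postcomp_vertex:
 assumes "simplicial_set X" "f : hom X Y" shows "postcomp X Y g 0 (vertex_of X f) = vertex_of X (cmp X g f)"
 unfolding postcomp_apply[OF vertex_of_hom[OF assms]] unfolding cmp_def[of "\<Delta> 0 \<otimes> X"] vertex_of_def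
 by (rule restr_cong) auto

lemma precomp_vertex:
 assumes "simplicial_set X" "f : hom X Y" "j : hom X' X"
 shows "precomp X' X Y j 0 (vertex_of X f) = vertex_of X' (cmp X' f j)"
 unfolding precomp_apply[OF vertex_of_hom[OF assms(1,2)]] unfolding vertex_of_def
 by (rule restr_cong) (use hom_cell[OF assms(3)] in auto)

lemma postcomp_postcomp:
 assumes "simplicial_set X" "h : hom (\<Delta> n \<otimes> X) Y" "g : hom Y Y'" "!!m y. y : cell Y m ==> k m y = g' m (g m y)"
 shows "postcomp X Y' g' n (postcomp X Y g n h) = postcomp X Y k n h"
proof -
 have D: "simplicial_set (\<Delta> n \<otimes> X)" using assms(1) by auto
 have c: "cmp (\<Delta> n \<otimes> X) g h : hom (\<Delta> n \<otimes> X) Y'" by (rule cmp_hom[OF assms(2,3) D])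
 show ?thesis
  unfolding postcomp_apply[OF assms(2)] postcomp_apply[OF c] unfolding cmp_def
  by (rule restr_cong) (use hom_cell[OF assms(2)] assms(4) in \<open>simp del: prod_cell\<close>)
qed

lemma postcomp_inverse:
 assumes "simplicial_set X" "h : hom (\<Delta> n \<otimes> X) Y" "g : hom Y Y'" "!!m y. y : cell Y m ==> g' m (g m y) = y"
 shows "postcomp X Y' g' n (postcomp X Y g n h) = h"
proof -
 have "postcomp X Y' g' n (postcomp X Y g n h) = postcomp X Y (%_ y. y) n h"
  by (rule postcomp_postcomp[OF assms(1-3)]) (simp add: assms(4))
 also have "... = h" unfolding postcomp_apply[OF assms(2)] cmp_def by (rule restr_eqI[OF assms(2)]) simp
 finally show ?thesis .
qed

lemma postcomp_precomp:
 assumes X: "simplicial_set X" "simplicial_set X'" and h: "h : hom (\<Delta> n \<otimes> X) Y" and j: "j : hom X' X" and g: "g : hom Y Y'"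
 shows "postcomp X' Y g n (precomp X' X Y j n h) = precomp X' X Y' j n (postcomp X Y g n h)"
proof -
 have c: "cmp (\<Delta> n \<otimes> X) g h : hom (\<Delta> n \<otimes> X) Y'" by (rule cmp_hom[OF h g]) (use X in auto)
 have jj: "j m x : cell X m" if "x : cell X' m" for m x by (rule hom_cell[OF j that])
 have "precomp X' X Y j n h : cell (Fun X' Y) n"
  by (rule hom_cell[OF precomp_hom[OF X(2,1) jj]]) (use h hom_act[OF j] in auto)
 then have p: "restr (\<Delta> n \<otimes> X') (%m (a, x). h m (a, j m x)) : hom (\<Delta> n \<otimes> X') Y" using h by simp
 show ?thesis
  unfolding precomp_apply[OF h] postcomp_apply[OF h] unfolding postcomp_apply[OF p] precomp_apply[OF c] unfolding cmp_def
  by (rule restr_cong) (use jj in auto)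
qed

text \<open>Conditions on the two ends of a sphere in \<open>E\<close> become pointwise conditions
  on the two functors at the ends of a sphere in \<open>Fun D E\<close>.\<close>

lemma postcomp_lift_ends:
 assumes E: "simplicial_set E" and D: "simplicial_set D" and p: "p : hom E D"
  and lift: "!!n s d. 0 < n ==> s : hom (boundary n) E ==> d : cell D n ==>
   (!!m a. a : cell (boundary n) m ==> p m (s m a) = act D n a d) ==> A (s 0 [0]) ==> Z (s 0 [n]) ==>
   EX e. sphere_fill E n s e & p n e = d"
  and n: "0 < n" and s: "s : hom (boundary n) (Fun D E)" and d: "d : cell (Fun D D) n"
  and sd: "!!m a. a : cell (boundary n) m ==> postcomp D E p m (s m a) = act (Fun D D) n a d"
  and v0: "s 0 [0] = vertex_of D f" "!!x. x : cell D 0 ==> A (f 0 x)"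
  and vn: "s 0 [n] = vertex_of D g" "!!x. x : cell D 0 ==> Z (g 0 x)"
 shows "EX H. sphere_fill (Fun D E) n s H & postcomp D E p n H = d"
proof -
 have d': "d : hom (\<Delta> n \<otimes> D) D" using d by simp
 show ?thesis
 proof (rule postcomp_lift[OF D E D p n s d' sd, where J = "%i e. (i = 0 --> A e) & (i = n --> Z e)"])
  show "(i = 0 --> A (s 0 [i] 0 ([0], x))) & (i = n --> Z (s 0 [i] 0 ([0], x)))" if "i <= n" "x : cell D 0" for i x
   using v0 vn that(2) by (auto simp: vertex_of_def)
  fix k sg de a
  assume k: "0 < k" "sg : hom (boundary k) E" "de : cell D k" "!!m b. b : cell (boundary k) m ==> p m (sg m b) = act D k b de"
   and a: "a : mono_maps k n" "set a = {..n}" and J: "!!i. i <= k ==> (a ! i = 0 --> A (sg 0 [i])) & (a ! i = n --> Z (sg 0 [i]))"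
  show "EX e. sphere_fill E k sg e & p k e = de"
   by (rule lift[OF k]) (use J[of 0] J[of k] mono_full_ends[OF a] in simp_all)
 qed
qed

text \<open>\<open>S\<close> is a section of \<open>p\<close> with values in \<open>A\<close>, and
  \<open>T\<close> a section of \<open>q\<close> with values in \<open>B\<close>. Spheres lift along
  \<open>p\<close> out of \<open>A\<close> and along \<open>q\<close> into \<open>B\<close>;
  \<open>Z\<close> is the condition at the other end, and it holds for the values of both
  sections.\<close>

lemma adjunction_by_lifting:
 assumes E: "simplicial_set E" and D: "simplicial_set D" and p: "p : hom E D" and q: "q : hom E D"
  and S: "S : hom D E" and T: "T : hom D E"
  and pS: "!!n x. x : cell D n ==> p n (S n x) = x" and qT: "!!n x. x : cell D n ==> q n (T n x) = x"
  and liftp: "!!n s d. 0 < n ==> s : hom (boundary n) E ==> d : cell D n ==>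
   (!!m a. a : cell (boundary n) m ==> p m (s m a) = act D n a d) ==> A (s 0 [0]) ==> Z (s 0 [n]) ==>
   EX e. sphere_fill E n s e & p n e = d"
  and liftq: "!!n s d. 0 < n ==> s : hom (boundary n) E ==> d : cell D n ==>
   (!!m a. a : cell (boundary n) m ==> q m (s m a) = act D n a d) ==> Z (s 0 [0]) ==> B (s 0 [n]) ==>
   EX e. sphere_fill E n s e & q n e = d"
  and SA: "!!x. x : cell D 0 ==> A (S 0 x) & Z (S 0 x)" and TB: "!!x. x : cell D 0 ==> B (T 0 x) & Z (T 0 x)"
 shows "adjunction D D (cmp D q S) (cmp D p T)"
proof -
 let ?FE = "Fun D E" and ?FD = "Fun D D" and ?v = "vertex_of D"
 define F where "F = cmp D q S"
 define G where "G = cmp D p T"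
 have F: "F : hom D D" unfolding F_def by (rule cmp_hom[OF S q D])
 have G: "G : hom D D" unfolding G_def by (rule cmp_hom[OF T p D])
 have FEs: "simplicial_set ?FE" and FDs: "simplicial_set ?FD" using D by auto
 note P = postcomp_hom[OF D p] and Q = postcomp_hom[OF D q] and PS = postcomp_hom[OF D S] and PT = postcomp_hom[OF D T]
 have prE: "precomp D D E j : hom ?FE ?FE" and prD: "precomp D D D j : hom ?FD ?FD" if "j : hom D D" for j
  by (rule precomp_hom[OF D D hom_cell[OF that] hom_act[OF that]], assumption+)+
 have vE: "?v f : cell ?FE 0" if "f : hom D E" for f using vertex_of_hom[OF D that] by simp
 have vD: "?v f : cell ?FD 0" if "f : hom D D" for f using vertex_of_hom[OF D that] by simp
 have mm: "[0] : mono_maps 0 1" "[1] : mono_maps 0 1" "[0, 0] : mono_maps 1 0" "[0, 1] : mono_maps 1 1" "[0, 1, 1] : mono_maps 2 1" "[0, 0, 1] : mono_maps 2 1"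
  "[0, 1] : mono_maps 1 2" "[1, 2] : mono_maps 1 2" "[0, 2] : mono_maps 1 2" "[0] : mono_maps 0 0"
  by (simp_all add: mono_maps_def)
 have cancel: "cmp D p (cmp D S f) = f" "cmp D q (cmp D T f) = f" if f: "f : hom D D" for f
  unfolding cmp_def by (rule restr_eqI[OF f]; use hom_cell[OF f] pS qT in simp)+
 have SI: "cmp D S (idm D) = S" "cmp D T (idm D) = T" "cmp D p S = idm D" "cmp D q T = idm D"
  unfolding cmp_def idm_def using pS qT by (auto intro!: restr_eqI[OF S] restr_eqI[OF T] restr_cong)
 have assoc1: "cmp D S (cmp D G F) = cmp D (cmp D S G) F" "cmp D T (cmp D F G) = cmp D (cmp D T F) G"
  "cmp D p (cmp D T F) = cmp D G F" "cmp D q (cmp D S G) = cmp D F G"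
  unfolding G_def F_def cmp_def using hom_cell[OF S] hom_cell[OF T] hom_cell[OF p] hom_cell[OF q] by (auto intro!: restr_cong)
 note hD = idm_hom[OF D]
 have hs: "cmp D S G : hom D E" "cmp D T F : hom D E" "cmp D G F : hom D D" "cmp D F G : hom D D"
  by (rule cmp_hom[OF G S D] cmp_hom[OF F T D] cmp_hom[OF F G D] cmp_hom[OF G F D])+
 have F0: "F 0 x : cell D 0" "G 0 x : cell D 0" if "x : cell D 0" for x using hom_cell[OF F that] hom_cell[OF G that] .
 have idt: "id_trans D D f : cell ?FD 1" "act ?FD 1 [0] (id_trans D D f) = ?v f" "act ?FD 1 [1] (id_trans D D f) = ?v f" if f: "f : hom D D" for f
 proof -
  show "id_trans D D f : cell ?FD 1" unfolding id_trans_def by (rule sset_cell[OF FDs mm(3) vD[OF f]])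
  have "act ?FD 0 [0] (?v f) = ?v f" using sset_id[OF FDs vD[OF f]] by (simp only: id_maps)
  then show "act ?FD 1 [0] (id_trans D D f) = ?v f" "act ?FD 1 [1] (id_trans D D f) = ?v f"
   unfolding id_trans_def using sset_act[OF FDs mm(3) mm(1) vD[OF f]] sset_act[OF FDs mm(3) mm(2) vD[OF f]] by (simp_all add: after_def)
 qed
 have deg: "act ?FD 1 [0, 0] h = id_trans D D f" "act ?FD 1 [1, 1] h = id_trans D D g"
  if h: "h : cell ?FD 1" "act ?FD 1 [0] h = ?v f" "act ?FD 1 [1] h = ?v g" for h f g
  unfolding id_trans_def h(2,3)[symmetric]
  using sset_act[OF FDs mm(1) mm(3) h(1)] sset_act[OF FDs mm(2) mm(3) h(1)] by (simp_all add: after_def)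
 have idp: "precomp D D D j 1 (id_trans D D f) = id_trans D D (cmp D f j)" if f: "f : hom D D" and j: "j : hom D D" for f j
  unfolding id_trans_def hom_act[OF prD[OF j] mm(3) vD[OF f]] precomp_vertex[OF D f j] ..
 note FT = postcomp_lift_ends[OF E D p, where A = A and Z = Z] and FQ = postcomp_lift_ends[OF E D q, where A = Z and Z = B]
 have z1: "(0::nat) < 1" and z2: "(0::nat) < 2" by simp_all
 \<comment> \<open>Both \<open>S G\<close> and \<open>T\<close> lie over \<open>G\<close> along
   \<open>p\<close>, so the identity of \<open>G\<close> lifts to a transformation from
   \<open>S G\<close> to \<open>T\<close>; its image under \<open>q\<close> is the counit.\<close>
 obtain c where c: "c : cell ?FE 1" "act ?FE 1 [0] c = ?v (cmp D S G)" "act ?FE 1 [1] c = ?v T" "postcomp D E p 1 c = id_trans D D G"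
 proof (rule edge_lift[OF FEs FDs P vE[OF hs(1)] vE[OF T] idt(1)[OF G]])
  show "act ?FD 1 [0] (id_trans D D G) = postcomp D E p 0 (?v (cmp D S G))" "act ?FD 1 [1] (id_trans D D G) = postcomp D E p 0 (?v T)"
   unfolding idt(2,3)[OF G] postcomp_vertex[OF D hs(1)] postcomp_vertex[OF D T] cancel(1)[OF G] G_def[symmetric] by simp_all
  show "EX e. sphere_fill ?FE 1 s e & postcomp D E p 1 e = id_trans D D G"
   if "s : hom (boundary 1) ?FE" "!!m a. a : cell (boundary 1) m ==> postcomp D E p m (s m a) = act ?FD 1 a (id_trans D D G)"
    "s 0 [0] = ?v (cmp D S G)" "s 0 [1] = ?v T" for s
   by (rule FT[OF _ z1 that(1) idt(1)[OF G] that(2) that(3) _ that(4)], (rule liftp; assumption)) (use SA TB F0 in auto)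
 qed (rule that; assumption)
 \<comment> \<open>Both \<open>S\<close> and \<open>T F\<close> lie over \<open>F\<close> along
   \<open>q\<close>, so the identity of \<open>F\<close> lifts to a transformation from
   \<open>S\<close> to \<open>T F\<close>; its image under \<open>p\<close> is the unit.\<close>
 obtain u where u: "u : cell ?FE 1" "act ?FE 1 [0] u = ?v S" "act ?FE 1 [1] u = ?v (cmp D T F)" "postcomp D E q 1 u = id_trans D D F"
 proof (rule edge_lift[OF FEs FDs Q vE[OF S] vE[OF hs(2)] idt(1)[OF F]])
  show "act ?FD 1 [0] (id_trans D D F) = postcomp D E q 0 (?v S)" "act ?FD 1 [1] (id_trans D D F) = postcomp D E q 0 (?v (cmp D T F))"
   unfolding idt(2,3)[OF F] postcomp_vertex[OF D hs(2)] postcomp_vertex[OF D S] cancel(2)[OF F] F_def[symmetric] by simp_all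
  show "EX e. sphere_fill ?FE 1 s e & postcomp D E q 1 e = id_trans D D F"
   if "s : hom (boundary 1) ?FE" "!!m a. a : cell (boundary 1) m ==> postcomp D E q m (s m a) = act ?FD 1 a (id_trans D D F)"
    "s 0 [0] = ?v S" "s 0 [1] = ?v (cmp D T F)" for s
   by (rule FQ[OF _ z1 that(1) idt(1)[OF F] that(2) that(3) _ that(4)], (rule liftq; assumption)) (use SA TB F0 in auto)
 qed (rule that; assumption)
 define \<eta> where "\<eta> = postcomp D E p 1 u"
 define \<epsilon> where "\<epsilon> = postcomp D E q 1 c"
 have \<eta>: "\<eta> : cell ?FD 1" "act ?FD 1 [0] \<eta> = ?v (idm D)" "act ?FD 1 [1] \<eta> = ?v (cmp D G F)"
  unfolding \<eta>_def using hom_cell[OF P u(1)] hom_act[OF P mm(1) u(1)] hom_act[OF P mm(2) u(1)]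
  by (simp_all only: u(2,3) postcomp_vertex[OF D S] postcomp_vertex[OF D hs(2)] SI assoc1)
 have \<epsilon>: "\<epsilon> : cell ?FD 1" "act ?FD 1 [0] \<epsilon> = ?v (cmp D F G)" "act ?FD 1 [1] \<epsilon> = ?v (idm D)"
  unfolding \<epsilon>_def using hom_cell[OF Q c(1)] hom_act[OF Q mm(1) c(1)] hom_act[OF Q mm(2) c(1)]
  by (simp_all only: c(2,3) postcomp_vertex[OF D T] postcomp_vertex[OF D hs(1)] SI assoc1)
 have h1: "u : hom (\<Delta> 1 \<otimes> D) E" "c : hom (\<Delta> 1 \<otimes> D) E" "\<eta> : hom (\<Delta> 1 \<otimes> D) D" "\<epsilon> : hom (\<Delta> 1 \<otimes> D) D"
  using u(1) c(1) \<eta>(1) \<epsilon>(1) by simp_all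
 have id1: "act ?FD 1 [0, 1] h = h" if "h : cell ?FD 1" for h using sset_id[OF FDs that] by (simp add: id_maps)
 have t1: "composite ?FD (postcomp D D F 1 \<eta>) (precomp D D D F 1 \<epsilon>) (id_trans D D F)"
 proof -
  \<comment> \<open>The edges \<open>S \<eta>\<close>, \<open>c F\<close> and \<open>u\<close> lie
    along \<open>p\<close> over \<open>\<eta>\<close>, an identity and \<open>\<eta>\<close>, that
    is, over a degenerate triangle. The lifted triangle has under \<open>q\<close> the edges
    \<open>F \<eta>\<close>, \<open>\<epsilon> F\<close> and the identity of
    \<open>F\<close>.\<close>
  let ?e01 = "postcomp D D S 1 \<eta>" and ?e12 = "precomp D D E F 1 c" and ?d = "act ?FD 1 [0, 1, 1] \<eta>"
  have e: "?e01 : cell ?FE 1" "?e12 : cell ?FE 1" by (rule hom_cell[OF PS \<eta>(1)] hom_cell[OF prE[OF F] c(1)])+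
  have v01: "act ?FE 1 [0] ?e01 = ?v S" "act ?FE 1 [1] ?e01 = ?v (cmp D (cmp D S G) F)"
   unfolding hom_act[OF PS mm(1) \<eta>(1), symmetric] hom_act[OF PS mm(2) \<eta>(1), symmetric] \<eta>(2,3)
    postcomp_vertex[OF D hD] postcomp_vertex[OF D hs(3)] SI assoc1 by simp_all
  have v12: "act ?FE 1 [0] ?e12 = ?v (cmp D (cmp D S G) F)" "act ?FE 1 [1] ?e12 = ?v (cmp D T F)"
   unfolding hom_act[OF prE[OF F] mm(1) c(1), symmetric] hom_act[OF prE[OF F] mm(2) c(1), symmetric] c(2,3)
    precomp_vertex[OF D hs(1) F] precomp_vertex[OF D T F] by simp_all
  have d: "?d : cell ?FD 2" by (rule sset_cell[OF FDs mm(5) \<eta>(1)])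
  have p01: "postcomp D E p 1 ?e01 = \<eta>" by (rule postcomp_inverse[OF D h1(3) S pS])
  have p12: "postcomp D E p 1 ?e12 = id_trans D D (cmp D G F)"
   unfolding postcomp_precomp[OF D D h1(2) F p] c(4) idp[OF G F] ..
  obtain t where t: "t : cell ?FE 2" "act ?FE 2 [0, 1] t = ?e01" "act ?FE 2 [1, 2] t = ?e12" "act ?FE 2 [0, 2] t = u"
  proof (rule triangle_lift[OF FEs FDs P e u(1) _ _ _ d])
   show "act ?FE 1 [0] ?e01 = act ?FE 1 [0] u" "act ?FE 1 [1] ?e01 = act ?FE 1 [0] ?e12" "act ?FE 1 [1] ?e12 = act ?FE 1 [1] u"
    unfolding v01 v12 u(2,3) by simp_all
   show "act ?FD 2 [0, 1] ?d = postcomp D E p 1 ?e01" "act ?FD 2 [1, 2] ?d = postcomp D E p 1 ?e12" "act ?FD 2 [0, 2] ?d = postcomp D E p 1 u"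
    unfolding p01 p12 \<eta>_def[symmetric] sset_act[OF FDs mm(5) mm(7) \<eta>(1)] sset_act[OF FDs mm(5) mm(8) \<eta>(1)] sset_act[OF FDs mm(5) mm(9) \<eta>(1)]
    using id1[OF \<eta>(1)] deg(2)[OF \<eta>] by (simp_all add: after_def)
   show "EX t. sphere_fill ?FE 2 s t & postcomp D E p 2 t = ?d"
    if "s : hom (boundary 2) ?FE" "!!m a. a : cell (boundary 2) m ==> postcomp D E p m (s m a) = act ?FD 2 a ?d"
     "s 0 [0] = act ?FE 1 [0] ?e01" "s 0 [2] = act ?FE 1 [1] ?e12" for s
    by (rule FT[OF _ z2 that(1) d that(2) that(3)[unfolded v01] _ that(4)[unfolded v12]], (rule liftp; assumption)) (use SA TB F0 in auto)
  qed (rule that; assumption)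
  have "postcomp D E q 2 t : cell ?FD 2" by (rule hom_cell[OF Q t(1)])
  moreover have "act ?FD 2 [0, 1] (postcomp D E q 2 t) = postcomp D D F 1 \<eta>"
   unfolding hom_act[OF Q mm(7) t(1), symmetric] t(2) by (rule postcomp_postcomp[OF D h1(3) S]) (simp add: F_def)
  moreover have "act ?FD 2 [1, 2] (postcomp D E q 2 t) = precomp D D D F 1 \<epsilon>"
   unfolding hom_act[OF Q mm(8) t(1), symmetric] t(3) postcomp_precomp[OF D D h1(2) F q] \<epsilon>_def ..
  moreover have "act ?FD 2 [0, 2] (postcomp D E q 2 t) = id_trans D D F"
   unfolding hom_act[OF Q mm(9) t(1), symmetric] t(4) u(4) ..
  ultimately show ?thesis unfolding composite_def by blast
 qed
 have t2: "composite ?FD (precomp D D D G 1 \<eta>) (postcomp D D G 1 \<epsilon>) (id_trans D D G)"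
 proof -
  \<comment> \<open>Now the edges \<open>u G\<close>, \<open>T \<epsilon>\<close> and
    \<open>c\<close> lie along \<open>q\<close> over an identity, \<open>\<epsilon>\<close> and
    \<open>\<epsilon>\<close>; under \<open>p\<close> the lifted triangle has the edges
    \<open>\<eta> G\<close>, \<open>G \<epsilon>\<close> and the identity of
    \<open>G\<close>.\<close>
  let ?e01 = "precomp D D E G 1 u" and ?e12 = "postcomp D D T 1 \<epsilon>" and ?d = "act ?FD 1 [0, 0, 1] \<epsilon>"
  have e: "?e01 : cell ?FE 1" "?e12 : cell ?FE 1" by (rule hom_cell[OF PT \<epsilon>(1)] hom_cell[OF prE[OF G] u(1)])+
  have v12: "act ?FE 1 [0] ?e12 = ?v (cmp D (cmp D T F) G)" "act ?FE 1 [1] ?e12 = ?v T"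
   unfolding hom_act[OF PT mm(1) \<epsilon>(1), symmetric] hom_act[OF PT mm(2) \<epsilon>(1), symmetric] \<epsilon>(2,3)
    postcomp_vertex[OF D hD] postcomp_vertex[OF D hs(4)] SI assoc1 by simp_all
  have v01: "act ?FE 1 [0] ?e01 = ?v (cmp D S G)" "act ?FE 1 [1] ?e01 = ?v (cmp D (cmp D T F) G)"
   unfolding hom_act[OF prE[OF G] mm(1) u(1), symmetric] hom_act[OF prE[OF G] mm(2) u(1), symmetric] u(2,3)
    precomp_vertex[OF D hs(2) G] precomp_vertex[OF D S G] by simp_all
  have d: "?d : cell ?FD 2" by (rule sset_cell[OF FDs mm(6) \<epsilon>(1)])
  have q12: "postcomp D E q 1 ?e12 = \<epsilon>" by (rule postcomp_inverse[OF D h1(4) T qT])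
  have q01: "postcomp D E q 1 ?e01 = id_trans D D (cmp D F G)"
   unfolding postcomp_precomp[OF D D h1(1) G q] u(4) idp[OF F G] ..
  obtain t where t: "t : cell ?FE 2" "act ?FE 2 [0, 1] t = ?e01" "act ?FE 2 [1, 2] t = ?e12" "act ?FE 2 [0, 2] t = c"
  proof (rule triangle_lift[OF FEs FDs Q e c(1) _ _ _ d])
   show "act ?FE 1 [0] ?e01 = act ?FE 1 [0] c" "act ?FE 1 [1] ?e01 = act ?FE 1 [0] ?e12" "act ?FE 1 [1] ?e12 = act ?FE 1 [1] c"
    unfolding v01 v12 c(2,3) by simp_all
   show "act ?FD 2 [0, 1] ?d = postcomp D E q 1 ?e01" "act ?FD 2 [1, 2] ?d = postcomp D E q 1 ?e12" "act ?FD 2 [0, 2] ?d = postcomp D E q 1 c"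
    unfolding q01 q12 \<epsilon>_def[symmetric] sset_act[OF FDs mm(6) mm(7) \<epsilon>(1)] sset_act[OF FDs mm(6) mm(8) \<epsilon>(1)] sset_act[OF FDs mm(6) mm(9) \<epsilon>(1)]
    using id1[OF \<epsilon>(1)] deg(1)[OF \<epsilon>] by (simp_all add: after_def)
   show "EX t. sphere_fill ?FE 2 s t & postcomp D E q 2 t = ?d"
    if "s : hom (boundary 2) ?FE" "!!m a. a : cell (boundary 2) m ==> postcomp D E q m (s m a) = act ?FD 2 a ?d"
     "s 0 [0] = act ?FE 1 [0] ?e01" "s 0 [2] = act ?FE 1 [1] ?e12" for s
    by (rule FQ[OF _ z2 that(1) d that(2) that(3)[unfolded v01] _ that(4)[unfolded v12]], (rule liftq; assumption)) (use SA TB F0 in auto)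
  qed (rule that; assumption)
  have "postcomp D E p 2 t : cell ?FD 2" by (rule hom_cell[OF P t(1)])
  moreover have "act ?FD 2 [0, 1] (postcomp D E p 2 t) = precomp D D D G 1 \<eta>"
   unfolding hom_act[OF P mm(7) t(1), symmetric] t(2) postcomp_precomp[OF D D h1(1) G p] \<eta>_def ..
  moreover have "act ?FD 2 [1, 2] (postcomp D E p 2 t) = postcomp D D G 1 \<epsilon>"
   unfolding hom_act[OF P mm(8) t(1), symmetric] t(3) by (rule postcomp_postcomp[OF D h1(4) T]) (simp add: G_def)
  moreover have "act ?FD 2 [0, 2] (postcomp D E p 2 t) = id_trans D D G"
   unfolding hom_act[OF P mm(9) t(1), symmetric] t(4) c(4) ..
  ultimately show ?thesis unfolding composite_def by blast
 qed
 have "nat_trans D D (idm D) (cmp D G F) \<eta>" "nat_trans D D (cmp D F G) (idm D) \<epsilon>"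
  unfolding nat_trans_def using \<eta> \<epsilon> by blast+
 then show ?thesis
  unfolding adjunction_def F_def[symmetric] G_def[symmetric] using F G t1 t2 by blast
qed

section \<open>Composites of two Kan sections\<close>

lemma kan_section_eval:
 assumes K: "simplicial_set K" and S: "kan_section K V C S" and y: "y : cell (Fun (full_sub K V) C) n"
  and a: "a : mono_maps m n" and x: "x : cell (full_sub K V) m"
 shows "S n y m (a, x) = y m (a, x)"
proof -
 let ?A = "full_sub K V"
 have Sh: "S n y : hom (\<Delta> n \<otimes> K) C" using S hom_cell[OF _ y, of S "Fun K C"] by (simp add: kan_section_def)
 have "cmp (Fun ?A C) (precomp ?A K C (%_ x. x)) S n y = idm (Fun ?A C) n y" using S by (simp add: kan_section_def)
 then have "precomp ?A K C (%_ x. x) n (S n y) = y" unfolding cmp_apply[OF y] idm_apply[OF y] .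
 then have "restr (\<Delta> n \<otimes> ?A) (%m (a, x). S n y m (a, x)) m (a, x) = y m (a, x)" unfolding precomp_apply[OF Sh] by simp
 then show ?thesis using a x by simp
qed

lemma precomp_incl_hom: "precomp (\<Delta> 1) Sq C incl_top : hom (Fun Sq C) (Fun (\<Delta> 1) C)"
  "precomp (\<Delta> 1) Sq C incl_right : hom (Fun Sq C) (Fun (\<Delta> 1) C)"
 by (rule precomp_hom[OF simplex_simplicial Sq_simplicial];
   (unfold simplex_cell simplex_act)?, (erule incl_cell | erule incl_act))+

lemma precomp_coord_hom: "precomp (sqs W) (\<Delta> 1) C (%_. fst) : hom (Fun (\<Delta> 1) C) (Fun (sqs W) C)"
  "precomp (sqs W) (\<Delta> 1) C (%_. snd) : hom (Fun (\<Delta> 1) C) (Fun (sqs W) C)"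
 by (rule precomp_hom[OF sqs_simplicial simplex_simplicial]; auto simp: sqs_cell Sq_cell Sq_act)+

abbreviation corner_zero :: "'a sset => (sq, 'a) fun_cell => bool" where
 "corner_zero C e == initial C (map_of_vertex Sq e 0 ([0], [1])) & final C (map_of_vertex Sq e 0 ([0], [1]))"

text \<open>The common form of the two constructions: \<open>E\<close> is an edge of the square and
  \<open>U\<close> this edge together with the corner; \<open>r\<close> is the coordinate on the
  edge and \<open>i\<close> its inclusion.\<close>

context
 fixes C :: "'a sset" and E U :: "(pair) set" and r :: "sq => nat list" and i R L
 assumes EU: "E <= U" and k: "kan_section (sqs U) (vx E) C R" "kan_section Sq (vx U) C L"
  and edge: "!!m s. s : cell (sqs E) m \<longleftrightarrow> r s : mono_maps m 1 & i m (r s) = s" and ri: "!!m b. r (i m b) = b"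
  and P: "precomp (sqs E) (\<Delta> 1) C (%_. r) : hom (Fun (\<Delta> 1) C) (Fun (sqs E) C)"
begin

abbreviation kan_comp where
 "kan_comp == cmp (Fun (\<Delta> 1) C) L (cmp (Fun (\<Delta> 1) C) R (precomp (sqs E) (\<Delta> 1) C (%_. r)))"

lemma kan_comp_hom: "kan_comp : hom (Fun (\<Delta> 1) C) (Fun Sq C)"
proof -
 have "R : hom (Fun (sqs E) C) (Fun (sqs U) C)" "L : hom (Fun (sqs U) C) (Fun Sq C)"
  using k unfolding kan_section_def sqs_sqs[OF EU] by blast+
 then show ?thesis using cmp_hom[OF cmp_hom[OF P]] Fun_simplicial[OF simplex_simplicial] by blast
qed

lemma kan_comp_cells:
 assumes "x : cell (Fun (\<Delta> 1) C) n"
 shows "precomp (sqs E) (\<Delta> 1) C (%_. r) n x : cell (Fun (sqs E) C) n"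
  "R n (precomp (sqs E) (\<Delta> 1) C (%_. r) n x) : cell (Fun (sqs U) C) n"
  "kan_comp n x = L n (R n (precomp (sqs E) (\<Delta> 1) C (%_. r) n x))"
proof -
 have "R : hom (Fun (sqs E) C) (Fun (sqs U) C)" using k(1) unfolding kan_section_def sqs_sqs[OF EU] by blast
 then show "R n (precomp (sqs E) (\<Delta> 1) C (%_. r) n x) : cell (Fun (sqs U) C) n"
  by (rule hom_cell[OF _ hom_cell[OF P assms]])
 show "precomp (sqs E) (\<Delta> 1) C (%_. r) n x : cell (Fun (sqs E) C) n" by (rule hom_cell[OF P assms])
qed (use assms in simp)

lemma kan_comp_eval:
 assumes "x : cell (Fun (\<Delta> 1) C) n" "a : mono_maps m n" "s : cell (sqs U) m"
 shows "kan_comp n x m (a, s) = R n (precomp (sqs E) (\<Delta> 1) C (%_. r) n x) m (a, s)"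
 unfolding kan_comp_cells(3)[OF assms(1)]
 by (rule kan_section_eval[OF Sq_simplicial k(2) kan_comp_cells(2)[OF assms(1)] assms(2,3)])

text \<open>Both Kan extension functors are sections of restriction, so restricting the composite to
  the edge returns the arrow.\<close>

lemma kan_comp_retract:
 assumes x: "x : cell (Fun (\<Delta> 1) C) n" shows "precomp (\<Delta> 1) Sq C i n (kan_comp n x) = x"
proof -
 have Sc: "kan_comp n x : hom (\<Delta> n \<otimes> Sq) C" using hom_cell[OF kan_comp_hom x] by simp
 have xh: "x : hom (\<Delta> n \<otimes> \<Delta> 1) C" using x by simp
 show ?thesis unfolding precomp_apply[OF Sc]
 proof (rule restr_eqI[OF xh])
  fix m w assume "w : cell (\<Delta> n \<otimes> \<Delta> 1) m"
  then obtain a b where w: "w = (a, b)" "a : mono_maps m n" "b : mono_maps m 1" by (cases w) auto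
  have e: "i m b : cell (sqs E) m" unfolding edge ri using w(3) by simp
  have "kan_comp n x m (a, i m b) = precomp (sqs E) (\<Delta> 1) C (%_. r) n x m (a, i m b)"
   unfolding kan_comp_eval[OF x w(2) sub_cell[OF sqs_sub[OF EU] e]]
   using kan_section_eval[OF sqs_simplicial k(1), unfolded sqs_sqs[OF EU], OF kan_comp_cells(1)[OF x] w(2) e] .
  also have "... = x m (a, b)" unfolding precomp_apply[OF xh] using w(2) e ri by simp
  finally show "(case w of (a, x') => kan_comp n x m (a, i m x')) = x m w" using w(1) by simp
 qed
qed

text \<open>The corner belongs to \<open>U\<close>, where the second extension keeps the value that
  the first one has chosen.\<close>

lemma kan_comp_corner:
 assumes "x : cell (Fun (\<Delta> 1) C) 0" "([0], [1]) : cell (sqs U) 0"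
 shows "map_of_vertex Sq (kan_comp 0 x) 0 ([0], [1]) = map_of_vertex (sqs U) (R 0 (precomp (sqs E) (\<Delta> 1) C (%_. r) 0 x)) 0 ([0], [1])"
proof -
 have c: "([0], [1]) : cell Sq 0" by (simp add: Sq_cell)
 have "[0] : mono_maps 0 0" by simp
 then show ?thesis unfolding map_of_vertex_eval[OF c] map_of_vertex_eval[OF assms(2)] replicate_1
  by (rule kan_comp_eval[OF assms(1) _ assms(2)])
qed

end

text \<open>The right Kan extension along the top edge makes the corner final. Lifts along the right
  edge that start at such a square need an initial corner; this is what
  \<open>final_imp_initial\<close> adds.\<close>

lemma Cof_section:
 assumes C: "quasi_category C" and z: "initial C z" "final C z"
  and R: "right_kan_functor (full_sub Sq span) top_edge C R" and L: "left_kan_functor Sq span C L"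
 defines "S == cmp (Fun (\<Delta> 1) C) L (cmp (Fun (\<Delta> 1) C) R (precomp (full_sub (full_sub Sq span) top_edge) (\<Delta> 1) C (%_. fst)))"
 shows "S : hom (Fun (\<Delta> 1) C) (Fun Sq C)"
  and "x : cell (Fun (\<Delta> 1) C) n ==> precomp (\<Delta> 1) Sq C incl_top n (S n x) = x"
  and "x : cell (Fun (\<Delta> 1) C) 0 ==> cofib C (map_of_vertex Sq (S 0 x)) & corner_zero C (S 0 x)"
proof -
 note e = edges_vx sqs_sqs[OF w_sub(1)]
 have k: "kan_section (sqs wspan) (vx wtop) C R" "kan_section Sq (vx wspan) C L"
  using R L unfolding right_kan_functor_def left_kan_functor_def edges_vx by blast+
 note a = w_sub(1) k edge_coords(1) _ precomp_coord_hom(1)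
 have ri: "fst (incl_top m b) = b" for m b by (simp add: incl_top_def)
 note kc = kan_comp_hom[OF a, OF ri] kan_comp_retract[OF a, OF ri] kan_comp_cells[OF a, OF ri] kan_comp_corner[OF a, OF ri]
 show "S : hom (Fun (\<Delta> 1) C) (Fun Sq C)" "x : cell (Fun (\<Delta> 1) C) n ==> precomp (\<Delta> 1) Sq C incl_top n (S n x) = x"
  unfolding S_def e by (rule kc; assumption)+
 assume x: "x : cell (Fun (\<Delta> 1) C) 0"
 have "left_kan Sq span C (map_of_vertex Sq (S 0 x))"
  using L kc(4)[OF x] unfolding left_kan_functor_def S_def e kc(5)[OF x] by blast
 then have co: "cofib C (map_of_vertex Sq (S 0 x))" using kan_iffs(1)[OF C] by blast
 have "right_kan (full_sub Sq span) top_edge C (map_of_vertex (sqs wspan) (R 0 (precomp (sqs wtop) (\<Delta> 1) C (%_. fst) 0 x)))"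
  using R kc(3)[OF x] unfolding right_kan_functor_def e by blast
 then have "final C (map_of_vertex (sqs wspan) (R 0 (precomp (sqs wtop) (\<Delta> 1) C (%_. fst) 0 x)) 0 ([0], [1]))"
  using kan_iffs(3)[OF C] by blast
 then have "final C (map_of_vertex Sq (S 0 x) 0 ([0], [1]))" unfolding S_def e kc(6)[OF x corner_new(3)] .
 then show "cofib C (map_of_vertex Sq (S 0 x)) & corner_zero C (S 0 x)" using co final_imp_initial[OF C z] by blast
qed

text \<open>Here the left Kan extension makes the corner initial, while lifts along the top edge
  that end at such a square need a final corner; this is what \<open>initial_imp_final\<close>
  adds.\<close>

lemma Fib_section:
 assumes C: "quasi_category C" and z: "initial C z" "final C z"
  and L: "left_kan_functor (full_sub Sq cospan) right_edge C L" and R: "right_kan_functor Sq cospan C R"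
 defines "S == cmp (Fun (\<Delta> 1) C) R (cmp (Fun (\<Delta> 1) C) L (precomp (full_sub (full_sub Sq cospan) right_edge) (\<Delta> 1) C (%_. snd)))"
 shows "S : hom (Fun (\<Delta> 1) C) (Fun Sq C)"
  and "x : cell (Fun (\<Delta> 1) C) n ==> precomp (\<Delta> 1) Sq C incl_right n (S n x) = x"
  and "x : cell (Fun (\<Delta> 1) C) 0 ==> cofib (op C) (fl usq (map_of_vertex Sq (S 0 x))) & corner_zero C (S 0 x)"
proof -
 note e = edges_vx sqs_sqs[OF w_sub(2)]
 have k: "kan_section (sqs wcospan) (vx wright) C L" "kan_section Sq (vx wcospan) C R"
  using R L unfolding right_kan_functor_def left_kan_functor_def edges_vx by blast+
 note a = w_sub(2) k edge_coords(2) _ precomp_coord_hom(2)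
 have ri: "snd (incl_right m b) = b" for m b by (simp add: incl_right_def)
 note kc = kan_comp_hom[OF a, OF ri] kan_comp_retract[OF a, OF ri] kan_comp_cells[OF a, OF ri] kan_comp_corner[OF a, OF ri]
 show "S : hom (Fun (\<Delta> 1) C) (Fun Sq C)" "x : cell (Fun (\<Delta> 1) C) n ==> precomp (\<Delta> 1) Sq C incl_right n (S n x) = x"
  unfolding S_def e by (rule kc; assumption)+
 assume x: "x : cell (Fun (\<Delta> 1) C) 0"
 have "right_kan Sq cospan C (map_of_vertex Sq (S 0 x))"
  using R kc(4)[OF x] unfolding right_kan_functor_def S_def e kc(5)[OF x] by blast
 then have co: "cofib (op C) (fl usq (map_of_vertex Sq (S 0 x)))" using kan_iffs(2)[OF C] by blast
 have "left_kan (full_sub Sq cospan) right_edge C (map_of_vertex (sqs wcospan) (L 0 (precomp (sqs wright) (\<Delta> 1) C (%_. snd) 0 x)))"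
  using L kc(3)[OF x] unfolding left_kan_functor_def e by blast
 then have "initial C (map_of_vertex (sqs wcospan) (L 0 (precomp (sqs wright) (\<Delta> 1) C (%_. snd) 0 x)) 0 ([0], [1]))"
  using kan_iffs(4)[OF C] by blast
 then have "initial C (map_of_vertex Sq (S 0 x) 0 ([0], [1]))" unfolding S_def e kc(6)[OF x corner_new(4)] .
 then show "cofib (op C) (fl usq (map_of_vertex Sq (S 0 x))) & corner_zero C (S 0 x)" using co initial_imp_final[OF C z] by blast
qed

theorem propositionA7:
  fixes C :: "'a sset"
  assumes "quasi_category C"
    and "pointed C"
    and "has_finite_limits C"
    and "has_finite_colimits C"
  shows "(\<exists>Cof. is_Cof C Cof) \<and> (\<exists>Fib. is_Fib C Fib) \<and>
    (\<forall>Cof Fib. is_Cof C Cof \<longrightarrow> is_Fib C Fib \<longrightarrow>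
       adjunction (Fun (\<Delta> 1) C) (Fun (\<Delta> 1) C) Cof Fib)"
proof -
 note C = assms(1)
 have Cs: "simplicial_set C" using C by (simp add: quasi_category_def)
 obtain z where z: "initial C z" "final C z" using assms(2) by (auto simp: pointed_def)
 note k = kan_functors_exist[OF C z finite_colimits_exT[OF Cs assms(4)] finite_limits_exT[OF Cs assms(3)]]
 have "adjunction (Fun (\<Delta> 1) C) (Fun (\<Delta> 1) C) Cof Fib" if Cof: "is_Cof C Cof" and Fib: "is_Fib C Fib" for Cof Fib
 proof -
  obtain R L where RL: "right_kan_functor (full_sub Sq span) top_edge C R" "left_kan_functor Sq span C L"
   and Ce: "Cof = cmp (Fun (\<Delta> 1) C) (precomp (\<Delta> 1) Sq C incl_right) (cmp (Fun (\<Delta> 1) C) L (cmp (Fun (\<Delta> 1) C) R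
    (precomp (full_sub (full_sub Sq span) top_edge) (\<Delta> 1) C (%_. fst))))"
   using Cof unfolding is_Cof_def by blast
  obtain L' R' where LR: "left_kan_functor (full_sub Sq cospan) right_edge C L'" "right_kan_functor Sq cospan C R'"
   and Fe: "Fib = cmp (Fun (\<Delta> 1) C) (precomp (\<Delta> 1) Sq C incl_top) (cmp (Fun (\<Delta> 1) C) R' (cmp (Fun (\<Delta> 1) C) L'
    (precomp (full_sub (full_sub Sq cospan) right_edge) (\<Delta> 1) C (%_. snd))))"
   using Fib unfolding is_Fib_def by blast
  note S = Cof_section[OF C z RL] and T = Fib_section[OF C z LR]
  show ?thesis
   unfolding Ce Fe
  \<comment> \<open>\<open>A\<close> singles out the pushout squares and \<open>B\<close> the
    pullback squares. Of the zero corner \<open>Z\<close>, lifts along the top edge use finality at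
    the last vertex and lifts along the right edge initiality at the first.\<close>
  proof (rule adjunction_by_lifting[OF Fun_simplicial[OF Sq_simplicial] Fun_simplicial[OF simplex_simplicial] precomp_incl_hom S(1) T(1),
     where A = "%e. cofib C (map_of_vertex Sq e)" and B = "%e. cofib (op C) (fl usq (map_of_vertex Sq e))" and Z = "corner_zero C"])
   fix n s d assume n: "(0::nat) < n" and s: "s : hom (boundary n) (Fun Sq C)" and d: "d : cell (Fun (\<Delta> 1) C) n"
   have d': "d : hom (\<Delta> n \<otimes> \<Delta> 1) C" using d by simp
   note l = edge_lifts[OF C n s d']
   show "EX e. sphere_fill (Fun Sq C) n s e & precomp (\<Delta> 1) Sq C incl_top n e = d"
    if "!!m a. a : cell (boundary n) m ==> precomp (\<Delta> 1) Sq C incl_top m (s m a) = act (Fun (\<Delta> 1) C) n a d"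
     "cofib C (map_of_vertex Sq (s 0 [0]))" "corner_zero C (s 0 [n])"
    by (rule l(1)[OF that(1,2) conjunct2[OF that(3)]])
   show "EX e. sphere_fill (Fun Sq C) n s e & precomp (\<Delta> 1) Sq C incl_right n e = d"
    if "!!m a. a : cell (boundary n) m ==> precomp (\<Delta> 1) Sq C incl_right m (s m a) = act (Fun (\<Delta> 1) C) n a d"
     "corner_zero C (s 0 [0])" "cofib (op C) (fl usq (map_of_vertex Sq (s 0 [n])))"
    by (rule l(2)[OF that(1) conjunct1[OF that(2)] that(3)])
  qed (erule S(2) | erule T(2) | erule S(3) | erule T(3))+
 qed
 then show ?thesis using k unfolding is_Cof_def is_Fib_def by blast
qed

end
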